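(* Let $m,\omega,\kappa,q>0$ be fixed constants. Then for every sufficiently small coupling constant $e>0$ (that is, there is $e_0>0$ such that for every $e\in(0,e_0)$) there exists a nontrivial solution $(u,N)$, with $u,N:\mathbb{R}^2\to\mathbb{R}$ radially symmetric, of the system $$ \begin{cases} \displaystyle -\frac{1}{2m}\Delta u+\omega u+\frac{e^4}{2m\kappa^2}\frac{h_u^2(|x|)}{|x|^2}u+\frac{e^4}{m\kappa^2}\,u\int_{|x|}^{\infty}\frac{u^2(s)}{s}h_u(s)\,ds+\left(1+\frac{\kappa q}{2m}\right)Nu+\frac{q}{4m^2}u^3=0 & \text{in }\mathbb{R}^2,\\[3mm] \displaystyle -\Delta N+\kappa^2q^2N+q\left(1+\frac{\kappa q}{2m}\right)u^2=0 & \text{in }\mathbb{R}^2, \end{cases} $$ where $h_u(|x|)=\int_0^{|x|}s\,u^2(s)\,ds$.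
   Context: A radially symmetric function $u$ on $\mathbb{R}^2$ is written $u(x)=u(|x|)$. Let $H^1_r(\mathbb{R}^2)$ be the space of radially symmetric functions in $H^1(\mathbb{R}^2)$ (real valued). Solutions are understood in the weak sense, as pairs $(u,N)\in H^1_r(\mathbb{R}^2)\times H^1_r(\mathbb{R}^2)$ that are critical points of the functional $$ I_e(u,N)=\frac{1}{4m}\|\nabla u\|_2^2+\frac{\omega}{2}\|u\|_2^2+\frac{e^4}{4m\kappa^2}\int_{\mathbb{R}^2}\frac{u^2(|x|)h_u^2(|x|)}{|x|^2}\,dx+\frac12\left(1+\frac{\kappa q}{2m}\right)\int_{\mathbb{R}^2}Nu^2\,dx+\frac{q}{16m^2}\|u\|_4^4+\frac{1}{4q}\|\nabla N\|_2^2+\frac{\kappa^2q}{4}\|N\|_2^2 $$ on $H^1_r(\mathbb{R}^2)\times H^1_r(\mathbb{R}^2)$, where $\|\cdot\|_p$ is the norm of $L^p(\mathbb{R}^2)$. Nontrivial means $(u,N)\neq(0,0)$. The parameters $m,\omega,\kappa,q$ are regarded as fixed and only $e$ varies, so the smallness of $e$ may depend on them. *)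

theory Defs
  imports "HOL-Analysis.Analysis"
begin

text \<open>
  Elements of \<open>L\<^sup>2(\<real>\<^sup>2)\<close> and \<open>H\<^sup>1(\<real>\<^sup>2)\<close> are represented by Borel functions on \<open>real ^ 2\<close>;
  every Lebesgue class has such a representative. Equality of classes is equality almost
  everywhere.
\<close>

definition L2 :: "(real ^ 2 \<Rightarrow> 'b::euclidean_space) \<Rightarrow> bool" where
  "L2 f \<longleftrightarrow> f \<in> borel_measurable lborel \<and> integrable lborel (\<lambda>x. (norm (f x))\<^sup>2)"

definition partial :: "2 \<Rightarrow> (real ^ 2 \<Rightarrow> real) \<Rightarrow> real ^ 2 \<Rightarrow> real" where
  "partial i \<phi> x = frechet_derivative \<phi> (at x) (axis i 1)"

primrec C_k :: "nat \<Rightarrow> (real ^ 2 \<Rightarrow> real) \<Rightarrow> bool" where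
  "C_k 0 \<phi> \<longleftrightarrow> continuous_on UNIV \<phi>"
| "C_k (Suc k) \<phi> \<longleftrightarrow> \<phi> differentiable_on UNIV \<and> (\<forall>i. C_k k (partial i \<phi>))"

definition test_function :: "(real ^ 2 \<Rightarrow> real) \<Rightarrow> bool" where
  "test_function \<phi> \<longleftrightarrow> (\<forall>k. C_k k \<phi>) \<and> compact (closure {x. \<phi> x \<noteq> 0})"

definition L2_weak_gradient :: "(real ^ 2 \<Rightarrow> real) \<Rightarrow> (real ^ 2 \<Rightarrow> real ^ 2) \<Rightarrow> bool" where
  "L2_weak_gradient u g \<longleftrightarrow> L2 g \<and>
     (\<forall>\<phi>. test_function \<phi> \<longrightarrow>
       (\<forall>i. (\<integral>x. u x * partial i \<phi> x \<partial>lborel) = - (\<integral>x. g x $ i * \<phi> x \<partial>lborel)))"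

definition H1 :: "(real ^ 2 \<Rightarrow> real) set" where
  "H1 = {u. L2 u \<and> (\<exists>g. L2_weak_gradient u g)}"

text \<open>For \<open>u \<in> H1\<close> the weak gradient is unique only almost everywhere; the choice below is
  immaterial because it is used under integrals only.\<close>

definition grad :: "(real ^ 2 \<Rightarrow> real) \<Rightarrow> real ^ 2 \<Rightarrow> real ^ 2" where
  "grad u = (SOME g. L2_weak_gradient u g)"

text \<open>A class that is radial almost everywhere has a representative that is radial everywhere, so
  radial symmetry is imposed pointwise. This makes the profile \<open>u(r)\<close> a genuine function.\<close>

definition radial :: "(real ^ 2 \<Rightarrow> real) \<Rightarrow> bool" where
  "radial u \<longleftrightarrow> (\<forall>x y. norm x = norm y \<longrightarrow> u x = u y)"

definition H1r :: "(real ^ 2 \<Rightarrow> real) set" where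
  "H1r = {u \<in> H1. radial u}"

definition profile :: "(real ^ 2 \<Rightarrow> real) \<Rightarrow> real \<Rightarrow> real" where
  "profile u r = u (r *\<^sub>R axis 1 1)"

lemma profile_norm:
  assumes "radial u"
  shows "profile u (norm x) = u x"
proof -
  have "norm (norm x *\<^sub>R axis 1 1 :: real ^ 2) = norm x"
    by (simp add: norm_axis_1)
  with assms show ?thesis
    unfolding radial_def profile_def by blast
qed

definition h :: "(real ^ 2 \<Rightarrow> real) \<Rightarrow> real \<Rightarrow> real" where
  "h u r = (LINT s:{0..r}|lborel. s * (profile u s)\<^sup>2)"

definition I_functional ::
  "real \<Rightarrow> real \<Rightarrow> real \<Rightarrow> real \<Rightarrow> real \<Rightarrow> (real ^ 2 \<Rightarrow> real) \<Rightarrow> (real ^ 2 \<Rightarrow> real) \<Rightarrow> real"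
where
  "I_functional m \<omega> \<kappa> q e u N =
      1 / (4 * m) * (\<integral>x. (norm (grad u x))\<^sup>2 \<partial>lborel)
    + \<omega> / 2 * (\<integral>x. (u x)\<^sup>2 \<partial>lborel)
    + e ^ 4 / (4 * m * \<kappa>\<^sup>2) * (\<integral>x. (u x)\<^sup>2 * (h u (norm x))\<^sup>2 / (norm x)\<^sup>2 \<partial>lborel)
    + 1 / 2 * (1 + \<kappa> * q / (2 * m)) * (\<integral>x. N x * (u x)\<^sup>2 \<partial>lborel)
    + q / (16 * m\<^sup>2) * (\<integral>x. (u x) ^ 4 \<partial>lborel)
    + 1 / (4 * q) * (\<integral>x. (norm (grad N x))\<^sup>2 \<partial>lborel)
    + \<kappa>\<^sup>2 * q / 4 * (\<integral>x. (N x)\<^sup>2 \<partial>lborel)"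

definition H1_pair_norm :: "(real ^ 2 \<Rightarrow> real) \<Rightarrow> (real ^ 2 \<Rightarrow> real) \<Rightarrow> real" where
  "H1_pair_norm \<phi> \<psi> = sqrt (
      (\<integral>x. (norm (grad \<phi> x))\<^sup>2 \<partial>lborel) + (\<integral>x. (\<phi> x)\<^sup>2 \<partial>lborel)
    + (\<integral>x. (norm (grad \<psi> x))\<^sup>2 \<partial>lborel) + (\<integral>x. (\<psi> x)\<^sup>2 \<partial>lborel))"

text \<open>\<open>J\<close> is Frechet differentiable at \<open>(u, N)\<close>, as a functional on \<open>H1r \<times> H1r\<close>, with derivative
  zero. This is spelled out because \<open>H1r\<close> is a set of functions with a seminorm, not a normed type.\<close>

definition critical_point ::
  "((real ^ 2 \<Rightarrow> real) \<Rightarrow> (real ^ 2 \<Rightarrow> real) \<Rightarrow> real) \<Rightarrow> (real ^ 2 \<Rightarrow> real) \<Rightarrow> (real ^ 2 \<Rightarrow> real) \<Rightarrow> bool"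
where
  "critical_point J u N \<longleftrightarrow> u \<in> H1r \<and> N \<in> H1r \<and>
     (\<forall>\<epsilon>>0. \<exists>\<delta>>0. \<forall>\<phi>\<in>H1r. \<forall>\<psi>\<in>H1r. H1_pair_norm \<phi> \<psi> < \<delta> \<longrightarrow>
        \<bar>J (\<lambda>x. u x + \<phi> x) (\<lambda>x. N x + \<psi> x) - J u N\<bar> \<le> \<epsilon> * H1_pair_norm \<phi> \<psi>)"

text \<open>
  The system is

    \<open>- 1/(2m) \<Delta>u + \<omega> u + e\<^sup>4/(2m\<kappa>\<^sup>2) h u (|x|)\<^sup>2/|x|\<^sup>2 u
       + e\<^sup>4/(m\<kappa>\<^sup>2) u \<integral>\<^bsub>|x|\<^esub>\<^sup>\<infinity> u(s)\<^sup>2/s h u s ds + (1 + \<kappa>q/(2m)) N u + q/(4m\<^sup>2) u\<^sup>3 = 0\<close>,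

    \<open>- \<Delta>N + \<kappa>\<^sup>2q\<^sup>2 N + q (1 + \<kappa>q/(2m)) u\<^sup>2 = 0\<close>,

  whose weak solutions are by definition the critical points of \<open>I_functional\<close> on \<open>H1r \<times> H1r\<close>;
  the two equations are its Euler-Lagrange equations, the second multiplied by \<open>2q\<close>.
\<close>

definition weak_solution ::
  "real \<Rightarrow> real \<Rightarrow> real \<Rightarrow> real \<Rightarrow> real \<Rightarrow> (real ^ 2 \<Rightarrow> real) \<Rightarrow> (real ^ 2 \<Rightarrow> real) \<Rightarrow> bool"
where
  "weak_solution m \<omega> \<kappa> q e u N \<longleftrightarrow> critical_point (I_functional m \<omega> \<kappa> q e) u N"

definition nontrivial :: "(real ^ 2 \<Rightarrow> real) \<Rightarrow> (real ^ 2 \<Rightarrow> real) \<Rightarrow> bool" where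
  "nontrivial u N \<longleftrightarrow> \<not> (AE x in lborel. u x = 0 \<and> N x = 0)"

end

theory Submission
  imports Defs "HOL-Real_Asymp.Real_Asymp" "HOL-Complex_Analysis.Great_Picard"
begin

text \<open>
  Write \<open>\<epsilon> = e\<^sup>4 / (4m\<kappa>\<^sup>2)\<close> and \<open>a = 1 + \<kappa>q / (2m)\<close>. The functional is \<open>Qf u - Cf u N + \<epsilon> * CSE u\<close>, where \<open>Qf\<close>
  is a positive quadratic form, \<open>CSE\<close> is the Chern-Simons energy, and \<open>- Cf\<close> collects the interaction
  \<open>N u\<^sup>2\<close>, the quartic term and the quadratic form \<open>Pf N\<close>. On the curve \<open>(\<surd>t u, t N)\<close> the three parts
  are homogeneous of degree 1, 2 and 3 in \<open>t\<close>, so the functional becomes the cubic polynomial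
  \<open>t Qf u - t\<^sup>2 Cf u N + \<epsilon> t\<^sup>3 CSE u\<close> (\<open>ray\<close>). For \<open>\<epsilon> = 0\<close> and \<open>Cf u N > 0\<close> it has a strict
  maximum at a positive \<open>t\<close>, which suggests a mountain pass. Positive values of \<open>Cf\<close> exist: for
  \<open>N = - b u\<^sup>2\<close> with a very flat profile \<open>u\<close> the gradient of \<open>N\<close> costs nothing, and the best \<open>b\<close>
  leaves the factor \<open>a\<^sup>2 / (4\<kappa>\<^sup>2q) - q / (16m\<^sup>2) = 1 / (4\<kappa>\<^sup>2q) + 1 / (4\<kappa>m) > 0\<close> in front of
  \<open>\<integral> u\<^sup>4\<close> (\<open>exists_positive_Cf\<close>, with Gaussians).

  For \<open>\<epsilon> > 0\<close> the cubic tends to infinity at the end of the ray, so the rays are cut off at a length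
  \<open>T\<close> fixed by one test pair with \<open>Cf = 1\<close>, and \<open>\<epsilon>\<close> is taken small in terms of \<open>T\<close>. Let \<open>level\<close> be
  the infimum, over pairs with \<open>Cf u N = 1\<close>, of the maximum of the ray over \<open>[0, T]\<close>. Pairs that
  nearly attain it satisfy \<open>Qf u \<le> T\<close>, and for those the smallness of \<open>\<epsilon>\<close> makes the ray strictly
  concave on \<open>[0, 2T]\<close> and decreasing on \<open>[T, 2T]\<close>.

  The level is attained (\<open>level_minimizer\<close>). A minimizing sequence is bounded in \<open>H\<^sup>1\<close>, so by radial
  compactness \<open>u\<^sub>n\<close> has a subsequence that is Cauchy in \<open>L\<^sup>4\<close> (\<open>L4_compactness\<close>), and on bounded sets
  all nonlinear terms are uniformly continuous with respect to \<open>L\<^sup>4\<close>. Hence they hardly change at the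
  midpoint of two members, whereas \<open>Qf\<close> and \<open>Pf\<close> drop by a quarter of their value on the difference.
  The midpoint cannot beat the level, so the differences tend to zero in \<open>H\<^sup>1\<close>. Strong convergence
  thus follows from the parallelogram law; weak limits do not enter.

  The minimizer yields a critical point (\<open>ray_stationary\<close>). Its ray has a unique maximum point \<open>t\<^sub>0\<close>, and
  the ray of every nearby pair reaches the level somewhere. Strict concavity keeps that point close
  to \<open>t\<^sub>0\<close>, and comparing first order terms shows that the derivative of the functional at
  \<open>(\<surd>t\<^sub>0 u, t\<^sub>0 N)\<close> vanishes in every direction. Since all terms have first order expansions
  with a quadratic remainder (\<open>quad_diff\<close>), it is a critical point in the sense of Frechet.
  It is nontrivial because \<open>Cf u N = 1\<close>.

  The analytic input is the behaviour of radial Sobolev functions. Testing the weak gradient with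
  radial fields shows that such a function has a representative \<open>w(|x|\<^sup>2)\<close> with
  \<open>(w s - w t)\<^sup>2 \<le> \<parallel>\<nabla>u\<parallel>\<^sup>2 / (4\<pi>) * ln (t / s)\<close> (\<open>radial_representative\<close>). Pointwise decay, the
  embedding into \<open>L\<^sup>4\<close> and its compactness all follow from this modulus of continuity. The
  Chern-Simons energy is controlled as a trilinear form in the densities \<open>u\<^sup>2\<close>.
\<close>

section \<open>Integrals of radial functions\<close>

lemma measure_eqI_atMost:
  fixes M N :: "real measure"
  assumes sets: "sets M = sets borel" "sets N = sets borel"
    and eq: "\<And>b. emeasure M {..b} = emeasure N {..b}" and fin: "\<And>b. emeasure M {..b} \<noteq> \<infinity>"
  shows "M = N"
proof (rule measure_eqI_generator_eq)
  show "Int_stable (range (\<lambda>b::real. {..b}))"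
    unfolding Int_stable_def
  proof safe
    fix b c :: real
    have "{..b} \<inter> {..c} = {..min b c}" by auto
    then show "{..b} \<inter> {..c} \<in> range (\<lambda>b::real. {..b})" by blast
  qed
  show "range (\<lambda>b::real. {..b}) \<subseteq> Pow UNIV" by simp
  show "emeasure M X = emeasure N X" if "X \<in> range (\<lambda>b::real. {..b})" for X
    using that eq by auto
  show "sets M = sigma_sets UNIV (range (\<lambda>b::real. {..b}))" "sets N = sigma_sets UNIV (range (\<lambda>b::real. {..b}))"
    unfolding sets by (simp_all add: borel_eq_atMost)
  show "range (\<lambda>i::nat. {..real i}) \<subseteq> range (\<lambda>b::real. {..b})" by auto
  show "(\<Union>i::nat. {..real i}) = UNIV" by (auto intro: real_arch_simple)
  show "emeasure M {..real i} \<noteq> \<infinity>" for i by (rule fin)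
qed

text \<open>The disc of radius \<open>\<surd>\<rho>\<close> has area \<open>\<pi>\<rho>\<close>, which is linear in \<open>\<rho>\<close>. In the variable \<open>\<rho> = |x|\<^sup>2\<close> radial
  integrals therefore carry no weight, and for this reason profiles are functions of \<open>|x|\<^sup>2\<close> below.\<close>

lemma distr_norm_square:
  "distr (lborel :: (real ^ 2) measure) borel (\<lambda>x. (norm x)\<^sup>2)
     = density lborel (\<lambda>\<rho>. ennreal (pi * indicator {0<..} \<rho>))" (is "?L = ?R")
proof (rule measure_eqI_atMost)
  have eL: "emeasure ?L {..b} = ennreal (pi * max 0 b)" for b :: real
  proof (cases "b \<ge> 0")
    case True
    have "(\<lambda>x::real^2. (norm x)\<^sup>2) -` {..b} = cball 0 (sqrt b)"
      using True real_sqrt_le_iff[of "(norm x)\<^sup>2" b for x :: "real^2"] by auto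
    then show ?thesis
      using True by (simp add: emeasure_distr emeasure_cball unit_ball_vol_2)
  next
    case False
    have "(\<lambda>x::real^2. (norm x)\<^sup>2) -` {..b} = {}"
      using False by (auto simp: not_le) (smt (verit) zero_le_power2)
    then show ?thesis using False by (simp add: emeasure_distr)
  qed
  have eR: "emeasure ?R {..b} = ennreal (pi * max 0 b)" for b :: real
  proof -
    have "emeasure ?R {..b} = (\<integral>\<^sup>+ x. ennreal pi * indicator {0<..b} x \<partial>lborel)"
      by (subst emeasure_density, simp, simp) (intro nn_integral_cong, auto simp: indicator_def)
    also have "\<dots> = ennreal pi * emeasure lborel {0<..b}"
      by (subst nn_integral_cmult) auto
    also have "\<dots> = ennreal (pi * max 0 b)"
      by (cases "b \<ge> 0") (auto simp: ennreal_mult)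
    finally show ?thesis .
  qed
  show "sets ?L = sets borel" "sets ?R = sets borel" by simp_all
  show "emeasure ?L {..b} = emeasure ?R {..b}" "emeasure ?L {..b} \<noteq> \<infinity>" for b
    by (simp_all add: eL eR)
qed

lemma integrable_radial_iff:
  fixes f :: "real \<Rightarrow> real"
  assumes [measurable]: "f \<in> borel_measurable borel"
  shows "integrable lborel (\<lambda>x :: real ^ 2. f ((norm x)\<^sup>2)) \<longleftrightarrow> set_integrable lborel {0<..} f"
proof -
  have "integrable lborel (\<lambda>x :: real ^ 2. f ((norm x)\<^sup>2))
     \<longleftrightarrow> integrable (distr (lborel :: (real ^ 2) measure) borel (\<lambda>x. (norm x)\<^sup>2)) f"
    by (subst integrable_distr_eq) auto
  also have "\<dots> \<longleftrightarrow> integrable lborel (\<lambda>\<rho>. (pi * indicator {0<..} \<rho>) *\<^sub>R f \<rho>)"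
    unfolding distr_norm_square by (subst integrable_density) auto
  also have "\<dots> \<longleftrightarrow> integrable lborel (\<lambda>\<rho>. pi * (indicator {0<..} \<rho> *\<^sub>R f \<rho>))"
    by (simp add: mult_ac)
  finally show ?thesis unfolding set_integrable_def
    by simp
qed

lemma integral_radial:
  fixes f :: "real \<Rightarrow> real"
  assumes [measurable]: "f \<in> borel_measurable borel"
  shows "(\<integral>x. f ((norm (x :: real ^ 2))\<^sup>2) \<partial>lborel) = pi * (LINT \<rho>:{0<..}|lborel. f \<rho>)"
proof -
  have "(\<integral>x. f ((norm (x :: real ^ 2))\<^sup>2) \<partial>lborel) = (\<integral>\<rho>. f \<rho> \<partial>distr lborel borel (\<lambda>x::real^2. (norm x)\<^sup>2))"
    by (subst integral_distr) auto
  also have "\<dots> = (\<integral>\<rho>. (pi * indicator {0<..} \<rho>) *\<^sub>R f \<rho> \<partial>lborel)"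
    unfolding distr_norm_square by (subst integral_density) auto
  also have "\<dots> = (\<integral>\<rho>. pi * (indicator {0<..} \<rho> *\<^sub>R f \<rho>) \<partial>lborel)"
    by (intro Bochner_Integration.integral_cong) auto
  finally show ?thesis unfolding set_lebesgue_integral_def by simp
qed

lemma AE_radial_iff:
  assumes [measurable]: "Measurable.pred borel P"
  shows "(AE x in lborel. P ((norm (x :: real ^ 2))\<^sup>2)) \<longleftrightarrow> (AE \<rho> in lborel. 0 < \<rho> \<longrightarrow> P \<rho>)"
proof -
  have "(AE x in lborel. P ((norm (x :: real ^ 2))\<^sup>2))
     \<longleftrightarrow> (AE \<rho> in distr (lborel :: (real ^ 2) measure) borel (\<lambda>x. (norm x)\<^sup>2). P \<rho>)"
    by (subst AE_distr_iff) auto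
  also have "\<dots> \<longleftrightarrow> (AE \<rho> in lborel. 0 < \<rho> \<longrightarrow> P \<rho>)"
    unfolding distr_norm_square by (subst AE_density) (auto simp: indicator_def)
  finally show ?thesis .
qed

section \<open>Smooth functions with compact support\<close>

text \<open>The one-variable counterpart of \<open>C_k\<close>. Test functions on the plane are assembled from smooth
  functions of one variable by composition with coordinates and with \<open>|x|\<^sup>2\<close>.\<close>

primrec Dk :: "nat \<Rightarrow> (real \<Rightarrow> real) \<Rightarrow> bool" where
  "Dk 0 f \<longleftrightarrow> continuous_on UNIV f"
| "Dk (Suc k) f \<longleftrightarrow> (\<exists>f'. (\<forall>x. (f has_real_derivative f' x) (at x)) \<and> Dk k f')"

lemma Dk_SucD: "Dk (Suc k) f \<Longrightarrow> Dk k f"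
proof (induction k arbitrary: f)
  case 0
  then show ?case by (auto intro!: continuous_at_imp_continuous_on) (metis DERIV_continuous)
next
  case (Suc k)
  then show ?case by (metis Dk.simps(2))
qed

lemma Dk_const: "Dk k (\<lambda>x. c)"
  by (induction k arbitrary: c) (auto intro!: exI[of _ "\<lambda>x. 0"])

lemma Dk_ident: "Dk k (\<lambda>x. x)"
  by (cases k) (auto intro!: exI[of _ "\<lambda>x. 1"] Dk_const)

lemma Dk_add: "Dk k f \<Longrightarrow> Dk k g \<Longrightarrow> Dk k (\<lambda>x. f x + g x)"
proof (induction k arbitrary: f g)
  case 0 then show ?case by (auto intro: continuous_intros)
next
  case (Suc k)
  then obtain f' g' where "\<forall>x. (f has_real_derivative f' x) (at x)" "Dk k f'"
    "\<forall>x. (g has_real_derivative g' x) (at x)" "Dk k g'" by auto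
  then show ?case using Suc.IH[of f' g']
    by (auto intro!: exI[of _ "\<lambda>x. f' x + g' x"] DERIV_add)
qed

lemma Dk_mult: "Dk k f \<Longrightarrow> Dk k g \<Longrightarrow> Dk k (\<lambda>x. f x * g x)"
proof (induction k arbitrary: f g)
  case 0 then show ?case by (auto intro: continuous_intros)
next
  case (Suc k)
  then obtain f' g' where *: "\<And>x. (f has_real_derivative f' x) (at x)" "Dk k f'"
    "\<And>x. (g has_real_derivative g' x) (at x)" "Dk k g'" by auto
  have "Dk k f" "Dk k g" using Suc.prems Dk_SucD by auto
  then have "Dk k (\<lambda>x. f' x * g x + g' x * f x)"
    using * Suc.IH by (intro Dk_add) auto
  then show ?case using DERIV_mult[OF *(1,3)]
    by (auto intro!: exI[of _ "\<lambda>x. f' x * g x + g' x * f x"])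
qed

lemma Dk_comp: "Dk k f \<Longrightarrow> Dk k g \<Longrightarrow> Dk k (\<lambda>x. f (g x))"
proof (induction k arbitrary: f g)
  case 0 then show ?case by (auto intro: continuous_on_compose2)
next
  case (Suc k)
  then obtain f' g' where *: "\<And>x. (f has_real_derivative f' x) (at x)" "Dk k f'"
    "\<And>x. (g has_real_derivative g' x) (at x)" "Dk k g'" by auto
  have "Dk k g" using Suc.prems Dk_SucD by auto
  then have "Dk k (\<lambda>x. f' (g x) * g' x)"
    using * Suc.IH by (intro Dk_mult) auto
  then show ?case using DERIV_chain2[OF *(1,3)]
    by (auto intro!: exI[of _ "\<lambda>x. f' (g x) * g' x"])
qed

lemma quotient_power_derivative:
  fixes x :: real
  assumes "x > 0"
  shows "(p * x ^ n - A * (real n * x ^ (n - Suc 0))) / (x ^ n * x ^ n) = p / x ^ n - real n * (A / x ^ (n + 1))"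
proof -
  have e: "real n * x ^ (n - Suc 0) = real n * x ^ n / x" using assms by (cases n) auto
  have "A * (real n * x ^ n / x) / (x ^ n * x ^ n) = real n * (A / x ^ (n + 1))"
    using assms by simp
  moreover have "p * x ^ n / (x ^ n * x ^ n) = p / x ^ n" using assms by simp
  ultimately show ?thesis unfolding e diff_divide_distrib by simp
qed

text \<open>The factor \<open>1 / x^n\<close> makes the family closed under differentiation up to linear combinations, so that
  smoothness at the origin is a single induction over the order.\<close>

definition flat :: "nat \<Rightarrow> real \<Rightarrow> real" where
  "flat n x = (if x > 0 then exp (- (1 / x)) / x ^ n else 0)"

lemma flat_DERIV:
  "(flat n has_real_derivative flat (n + 2) x - real n * flat (n + 1) x) (at x)"
proof -
  consider "x > 0" | "x < 0" | "x = 0" by linarith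
  then show ?thesis
  proof cases
    case 1
    have "((\<lambda>x. exp (- (1 / x)) / x ^ n) has_real_derivative flat (n + 2) x - real n * flat (n + 1) x) (at x)"
    proof -
      have e: "((\<lambda>x. exp (- (1 / x))) has_real_derivative exp (- (1 / x)) * (1 / x\<^sup>2)) (at x)"
        using 1 by (auto intro!: derivative_eq_intros simp: field_simps) (simp add: power2_eq_square)
      have "((\<lambda>x. exp (- (1 / x)) / x ^ n) has_real_derivative
        (exp (- (1 / x)) * (1 / x\<^sup>2) * x ^ n - exp (- (1 / x)) * (real n * x ^ (n - Suc 0))) / (x ^ n * x ^ n)) (at x)"
        using 1 by (intro DERIV_divide[OF e DERIV_pow]) auto
      moreover have "(exp (- (1 / x)) * (1 / x\<^sup>2) * x ^ n - exp (- (1 / x)) * (real n * x ^ (n - Suc 0))) / (x ^ n * x ^ n)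
         = flat (n + 2) x - real n * flat (n + 1) x"
        unfolding quotient_power_derivative[OF 1] using 1 by (simp add: flat_def power_add power2_eq_square)
      ultimately show ?thesis by simp
    qed
    then show ?thesis
      by (rule DERIV_cong_ev[THEN iffD1, rotated 3])
         (use 1 in \<open>auto simp: flat_def intro!: eventually_mono[OF eventually_gt_at_top] 
            eventually_nhds_in_open[of "{0<..}", THEN eventually_mono]\<close>)
  next
    case 2
    have "((\<lambda>x. 0) has_real_derivative flat (n + 2) x - real n * flat (n + 1) x) (at x)"
      using 2 by (auto simp: flat_def)
    then show ?thesis
      by (rule DERIV_cong_ev[THEN iffD1, rotated 3])
         (use 2 in \<open>auto simp: flat_def intro!: eventually_nhds_in_open[of "{..<0}", THEN eventually_mono]\<close>)
  next
    case 3
    have "((\<lambda>h. exp (- (1 / h)) / h ^ (n + 1)) \<longlongrightarrow> 0) (at_right (0::real))"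
      by real_asymp
    then have r: "((\<lambda>h. flat n h / h) \<longlongrightarrow> 0) (at_right 0)"
      by (rule Lim_transform_eventually)
         (auto simp: flat_def eventually_at_filter field_simps)
    have l: "((\<lambda>h. flat n h / h) \<longlongrightarrow> 0) (at_left 0)"
      by (rule Lim_transform_eventually[OF tendsto_const])
         (auto simp: flat_def eventually_at_filter field_simps)
    have "((\<lambda>h. flat n h / h) \<longlongrightarrow> 0) (at 0)"
      using l r by (simp add: filterlim_split_at)
    then show ?thesis using 3
      by (simp add: DERIV_def flat_def)
  qed
qed

lemma Dk_flat: "Dk k (flat n)"
proof (induction k arbitrary: n)
  case 0
  show ?case using DERIV_continuous[OF flat_DERIV] by (auto intro!: continuous_at_imp_continuous_on)
next
  case (Suc k)
  have "Dk k (\<lambda>x. flat (n + 2) x + (- real n) * flat (n + 1) x)"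
    by (intro Dk_add Dk_mult Dk_const Suc.IH)
  then show ?case using flat_DERIV[of n]
    by (auto intro!: exI[of _ "\<lambda>x. flat (n + 2) x - real n * flat (n + 1) x"])
qed

text \<open>The factor \<open>n\<close> steepens both edges, so that the bumps converge to the indicator of the interval
  as \<open>n\<close> grows.\<close>

definition bump :: "real \<Rightarrow> real \<Rightarrow> nat \<Rightarrow> real \<Rightarrow> real" where
  "bump a b n x = flat 0 (real n * (x - a)) * flat 0 (real n * (b - x))"

lemma Dk_bump: "Dk k (bump a b n)"
proof -
  have "Dk k (\<lambda>x. flat 0 (real n * (x + (-a))) * flat 0 (real n * (b + (-1) * x)))"
    by (intro Dk_mult Dk_comp[OF Dk_flat] Dk_add Dk_const Dk_ident)
  then show ?thesis by (simp add: bump_def[abs_def])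
qed

lemma flat0_bounds: "0 \<le> flat 0 x" "flat 0 x \<le> 1"
  by (auto simp: flat_def)

lemma bump_bounds: "0 \<le> bump a b n x" "bump a b n x \<le> 1"
  unfolding bump_def using flat0_bounds by (auto intro: mult_le_one)

lemma bump_eq_0: "x \<notin> {a<..<b} \<Longrightarrow> bump a b n x = 0"
  by (auto simp: bump_def flat_def zero_less_mult_iff not_less)

lemma bump_pos: "x \<in> {a<..<b} \<Longrightarrow> 0 < n \<Longrightarrow> bump a b n x > 0"
  by (auto simp: bump_def flat_def)

lemma bump_tendsto: "(\<lambda>n. bump a b n x) \<longlonglongrightarrow> indicator {a<..<b} x"
proof (cases "x \<in> {a<..<b}")
  case True
  have *: "(\<lambda>n. flat 0 (real n * c)) \<longlonglongrightarrow> 1" if "c > 0" for c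
  proof -
    have "(\<lambda>n. exp (- (1 / (real n * c)))) \<longlonglongrightarrow> 1" using that by real_asymp
    then show ?thesis
      by (rule Lim_transform_eventually)
         (use that in \<open>auto simp: flat_def intro!: eventually_mono[OF eventually_gt_at_top[of 0]]\<close>)
  qed
  have "(\<lambda>n. bump a b n x) \<longlonglongrightarrow> 1 * 1"
    unfolding bump_def using True by (intro tendsto_mult *) auto
  then show ?thesis using True by simp
next
  case False
  then show ?thesis using bump_eq_0[OF False] by simp
qed

lemma Dk_continuous: "Dk k f \<Longrightarrow> continuous_on UNIV f"
  by (induction k) (use Dk_SucD in \<open>simp, blast\<close>)

text \<open>The function vanishes near the only singularity of the divisor. This makes the field
  \<open>x \<zeta>(|x|\<^sup>2) / |x|\<^sup>2\<close> admissible as a test field.\<close>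

lemma Dk_divide_power:
  assumes "Dk k f" and "0 < a" and "\<And>x. x < a \<Longrightarrow> f x = 0"
  shows "Dk k (\<lambda>x. f x / x ^ n)"
  using assms
proof (induction k arbitrary: f n)
  case 0
  have c: "continuous_on UNIV f" using 0 by simp
  have "isCont (\<lambda>x. f x / x ^ n) x" for x
  proof (cases "x > 0")
    case True
    have "isCont f x" using c by (simp add: continuous_on_eq_continuous_at)
    then show ?thesis using True by (auto intro!: continuous_intros)
  next
    case False
    have "\<forall>\<^sub>F y in nhds x. f y / y ^ n = 0"
      by (rule eventually_mono[OF eventually_nhds_in_open[of "{..<a}"]]) (use False 0 in auto)
    then show ?thesis by (subst isCont_cong[of _ "\<lambda>_. 0"]) auto
  qed
  then show ?case by (simp add: continuous_at_imp_continuous_on)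
next
  case (Suc k)
  then obtain f' where f': "\<And>x. (f has_real_derivative f' x) (at x)" "Dk k f'" by auto
  have f0: "f' x = 0" if "x < a" for x
  proof -
    have "((\<lambda>x. 0) has_real_derivative f' x) (at x)"
      by (rule DERIV_cong_ev[THEN iffD1, rotated 3, OF f'(1)])
         (use that Suc.prems in \<open>auto intro!: eventually_nhds_in_open[of "{..<a}", THEN eventually_mono]\<close>)
    then show ?thesis using DERIV_unique DERIV_const by blast
  qed
  let ?d = "\<lambda>x. f' x / x ^ n + (- real n) * (f x / x ^ (n + 1))"
  have "Dk k f" using Suc.prems Dk_SucD by blast
  then have "Dk k ?d"
    using Suc.IH[of f' n] Suc.IH[of f "n+1"] f' f0 Suc.prems
    by (intro Dk_add Dk_mult Dk_const) auto
  moreover have "((\<lambda>x. f x / x ^ n) has_real_derivative ?d x) (at x)" for x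
  proof (cases "x > 0")
    case True
    show ?thesis
    proof -
      have "((\<lambda>x. f x / x ^ n) has_real_derivative
        (f' x * x ^ n - f x * (real n * x ^ (n - Suc 0))) / (x ^ n * x ^ n)) (at x)"
        using True by (intro DERIV_divide[OF f'(1) DERIV_pow]) auto
      moreover have "(f' x * x ^ n - f x * (real n * x ^ (n - Suc 0))) / (x ^ n * x ^ n) = ?d x"
        unfolding quotient_power_derivative[OF True] by simp
      ultimately show ?thesis by simp
    qed
  next
    case False
    have "((\<lambda>x. 0) has_real_derivative ?d x) (at x)"
      using False Suc.prems f0 by auto
    then show ?thesis
      by (rule DERIV_cong_ev[THEN iffD1, rotated 3])
         (use False Suc.prems in \<open>auto intro!: eventually_nhds_in_open[of "{..<a}", THEN eventually_mono]\<close>)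
  qed
  ultimately show ?case unfolding Dk.simps by (intro exI[of _ ?d]) blast
qed

lemma partial_eq: "(\<phi> has_derivative D) (at x) \<Longrightarrow> partial i \<phi> x = D (axis i 1)"
  unfolding partial_def using frechet_derivative_at by metis

lemma C_k_SucD: "C_k (Suc k) \<phi> \<Longrightarrow> C_k k \<phi>"
proof (induction k arbitrary: \<phi>)
  case 0
  then show ?case by (auto intro: differentiable_imp_continuous_on)
next
  case (Suc k)
  then show ?case by (metis C_k.simps(2))
qed

lemma C_k_const: "C_k k (\<lambda>x. c)"
proof (induction k arbitrary: c)
  case (Suc k)
  have "partial i (\<lambda>x. c) = (\<lambda>x. 0)" for i
    by (rule ext) (rule partial_eq, rule has_derivative_const)
  then show ?case using Suc by simp
qed simp

lemma C_k_coord: "C_k k (\<lambda>x. x $ i)"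
proof (cases k)
  case 0
  then show ?thesis by (auto intro!: continuous_intros)
next
  case (Suc j)
  have d: "((\<lambda>x::real^2. x $ i) has_derivative (\<lambda>h. h $ i)) (at x)" for x
    by (intro bounded_linear_imp_has_derivative bounded_linear_vec_nth)
  have "partial l (\<lambda>x. x $ i) = (\<lambda>x. axis l 1 $ i)" for l
    by (rule ext) (rule partial_eq[OF d])
  then show ?thesis using Suc d C_k_const
    by (auto simp: differentiable_on_def differentiable_def)
qed

lemma C_k_has_derivative:
  assumes "C_k (Suc k) \<phi>"
  obtains D where "(\<phi> has_derivative D) (at x)" "\<And>i. D (axis i 1) = partial i \<phi> x"
proof -
  obtain D where "(\<phi> has_derivative D) (at x)"
    using assms unfolding C_k.simps differentiable_on_def differentiable_def by auto
  then show thesis using that[of D] partial_eq by simp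
qed

lemma C_k_add: "C_k k \<phi> \<Longrightarrow> C_k k \<psi> \<Longrightarrow> C_k k (\<lambda>x. \<phi> x + \<psi> x)"
proof (induction k arbitrary: \<phi> \<psi>)
  case 0 then show ?case by (auto intro: continuous_intros)
next
  case (Suc k)
  have p: "partial i (\<lambda>x. \<phi> x + \<psi> x) = (\<lambda>x. partial i \<phi> x + partial i \<psi> x)" for i
  proof
    fix x
    obtain D where D: "(\<phi> has_derivative D) (at x)" "\<And>i. D (axis i 1) = partial i \<phi> x"
      using C_k_has_derivative[OF Suc.prems(1)] by blast
    obtain E where E: "(\<psi> has_derivative E) (at x)" "\<And>i. E (axis i 1) = partial i \<psi> x"
      using C_k_has_derivative[OF Suc.prems(2)] by blast
    then show "partial i (\<lambda>x. \<phi> x + \<psi> x) x = partial i \<phi> x + partial i \<psi> x"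
      using partial_eq[OF has_derivative_add[OF D(1) E(1)], of i] D(2) E(2) by simp
  qed
  show ?case using Suc by (auto simp: p intro: differentiable_on_add)
qed

lemma C_k_mult: "C_k k \<phi> \<Longrightarrow> C_k k \<psi> \<Longrightarrow> C_k k (\<lambda>x. \<phi> x * \<psi> x)"
proof (induction k arbitrary: \<phi> \<psi>)
  case 0 then show ?case by (auto intro: continuous_intros)
next
  case (Suc k)
  have p: "partial i (\<lambda>x. \<phi> x * \<psi> x) = (\<lambda>x. \<phi> x * partial i \<psi> x + partial i \<phi> x * \<psi> x)" for i
  proof
    fix x
    obtain D where D: "(\<phi> has_derivative D) (at x)" "\<And>i. D (axis i 1) = partial i \<phi> x"
      using C_k_has_derivative[OF Suc.prems(1)] by blast
    obtain E where E: "(\<psi> has_derivative E) (at x)" "\<And>i. E (axis i 1) = partial i \<psi> x"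
      using C_k_has_derivative[OF Suc.prems(2)] by blast
    then show "partial i (\<lambda>x. \<phi> x * \<psi> x) x = \<phi> x * partial i \<psi> x + partial i \<phi> x * \<psi> x"
      using partial_eq[OF has_derivative_mult[OF D(1) E(1)], of i] D(2) E(2) by simp
  qed
  have "C_k k \<phi>" "C_k k \<psi>" using Suc.prems C_k_SucD by blast+
  then have "C_k k (partial i (\<lambda>x. \<phi> x * \<psi> x))" for i
    unfolding p using Suc by (intro C_k_add) auto
  moreover have "(\<lambda>x. \<phi> x * \<psi> x) differentiable_on UNIV"
    using Suc.prems by (auto simp: differentiable_on_def intro: differentiable_mult)
  ultimately show ?case by simp
qed

lemma C_k_comp: "Dk k f \<Longrightarrow> C_k k \<psi> \<Longrightarrow> C_k k (\<lambda>x. f (\<psi> x))"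
proof (induction k arbitrary: f \<psi>)
  case 0 then show ?case by (auto intro: continuous_on_compose2)
next
  case (Suc k)
  then obtain f' where f': "\<And>x. (f has_real_derivative f' x) (at x)" "Dk k f'" by auto
  have d: "\<exists>E. ((\<lambda>x. f (\<psi> x)) has_derivative E) (at x) \<and> (\<forall>i. E (axis i 1) = f' (\<psi> x) * partial i \<psi> x)" for x
  proof -
    obtain E where E: "(\<psi> has_derivative E) (at x)" "\<And>i. E (axis i 1) = partial i \<psi> x"
      using C_k_has_derivative[OF Suc.prems(2)] by blast
    then have "((\<lambda>x. f (\<psi> x)) has_derivative (\<lambda>h. f' (\<psi> x) * E h)) (at x)"
      using has_derivative_compose[OF E(1) f'(1)[unfolded has_field_derivative_def]] by simp
    then show ?thesis using E(2) by (intro exI[of _ "\<lambda>h. f' (\<psi> x) * E h"]) simp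
  qed
  have p: "partial i (\<lambda>x. f (\<psi> x)) = (\<lambda>x. f' (\<psi> x) * partial i \<psi> x)" for i
  proof
    fix x
    obtain E where "((\<lambda>x. f (\<psi> x)) has_derivative E) (at x)" "E (axis i 1) = f' (\<psi> x) * partial i \<psi> x"
      using d by blast
    then show "partial i (\<lambda>x. f (\<psi> x)) x = f' (\<psi> x) * partial i \<psi> x"
      using partial_eq by simp
  qed
  have "C_k k \<psi>" using Suc.prems C_k_SucD by blast
  then have "C_k k (partial i (\<lambda>x. f (\<psi> x)))" for i
    unfolding p using Suc f' by (intro C_k_mult) auto
  moreover have "(\<lambda>x. f (\<psi> x)) differentiable_on UNIV"
    using d by (auto simp: differentiable_on_def differentiable_def) 
  ultimately show ?case by simp
qed

lemma test_functionI:
  assumes "\<And>k. C_k k \<phi>" and "\<And>x. R < norm x \<Longrightarrow> \<phi> x = 0"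
  shows "test_function \<phi>"
proof -
  have "bounded {x. \<phi> x \<noteq> 0}"
    unfolding bounded_iff using assms(2) by (intro exI[of _ R]) force
  then show ?thesis using assms(1) by (simp add: test_function_def)
qed

lemma test_function_support:
  assumes "test_function \<phi>"
  obtains R where "R > 0" "\<And>x. R < norm x \<Longrightarrow> \<phi> x = 0"
proof -
  have "bounded {x. \<phi> x \<noteq> 0}"
    using assms unfolding test_function_def by (meson bounded_subset closure_subset compact_imp_bounded)
  then obtain R where "R > 0" "\<And>x. \<phi> x \<noteq> 0 \<Longrightarrow> norm x \<le> R"
    unfolding bounded_pos by auto
  then show thesis using that[of R] by force
qed

lemma test_function_continuous: "test_function \<phi> \<Longrightarrow> continuous_on UNIV \<phi>"
  unfolding test_function_def by (metis C_k.simps(1))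

lemma test_function_partial:
  assumes "test_function \<phi>"
  shows "test_function (partial i \<phi>)"
proof -
  obtain R where R: "R > 0" "\<And>x. R < norm x \<Longrightarrow> \<phi> x = 0" using test_function_support[OF assms] by blast
  show ?thesis
  proof (rule test_functionI)
    show "C_k k (partial i \<phi>)" for k
      using assms unfolding test_function_def by (metis C_k.simps(2))
    show "partial i \<phi> x = 0" if "R < norm x" for x
    proof -
      have "open {y::real^2. R < norm y}" by (intro open_Collect_less continuous_intros)
      then have "(\<phi> has_derivative (\<lambda>h. 0)) (at x)"
        using that R(2) by (intro has_derivative_transform_within_open[OF has_derivative_const[of 0]]) auto
      then show ?thesis by (rule partial_eq)
    qed
  qed
qed

lemma test_function_bound:
  assumes "test_function \<phi>"
  obtains B R where "B \<ge> 0" "R > 0" "\<And>x. \<bar>\<phi> x\<bar> \<le> B * indicator (cball 0 R) x"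
proof -
  obtain R where R: "R > 0" "\<And>x. R < norm x \<Longrightarrow> \<phi> x = 0" using test_function_support[OF assms] by blast
  have "compact (\<phi> ` cball 0 R)"
    by (rule compact_continuous_image[OF continuous_on_subset[OF test_function_continuous[OF assms] subset_UNIV] compact_cball])
  from compact_imp_bounded[OF this] obtain B where B0: "\<And>y. y \<in> \<phi> ` cball 0 R \<Longrightarrow> norm y \<le> B"
    unfolding bounded_iff by blast
  have B: "\<bar>\<phi> x\<bar> \<le> B" if "x \<in> cball 0 R" for x
    using B0[OF imageI[OF that]] by simp
  have "\<bar>\<phi> x\<bar> \<le> \<bar>B\<bar> * indicator (cball 0 R) x" for x
  proof (cases "x \<in> cball 0 R")
    case True
    then show ?thesis using B[OF True] by simp
  next
    case False
    then show ?thesis using R(2)[of x] by simp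
  qed
  then show thesis using that[of "\<bar>B\<bar>" R] R by auto
qed

section \<open>Square integrable functions\<close>

lemma Cauchy_Schwarz_integral:
  fixes f g :: "'a \<Rightarrow> real"
  assumes [measurable]: "f \<in> borel_measurable M" "g \<in> borel_measurable M"
    and f: "integrable M (\<lambda>x. (f x)\<^sup>2)" and g: "integrable M (\<lambda>x. (g x)\<^sup>2)"
  shows "integrable M (\<lambda>x. f x * g x)"
    and "(\<integral>x. f x * g x \<partial>M)\<^sup>2 \<le> (\<integral>x. (f x)\<^sup>2 \<partial>M) * (\<integral>x. (g x)\<^sup>2 \<partial>M)"
proof -
  show i: "integrable M (\<lambda>x. f x * g x)"
  proof (rule Bochner_Integration.integrable_bound)
    show "integrable M (\<lambda>x. (f x)\<^sup>2 + (g x)\<^sup>2)" using f g by simp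
    have *: "\<bar>a * b\<bar> \<le> a\<^sup>2 + b\<^sup>2" for a b :: real
    proof -
      have "2 * (\<bar>a\<bar> * \<bar>b\<bar>) \<le> a\<^sup>2 + b\<^sup>2" "0 \<le> \<bar>a\<bar> * \<bar>b\<bar>"
        using sum_squares_bound[of "\<bar>a\<bar>" "\<bar>b\<bar>"] by (simp_all add: mult.assoc)
      then show ?thesis unfolding abs_mult by linarith
    qed
    show "AE x in M. norm (f x * g x) \<le> norm ((f x)\<^sup>2 + (g x)\<^sup>2)"
      unfolding real_norm_def by (intro AE_I2 order_trans[OF * abs_ge_self])
  qed measurable
  define A where "A = (\<integral>x. (f x)\<^sup>2 \<partial>M)"
  define B where "B = (\<integral>x. f x * g x \<partial>M)"
  define C where "C = (\<integral>x. (g x)\<^sup>2 \<partial>M)"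
  have q: "0 \<le> A - 2 * t * B + t\<^sup>2 * C" for t
  proof -
    have "0 \<le> (\<integral>x. (f x - t * g x)\<^sup>2 \<partial>M)" by simp
    also have "\<dots> = (\<integral>x. (f x)\<^sup>2 - 2 * t * (f x * g x) + t\<^sup>2 * (g x)\<^sup>2 \<partial>M)"
      by (intro Bochner_Integration.integral_cong) (auto simp: power2_eq_square algebra_simps)
    also have "\<dots> = A - 2 * t * B + t\<^sup>2 * C"
      using f g i by (simp add: A_def B_def C_def)
    finally show ?thesis .
  qed
  have "C \<ge> 0" by (simp add: C_def)
  have "B\<^sup>2 \<le> A * C"
  proof (cases "C = 0")
    case True
    have "B = 0"
    proof (rule ccontr)
      assume "B \<noteq> 0"
      then show False using q[of "(A + 1) / (2 * B)"] True by simp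
    qed
    then show ?thesis using True by simp
  next
    case False
    then have "C > 0" using \<open>C \<ge> 0\<close> by simp
    have "A - 2 * (B / C) * B + (B / C)\<^sup>2 * C = A - B\<^sup>2 / C"
      using \<open>C > 0\<close> by (simp add: power2_eq_square field_simps)
    then have "B\<^sup>2 / C \<le> A" using q[of "B / C"] by simp
    then show ?thesis using \<open>C > 0\<close> by (simp add: pos_divide_le_eq)
  qed
  then show "(\<integral>x. f x * g x \<partial>M)\<^sup>2 \<le> (\<integral>x. (f x)\<^sup>2 \<partial>M) * (\<integral>x. (g x)\<^sup>2 \<partial>M)"
    by (simp add: A_def B_def C_def)
qed

lemma L2_mult_integrable:
  fixes f g :: "real ^ 2 \<Rightarrow> real"
  assumes "L2 f" "L2 g"
  shows "integrable lborel (\<lambda>x. f x * g x)"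
proof (rule Bochner_Integration.integrable_bound)
  show "integrable lborel (\<lambda>x. (f x)\<^sup>2 + (g x)\<^sup>2)"
    using assms by (auto simp: L2_def)
  show "(\<lambda>x. f x * g x) \<in> borel_measurable lborel" using assms by (auto simp: L2_def)
  have *: "\<bar>a * b\<bar> \<le> a\<^sup>2 + b\<^sup>2" for a b :: real
  proof -
    have "2 * (\<bar>a\<bar> * \<bar>b\<bar>) \<le> a\<^sup>2 + b\<^sup>2" "0 \<le> \<bar>a\<bar> * \<bar>b\<bar>"
      using sum_squares_bound[of "\<bar>a\<bar>" "\<bar>b\<bar>"] by (simp_all add: mult.assoc)
    then show ?thesis unfolding abs_mult by linarith
  qed
  show "AE x in lborel. norm (f x * g x) \<le> norm ((f x)\<^sup>2 + (g x)\<^sup>2)"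
    unfolding real_norm_def by (intro AE_I2 order_trans[OF * abs_ge_self])
qed

lemma L2_lincomb:
  fixes f g :: "real ^ 2 \<Rightarrow> 'b::euclidean_space"
  assumes "L2 f" "L2 g"
  shows "L2 (\<lambda>x. a *\<^sub>R f x + b *\<^sub>R g x)"
  unfolding L2_def
proof
  have [measurable]: "f \<in> borel_measurable lborel" "g \<in> borel_measurable lborel" using assms by (auto simp: L2_def)
  show "(\<lambda>x. a *\<^sub>R f x + b *\<^sub>R g x) \<in> borel_measurable lborel" by measurable
  show "integrable lborel (\<lambda>x. (norm (a *\<^sub>R f x + b *\<^sub>R g x))\<^sup>2)"
  proof (rule Bochner_Integration.integrable_bound)
    show "integrable lborel (\<lambda>x. 2 * a\<^sup>2 * (norm (f x))\<^sup>2 + 2 * b\<^sup>2 * (norm (g x))\<^sup>2)"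
      using assms by (auto simp: L2_def)
    have nrm2: "(norm (v + w))\<^sup>2 \<le> 2 * (norm v)\<^sup>2 + 2 * (norm w)\<^sup>2" for v w :: 'b
    proof -
      have "(norm (v + w))\<^sup>2 + (norm (v - w))\<^sup>2 = 2 * (norm v)\<^sup>2 + 2 * (norm w)\<^sup>2"
        unfolding power2_norm_eq_inner by (simp add: inner_simps inner_commute)
      then show ?thesis using zero_le_power2[of "norm (v - w)"] by linarith
    qed
    have q: "(norm (a *\<^sub>R f x + b *\<^sub>R g x))\<^sup>2 \<le> 2 * a\<^sup>2 * (norm (f x))\<^sup>2 + 2 * b\<^sup>2 * (norm (g x))\<^sup>2" for x
      using nrm2[of "a *\<^sub>R f x" "b *\<^sub>R g x"] unfolding norm_scaleR power_mult_distrib power2_abs by (simp only: mult.assoc)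
    show "AE x in lborel. norm ((norm (a *\<^sub>R f x + b *\<^sub>R g x))\<^sup>2) \<le> norm (2 * a\<^sup>2 * (norm (f x))\<^sup>2 + 2 * b\<^sup>2 * (norm (g x))\<^sup>2)"
      unfolding real_norm_def abs_power2 by (intro AE_I2 order_trans[OF q abs_ge_self])
  qed measurable
qed

lemma measurable_component [measurable (raw)]:
  fixes g :: "'a \<Rightarrow> real ^ 'n"
  assumes "g \<in> borel_measurable M"
  shows "(\<lambda>x. g x $ i) \<in> borel_measurable M"
proof -
  have "(\<lambda>v :: real ^ 'n. v $ i) \<in> borel_measurable borel"
    by (intro borel_measurable_continuous_onI continuous_intros)
  from measurable_compose[OF assms this] show ?thesis .
qed

lemma L2_component:
  fixes g :: "real ^ 2 \<Rightarrow> real ^ 2"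
  assumes "L2 g" shows "L2 (\<lambda>x. g x $ i)"
  unfolding L2_def
proof
  have [measurable]: "g \<in> borel_measurable lborel" using assms by (auto simp: L2_def)
  show "(\<lambda>x. g x $ i) \<in> borel_measurable lborel" by measurable
  have "\<bar>v $ i\<bar>\<^sup>2 \<le> (norm v)\<^sup>2" for v :: "real ^ 2"
    by (rule power_mono[OF component_le_norm_cart abs_ge_zero])
  then have b: "norm ((norm (g x $ i))\<^sup>2) \<le> norm ((norm (g x))\<^sup>2)" for x by simp
  have "integrable lborel (\<lambda>x. (norm (g x))\<^sup>2)" using assms by (simp add: L2_def)
  then show "integrable lborel (\<lambda>x. (norm (g x $ i))\<^sup>2)"
    by (rule Bochner_Integration.integrable_bound) (use b in auto)
qed

lemma test_function_L2:
  assumes "test_function \<phi>" shows "L2 \<phi>"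
  unfolding L2_def
proof
  obtain B R where B: "B \<ge> 0" "\<And>x. \<bar>\<phi> x\<bar> \<le> B * indicator (cball 0 R) x"
    using test_function_bound[OF assms] by metis
  show m: "\<phi> \<in> borel_measurable lborel"
    using test_function_continuous[OF assms] by (simp add: borel_measurable_continuous_onI)
  show "integrable lborel (\<lambda>x. (norm (\<phi> x))\<^sup>2)"
  proof (rule Bochner_Integration.integrable_bound)
    show "integrable lborel (\<lambda>x :: real ^ 2. B\<^sup>2 * indicator (cball 0 R) x :: real)"
      using emeasure_lborel_cball_finite[of "0::real^2" R] 
      by (intro integrable_mult_right integrable_real_indicator) auto
    have "(\<phi> x)\<^sup>2 \<le> B\<^sup>2 * indicator (cball 0 R) x" for x
    proof (cases "x \<in> cball 0 R")
      case True
      then have "\<bar>\<phi> x\<bar> \<le> B" using B(2)[of x] by simp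
      then have "\<bar>\<phi> x\<bar>\<^sup>2 \<le> B\<^sup>2" by (rule power_mono) simp
      then show ?thesis using True by simp
    next
      case False
      then show ?thesis using B(2)[of x] by simp
    qed
    then show "AE x :: real ^ 2 in lborel. norm ((norm (\<phi> x))\<^sup>2) \<le> norm (B\<^sup>2 * indicator (cball 0 R) x :: real)"
      by simp
  qed (use m in measurable)
qed

section \<open>The fundamental lemma of the calculus of variations\<close>

text \<open>The positive and the negative part of \<open>f\<close> are densities of two measures that agree on the
  intersection-stable generator of all boxes, hence agree.\<close>

lemma AE_zero_of_box_integrals:
  fixes f :: "'a::euclidean_space \<Rightarrow> real"
  assumes [measurable]: "f \<in> borel_measurable borel"
    and int: "\<And>a b. integrable lborel (\<lambda>x. indicator (box a b) x * f x)"
    and zero: "\<And>a b. (\<integral>x. indicator (box a b) x * f x \<partial>lborel) = 0"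
  shows "AE x in lborel. f x = 0"
proof -
  let ?p = "\<lambda>x. ennreal (f x)" and ?n = "\<lambda>x. ennreal (- f x)"
  have eq: "emeasure (density lborel ?p) (box a b) = emeasure (density lborel ?n) (box a b)"
    and fin: "emeasure (density lborel ?p) (box a b) \<noteq> \<infinity>" for a b :: 'a
  proof -
    let ?g = "\<lambda>x. indicator (box a b) x * f x"
    have 1: "emeasure (density lborel ?p) (box a b) = (\<integral>\<^sup>+x. ennreal (?g x) \<partial>lborel)"
      by (subst emeasure_density) (auto intro!: nn_integral_cong simp: indicator_def)
    have 2: "emeasure (density lborel ?n) (box a b) = (\<integral>\<^sup>+x. ennreal (- ?g x) \<partial>lborel)"
      by (subst emeasure_density) (auto intro!: nn_integral_cong simp: indicator_def)
    have f1: "(\<integral>\<^sup>+x. ennreal (?g x) \<partial>lborel) \<noteq> \<infinity>" "(\<integral>\<^sup>+x. ennreal (- ?g x) \<partial>lborel) \<noteq> \<infinity>"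
      using int[of a b] by (auto simp: real_integrable_def)
    have "enn2real (\<integral>\<^sup>+x. ennreal (?g x) \<partial>lborel) = enn2real (\<integral>\<^sup>+x. ennreal (- ?g x) \<partial>lborel)"
      using real_lebesgue_integral_def[OF int[of a b]] zero[of a b] by simp
    then show "emeasure (density lborel ?p) (box a b) = emeasure (density lborel ?n) (box a b)"
      unfolding 1 2 using f1[unfolded infinity_ennreal_def top.not_eq_extremum, THEN ennreal_enn2real] by metis
    show "emeasure (density lborel ?p) (box a b) \<noteq> \<infinity>" unfolding 1 by (rule f1)
  qed
  have "density lborel ?p = density lborel ?n"
  proof (rule measure_eqI_generator_eq)
    let ?E = "range (\<lambda>(a, b). box a b :: 'a set)"
    show "Int_stable ?E"
      unfolding Int_stable_def
    proof safe
      fix a b c d :: 'a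
      have "box a b \<inter> box c d = (\<lambda>(a, b). box a b) (\<Sum>i\<in>Basis. max (a \<bullet> i) (c \<bullet> i) *\<^sub>R i, \<Sum>i\<in>Basis. min (b \<bullet> i) (d \<bullet> i) *\<^sub>R i)"
        unfolding split_conv by (rule box_Int_box)
      then show "box a b \<inter> box c d \<in> ?E" by blast
    qed
    show "?E \<subseteq> Pow UNIV" by simp
    show "emeasure (density lborel ?p) X = emeasure (density lborel ?n) X" if "X \<in> ?E" for X
      using that eq by auto
    show "sets (density lborel ?p) = sigma_sets UNIV ?E" "sets (density lborel ?n) = sigma_sets UNIV ?E"
      by (simp_all add: borel_eq_box)
    show "range (\<lambda>n::nat. box (- (real n *\<^sub>R One)) (real n *\<^sub>R One)) \<subseteq> ?E" by auto
    show "(\<Union>n::nat. box (- (real n *\<^sub>R One)) (real n *\<^sub>R One) :: 'a set) = UNIV"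
      by (rule UN_box_eq_UNIV)
    show "emeasure (density lborel ?p) (box (- (real i *\<^sub>R One)) (real i *\<^sub>R One)) \<noteq> \<infinity>" for i
      by (rule fin)
  qed
  then have "AE x in lborel. ?p x = ?n x"
    by (subst (asm) sigma_finite_measure.density_unique_iff[OF sigma_finite_lborel]) auto
  then show ?thesis
  proof eventually_elim
    case (elim x)
    show ?case
    proof (cases "f x \<ge> 0")
      case True
      then have "ennreal (f x) = 0" using elim by (simp add: ennreal_neg)
      then show ?thesis using True by (simp add: ennreal_eq_0_iff)
    next
      case False
      then have "ennreal (- f x) = 0" using elim by (simp add: ennreal_neg)
      then show ?thesis using False by (simp add: ennreal_eq_0_iff)
    qed
  qed
qed

lemma box_vec_2:
  "x \<in> box a b \<longleftrightarrow> x $ 1 \<in> {a $ 1<..<b $ 1} \<and> x $ 2 \<in> {a $ 2<..<b $ 2}" for x :: "real ^ 2"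
  by (auto simp: mem_box_cart forall_2)

definition bump2 :: "real ^ 2 \<Rightarrow> real ^ 2 \<Rightarrow> nat \<Rightarrow> real ^ 2 \<Rightarrow> real" where
  "bump2 a b n x = bump (a $ 1) (b $ 1) n (x $ 1) * bump (a $ 2) (b $ 2) n (x $ 2)"

lemma bump2_bound: "\<bar>bump2 a b n x\<bar> \<le> indicator (box a b) x"
proof (cases "x \<in> box a b")
  case True
  then show ?thesis using bump_bounds by (auto simp: bump2_def abs_mult intro!: mult_le_one)
next
  case False
  then show ?thesis using bump_eq_0 by (fastforce simp: bump2_def box_vec_2)
qed

lemma bump2_tendsto: "(\<lambda>n. bump2 a b n x) \<longlonglongrightarrow> indicator (box a b) x"
proof -
  have "(\<lambda>n. bump2 a b n x) \<longlonglongrightarrow> indicator {a $ 1<..<b $ 1} (x $ 1) * indicator {a $ 2<..<b $ 2} (x $ 2)"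
    unfolding bump2_def by (intro tendsto_mult bump_tendsto)
  also have "indicator {a $ 1<..<b $ 1} (x $ 1) * indicator {a $ 2<..<b $ 2} (x $ 2) = (indicator (box a b) x :: real)"
    by (auto simp: indicator_def box_vec_2)
  finally show ?thesis .
qed

lemma test_function_bump2: "test_function (bump2 a b n)"
proof -
  have C: "C_k k (bump2 a b n)" for k
    unfolding bump2_def[abs_def] by (intro C_k_mult C_k_comp[OF Dk_bump] C_k_coord)
  obtain R where "\<And>x. x \<in> box a b \<Longrightarrow> norm x \<le> R"
    using bounded_box[of a b] unfolding bounded_iff by blast
  then show ?thesis using bump2_bound[of a b n]
    by (intro test_functionI[OF C, of R]) (metis abs_le_zero_iff indicator_simps(2) not_le)
qed

text \<open>Products of bumps in the two coordinates approximate the indicator of a box boundedly, so all box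
  integrals of \<open>f\<close> vanish.\<close>

lemma fundamental_lemma:
  fixes f :: "real ^ 2 \<Rightarrow> real"
  assumes "L2 f" and zero: "\<And>\<phi>. test_function \<phi> \<Longrightarrow> (\<integral>x. f x * \<phi> x \<partial>lborel) = 0"
  shows "AE x in lborel. f x = 0"
proof (rule AE_zero_of_box_integrals)
  show m [measurable]: "f \<in> borel_measurable borel" using assms by (simp add: L2_def)
  fix a b :: "real ^ 2"
  have "L2 (indicator (box a b) :: real ^ 2 \<Rightarrow> real)"
    unfolding L2_def
  proof
    have "integrable lborel (indicator (box a b) :: real ^ 2 \<Rightarrow> real)"
      using emeasure_lborel_box_finite[of a b] by (intro integrable_real_indicator) auto
    moreover have "(norm (indicator (box a b) x :: real))\<^sup>2 = indicator (box a b) x" for x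
      by (simp add: indicator_def)
    ultimately show "integrable lborel (\<lambda>x. (norm (indicator (box a b) x :: real))\<^sup>2)" by simp
  qed measurable
  from L2_mult_integrable[OF this assms(1)]
  show i: "integrable lborel (\<lambda>x. indicator (box a b) x * f x)" .
  have "(\<lambda>n. \<integral>x. f x * bump2 a b n x \<partial>lborel) \<longlonglongrightarrow> (\<integral>x. indicator (box a b) x * f x \<partial>lborel)"
  proof (rule integral_dominated_convergence[where w = "\<lambda>x. \<bar>indicator (box a b) x * f x\<bar>"])
    show "AE x in lborel. (\<lambda>n. f x * bump2 a b n x) \<longlonglongrightarrow> indicator (box a b) x * f x"
      unfolding mult.commute[of "indicator _ _"] by (intro AE_I2 tendsto_mult tendsto_const bump2_tendsto)
    have "\<bar>f x\<bar> * \<bar>bump2 a b n x\<bar> \<le> \<bar>f x\<bar> * indicator (box a b) x" for n x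
      by (intro mult_left_mono bump2_bound) auto
    then show "AE x in lborel. norm (f x * bump2 a b n x) \<le> \<bar>indicator (box a b) x * f x\<bar>" for n
      unfolding real_norm_def abs_mult abs_indicator mult.commute[of "indicator _ _"] by (intro AE_I2)
    have [measurable]: "bump2 a b n \<in> borel_measurable borel" for n
      using test_function_L2[OF test_function_bump2] by (auto simp: L2_def)
    show "(\<lambda>x. f x * bump2 a b n x) \<in> borel_measurable lborel" for n by measurable
  qed (use i in auto)
  then show "(\<integral>x. indicator (box a b) x * f x \<partial>lborel) = 0"
    unfolding zero[OF test_function_bump2] by (simp add: LIMSEQ_const_iff)
qed

section \<open>The weak gradient\<close>

lemma weak_gradient_lincomb:
  assumes "L2 u" "L2 v" "L2_weak_gradient u g" "L2_weak_gradient v k"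
  shows "L2_weak_gradient (\<lambda>x. a * u x + b * v x) (\<lambda>x. a *\<^sub>R g x + b *\<^sub>R k x)"
  unfolding L2_weak_gradient_def
proof safe
  have L: "L2 g" "L2 k" using assms by (auto simp: L2_weak_gradient_def)
  show "L2 (\<lambda>x. a *\<^sub>R g x + b *\<^sub>R k x)" by (rule L2_lincomb[OF L])
  fix \<phi> i assume t: "test_function \<phi>"
  note tL = test_function_L2[OF t] test_function_L2[OF test_function_partial[OF t, of i]]
  have "(\<integral>x. (a * u x + b * v x) * partial i \<phi> x \<partial>lborel)
     = a * (\<integral>x. u x * partial i \<phi> x \<partial>lborel) + b * (\<integral>x. v x * partial i \<phi> x \<partial>lborel)"
    using L2_mult_integrable[OF assms(1) tL(2)] L2_mult_integrable[OF assms(2) tL(2)]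
    by (simp add: distrib_right mult.assoc)
  also have "\<dots> = a * - (\<integral>x. g x $ i * \<phi> x \<partial>lborel) + b * - (\<integral>x. k x $ i * \<phi> x \<partial>lborel)"
    using assms t by (simp add: L2_weak_gradient_def)
  also have "\<dots> = - (\<integral>x. (a *\<^sub>R g x + b *\<^sub>R k x) $ i * \<phi> x \<partial>lborel)"
    using L2_mult_integrable[OF L2_component[OF L(1)] tL(1)] L2_mult_integrable[OF L2_component[OF L(2)] tL(1)]
    by (simp add: distrib_right mult.assoc)
  finally show "(\<integral>x. (a * u x + b * v x) * partial i \<phi> x \<partial>lborel)
     = - (\<integral>x. (a *\<^sub>R g x + b *\<^sub>R k x) $ i * \<phi> x \<partial>lborel)" .
qed

text \<open>Consequently \<open>grad\<close>, which is an arbitrary choice, agrees almost everywhere with any weak gradient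
  found by computation.\<close>

lemma weak_gradient_unique:
  assumes "L2_weak_gradient u g" "L2_weak_gradient u k"
  shows "AE x in lborel. g x = k x"
proof -
  have L: "L2 g" "L2 k" using assms by (auto simp: L2_weak_gradient_def)
  have "AE x in lborel. g x $ i - k x $ i = 0" for i
  proof (rule fundamental_lemma)
    show "L2 (\<lambda>x. g x $ i - k x $ i)"
      using L2_lincomb[OF L2_component[OF L(1), of i] L2_component[OF L(2), of i], of 1 "-1"] by simp
    fix \<phi> assume t: "test_function \<phi>"
    note tL = test_function_L2[OF t]
    have "(\<integral>x. g x $ i * \<phi> x \<partial>lborel) = (\<integral>x. k x $ i * \<phi> x \<partial>lborel)"
    proof -
      have "- (\<integral>x. g x $ i * \<phi> x \<partial>lborel) = - (\<integral>x. k x $ i * \<phi> x \<partial>lborel)"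
        using assms t unfolding L2_weak_gradient_def by auto
      then show ?thesis by simp
    qed
    then show "(\<integral>x. (g x $ i - k x $ i) * \<phi> x \<partial>lborel) = 0"
      using L2_mult_integrable[OF L2_component[OF L(1)] tL(1)] L2_mult_integrable[OF L2_component[OF L(2)] tL(1)]
      by (simp add: left_diff_distrib)
  qed
  from this[of 1] this[of 2] show ?thesis
    by eventually_elim (simp add: vec_eq_iff forall_2)
qed

lemma weak_gradient_grad: "L2_weak_gradient u g \<Longrightarrow> L2_weak_gradient u (grad u)"
  unfolding grad_def by (rule someI[of "L2_weak_gradient u"])

lemma grad_weak: "u \<in> H1 \<Longrightarrow> L2_weak_gradient u (grad u)"
  unfolding H1_def using weak_gradient_grad by blast

lemma H1_L2: "u \<in> H1 \<Longrightarrow> L2 u" "u \<in> H1 \<Longrightarrow> L2 (grad u)"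
  using grad_weak by (auto simp: H1_def L2_weak_gradient_def)

lemma grad_AE: "L2_weak_gradient u g \<Longrightarrow> AE x in lborel. grad u x = g x"
  by (rule weak_gradient_unique[OF weak_gradient_grad])

lemma H1_lincomb:
  assumes "u \<in> H1" "v \<in> H1"
  shows "(\<lambda>x. a * u x + b * v x) \<in> H1"
    and "AE x in lborel. grad (\<lambda>x. a * u x + b * v x) x = a *\<^sub>R grad u x + b *\<^sub>R grad v x"
proof -
  note w = weak_gradient_lincomb[OF H1_L2(1)[OF assms(1)] H1_L2(1)[OF assms(2)] grad_weak[OF assms(1)] grad_weak[OF assms(2)]]
  show "(\<lambda>x. a * u x + b * v x) \<in> H1"
    unfolding H1_def using w L2_lincomb[OF H1_L2(1)[OF assms(1)] H1_L2(1)[OF assms(2)], of a b] by auto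
  show "AE x in lborel. grad (\<lambda>x. a * u x + b * v x) x = a *\<^sub>R grad u x + b *\<^sub>R grad v x"
    by (rule grad_AE[OF w])
qed

lemma H1r_lincomb:
  assumes "u \<in> H1r" "v \<in> H1r"
  shows "(\<lambda>x. a * u x + b * v x) \<in> H1r"
proof -
  have "radial (\<lambda>x. a * u x + b * v x)"
    using assms unfolding H1r_def radial_def by (metis (mono_tags, lifting) mem_Collect_eq)
  then show ?thesis using assms H1_lincomb(1) by (auto simp: H1r_def)
qed

section \<open>Profiles of radial Sobolev functions\<close>

lemma norm_square_2: "(norm x)\<^sup>2 = x $ 1 * x $ 1 + x $ 2 * x $ 2" for x :: "real ^ 2"
  unfolding power2_norm_eq_inner inner_vec_def by (simp add: sum_2)

lemma norm_square_has_derivative: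
  "((\<lambda>x :: real ^ 2. (norm x)\<^sup>2) has_derivative (\<lambda>h. 2 * (x \<bullet> h))) (at x)"
  unfolding power2_norm_eq_inner by (auto intro!: derivative_eq_intros simp: inner_commute)

text \<open>The test field is \<open>x \<zeta>(|x|\<^sup>2) / |x|\<^sup>2\<close>. In the plane \<open>x / |x|\<^sup>2\<close> is divergence free away from the origin,
  so only \<open>\<zeta>\<close> is differentiated and the divergence is \<open>2 \<zeta>'(|x|\<^sup>2)\<close>.\<close>

lemma weak_gradient_radial_field:
  assumes "L2 u" and g: "L2_weak_gradient u g"
    and smooth: "\<And>k. Dk k \<zeta>" and d\<zeta>: "\<And>x. (\<zeta> has_real_derivative \<alpha> x) (at x)"
    and "0 < a" and supp: "\<And>x. x < a \<Longrightarrow> \<zeta> x = 0" "\<And>x. x > b \<Longrightarrow> \<zeta> x = 0"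
  shows "(\<integral>x. u x * (2 * \<alpha> ((norm x)\<^sup>2)) \<partial>lborel)
       = - (\<integral>x. (g x \<bullet> x) / (norm x)\<^sup>2 * \<zeta> ((norm x)\<^sup>2) \<partial>lborel)"
proof -
  define \<eta> where "\<eta> = (\<lambda>\<rho>. \<zeta> \<rho> / \<rho> ^ 1)"
  have Dk\<eta>: "Dk k \<eta>" for k unfolding \<eta>_def by (rule Dk_divide_power[OF smooth \<open>0 < a\<close> supp(1)])
  then have "\<exists>\<eta>'. \<forall>x. (\<eta> has_real_derivative \<eta>' x) (at x)"
    by (metis Dk.simps(2))
  then obtain \<eta>' where d\<eta>: "\<And>x. (\<eta> has_real_derivative \<eta>' x) (at x)" by blast
  define \<phi> where "\<phi> = (\<lambda>i (x :: real ^ 2). x $ i * \<eta> ((norm x)\<^sup>2))"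
  have t: "test_function (\<phi> i)" for i
  proof (rule test_functionI)
    show "C_k k (\<phi> i)" for k
      unfolding \<phi>_def norm_square_2 by (intro C_k_mult C_k_comp[OF Dk\<eta>] C_k_add C_k_coord)
    show "\<phi> i x = 0" if "sqrt \<bar>b\<bar> < norm x" for x
    proof -
      have "b < (norm x)\<^sup>2" using that real_sqrt_less_iff[of "\<bar>b\<bar>" "(norm x)\<^sup>2"] by simp
      then show ?thesis by (simp add: \<phi>_def \<eta>_def supp)
    qed
  qed
  have p: "partial i (\<phi> i) x = \<eta> ((norm x)\<^sup>2) + 2 * (x $ i)\<^sup>2 * \<eta>' ((norm x)\<^sup>2)" for i x
  proof -
    have 1: "((\<lambda>x::real^2. x $ i) has_derivative (\<lambda>h. h $ i)) (at x)"
      by (intro bounded_linear_imp_has_derivative bounded_linear_vec_nth)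
    have 2: "((\<lambda>x::real^2. \<eta> ((norm x)\<^sup>2)) has_derivative (\<lambda>h. \<eta>' ((norm x)\<^sup>2) * (2 * (x \<bullet> h)))) (at x)"
      using has_derivative_compose[OF norm_square_has_derivative d\<eta>[unfolded has_field_derivative_def]] by simp
    show ?thesis
      unfolding \<phi>_def using partial_eq[OF has_derivative_mult[OF 1 2], of i]
      by (simp add: inner_axis power2_eq_square)
  qed
  \<comment> \<open>the product rule for \<open>\<zeta> \<rho> = \<rho> * \<eta> \<rho>\<close>\<close>
  have div: "partial 1 (\<phi> 1) x + partial 2 (\<phi> 2) x = 2 * \<alpha> ((norm x)\<^sup>2)" if "x \<noteq> 0" for x
  proof -
    define \<rho> where "\<rho> = (norm x)\<^sup>2"
    have "\<rho> > 0" using that by (simp add: \<rho>_def)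
    have "((\<lambda>\<rho>. \<rho> * \<eta> \<rho>) has_real_derivative \<eta> \<rho> + \<rho> * \<eta>' \<rho>) (at \<rho>)"
      using DERIV_mult[OF DERIV_ident d\<eta>[of \<rho>]] by (simp add: mult.commute)
    moreover have "(\<lambda>\<rho>. \<rho> * \<eta> \<rho>) = \<zeta>"
      using supp(1)[of 0] \<open>0 < a\<close> by (auto simp: \<eta>_def fun_eq_iff)
    ultimately have e1: "\<eta> \<rho> + \<rho> * \<eta>' \<rho> = \<alpha> \<rho>" using DERIV_unique[OF _ d\<zeta>] by simp
    have e2: "\<rho> = (x $ 1)\<^sup>2 + (x $ 2)\<^sup>2" unfolding \<rho>_def norm_square_2 by (simp add: power2_eq_square)
    have "partial 1 (\<phi> 1) x + partial 2 (\<phi> 2) x = 2 * (\<eta> \<rho> + ((x $ 1)\<^sup>2 + (x $ 2)\<^sup>2) * \<eta>' \<rho>)"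
      unfolding p \<rho>_def[symmetric] by (simp add: algebra_simps)
    then show ?thesis using e1 unfolding e2[symmetric] \<rho>_def by simp
  qed
  have Lg: "L2 g" using g by (simp add: L2_weak_gradient_def)
  note tL = test_function_L2[OF t] test_function_L2[OF test_function_partial[OF t]]
  have i: "integrable lborel (\<lambda>x. u x * partial i (\<phi> i) x)" "integrable lborel (\<lambda>x. g x $ i * \<phi> i x)" for i
    using L2_mult_integrable[OF \<open>L2 u\<close> tL(2)] L2_mult_integrable[OF L2_component[OF Lg] tL(1)] by auto
  have "AE x in lborel. x \<noteq> (0 :: real ^ 2)" by (rule AE_lborel_singleton)
  then have ae: "AE x in lborel. u x * (2 * \<alpha> ((norm x)\<^sup>2)) = u x * partial 1 (\<phi> 1) x + u x * partial 2 (\<phi> 2) x"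
    by eventually_elim (simp add: div[symmetric] distrib_left)
  obtain \<alpha>' where "\<And>x. (\<zeta> has_real_derivative \<alpha>' x) (at x)" "continuous_on UNIV \<alpha>'"
    using smooth[of "Suc 0"] by auto
  moreover have "\<alpha>' = \<alpha>" using calculation(1) d\<zeta> DERIV_unique by blast
  ultimately have [measurable]: "\<alpha> \<in> borel_measurable borel"
    by (simp add: borel_measurable_continuous_onI)
  have [measurable]: "u \<in> borel_measurable borel" using \<open>L2 u\<close> by (simp add: L2_def)
  have [measurable]: "partial i (\<phi> i) \<in> borel_measurable borel" for i using tL(2) by (simp add: L2_def)
  have "(\<integral>x. u x * (2 * \<alpha> ((norm x)\<^sup>2)) \<partial>lborel)
     = (\<integral>x. u x * partial 1 (\<phi> 1) x + u x * partial 2 (\<phi> 2) x \<partial>lborel)"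
    by (rule integral_cong_AE[OF _ _ ae]) measurable
  also have "\<dots> = (\<integral>x. u x * partial 1 (\<phi> 1) x \<partial>lborel) + (\<integral>x. u x * partial 2 (\<phi> 2) x \<partial>lborel)"
    by (rule Bochner_Integration.integral_add[OF i(1) i(1)])
  also have "\<dots> = - (\<integral>x. g x $ 1 * \<phi> 1 x \<partial>lborel) - (\<integral>x. g x $ 2 * \<phi> 2 x \<partial>lborel)"
    using g t by (simp add: L2_weak_gradient_def)
  also have "\<dots> = - (\<integral>x. g x $ 1 * \<phi> 1 x + g x $ 2 * \<phi> 2 x \<partial>lborel)"
    by (simp add: Bochner_Integration.integral_add[OF i(2) i(2)])
  also have "(\<lambda>x. g x $ 1 * \<phi> 1 x + g x $ 2 * \<phi> 2 x) = (\<lambda>x. (g x \<bullet> x) / (norm x)\<^sup>2 * \<zeta> ((norm x)\<^sup>2))"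
    by (auto simp: fun_eq_iff \<phi>_def \<eta>_def inner_vec_def sum_2 algebra_simps add_divide_distrib)
  finally show ?thesis .
qed

lemma annulus_inverse_square:
  assumes "0 < s" "s \<le> t"
  shows "L2 (\<lambda>x :: real ^ 2. indicator {s..t} ((norm x)\<^sup>2) / norm x)"
    and "(\<integral>x. (indicator {s..t} ((norm x)\<^sup>2) / norm (x :: real ^ 2))\<^sup>2 \<partial>lborel) = pi * ln (t / s)"
proof -
  define f where "f = (\<lambda>\<rho> :: real. indicator {s..t} \<rho> / \<rho>)"
  have [measurable]: "f \<in> borel_measurable borel" unfolding f_def by measurable
  have eq: "(indicator {s..t} ((norm x)\<^sup>2) / norm x)\<^sup>2 = f ((norm x)\<^sup>2)" for x :: "real ^ 2"
    by (simp add: f_def indicator_def power_divide)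
  have h: "has_bochner_integral lborel (\<lambda>x. inverse x * indicator {s..t} x) (ln t - ln s)"
    using assms by (intro has_bochner_integral_FTC_Icc_real)
      (auto intro!: DERIV_ln continuous_intros)
  have fe: "indicator {0<..} \<rho> *\<^sub>R f \<rho> = inverse \<rho> * indicator {s..t} \<rho>" for \<rho>
    using assms by (auto simp: f_def indicator_def field_simps)
  have si: "set_integrable lborel {0<..} f" and sv: "(LINT \<rho>:{0<..}|lborel. f \<rho>) = ln t - ln s"
    unfolding set_integrable_def set_lebesgue_integral_def fe using h
    by (auto simp: has_bochner_integral_iff)
  show "L2 (\<lambda>x :: real ^ 2. indicator {s..t} ((norm x)\<^sup>2) / norm x)"
    unfolding L2_def
  proof
    show "integrable lborel (\<lambda>x::real^2. (norm (indicator {s..t} ((norm x)\<^sup>2) / norm x))\<^sup>2)"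
      unfolding real_norm_def power2_abs eq integrable_radial_iff[OF \<open>f \<in> borel_measurable borel\<close>] by (rule si)
  qed measurable
  show "(\<integral>x. (indicator {s..t} ((norm x)\<^sup>2) / norm (x :: real ^ 2))\<^sup>2 \<partial>lborel) = pi * ln (t / s)"
    unfolding eq integral_radial[OF \<open>f \<in> borel_measurable borel\<close>] sv using assms by (simp add: ln_div)
qed

text \<open>Cauchy-Schwarz against \<open>1 / |x|\<close>, whose square has logarithmic mass on an annulus. This is where the
  logarithmic modulus of continuity comes from.\<close>

lemma radial_flux_bound:
  assumes "L2 g" "0 < s" "s \<le> t"
  shows "integrable lborel (\<lambda>x. \<bar>(g x \<bullet> x) / (norm x)\<^sup>2\<bar> * indicator {s..t} ((norm x)\<^sup>2))"
    and "(\<integral>x. \<bar>(g x \<bullet> x) / (norm x)\<^sup>2\<bar> * indicator {s..t} ((norm x)\<^sup>2) \<partial>lborel)\<^sup>2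
       \<le> (\<integral>x. (norm (g x))\<^sup>2 \<partial>lborel) * (pi * ln (t / s))"
proof -
  let ?k = "\<lambda>x :: real ^ 2. indicator {s..t} ((norm x)\<^sup>2) / norm x :: real"
  let ?q = "\<lambda>x. \<bar>(g x \<bullet> x) / (norm x)\<^sup>2\<bar> * indicator {s..t} ((norm x)\<^sup>2)"
  note k = annulus_inverse_square[OF assms(2,3)]
  have [measurable]: "g \<in> borel_measurable borel" using assms(1) by (simp add: L2_def)
  have g2: "integrable lborel (\<lambda>x. (norm (g x))\<^sup>2)" using assms(1) by (simp add: L2_def)
  have k2: "integrable lborel (\<lambda>x. (?k x)\<^sup>2)" using k(1) by (simp add: L2_def)
  have [measurable]: "?k \<in> borel_measurable borel" using k(1) by (simp add: L2_def)
  note CS = Cauchy_Schwarz_integral[of "\<lambda>x. norm (g x)" lborel ?k, OF _ _ g2 k2]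
  have b: "?q x \<le> norm (g x) * ?k x" for x
  proof (cases "x = 0")
    case False
    have "\<bar>g x \<bullet> x\<bar> / (norm x)\<^sup>2 \<le> norm (g x) * norm x / (norm x)\<^sup>2"
      by (intro divide_right_mono Cauchy_Schwarz_ineq2) simp
    also have "\<dots> = norm (g x) / norm x" using False by (simp add: power2_eq_square)
    finally show ?thesis by (auto simp: indicator_def)
  qed simp
  have gk: "integrable lborel (\<lambda>x. norm (g x) * ?k x)" by (rule CS(1)) measurable
  show i: "integrable lborel ?q"
  proof (rule Bochner_Integration.integrable_bound[OF gk])
    show "AE x in lborel. norm (?q x) \<le> norm (norm (g x) * ?k x)"
      using order_trans[OF b abs_ge_self] by (intro AE_I2) (simp only: real_norm_def abs_mult abs_abs abs_indicator)
  qed measurable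
  have "(\<integral>x. ?q x \<partial>lborel)\<^sup>2 \<le> (\<integral>x. norm (g x) * ?k x \<partial>lborel)\<^sup>2"
    by (intro power_mono integral_mono[OF i gk b] Bochner_Integration.integral_nonneg) simp
  also have "\<dots> \<le> (\<integral>x. (norm (g x))\<^sup>2 \<partial>lborel) * (\<integral>x. (?k x)\<^sup>2 \<partial>lborel)"
    by (rule CS(2)) measurable
  finally show "(\<integral>x. ?q x \<partial>lborel)\<^sup>2 \<le> (\<integral>x. (norm (g x))\<^sup>2 \<partial>lborel) * (pi * ln (t / s))"
    unfolding k(2) .
qed

lemma smooth_antiderivative:
  fixes \<alpha> :: "real \<Rightarrow> real"
  assumes cont: "continuous_on UNIV \<alpha>" and supp: "\<And>x. x \<notin> {a..b} \<Longrightarrow> \<alpha> x = 0"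
  defines "\<zeta> \<equiv> \<lambda>y. \<integral>\<sigma>. indicator {..y} \<sigma> * \<alpha> \<sigma> \<partial>lborel"
  shows "integrable lborel \<alpha>" and "(\<zeta> has_real_derivative \<alpha> x) (at x)"
    and "y < a \<Longrightarrow> \<zeta> y = 0" and "b < y \<Longrightarrow> \<zeta> y = (\<integral>\<sigma>. \<alpha> \<sigma> \<partial>lborel)"
proof -
  have "integrable lborel (\<lambda>x. indicator {a..b} x *\<^sub>R \<alpha> x)"
    by (intro borel_integrable_compact continuous_on_subset[OF cont]) auto
  also have "(\<lambda>x. indicator {a..b} x *\<^sub>R \<alpha> x) = \<alpha>"
    using supp by (auto simp: fun_eq_iff indicator_def)
  finally show i: "integrable lborel \<alpha>" .
  show "\<zeta> y = 0" if "y < a"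
  proof -
    have "(\<lambda>\<sigma>. indicator {..y} \<sigma> * \<alpha> \<sigma>) = (\<lambda>\<sigma>. 0)"
      using supp that by (auto simp: fun_eq_iff indicator_def)
    then show ?thesis unfolding \<zeta>_def by simp
  qed
  show "\<zeta> y = (\<integral>\<sigma>. \<alpha> \<sigma> \<partial>lborel)" if "b < y"
  proof -
    have "(\<lambda>\<sigma>. indicator {..y} \<sigma> * \<alpha> \<sigma>) = \<alpha>"
      using supp that by (auto simp: fun_eq_iff indicator_def)
    then show ?thesis unfolding \<zeta>_def by simp
  qed
  define N where "N = \<bar>x\<bar> + \<bar>a\<bar> + \<bar>b\<bar> + 1"
  have eq: "\<zeta> y = integral {-N..y} \<alpha>" for y
  proof -
    have "set_integrable lborel {-N..y} \<alpha>"
      unfolding set_integrable_def by (intro borel_integrable_compact continuous_on_subset[OF cont]) auto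
    then have "integral {-N..y} \<alpha> = (LINT x:{-N..y}|lborel. \<alpha> x)"
      by (simp add: set_borel_integral_eq_integral(2))
    also have "\<dots> = \<zeta> y"
      unfolding \<zeta>_def set_lebesgue_integral_def
    proof (rule Bochner_Integration.integral_cong[OF refl])
      fix \<sigma>
      show "indicator {-N..y} \<sigma> *\<^sub>R \<alpha> \<sigma> = indicator {..y} \<sigma> * \<alpha> \<sigma>"
        using supp[of \<sigma>] unfolding N_def by (cases "\<sigma> \<in> {a..b}") (auto simp: indicator_def)
    qed
    finally show ?thesis by simp
  qed
  have "((\<lambda>y. integral {-N..y} \<alpha>) has_real_derivative \<alpha> x) (at x within {-N..N})"
    by (rule integral_has_real_derivative) (auto simp: N_def intro: continuous_on_subset[OF cont])
  moreover have "x \<in> interior {-N..N}" by (auto simp: N_def)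
  then have "at x within {-N..N} = at x" by (rule at_within_interior)
  ultimately have "((\<lambda>y. integral {-N..y} \<alpha>) has_real_derivative \<alpha> x) (at x)" by simp
  moreover have "\<zeta> = (\<lambda>y. integral {-N..y} \<alpha>)" using eq by (rule ext)
  ultimately show "(\<zeta> has_real_derivative \<alpha> x) (at x)" by simp
qed

text \<open>Up to sign the indicator of the interval between \<open>s\<close> and 1. The base point 1 keeps the annuli
  away from the origin, where \<open>1 / |x|\<close> is not square integrable.\<close>

definition step_difference :: "real \<Rightarrow> real \<Rightarrow> real" where
  "step_difference s \<rho> = (if s \<le> \<rho> then 1 else 0) - (if 1 \<le> \<rho> then 1 else 0)"

text \<open>For a smooth radial function \<open>u\<close> with gradient \<open>g\<close>, polar coordinates turn this into
  \<open>2\<pi> (u(1) - u(\<surd>s))\<close>.\<close>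

definition radial_flux :: "(real ^ 2 \<Rightarrow> real ^ 2) \<Rightarrow> real \<Rightarrow> real" where
  "radial_flux g s = (\<integral>x. (g x \<bullet> x) / (norm x)\<^sup>2 * step_difference s ((norm x)\<^sup>2) \<partial>lborel)"

lemma step_difference_measurable [measurable (raw)]:
  assumes [measurable]: "f \<in> borel_measurable M" "k \<in> borel_measurable M"
  shows "(\<lambda>x. step_difference (f x) (k x)) \<in> borel_measurable M"
  unfolding step_difference_def by measurable

lemma step_difference_bound:
  "\<bar>step_difference s \<rho>\<bar> \<le> indicator {min s 1..max s 1} \<rho>"
  by (auto simp: step_difference_def indicator_def)

text \<open>Interchanging the integrals moves the antiderivative of \<open>\<alpha>\<close> from the test field to the flux of \<open>g\<close>.\<close>

lemma radial_flux_Fubini: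
  fixes \<alpha> :: "real \<Rightarrow> real"
  assumes g: "L2 g" and [measurable]: "\<alpha> \<in> borel_measurable borel"
    and "0 < a" and bd: "\<And>\<sigma>. \<bar>\<alpha> \<sigma>\<bar> \<le> B * indicator {a..b} \<sigma>"
  shows "integrable lborel (\<lambda>\<sigma>. \<alpha> \<sigma> * radial_flux g \<sigma>)"
    and "(\<integral>x. (g x \<bullet> x) / (norm x)\<^sup>2 * (\<integral>\<sigma>. \<alpha> \<sigma> * step_difference \<sigma> ((norm x)\<^sup>2) \<partial>lborel) \<partial>lborel)
       = (\<integral>\<sigma>. \<alpha> \<sigma> * radial_flux g \<sigma> \<partial>lborel)"
proof -
  define q where "q x = (g x \<bullet> x) / (norm x)\<^sup>2" for x
  define f where "f x \<sigma> = q x * (\<alpha> \<sigma> * step_difference \<sigma> ((norm x)\<^sup>2))" for x \<sigma>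
  define a' b' where "a' = min a 1" and "b' = max b 1"
  have [measurable]: "g \<in> borel_measurable borel" using g by (simp add: L2_def)
  have [measurable]: "q \<in> borel_measurable borel" unfolding q_def by measurable
  let ?Q = "\<lambda>x. \<bar>q x\<bar> * indicator {a'..b'} ((norm x)\<^sup>2)"
  have iQ: "integrable lborel ?Q"
    unfolding q_def using \<open>0 < a\<close> by (intro radial_flux_bound(1)[OF g]) (auto simp: a'_def b'_def)
  have i\<alpha>: "integrable lborel \<alpha>"
  proof (rule Bochner_Integration.integrable_bound)
    show "integrable lborel (\<lambda>\<sigma>. B * indicator {a..b} \<sigma> :: real)"
      using emeasure_lborel_cbox_finite[of a b] by (intro integrable_mult_right integrable_real_indicator) auto
    show "AE x in lborel. norm (\<alpha> x) \<le> norm (B * indicator {a..b} x :: real)"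
      unfolding real_norm_def by (intro AE_I2 order_trans[OF bd abs_ge_self])
  qed measurable
  have fb: "\<bar>f x \<sigma>\<bar> \<le> ?Q x * \<bar>\<alpha> \<sigma>\<bar>" for x \<sigma>
  proof (cases "\<sigma> \<in> {a..b}")
    case True
    have "\<bar>step_difference \<sigma> ((norm x)\<^sup>2)\<bar> \<le> indicator {min \<sigma> 1..max \<sigma> 1} ((norm x)\<^sup>2)"
      by (rule step_difference_bound)
    also have "\<dots> \<le> indicator {a'..b'} ((norm x)\<^sup>2)"
      using True by (auto simp: indicator_def a'_def b'_def)
    finally have "\<bar>q x\<bar> * \<bar>\<alpha> \<sigma>\<bar> * \<bar>step_difference \<sigma> ((norm x)\<^sup>2)\<bar> \<le> \<bar>q x\<bar> * \<bar>\<alpha> \<sigma>\<bar> * indicator {a'..b'} ((norm x)\<^sup>2)"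
      by (intro mult_left_mono) auto
    then show ?thesis by (simp add: f_def abs_mult mult_ac)
  next
    case False
    then have "\<alpha> \<sigma> = 0" using bd[of \<sigma>] by simp
    then show ?thesis by (simp add: f_def)
  qed
  have [measurable]: "(\<lambda>p. f (fst p) (snd p)) \<in> borel_measurable (lborel \<Otimes>\<^sub>M lborel)"
    unfolding f_def by measurable
  have inner: "integrable lborel (\<lambda>\<sigma>. f x \<sigma>)" for x
  proof (rule Bochner_Integration.integrable_bound)
    show "integrable lborel (\<lambda>\<sigma>. ?Q x * \<bar>\<alpha> \<sigma>\<bar>)" using i\<alpha> by (intro integrable_mult_right integrable_abs)
    show "AE \<sigma> in lborel. norm (f x \<sigma>) \<le> norm (?Q x * \<bar>\<alpha> \<sigma>\<bar>)"
      unfolding real_norm_def by (intro AE_I2 order_trans[OF fb abs_ge_self])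
    show "(\<lambda>\<sigma>. f x \<sigma>) \<in> borel_measurable lborel" unfolding f_def by measurable
  qed
  have fubini: "integrable (lborel \<Otimes>\<^sub>M lborel) (case_prod f)"
  proof (rule lborel_pair.Fubini_integrable)
    show "case_prod f \<in> borel_measurable (lborel \<Otimes>\<^sub>M lborel)"
      by (simp add: case_prod_beta' )
    show "AE x in lborel. integrable lborel (\<lambda>y. case (x, y) of (x, xa) \<Rightarrow> f x xa)" using inner by simp
    show "integrable lborel (\<lambda>x. \<integral>y. norm (case (x, y) of (x, xa) \<Rightarrow> f x xa) \<partial>lborel)"
    proof (rule Bochner_Integration.integrable_bound)
      show "integrable lborel (\<lambda>x. ?Q x * (\<integral>\<sigma>. \<bar>\<alpha> \<sigma>\<bar> \<partial>lborel))" using iQ by (intro integrable_mult_left)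
      show "(\<lambda>x. \<integral>y. norm (case (x, y) of (x, xa) \<Rightarrow> f x xa) \<partial>lborel) \<in> borel_measurable lborel"
        unfolding prod.case f_def by measurable
      have "(\<integral>y. \<bar>f x y\<bar> \<partial>lborel) \<le> \<bar>?Q x * (\<integral>\<sigma>. \<bar>\<alpha> \<sigma>\<bar> \<partial>lborel)\<bar>" for x
      proof -
        have "(\<integral>y. \<bar>f x y\<bar> \<partial>lborel) \<le> (\<integral>\<sigma>. ?Q x * \<bar>\<alpha> \<sigma>\<bar> \<partial>lborel)"
          using i\<alpha> by (intro integral_mono fb integrable_abs inner integrable_mult_right)
        also have "\<dots> = ?Q x * (\<integral>\<sigma>. \<bar>\<alpha> \<sigma>\<bar> \<partial>lborel)" by simp
        finally show ?thesis by (rule order_trans[OF _ abs_ge_self])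
      qed
      then show "AE x in lborel. norm (\<integral>y. norm (case (x, y) of (x, xa) \<Rightarrow> f x xa) \<partial>lborel)
           \<le> norm (?Q x * (\<integral>\<sigma>. \<bar>\<alpha> \<sigma>\<bar> \<partial>lborel))"
        by simp
    qed
  qed
  have K: "(\<integral>x. f x \<sigma> \<partial>lborel) = \<alpha> \<sigma> * radial_flux g \<sigma>" for \<sigma>
  proof -
    have "(\<integral>x. f x \<sigma> \<partial>lborel) = (\<integral>x. \<alpha> \<sigma> * (q x * step_difference \<sigma> ((norm x)\<^sup>2)) \<partial>lborel)"
      by (intro Bochner_Integration.integral_cong) (auto simp: f_def)
    also have "\<dots> = \<alpha> \<sigma> * (\<integral>x. q x * step_difference \<sigma> ((norm x)\<^sup>2) \<partial>lborel)"
      by (rule integral_mult_right_zero)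
    finally show ?thesis unfolding radial_flux_def q_def .
  qed
  show "integrable lborel (\<lambda>\<sigma>. \<alpha> \<sigma> * radial_flux g \<sigma>)"
    using lborel_pair.integrable_snd[OF fubini] unfolding K .
  show "(\<integral>x. (g x \<bullet> x) / (norm x)\<^sup>2 * (\<integral>\<sigma>. \<alpha> \<sigma> * step_difference \<sigma> ((norm x)\<^sup>2) \<partial>lborel) \<partial>lborel)
       = (\<integral>\<sigma>. \<alpha> \<sigma> * radial_flux g \<sigma> \<partial>lborel)"
    using lborel_pair.Fubini_integral[OF fubini] unfolding K by (simp add: f_def q_def)
qed

lemma radial_flux_measurable:
  assumes "L2 g" shows "radial_flux g \<in> borel_measurable borel"
proof -
  have [measurable]: "g \<in> borel_measurable borel" using assms by (simp add: L2_def)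
  show ?thesis unfolding radial_flux_def by measurable
qed

lemma radial_flux_diff:
  assumes "L2 g" "0 < s" "s \<le> t"
  shows "(radial_flux g s - radial_flux g t)\<^sup>2 \<le> (\<integral>x. (norm (g x))\<^sup>2 \<partial>lborel) * (pi * ln (t / s))"
proof -
  define q where "q x = (g x \<bullet> x) / (norm x)\<^sup>2" for x
  have [measurable]: "g \<in> borel_measurable borel" using assms by (simp add: L2_def)
  have [measurable]: "q \<in> borel_measurable borel" unfolding q_def by measurable
  have i: "integrable lborel (\<lambda>x. q x * step_difference r ((norm x)\<^sup>2))" if "0 < r" for r
  proof (rule Bochner_Integration.integrable_bound)
    show "integrable lborel (\<lambda>x. \<bar>q x\<bar> * indicator {min r 1..max r 1} ((norm x)\<^sup>2))"
      unfolding q_def using that by (intro radial_flux_bound(1)[OF assms(1)]) auto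
    show "AE x in lborel. norm (q x * step_difference r ((norm x)\<^sup>2)) \<le> norm (\<bar>q x\<bar> * indicator {min r 1..max r 1} ((norm x)\<^sup>2))"
      unfolding real_norm_def abs_mult abs_abs abs_indicator
      by (intro AE_I2 mult_left_mono step_difference_bound abs_ge_zero)
  qed measurable
  let ?Q = "\<lambda>x. \<bar>q x\<bar> * indicator {s..t} ((norm x)\<^sup>2)"
  have iQ: "integrable lborel ?Q" unfolding q_def by (rule radial_flux_bound(1)[OF assms])
  have "\<bar>radial_flux g s - radial_flux g t\<bar> = \<bar>\<integral>x. q x * step_difference s ((norm x)\<^sup>2) - q x * step_difference t ((norm x)\<^sup>2) \<partial>lborel\<bar>"
    unfolding radial_flux_def q_def[symmetric] using i[of s] i[of t] assms by simp
  also have "\<dots> \<le> (\<integral>x. \<bar>q x * step_difference s ((norm x)\<^sup>2) - q x * step_difference t ((norm x)\<^sup>2)\<bar> \<partial>lborel)"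
    by (rule integral_abs_bound)
  also have "\<dots> \<le> (\<integral>x. ?Q x \<partial>lborel)"
  proof (rule integral_mono[OF _ iQ])
    show "integrable lborel (\<lambda>x. \<bar>q x * step_difference s ((norm x)\<^sup>2) - q x * step_difference t ((norm x)\<^sup>2)\<bar>)"
      using i[of s] i[of t] assms by (intro integrable_abs Bochner_Integration.integrable_diff) auto
    show "\<bar>q x * step_difference s ((norm x)\<^sup>2) - q x * step_difference t ((norm x)\<^sup>2)\<bar> \<le> ?Q x" for x
      using assms by (auto simp: step_difference_def indicator_def)
  qed
  finally have "\<bar>radial_flux g s - radial_flux g t\<bar>\<^sup>2 \<le> (\<integral>x. ?Q x \<partial>lborel)\<^sup>2"
    by (rule power_mono) simp
  also have "\<dots> \<le> (\<integral>x. (norm (g x))\<^sup>2 \<partial>lborel) * (pi * ln (t / s))"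
    unfolding q_def by (rule radial_flux_bound(2)[OF assms])
  finally show ?thesis by simp
qed

lemma profile_measurable:
  assumes "u \<in> borel_measurable borel"
  shows "(\<lambda>\<rho>. profile u (sqrt \<rho>)) \<in> borel_measurable borel"
  unfolding profile_def
  by (rule measurable_compose[OF _ assms]) (intro borel_measurable_continuous_onI continuous_intros)

lemma profile_sqrt: "radial u \<Longrightarrow> profile u (sqrt ((norm x)\<^sup>2)) = u x"
  using profile_norm by simp

lemma bounded_support_radial_L2:
  fixes \<alpha> :: "real \<Rightarrow> real"
  assumes [measurable]: "\<alpha> \<in> borel_measurable borel" and bd: "\<And>\<sigma>. \<bar>\<alpha> \<sigma>\<bar> \<le> B * indicator {a..b} \<sigma>"
  shows "L2 (\<lambda>x. \<alpha> ((norm x)\<^sup>2))"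
  unfolding L2_def
proof
  show "integrable lborel (\<lambda>x :: real ^ 2. (norm (\<alpha> ((norm x)\<^sup>2)))\<^sup>2)"
    unfolding real_norm_def power2_abs
  proof (subst integrable_radial_iff[where f = "\<lambda>\<rho>. (\<alpha> \<rho>)\<^sup>2"])
    show "set_integrable lborel {0<..} (\<lambda>\<rho>. (\<alpha> \<rho>)\<^sup>2)"
      unfolding set_integrable_def
    proof (rule Bochner_Integration.integrable_bound)
      show "integrable lborel (\<lambda>\<sigma>. B\<^sup>2 * indicator {a..b} \<sigma> :: real)"
        using emeasure_lborel_cbox_finite[of a b] by (intro integrable_mult_right integrable_real_indicator) auto
      have "\<bar>indicator {0<..} x *\<^sub>R (\<alpha> x)\<^sup>2\<bar> \<le> \<bar>B\<^sup>2 * indicator {a..b} x\<bar>" for x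
      proof (cases "x \<in> {a..b}")
        case True
        then have "\<bar>\<alpha> x\<bar> \<le> B" using bd[of x] by simp
        then have "\<bar>\<alpha> x\<bar>\<^sup>2 \<le> B\<^sup>2" by (rule power_mono) simp
        then show ?thesis using True by (simp add: indicator_def)
      next
        case False
        then have "\<alpha> x = 0" using bd[of x] by simp
        then show ?thesis by simp
      qed
      then show "AE x in lborel. norm (indicator {0<..} x *\<^sub>R (\<alpha> x)\<^sup>2) \<le> norm (B\<^sup>2 * indicator {a..b} x)"
        unfolding real_norm_def by (intro AE_I2)
    qed measurable
  qed measurable
qed measurable

lemma profile_pairing:
  fixes \<alpha> :: "real \<Rightarrow> real"
  assumes u: "L2 u" "radial u"
    and [measurable]: "\<alpha> \<in> borel_measurable borel"
    and "0 < a" and bd: "\<And>\<sigma>. \<bar>\<alpha> \<sigma>\<bar> \<le> B * indicator {a..b} \<sigma>"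
  shows "integrable lborel (\<lambda>\<sigma>. \<alpha> \<sigma> * profile u (sqrt \<sigma>))"
    and "(\<integral>x. u x * \<alpha> ((norm x)\<^sup>2) \<partial>lborel) = pi * (\<integral>\<sigma>. \<alpha> \<sigma> * profile u (sqrt \<sigma>) \<partial>lborel)"
proof -
  let ?W = "\<lambda>\<rho>. profile u (sqrt \<rho>)"
  have [measurable]: "u \<in> borel_measurable borel" using u by (simp add: L2_def)
  note [measurable] = profile_measurable[OF this]
  have i: "integrable lborel (\<lambda>x. u x * \<alpha> ((norm x)\<^sup>2))"
    by (rule L2_mult_integrable[OF u(1) bounded_support_radial_L2[OF _ bd]]) measurable
  have eq: "u x * \<alpha> ((norm x)\<^sup>2) = (\<lambda>\<rho>. \<alpha> \<rho> * ?W \<rho>) ((norm x)\<^sup>2)" for x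
    using profile_sqrt[OF u(2), of x] by simp
  have m: "(\<lambda>\<rho>. \<alpha> \<rho> * ?W \<rho>) \<in> borel_measurable borel" by measurable
  have e0: "(\<lambda>\<rho>. indicator {0<..} \<rho> *\<^sub>R (\<alpha> \<rho> * ?W \<rho>)) = (\<lambda>\<rho>. \<alpha> \<rho> * ?W \<rho>)"
  proof
    fix \<rho>
    show "indicator {0<..} \<rho> *\<^sub>R (\<alpha> \<rho> * ?W \<rho>) = \<alpha> \<rho> * ?W \<rho>"
      using bd[of \<rho>] \<open>0 < a\<close> by (cases "\<rho> > 0") (auto simp: indicator_def)
  qed
  show "integrable lborel (\<lambda>\<sigma>. \<alpha> \<sigma> * ?W \<sigma>)"
    using i unfolding eq integrable_radial_iff[OF m] set_integrable_def e0 .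
  show "(\<integral>x. u x * \<alpha> ((norm x)\<^sup>2) \<partial>lborel) = pi * (\<integral>\<sigma>. \<alpha> \<sigma> * ?W \<sigma> \<partial>lborel)"
    unfolding eq integral_radial[OF m] set_lebesgue_integral_def e0 ..
qed

text \<open>The mean zero condition makes the antiderivative of \<open>\<alpha>\<close> compactly supported, hence admissible in
  \<open>weak_gradient_radial_field\<close>.\<close>

lemma profile_flux_orthogonal:
  fixes \<alpha> :: "real \<Rightarrow> real"
  assumes u: "L2 u" "radial u" and g: "L2_weak_gradient u g"
    and smooth: "\<And>k. Dk k \<alpha>" and "0 < a" and bd: "\<And>\<sigma>. \<bar>\<alpha> \<sigma>\<bar> \<le> B * indicator {a..b} \<sigma>"
    and mean: "(\<integral>\<sigma>. \<alpha> \<sigma> \<partial>lborel) = 0"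
  shows "(\<integral>\<sigma>. \<alpha> \<sigma> * (2 * pi * profile u (sqrt \<sigma>) + radial_flux g \<sigma>) \<partial>lborel) = 0"
proof -
  have Lg: "L2 g" using g by (simp add: L2_weak_gradient_def)
  have cont: "continuous_on UNIV \<alpha>" using smooth Dk_continuous by blast
  then have [measurable]: "\<alpha> \<in> borel_measurable borel" by (rule borel_measurable_continuous_onI)
  have supp: "\<alpha> x = 0" if "x \<notin> {a..b}" for x using bd[of x] that by simp
  define \<zeta> where "\<zeta> = (\<lambda>y. \<integral>\<sigma>. indicator {..y} \<sigma> * \<alpha> \<sigma> \<partial>lborel)"
  note \<zeta> = smooth_antiderivative[where a = a and b = b, OF cont supp, folded \<zeta>_def]
  have Dk\<zeta>: "Dk k \<zeta>" for k
  proof -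
    have "Dk (Suc k) \<zeta>" unfolding Dk.simps using \<zeta>(2) smooth by blast
    then show ?thesis by (rule Dk_SucD)
  qed
  have \<zeta>_eq: "(\<integral>\<sigma>. \<alpha> \<sigma> * step_difference \<sigma> \<rho> \<partial>lborel) = \<zeta> \<rho>" for \<rho>
  proof -
    have i1: "integrable lborel (\<lambda>\<sigma>. indicator {..\<rho>} \<sigma> * \<alpha> \<sigma>)"
      using integrable_mult_indicator[OF _ \<zeta>(1), of "{..\<rho>}"] by simp
    have "(\<integral>\<sigma>. \<alpha> \<sigma> * step_difference \<sigma> \<rho> \<partial>lborel)
       = (\<integral>\<sigma>. indicator {..\<rho>} \<sigma> * \<alpha> \<sigma> - (if 1 \<le> \<rho> then 1 else 0) * \<alpha> \<sigma> \<partial>lborel)"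
      by (intro Bochner_Integration.integral_cong) (auto simp: step_difference_def indicator_def)
    also have "\<dots> = \<zeta> \<rho> - (if 1 \<le> \<rho> then 1 else 0) * (\<integral>\<sigma>. \<alpha> \<sigma> \<partial>lborel)"
      unfolding \<zeta>_def using i1 \<zeta>(1)
      by (subst Bochner_Integration.integral_diff) (auto intro: integrable_mult_right)
    finally show ?thesis using mean by simp
  qed
  have "\<And>x. x < a \<Longrightarrow> \<zeta> x = 0" "\<And>x. b < x \<Longrightarrow> \<zeta> x = 0" using \<zeta>(3,4) mean unfolding \<zeta>_def by auto
  from weak_gradient_radial_field[OF u(1) g Dk\<zeta> \<zeta>(2) \<open>0 < a\<close> this]
  have "(\<integral>x. u x * (2 * \<alpha> ((norm x)\<^sup>2)) \<partial>lborel) = - (\<integral>x. (g x \<bullet> x) / (norm x)\<^sup>2 * \<zeta> ((norm x)\<^sup>2) \<partial>lborel)"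
    by simp
  also have "\<dots> = - (\<integral>\<sigma>. \<alpha> \<sigma> * radial_flux g \<sigma> \<partial>lborel)"
    using radial_flux_Fubini(2)[OF Lg _ \<open>0 < a\<close> bd] unfolding \<zeta>_eq by simp
  finally have 1: "2 * (\<integral>x. u x * \<alpha> ((norm x)\<^sup>2) \<partial>lborel) = - (\<integral>\<sigma>. \<alpha> \<sigma> * radial_flux g \<sigma> \<partial>lborel)"
    unfolding mult.left_commute[of "u x" 2 for x] by simp
  have "(\<integral>\<sigma>. \<alpha> \<sigma> * (2 * pi * profile u (sqrt \<sigma>) + radial_flux g \<sigma>) \<partial>lborel)
     = (\<integral>\<sigma>. 2 * pi * (\<alpha> \<sigma> * profile u (sqrt \<sigma>)) + \<alpha> \<sigma> * radial_flux g \<sigma> \<partial>lborel)"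
    by (intro Bochner_Integration.integral_cong) (auto simp: algebra_simps)
  also have "\<dots> = 2 * pi * (\<integral>\<sigma>. \<alpha> \<sigma> * profile u (sqrt \<sigma>) \<partial>lborel) + (\<integral>\<sigma>. \<alpha> \<sigma> * radial_flux g \<sigma> \<partial>lborel)"
    using profile_pairing(1)[OF u _ \<open>0 < a\<close> bd] radial_flux_Fubini(1)[OF Lg _ \<open>0 < a\<close> bd]
    by (subst Bochner_Integration.integral_add) auto
  also have "\<dots> = 0"
    using 1 profile_pairing(2)[OF u _ \<open>0 < a\<close> bd] by simp
  finally show ?thesis .
qed

lemma bump_bound: "\<bar>bump a b n x\<bar> \<le> 1 * indicator {a..b} x"
proof (cases "x \<in> {a<..<b}")
  case True
  then show ?thesis using bump_bounds[of a b n x] by (auto simp: indicator_def)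
next
  case False
  then show ?thesis using bump_eq_0[OF False] by simp
qed

lemma bump_measurable [measurable]: "bump a b n \<in> borel_measurable borel"
  using Dk_continuous[OF Dk_bump[of 0]] by (rule borel_measurable_continuous_onI)

lemma bump_integrable: "integrable lborel (bump a b n)"
proof (rule Bochner_Integration.integrable_bound)
  show "integrable lborel (indicator {a..b} :: real \<Rightarrow> real)"
    using emeasure_lborel_cbox_finite[of a b] by (intro integrable_real_indicator) auto
  show "AE x in lborel. norm (bump a b n x) \<le> norm (indicator {a..b} x :: real)"
    using bump_bound[of a b n] by simp
qed measurable

lemma bump_integral_pos: "0 < (\<integral>x. bump 1 2 1 x \<partial>lborel)"
proof -
  have "(\<integral>x. bump 1 2 1 x \<partial>lborel) \<noteq> 0"
  proof
    assume "(\<integral>x. bump 1 2 1 x \<partial>lborel) = 0"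
    then have "AE x in lborel. bump 1 2 1 x = 0"
      using bump_bounds by (subst (asm) integral_nonneg_eq_0_iff_AE[OF bump_integrable]) auto
    then have "AE x :: real in lborel. x \<notin> {1<..<2}"
      by eventually_elim (use bump_pos[of _ 1 2 1] in force)
    then have "emeasure lborel {1<..<2 :: real} = 0"
      by (subst (asm) AE_iff_measurable[of "{1<..<2}"]) auto
    then show False by simp
  qed
  moreover have "0 \<le> (\<integral>x. bump 1 2 1 x \<partial>lborel)" using bump_bounds by (intro Bochner_Integration.integral_nonneg) auto
  ultimately show ?thesis by simp
qed

text \<open>The du Bois-Reymond argument: a function orthogonal to all test functions of mean zero is constant.
  Arbitrary bumps are corrected to mean zero with one fixed bump \<open>\<gamma>\<close>, and \<open>C\<close> is the \<open>\<gamma>\<close>-weighted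
  mean of the function.\<close>

lemma profile_flux_constant:
  assumes u: "L2 u" "radial u" and g: "L2_weak_gradient u g"
  shows "\<exists>C. AE \<rho> in lborel. 0 < \<rho> \<longrightarrow> 2 * pi * profile u (sqrt \<rho>) + radial_flux g \<rho> = C"
proof -
  define f where "f = (\<lambda>\<rho>. 2 * pi * profile u (sqrt \<rho>) + radial_flux g \<rho>)"
  have Lg: "L2 g" using g by (simp add: L2_weak_gradient_def)
  have [measurable]: "u \<in> borel_measurable borel" using u by (simp add: L2_def)
  note [measurable] = profile_measurable[OF this] radial_flux_measurable[OF Lg]
  have [measurable]: "f \<in> borel_measurable borel" unfolding f_def by measurable
  have i: "integrable lborel (\<lambda>\<sigma>. \<alpha> \<sigma> * f \<sigma>)"
    if "\<alpha> \<in> borel_measurable borel" "0 < a" "\<And>\<sigma>. \<bar>\<alpha> \<sigma>\<bar> \<le> B * indicator {a..b} \<sigma>" for \<alpha> :: "real \<Rightarrow> real" and a b B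
  proof -
    have "integrable lborel (\<lambda>\<sigma>. 2 * pi * (\<alpha> \<sigma> * profile u (sqrt \<sigma>)) + \<alpha> \<sigma> * radial_flux g \<sigma>)"
      by (intro Bochner_Integration.integrable_add integrable_mult_right
          profile_pairing(1)[OF u that] radial_flux_Fubini(1)[OF Lg that])
    then show ?thesis unfolding f_def by (simp add: algebra_simps)
  qed
  define \<gamma> where "\<gamma> = bump 1 2 1"
  define c where "c = (\<integral>x. \<gamma> x \<partial>lborel)"
  have "c > 0" unfolding c_def \<gamma>_def by (rule bump_integral_pos)
  define C where "C = (\<integral>x. \<gamma> x * f x \<partial>lborel) / c"
  have i\<gamma>: "integrable lborel (\<lambda>x. \<gamma> x * f x)" unfolding \<gamma>_def by (rule i[OF bump_measurable _ bump_bound]) simp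
  have orth: "(\<integral>x. bump a b n x * (f x - C) \<partial>lborel) = 0" if "0 < a" for a b n
  proof -
    let ?\<beta> = "bump a b n"
    define d where "d = (\<integral>x. ?\<beta> x \<partial>lborel)"
    define \<alpha> where "\<alpha> = (\<lambda>x. ?\<beta> x * c + \<gamma> x * (- d))"
    have Dk: "Dk k \<alpha>" for k unfolding \<alpha>_def \<gamma>_def by (intro Dk_add Dk_mult Dk_const Dk_bump)
    have bd: "\<bar>\<alpha> x\<bar> \<le> (c + \<bar>d\<bar>) * indicator {min a 1..max b 2} x" for x
    proof -
      have "\<bar>\<alpha> x\<bar> \<le> \<bar>?\<beta> x\<bar> * c + \<bar>\<gamma> x\<bar> * \<bar>d\<bar>"
        unfolding \<alpha>_def using \<open>c > 0\<close> abs_triangle_ineq[of "?\<beta> x * c" "\<gamma> x * (- d)"] by (simp add: abs_mult)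
      also have "\<dots> \<le> indicator {min a 1..max b 2} x * c + indicator {min a 1..max b 2} x * \<bar>d\<bar>"
      proof (intro add_mono mult_right_mono)
        show "\<bar>?\<beta> x\<bar> \<le> indicator {min a 1..max b 2} x"
          by (rule order_trans[OF bump_bound]) (auto simp: indicator_def)
        show "\<bar>\<gamma> x\<bar> \<le> indicator {min a 1..max b 2} x"
          unfolding \<gamma>_def by (rule order_trans[OF bump_bound]) (auto simp: indicator_def)
      qed (use \<open>c > 0\<close> in auto)
      finally show ?thesis by (simp add: algebra_simps)
    qed
    have mean: "(\<integral>x. \<alpha> x \<partial>lborel) = 0"
      unfolding \<alpha>_def \<gamma>_def using bump_integrable
      by (subst Bochner_Integration.integral_add) (auto simp: c_def d_def \<gamma>_def)
    have i\<beta>: "integrable lborel (\<lambda>x. ?\<beta> x * f x)" by (rule i[OF bump_measurable that bump_bound])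
    have "0 = (\<integral>x. \<alpha> x * f x \<partial>lborel)"
      using profile_flux_orthogonal[OF u g Dk _ bd mean] that unfolding f_def by simp
    also have "\<dots> = (\<integral>x. c * (?\<beta> x * f x) - d * (\<gamma> x * f x) \<partial>lborel)"
      by (intro Bochner_Integration.integral_cong) (auto simp: \<alpha>_def algebra_simps)
    also have "\<dots> = c * (\<integral>x. ?\<beta> x * f x \<partial>lborel) - d * (\<integral>x. \<gamma> x * f x \<partial>lborel)"
      using i\<beta> i\<gamma> by simp
    finally have e: "(\<integral>x. ?\<beta> x * f x \<partial>lborel) = d * C"
      using \<open>c > 0\<close> by (simp add: C_def field_simps)
    have "(\<integral>x. ?\<beta> x * (f x - C) \<partial>lborel) = (\<integral>x. ?\<beta> x * f x - ?\<beta> x * C \<partial>lborel)"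
      by (simp add: right_diff_distrib)
    also have "\<dots> = d * C - d * C"
      using i\<beta> bump_integrable[of a b n] by (simp add: e d_def)
    finally show ?thesis by simp
  qed
  have ii: "integrable lborel (\<lambda>x. indicator {a<..<b} x * (f x - C))" if "0 < a" for a b
  proof -
    have bd: "\<bar>indicator {a<..<b} \<sigma> :: real\<bar> \<le> 1 * indicator {a..b} \<sigma>" for \<sigma> :: real by (auto simp: indicator_def)
    have 1: "integrable lborel (\<lambda>x. indicator {a<..<b} x * f x)" by (rule i[OF _ that bd]) measurable
    have "integrable lborel (indicator {a<..<b} :: real \<Rightarrow> real)"
      using emeasure_lborel_box_finite[of a b] by (intro integrable_real_indicator) auto
    then have 2: "integrable lborel (\<lambda>x. indicator {a<..<b} x * C)" by (rule integrable_mult_left)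
    show ?thesis using Bochner_Integration.integrable_diff[OF 1 2] by (simp add: right_diff_distrib)
  qed
  have zero: "(\<integral>x. indicator {a<..<b} x * (f x - C) \<partial>lborel) = 0" if "0 < a" for a b
  proof -
    have "(\<lambda>n. \<integral>x. bump a b n x * (f x - C) \<partial>lborel) \<longlonglongrightarrow> (\<integral>x. indicator {a<..<b} x * (f x - C) \<partial>lborel)"
    proof (rule integral_dominated_convergence[where w = "\<lambda>x. \<bar>indicator {a<..<b} x * (f x - C)\<bar>"])
      show "AE x in lborel. (\<lambda>n. bump a b n x * (f x - C)) \<longlonglongrightarrow> indicator {a<..<b} x * (f x - C)"
        by (intro AE_I2 tendsto_mult bump_tendsto tendsto_const)
      have "\<bar>bump a b n x\<bar> \<le> indicator {a<..<b} x" for n x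
        using bump_bounds[of a b n x] bump_eq_0[of x a b n] by (auto simp: indicator_def)
      then show "AE x in lborel. norm (bump a b n x * (f x - C)) \<le> \<bar>indicator {a<..<b} x * (f x - C)\<bar>" for n
        unfolding real_norm_def abs_mult abs_indicator by (intro AE_I2 mult_right_mono) auto
      show "integrable lborel (\<lambda>x. \<bar>indicator {a<..<b} x * (f x - C)\<bar>)" using ii[OF that] by (rule integrable_abs)
    qed measurable
    then show ?thesis unfolding orth[OF that] by (simp add: LIMSEQ_const_iff)
  qed
  \<comment> \<open>the flux is only controlled away from the origin, so the half line is exhausted by \<open>(1 / (k + 1), \<infinity>)\<close>\<close>
  have "AE x in lborel. indicator {1 / real (Suc k)<..} x * (f x - C) = 0" for k
  proof (rule AE_zero_of_box_integrals)
    have e: "indicator (box a b) x * (indicator {1 / real (Suc k)<..} x * (f x - C))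
      = indicator {max a (1 / real (Suc k))<..<b} x * (f x - C)" for a b x
      by (auto simp: indicator_def)
    have p: "0 < max a (1 / real (Suc k))" for a by (simp add: less_max_iff_disj)
    show "integrable lborel (\<lambda>x. indicator (box a b) x * (indicator {1 / real (Suc k)<..} x * (f x - C)))" for a b
      unfolding e by (rule ii[OF p])
    show "(\<integral>x. indicator (box a b) x * (indicator {1 / real (Suc k)<..} x * (f x - C)) \<partial>lborel) = 0" for a b
      unfolding e by (rule zero[OF p])
  qed measurable
  then have "AE x in lborel. \<forall>k. indicator {1 / real (Suc k)<..} x * (f x - C) = 0"
    unfolding AE_all_countable by blast
  then have "AE \<rho> in lborel. 0 < \<rho> \<longrightarrow> f \<rho> = C"
  proof eventually_elim
    case (elim x)
    show ?case
    proof
      assume "0 < x"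
      then obtain k where "1 / real (Suc k) < x"
        using reals_Archimedean[of x] by (auto simp: inverse_eq_divide)
      then show "f x = C" using elim[rule_format, of k] by simp
    qed
  qed
  then show ?thesis unfolding f_def by blast
qed

lemma radial_representative:
  assumes "u \<in> H1r"
  obtains w where "w \<in> borel_measurable borel" "AE x in lborel. u x = w ((norm x)\<^sup>2)"
    "\<And>s t. 0 < s \<Longrightarrow> s \<le> t \<Longrightarrow> (w s - w t)\<^sup>2 \<le> (\<integral>x. (norm (grad u x))\<^sup>2 \<partial>lborel) / (4 * pi) * ln (t / s)"
proof -
  have u: "L2 u" "radial u" "u \<in> H1" using assms H1_L2 by (auto simp: H1r_def)
  note g = grad_weak[OF u(3)]
  have Lg: "L2 (grad u)" using g by (simp add: L2_weak_gradient_def)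
  have [measurable]: "u \<in> borel_measurable borel" using u by (simp add: L2_def)
  note [measurable] = profile_measurable[OF this] radial_flux_measurable[OF Lg]
  obtain C where C: "AE \<rho> in lborel. 0 < \<rho> \<longrightarrow> 2 * pi * profile u (sqrt \<rho>) + radial_flux (grad u) \<rho> = C"
    using profile_flux_constant[OF u(1,2) g] by blast
  define w where "w = (\<lambda>\<rho>. (C - radial_flux (grad u) \<rho>) / (2 * pi))"
  have [measurable]: "w \<in> borel_measurable borel" unfolding w_def by measurable
  have "AE \<rho> in lborel. 0 < \<rho> \<longrightarrow> profile u (sqrt \<rho>) = w \<rho>"
    using C by eventually_elim (auto simp: w_def field_simps)
  then have "AE x in lborel. profile u (sqrt ((norm (x :: real ^ 2))\<^sup>2)) = w ((norm x)\<^sup>2)"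
    by (subst AE_radial_iff[where P = "\<lambda>\<rho>. profile u (sqrt \<rho>) = w \<rho>"]) auto
  then have ae: "AE x in lborel. u x = w ((norm x)\<^sup>2)"
    unfolding profile_sqrt[OF u(2)] .
  have "(w s - w t)\<^sup>2 \<le> (\<integral>x. (norm (grad u x))\<^sup>2 \<partial>lborel) / (4 * pi) * ln (t / s)" if "0 < s" "s \<le> t" for s t
  proof -
    have "(w s - w t)\<^sup>2 = (radial_flux (grad u) s - radial_flux (grad u) t)\<^sup>2 / (2 * pi)\<^sup>2"
      unfolding w_def power_divide[symmetric] by (subst power2_commute) (simp add: diff_divide_distrib)
    also have "\<dots> \<le> ((\<integral>x. (norm (grad u x))\<^sup>2 \<partial>lborel) * (pi * ln (t / s))) / (2 * pi)\<^sup>2"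
      by (intro divide_right_mono radial_flux_diff[OF Lg that]) simp
    also have "\<dots> = (\<integral>x. (norm (grad u x))\<^sup>2 \<partial>lborel) / (4 * pi) * ln (t / s)"
      by (simp add: power2_eq_square)
    finally show ?thesis .
  qed
  then show thesis using that[OF _ ae] by simp
qed

section \<open>The radial embedding into \<open>L\<^sup>4\<close> and its compactness\<close>

definition Dir :: "(real ^ 2 \<Rightarrow> real) \<Rightarrow> real" where
  "Dir u = (\<integral>x. (norm (grad u x))\<^sup>2 \<partial>lborel)"

definition Mass :: "(real ^ 2 \<Rightarrow> real) \<Rightarrow> real" where
  "Mass u = (\<integral>x. (u x)\<^sup>2 \<partial>lborel)"

definition H1sq :: "(real ^ 2 \<Rightarrow> real) \<Rightarrow> real" where
  "H1sq u = Dir u + Mass u"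

lemma Dir_nonneg: "0 \<le> Dir u" and Mass_nonneg: "0 \<le> Mass u" and H1sq_nonneg: "0 \<le> H1sq u"
  and Dir_le_H1sq: "Dir u \<le> H1sq u" and Mass_le_H1sq: "Mass u \<le> H1sq u"
  by (auto simp: Dir_def Mass_def H1sq_def)

lemma H1r_D: assumes "u \<in> H1r" shows "u \<in> H1" "L2 u" "radial u" "u \<in> borel_measurable borel"
    "integrable lborel (\<lambda>x. (u x)\<^sup>2)"
  using assms H1_L2(1)[of u] by (auto simp: H1r_def L2_def)

lemma inverse_norm_integrable:
  assumes "0 \<le> A"
  shows "integrable lborel (\<lambda>x :: real ^ 2. indicator {..A} ((norm x)\<^sup>2) / norm x)"
proof -
  define f :: "real \<Rightarrow> real" where "f = (\<lambda>\<rho>. indicator {..A} \<rho> / sqrt \<rho>)"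
  have [measurable]: "f \<in> borel_measurable borel" unfolding f_def by measurable
  have "(\<lambda>x. x powr (- (1 / 2))) integrable_on {0..A}"
    using has_integral_powr_from_0[of "- (1 / 2)" A] assms by (auto simp: integrable_on_def)
  then have "set_integrable lebesgue {0..A} (\<lambda>x. x powr (- (1 / 2)))"
    by (subst absolutely_integrable_on_iff_nonneg) auto
  then have "integrable lborel (\<lambda>x. indicator {0..A} x *\<^sub>R x powr (- (1 / 2)) :: real)"
    unfolding set_integrable_def by (subst (asm) integrable_completion) auto
  moreover have "indicator {0..A} x *\<^sub>R x powr (- (1 / 2)) = indicator {0<..} x *\<^sub>R f x" for x :: real
    by (auto simp: f_def indicator_def powr_minus powr_half_sqrt inverse_eq_divide)
  ultimately have "set_integrable lborel {0<..} f" unfolding set_integrable_def by simp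
  then have "integrable lborel (\<lambda>x :: real ^ 2. f ((norm x)\<^sup>2))"
    by (subst integrable_radial_iff) auto
  then show ?thesis by (simp add: f_def)
qed

text \<open>The fourth root is chosen so that a profile whose square is bounded by this logarithm has fourth power
  at most of order \<open>1 / \<surd>\<rho> = 1 / |x|\<close>, which is integrable near the origin of the plane.\<close>

lemma ln_one_plus_inverse_bound:
  assumes "0 < \<rho>"
  shows "ln (1 + 1 / \<rho>) \<le> 4 / sqrt (sqrt \<rho>)"
proof -
  define r where "r = sqrt (sqrt \<rho>)"
  have "r ^ 4 = (r\<^sup>2)\<^sup>2" by simp
  also have "r\<^sup>2 = sqrt \<rho>" using assms by (simp add: r_def)
  also have "(sqrt \<rho>)\<^sup>2 = \<rho>" using assms by simp
  finally have r: "0 < r" "\<rho> = r ^ 4" using assms by (simp_all add: r_def)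
  have "1 + 1 / \<rho> = 1 + (1 / r) ^ 4" unfolding r(2) power_one_over by (rule refl)
  also have "\<dots> \<le> (1 + 1 / r) ^ 4"
  proof -
    define y where "y = 1 / r"
    have "y \<ge> 0" using r by (simp add: y_def)
    have "(1 + y) ^ 4 = 1 + y ^ 4 + (4 * y + 6 * y\<^sup>2 + 4 * y ^ 3)"
      by (simp add: power4_eq_xxxx power2_eq_square power3_eq_cube algebra_simps)
    moreover have "0 \<le> 4 * y + 6 * y\<^sup>2 + 4 * y ^ 3"
      using \<open>y \<ge> 0\<close> by (intro add_nonneg_nonneg mult_nonneg_nonneg zero_le_power) auto
    ultimately show ?thesis unfolding y_def by linarith
  qed
  finally have "ln (1 + 1 / \<rho>) \<le> ln ((1 + 1 / r) ^ 4)"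
  proof (rule ln_mono)
    show "0 < 1 + 1 / \<rho>" using assms by (intro add_pos_pos) auto
  qed
  also have "\<dots> = 4 * ln (1 + 1 / r)"
  proof -
    have "0 < 1 + 1 / r" using r by (intro add_pos_pos) auto
    then show ?thesis using ln_realpow[of "1 + 1 / r" 4] by simp
  qed
  also have "\<dots> \<le> 4 * (1 / r)" using r ln_add_one_self_le_self[of "1 / r"] by simp
  finally show ?thesis by (simp add: r_def)
qed

text \<open>Averaging the modulus of continuity over an interval \<open>[\<rho>, \<rho> + L]\<close> bounds \<open>(w \<rho>)\<^sup>2\<close> by the mass divided
  by \<open>L\<close> plus the oscillation. The choice \<open>L = \<surd>\<rho>\<close> balances the two for large \<open>\<rho>\<close> and gives the decay
  \<open>1 / |x|\<close> of \<open>w\<^sup>2\<close>; the choice \<open>L = 1\<close> gives a logarithmic singularity at the origin.\<close>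

lemma radial_bounds:
  assumes "u \<in> H1r"
  obtains w where "w \<in> borel_measurable borel" "AE x in lborel. u x = w ((norm x)\<^sup>2)"
    "\<And>s t. 0 < s \<Longrightarrow> s \<le> t \<Longrightarrow> (w s - w t)\<^sup>2 \<le> H1sq u * ln (t / s)"
    "\<And>\<rho>. 0 < \<rho> \<Longrightarrow> (w \<rho>) ^ 4 \<le> 4 * (H1sq u)\<^sup>2 / sqrt \<rho>"
    "\<And>\<rho>. 1 \<le> \<rho> \<Longrightarrow> (w \<rho>)\<^sup>2 \<le> H1sq u / sqrt \<rho>"
proof -
  obtain w where w: "w \<in> borel_measurable borel" "AE x in lborel. u x = w ((norm x)\<^sup>2)"
    and osc: "\<And>s t. 0 < s \<Longrightarrow> s \<le> t \<Longrightarrow> (w s - w t)\<^sup>2 \<le> Dir u / (4 * pi) * ln (t / s)"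
    using radial_representative[OF assms] unfolding Dir_def by blast
  note [measurable] = w(1) H1r_D(4)[OF assms]
  define E where "E = H1sq u"
  have E: "Dir u \<le> E" "Mass u \<le> E" "0 \<le> E"
    using Dir_le_H1sq Mass_le_H1sq H1sq_nonneg by (auto simp: E_def)
  have m2: "(\<lambda>\<rho>. (w \<rho>)\<^sup>2) \<in> borel_measurable borel" by measurable
  have ae2: "AE x in lborel. (u x)\<^sup>2 = (w ((norm x)\<^sup>2))\<^sup>2" using w(2) by eventually_elim simp
  have iw: "set_integrable lborel {0<..} (\<lambda>\<rho>. (w \<rho>)\<^sup>2)"
  proof -
    have "integrable lborel (\<lambda>x :: real ^ 2. (w ((norm x)\<^sup>2))\<^sup>2)"
      using H1r_D(5)[OF assms] by (subst (asm) integrable_cong_AE[OF _ _ ae2]) auto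
    then show ?thesis using integrable_radial_iff[OF m2] by simp
  qed
  have Mw: "pi * (LINT \<rho>:{0<..}|lborel. (w \<rho>)\<^sup>2) = Mass u"
  proof -
    have "Mass u = (\<integral>x. (w ((norm (x :: real ^ 2))\<^sup>2))\<^sup>2 \<partial>lborel)"
      unfolding Mass_def by (rule integral_cong_AE[OF _ _ ae2]) measurable
    also have "\<dots> = pi * (LINT \<rho>:{0<..}|lborel. (w \<rho>)\<^sup>2)" by (rule integral_radial[OF m2])
    finally show ?thesis by (rule sym)
  qed
  have avg: "(w \<rho>)\<^sup>2 \<le> 2 * E / (pi * L) + E / (2 * pi) * ln (1 + L / \<rho>)" if "0 < \<rho>" "0 < L" for \<rho> L
  proof -
    let ?c = "E / (2 * pi) * ln (1 + L / \<rho>)"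
    have pt: "(w \<rho>)\<^sup>2 \<le> 2 * (w \<sigma>)\<^sup>2 + ?c" if "\<sigma> \<in> {\<rho>..\<rho> + L}" for \<sigma>
    proof -
      have "(w \<rho> - w \<sigma>)\<^sup>2 \<le> Dir u / (4 * pi) * ln (\<sigma> / \<rho>)" using that \<open>0 < \<rho>\<close> by (intro osc) auto
      also have "\<dots> \<le> E / (4 * pi) * ln (1 + L / \<rho>)"
      proof (intro mult_mono divide_right_mono)
        have "\<sigma> / \<rho> \<le> 1 + L / \<rho>" using that \<open>0 < \<rho>\<close> by (simp add: field_simps)
        then show "ln (\<sigma> / \<rho>) \<le> ln (1 + L / \<rho>)"
          using that \<open>0 < \<rho>\<close> \<open>0 < L\<close> by (subst ln_le_cancel_iff) (auto simp: add_pos_pos)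
        show "0 \<le> ln (\<sigma> / \<rho>)" using that \<open>0 < \<rho>\<close> by simp
      qed (use E in auto)
      finally have "2 * (w \<rho> - w \<sigma>)\<^sup>2 \<le> ?c" by simp
      moreover have "(w \<rho>)\<^sup>2 \<le> 2 * (w \<sigma>)\<^sup>2 + 2 * (w \<rho> - w \<sigma>)\<^sup>2"
        using zero_le_power2[of "w \<rho> - 2 * w \<sigma>"] by (simp add: power2_eq_square algebra_simps)
      ultimately show ?thesis by linarith
    qed
    have fin: "emeasure lborel {\<rho>..\<rho> + L} < \<infinity>" using \<open>0 < L\<close> by simp
    have i1: "set_integrable lborel {\<rho>..\<rho> + L} (\<lambda>_. (w \<rho>)\<^sup>2)"
      and i2: "set_integrable lborel {\<rho>..\<rho> + L} (\<lambda>_. ?c)"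
      unfolding set_integrable_def using fin by (auto intro!: integrable_mult_left integrable_real_indicator)
    have i3: "set_integrable lborel {\<rho>..\<rho> + L} (\<lambda>\<sigma>. (w \<sigma>)\<^sup>2)"
      using that by (intro set_integrable_subset[OF iw]) auto
    have i4: "set_integrable lborel {\<rho>..\<rho> + L} (\<lambda>\<sigma>. 2 * (w \<sigma>)\<^sup>2 + ?c)"
      by (intro set_integral_add(1) set_integrable_mult_right i3 i2)
    have "L * (w \<rho>)\<^sup>2 = (LINT \<sigma>:{\<rho>..\<rho> + L}|lborel. (w \<rho>)\<^sup>2)"
      using \<open>0 < L\<close> by (simp add: set_lebesgue_integral_def)
    also have "\<dots> \<le> (LINT \<sigma>:{\<rho>..\<rho> + L}|lborel. 2 * (w \<sigma>)\<^sup>2 + ?c)"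
      by (rule set_integral_mono[OF i1 i4 pt])
    also have "\<dots> = (LINT \<sigma>:{\<rho>..\<rho> + L}|lborel. 2 * (w \<sigma>)\<^sup>2) + (LINT \<sigma>:{\<rho>..\<rho> + L}|lborel. ?c)"
      by (intro set_integral_add(2) set_integrable_mult_right i3 i2)
    also have "\<dots> = 2 * (LINT \<sigma>:{\<rho>..\<rho> + L}|lborel. (w \<sigma>)\<^sup>2) + L * ?c"
      using \<open>0 < L\<close> by (simp add: set_lebesgue_integral_def)
    also have "(LINT \<sigma>:{\<rho>..\<rho> + L}|lborel. (w \<sigma>)\<^sup>2) \<le> (LINT \<rho>:{0<..}|lborel. (w \<rho>)\<^sup>2)"
      using i3 iw that unfolding set_integrable_def set_lebesgue_integral_def
      by (intro integral_mono) (auto simp: indicator_def)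
    also have "\<dots> = Mass u / pi" using Mw by (simp add: field_simps)
    also have "\<dots> \<le> E / pi" using E by (simp add: divide_right_mono)
    finally have "L * (w \<rho>)\<^sup>2 \<le> 2 * (E / pi) + L * ?c" by simp
    also have "\<dots> = L * (2 * E / (pi * L) + ?c)"
      unfolding distrib_left[of L] using \<open>0 < L\<close> by simp
    finally show ?thesis using \<open>0 < L\<close> by (simp only: mult_le_cancel_left_pos)
  qed
  have "pi > 3" by (rule pi_gt3)
  have far: "(w \<rho>)\<^sup>2 \<le> E / sqrt \<rho>" if "1 \<le> \<rho>" for \<rho>
  proof -
    have s: "0 < sqrt \<rho>" "sqrt \<rho> * sqrt \<rho> = \<rho>" using that by auto
    have q: "sqrt \<rho> / \<rho> = 1 / sqrt \<rho>" using s that by (simp add: field_simps)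
    have "(w \<rho>)\<^sup>2 \<le> 2 * E / (pi * sqrt \<rho>) + E / (2 * pi) * ln (1 + 1 / sqrt \<rho>)"
      using avg[of \<rho> "sqrt \<rho>"] that s q by simp
    also have "\<dots> \<le> 2 * E / (pi * sqrt \<rho>) + E / (2 * pi) * (1 / sqrt \<rho>)"
      using E s by (intro add_left_mono mult_left_mono ln_add_one_self_le_self) auto
    also have "\<dots> = (5 / (2 * pi)) * (E / sqrt \<rho>)" using s by (simp add: field_simps)
    also have "\<dots> \<le> 1 * (E / sqrt \<rho>)"
      using E s \<open>pi > 3\<close> by (intro mult_right_mono) auto
    finally show ?thesis by simp
  qed
  have near: "(w \<rho>) ^ 4 \<le> 4 * E\<^sup>2 / sqrt \<rho>" if "0 < \<rho>" for \<rho>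
  proof (cases "1 \<le> \<rho>")
    case True
    then have s: "1 \<le> sqrt \<rho>" by simp
    have "(w \<rho>) ^ 4 = ((w \<rho>)\<^sup>2)\<^sup>2" by simp
    also have "\<dots> \<le> (E / sqrt \<rho>)\<^sup>2" by (intro power_mono far True) simp
    also have "\<dots> = E\<^sup>2 / sqrt \<rho> * (1 / sqrt \<rho>)" by (simp add: power2_eq_square)
    also have "\<dots> \<le> E\<^sup>2 / sqrt \<rho> * 4"
    proof (rule mult_left_mono)
      have "1 / sqrt \<rho> \<le> 1" using s by simp
      then show "1 / sqrt \<rho> \<le> 4" by linarith
    qed (use that in auto)
    finally show ?thesis by (simp add: mult.commute)
  next
    case False
    define r where "r = sqrt (sqrt \<rho>)"
    have "0 < r" using that by (simp add: r_def)
    moreover have "r\<^sup>2 = sqrt \<rho>" using that by (simp add: r_def)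
    moreover have "r \<le> 1" using False by (simp add: r_def)
    ultimately have r: "0 < r" "r\<^sup>2 = sqrt \<rho>" "r \<le> 1" by auto
    have "(w \<rho>)\<^sup>2 \<le> 2 * E / pi + E / (2 * pi) * ln (1 + 1 / \<rho>)" using avg[of \<rho> 1] that by simp
    also have "\<dots> \<le> 2 * E / pi + E / (2 * pi) * (4 / r)"
      unfolding r_def using E by (intro add_left_mono mult_left_mono ln_one_plus_inverse_bound that) auto
    also have "\<dots> = 2 / pi * E + 2 / pi * (E / r)" using r by (simp add: field_simps)
    also have "\<dots> \<le> 1 * (E / r) + 1 * (E / r)"
    proof (intro add_mono mult_mono)
      show "2 / pi \<le> 1" "2 / pi \<le> 1" using \<open>pi > 3\<close> by auto
      show "E \<le> E / r" using E r by (simp add: le_divide_eq mult_left_le)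
    qed (use E r in auto)
    finally have "(w \<rho>)\<^sup>2 \<le> 2 * (E / r)" by simp
    then have "((w \<rho>)\<^sup>2)\<^sup>2 \<le> (2 * (E / r))\<^sup>2" by (rule power_mono) simp
    then show ?thesis unfolding r(2)[symmetric] by (simp add: power_divide power_mult_distrib)
  qed
  have osc': "(w s - w t)\<^sup>2 \<le> E * ln (t / s)" if "0 < s" "s \<le> t" for s t
  proof -
    have "Dir u / (4 * pi) \<le> E / 1"
      using E Dir_nonneg[of u] \<open>pi > 3\<close> by (intro frac_le) auto
    then have "Dir u / (4 * pi) * ln (t / s) \<le> E * ln (t / s)"
      using that by (intro mult_right_mono) auto
    then show ?thesis using osc[OF that] by linarith
  qed
  show thesis using that[OF w osc'[unfolded E_def] near[unfolded E_def] far[unfolded E_def]] by simp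
qed

definition inverse_norm_mass :: real where
  "inverse_norm_mass = (\<integral>x. indicator {..1} ((norm x)\<^sup>2) / norm (x :: real ^ 2) \<partial>lborel)"

text \<open>Near the origin \<open>u\<^sup>4\<close> is at most \<open>4 (H1sq u)\<^sup>2 / |x|\<close>; outside the unit disc it is at most \<open>H1sq u * u\<^sup>2\<close>,
  which contributes the summand 1.\<close>

definition K4 :: real where "K4 = 4 * inverse_norm_mass + 1"

lemma K4_pos: "K4 \<ge> 1"
proof -
  have "0 \<le> inverse_norm_mass" unfolding inverse_norm_mass_def by (intro Bochner_Integration.integral_nonneg) auto
  then show ?thesis by (simp add: K4_def)
qed

lemma L4_embedding:
  assumes "u \<in> H1r"
  shows "integrable lborel (\<lambda>x. (u x) ^ 4)" and "(\<integral>x. (u x) ^ 4 \<partial>lborel) \<le> K4 * (H1sq u)\<^sup>2"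
proof -
  obtain w where [measurable]: "w \<in> borel_measurable borel" and w: "AE x in lborel. u x = w ((norm x)\<^sup>2)"
    and b: "\<And>\<rho>. 0 < \<rho> \<Longrightarrow> (w \<rho>) ^ 4 \<le> 4 * (H1sq u)\<^sup>2 / sqrt \<rho>"
    "\<And>\<rho>. 1 \<le> \<rho> \<Longrightarrow> (w \<rho>)\<^sup>2 \<le> H1sq u / sqrt \<rho>"
    by (rule radial_bounds[OF assms]) blast
  note [measurable] = H1r_D(4)[OF assms]
  let ?E = "H1sq u"
  let ?g = "\<lambda>x. 4 * ?E\<^sup>2 * (indicator {..1} ((norm x)\<^sup>2) / norm x) + ?E * (u x)\<^sup>2"
  have ig: "integrable lborel ?g"
    using inverse_norm_integrable[of 1] H1r_D(5)[OF assms]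
    by (intro Bochner_Integration.integrable_add integrable_mult_right) auto
  have nz: "AE x in lborel. x \<noteq> (0 :: real ^ 2)" by (rule AE_lborel_singleton)
  have bd: "AE x in lborel. (u x) ^ 4 \<le> ?g x"
    using w nz
  proof eventually_elim
    case (elim x)
    let ?\<rho> = "(norm x)\<^sup>2"
    have "0 < ?\<rho>" using elim by simp
    show ?case
    proof (cases "?\<rho> \<le> 1")
      case True
      have "(u x) ^ 4 \<le> 4 * ?E\<^sup>2 / norm x" using b(1)[OF \<open>0 < ?\<rho>\<close>] elim by simp
      moreover have "0 \<le> ?E * (u x)\<^sup>2" using H1sq_nonneg by simp
      ultimately show ?thesis using True by simp
    next
      case False
      then have "(u x)\<^sup>2 \<le> ?E / norm x" using b(2)[of ?\<rho>] elim by simp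
      also have "\<dots> \<le> ?E / 1"
      proof -
        have "1 \<le> norm x" using False power_le_one[of "norm x" 2] by (meson linorder_le_cases norm_ge_zero)
        then show ?thesis using H1sq_nonneg[of u] by (intro divide_left_mono) auto
      qed
      finally have "(u x)\<^sup>2 * (u x)\<^sup>2 \<le> ?E * (u x)\<^sup>2" by (intro mult_right_mono) auto
      then show ?thesis using False by (simp add: power4_eq_xxxx power2_eq_square mult_ac)
    qed
  qed
  show i: "integrable lborel (\<lambda>x. (u x) ^ 4)"
  proof (rule Bochner_Integration.integrable_bound[OF ig])
    show "AE x in lborel. norm ((u x) ^ 4) \<le> norm (?g x)"
      using bd by eventually_elim (simp add: abs_of_nonneg)
  qed measurable
  have "(\<integral>x. (u x) ^ 4 \<partial>lborel) \<le> (\<integral>x. ?g x \<partial>lborel)" by (rule integral_mono_AE[OF i ig bd])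
  also have "\<dots> = 4 * ?E\<^sup>2 * inverse_norm_mass + ?E * Mass u"
  proof -
    have ia: "integrable lborel (\<lambda>x :: real ^ 2. 4 * ?E\<^sup>2 * (indicator {..1} ((norm x)\<^sup>2) / norm x))"
      by (intro integrable_mult_right inverse_norm_integrable) simp
    have ib: "integrable lborel (\<lambda>x. ?E * (u x)\<^sup>2)" by (intro integrable_mult_right H1r_D(5)[OF assms])
    show ?thesis unfolding inverse_norm_mass_def Mass_def Bochner_Integration.integral_add[OF ia ib] integral_mult_right_zero
      by (rule refl)
  qed
  also have "\<dots> \<le> 4 * ?E\<^sup>2 * inverse_norm_mass + ?E * ?E"
    using H1sq_nonneg Mass_le_H1sq by (intro add_left_mono mult_left_mono)
  finally show "(\<integral>x. (u x) ^ 4 \<partial>lborel) \<le> K4 * ?E\<^sup>2"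
    by (simp add: K4_def power2_eq_square algebra_simps)
qed

lemma power4_add_le: "(a + b) ^ 4 \<le> 8 * (a ^ 4 + b ^ 4)" for a b :: real
proof -
  have sq: "(c + d)\<^sup>2 \<le> 2 * (c\<^sup>2 + d\<^sup>2)" for c d :: real
    using zero_le_power2[of "c - d"] by (simp add: power2_eq_square algebra_simps)
  have "((a + b)\<^sup>2)\<^sup>2 \<le> (2 * (a\<^sup>2 + b\<^sup>2))\<^sup>2" by (intro power_mono sq) simp
  also have "\<dots> = 4 * (a\<^sup>2 + b\<^sup>2)\<^sup>2" by (simp only: power_mult_distrib) simp
  also have "\<dots> \<le> 4 * (2 * ((a\<^sup>2)\<^sup>2 + (b\<^sup>2)\<^sup>2))" by (intro mult_left_mono sq) simp
  finally show ?thesis by simp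
qed

lemma power4_diff_le: "(a - b) ^ 4 \<le> 8 * (a ^ 4 + b ^ 4)" for a b :: real
  using power4_add_le[of a "- b"] by simp

text \<open>The representatives of \<open>radial_bounds\<close> are uniformly bounded and equicontinuous away from the
  origin, so a diagonal subsequence converges pointwise. Inside a large disc the fourth powers of
  the differences are dominated by a multiple of \<open>1 / |x|\<close>; outside, the decay of the profiles makes
  their integral small uniformly in the sequence.\<close>

lemma L4_compactness:
  assumes H: "\<And>n. u n \<in> H1r" and R: "\<And>n. H1sq (u n) \<le> R"
  shows "\<exists>r :: nat \<Rightarrow> nat. strict_mono r \<and>
    (\<forall>\<eta>>0. \<exists>N. \<forall>m\<ge>N. \<forall>n\<ge>N. (\<integral>x. (u (r m) x - u (r n) x) ^ 4 \<partial>lborel) < \<eta>)"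
proof -
  have "R \<ge> 0" using R[of 0] H1sq_nonneg[of "u 0"] by linarith
  define Q where "Q n w \<longleftrightarrow> w \<in> borel_measurable borel \<and> (AE x in lborel. u n x = w ((norm x)\<^sup>2)) \<and>
    (\<forall>s t. 0 < s \<longrightarrow> s \<le> t \<longrightarrow> (w s - w t)\<^sup>2 \<le> R * ln (t / s)) \<and>
    (\<forall>\<rho>>0. (w \<rho>) ^ 4 \<le> 4 * R\<^sup>2 / sqrt \<rho>) \<and> (\<forall>\<rho>\<ge>1. (w \<rho>)\<^sup>2 \<le> R / sqrt \<rho>)" for n w
  have "\<exists>w. Q n w" for n
  proof (rule radial_bounds[OF H[of n]])
    fix w assume w: "w \<in> borel_measurable borel" "AE x in lborel. u n x = w ((norm x)\<^sup>2)"
      and o: "\<And>s t. 0 < s \<Longrightarrow> s \<le> t \<Longrightarrow> (w s - w t)\<^sup>2 \<le> H1sq (u n) * ln (t / s)"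
      and b: "\<And>\<rho>. 0 < \<rho> \<Longrightarrow> (w \<rho>) ^ 4 \<le> 4 * (H1sq (u n))\<^sup>2 / sqrt \<rho>"
      "\<And>\<rho>. 1 \<le> \<rho> \<Longrightarrow> (w \<rho>)\<^sup>2 \<le> H1sq (u n) / sqrt \<rho>"
    have "(w s - w t)\<^sup>2 \<le> R * ln (t / s)" if "0 < s" "s \<le> t" for s t
      using o[OF that] mult_right_mono[OF R[of n], of "ln (t / s)"] that by simp
    moreover have "(w \<rho>) ^ 4 \<le> 4 * R\<^sup>2 / sqrt \<rho>" if "0 < \<rho>" for \<rho>
    proof -
      have "4 * (H1sq (u n))\<^sup>2 / sqrt \<rho> \<le> 4 * R\<^sup>2 / sqrt \<rho>"
        using that R[of n] H1sq_nonneg by (intro divide_right_mono mult_left_mono power_mono) auto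
      then show ?thesis using b(1)[OF that] by linarith
    qed
    moreover have "(w \<rho>)\<^sup>2 \<le> R / sqrt \<rho>" if "1 \<le> \<rho>" for \<rho>
    proof -
      have "H1sq (u n) / sqrt \<rho> \<le> R / sqrt \<rho>" using that R[of n] by (intro divide_right_mono) auto
      then show ?thesis using b(2)[OF that] by linarith
    qed
    ultimately show ?thesis using w unfolding Q_def by blast
  qed
  then obtain w where Q: "\<And>n. Q n (w n)" by metis
  then have w: "\<And>n. w n \<in> borel_measurable borel" "\<And>n. AE x in lborel. u n x = w n ((norm x)\<^sup>2)"
    and osc: "\<And>n s t. 0 < s \<Longrightarrow> s \<le> t \<Longrightarrow> (w n s - w n t)\<^sup>2 \<le> R * ln (t / s)"
    and b4: "\<And>n \<rho>. 0 < \<rho> \<Longrightarrow> (w n \<rho>) ^ 4 \<le> 4 * R\<^sup>2 / sqrt \<rho>"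
    and b2: "\<And>n \<rho>. 1 \<le> \<rho> \<Longrightarrow> (w n \<rho>)\<^sup>2 \<le> R / sqrt \<rho>"
    unfolding Q_def by blast+
  note [measurable] = w(1) H1r_D(4)[OF H]
  define S where "S = {\<rho> :: real. 0 < \<rho> \<and> \<rho> \<in> \<rat>}"
  have "countable S" unfolding S_def by (rule countable_subset[OF _ countable_rat]) auto
  \<comment> \<open>\<open>function_convergent_subsequence\<close> asks for a uniform bound, so the profiles are divided by \<open>B\<close>\<close>
  define B where "B \<rho> = 1 + 4 * R\<^sup>2 / sqrt \<rho>" for \<rho>
  have wB: "\<bar>w n \<rho>\<bar> \<le> B \<rho>" if "0 < \<rho>" for n \<rho>
  proof (cases "\<bar>w n \<rho>\<bar> \<le> 1")
    case True
    moreover have "0 \<le> 4 * R\<^sup>2 / sqrt \<rho>" using that by simp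
    ultimately show ?thesis unfolding B_def by linarith
  next
    case False
    then have "\<bar>w n \<rho>\<bar> ^ 1 \<le> \<bar>w n \<rho>\<bar> ^ 4" by (intro power_increasing) auto
    then show ?thesis using b4[OF that, of n] by (simp add: B_def)
  qed
  have Bpos: "0 < B \<rho>" if "0 < \<rho>" for \<rho>
    unfolding B_def using that by (intro add_pos_nonneg) auto
  have nb: "norm (w n \<rho> / B \<rho>) \<le> 1" if "\<rho> \<in> S" for n \<rho>
    using wB[of \<rho> n] Bpos[of \<rho>] that by (simp add: S_def)
  obtain r :: "nat \<Rightarrow> nat" where "strict_mono r" and r: "\<And>\<rho>. \<rho> \<in> S \<Longrightarrow> \<exists>l. (\<lambda>n. w (r n) \<rho> / B \<rho>) \<longlonglongrightarrow> l"
    by (rule function_convergent_subsequence[of S "\<lambda>n \<rho>. w n \<rho> / B \<rho>" 1]) (use \<open>countable S\<close> nb in auto)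
  have convS: "convergent (\<lambda>n. w (r n) \<sigma>)" if "\<sigma> \<in> S" for \<sigma>
  proof -
    obtain l where "(\<lambda>n. w (r n) \<sigma> / B \<sigma>) \<longlonglongrightarrow> l" using r[OF \<open>\<sigma> \<in> S\<close>] by blast
    then have "(\<lambda>n. w (r n) \<sigma> / B \<sigma> * B \<sigma>) \<longlonglongrightarrow> l * B \<sigma>" by (intro tendsto_mult tendsto_const)
    then show ?thesis using Bpos[of \<sigma>] that by (auto simp: convergent_def S_def)
  qed
  \<comment> \<open>the modulus of continuity carries convergence from the rationals to all points\<close>
  have conv: "convergent (\<lambda>n. w (r n) \<rho>)" if "0 < \<rho>" for \<rho>
  proof -
    have "Cauchy (\<lambda>n. w (r n) \<rho>)"
    proof (rule metric_CauchyI)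
      fix e :: real assume "0 < e"
      define d where "d = (e / 4)\<^sup>2 / (R + 1)"
      have "d > 0" using \<open>0 < e\<close> \<open>R \<ge> 0\<close> by (simp add: d_def)
      have "\<rho> * exp (- d) < \<rho>" using that \<open>d > 0\<close> by simp
      then obtain \<sigma> where \<sigma>: "\<sigma> \<in> \<rat>" "\<rho> * exp (- d) < \<sigma>" "\<sigma> < \<rho>" using Rats_dense_in_real by blast
      have "0 < \<sigma>" using \<sigma>(2) that by (meson exp_gt_zero less_trans mult_pos_pos)
      have close: "\<bar>w n \<sigma> - w n \<rho>\<bar> \<le> e / 4" for n
      proof -
        have "\<rho> / \<sigma> \<le> exp d"
          using \<sigma>(2) \<open>0 < \<sigma>\<close> by (simp add: exp_minus field_simps)
        then have "ln (\<rho> / \<sigma>) \<le> d"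
          using ln_mono[of "\<rho> / \<sigma>" "exp d"] that \<open>0 < \<sigma>\<close> by simp
        then have "(w n \<sigma> - w n \<rho>)\<^sup>2 \<le> R * d"
          using osc[OF \<open>0 < \<sigma>\<close>, of \<rho> n] \<sigma>(3) mult_left_mono[OF _ \<open>R \<ge> 0\<close>, of "ln (\<rho> / \<sigma>)" d] by simp
        also have "\<dots> \<le> (R + 1) * d" using \<open>d > 0\<close> by simp
        also have "\<dots> = (e / 4)\<^sup>2" using \<open>R \<ge> 0\<close> by (simp add: d_def)
        finally show ?thesis using \<open>0 < e\<close> by (intro power2_le_imp_le[of "\<bar>_\<bar>"]) auto
      qed
      have "Cauchy (\<lambda>n. w (r n) \<sigma>)" using convS \<sigma>(1) \<open>0 < \<sigma>\<close> by (intro convergent_Cauchy) (auto simp: S_def)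
      then obtain M where M: "\<And>m n. m \<ge> M \<Longrightarrow> n \<ge> M \<Longrightarrow> dist (w (r m) \<sigma>) (w (r n) \<sigma>) < e / 4"
        using \<open>0 < e\<close> by (meson metric_CauchyD zero_less_divide_iff zero_less_numeral)
      have "dist (w (r m) \<rho>) (w (r n) \<rho>) < e" if "m \<ge> M" "n \<ge> M" for m n
        using M[OF that] close[of "r m"] close[of "r n"] \<open>0 < e\<close> unfolding dist_real_def by arith
      then show "\<exists>M. \<forall>m\<ge>M. \<forall>n\<ge>M. dist (w (r m) \<rho>) (w (r n) \<rho>) < e" by blast
    qed
    then show ?thesis by (simp add: Cauchy_convergent_iff)
  qed
  define v where "v \<rho> = lim (\<lambda>n. w (r n) \<rho>)" for \<rho>
  have [measurable]: "v \<in> borel_measurable borel" unfolding v_def by measurable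
  have lim: "(\<lambda>n. w (r n) \<rho>) \<longlonglongrightarrow> v \<rho>" if "0 < \<rho>" for \<rho>
    using conv[OF that] unfolding v_def by (simp add: convergent_LIMSEQ_iff)
  have v4: "(v \<rho>) ^ 4 \<le> 4 * R\<^sup>2 / sqrt \<rho>" if "0 < \<rho>" for \<rho>
    by (rule LIMSEQ_le_const2[OF tendsto_power[OF lim[OF that]]]) (use b4[OF that] in auto)
  let ?w = "\<lambda>n x :: real ^ 2. w n ((norm x)\<^sup>2)"
  let ?v = "\<lambda>x :: real ^ 2. v ((norm x)\<^sup>2)"
  have nz: "AE x in lborel. x \<noteq> (0 :: real ^ 2)" by (rule AE_lborel_singleton)
  \<comment> \<open>dominated convergence in a fixed disc\<close>
  have inside: "(\<lambda>n. \<integral>x. indicator {..A} ((norm x)\<^sup>2) * (?w (r n) x - ?v x) ^ 4 \<partial>lborel) \<longlonglongrightarrow> 0"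
    and inside_i: "integrable lborel (\<lambda>x. indicator {..A} ((norm x)\<^sup>2) * (?w (r n) x - ?v x) ^ 4)" if "0 \<le> A" for A n
  proof -
    let ?g = "\<lambda>x :: real ^ 2. 64 * R\<^sup>2 * (indicator {..A} ((norm x)\<^sup>2) / norm x)"
    have ig: "integrable lborel ?g" by (intro integrable_mult_right inverse_norm_integrable that)
    have bd: "AE x in lborel. norm (indicator {..A} ((norm x)\<^sup>2) * (?w (r n) x - ?v x) ^ 4) \<le> ?g x" for n
      using nz
    proof eventually_elim
      case (elim x)
      then have "0 < (norm x)\<^sup>2" by simp
      have "(?w (r n) x - ?v x) ^ 4 \<le> 8 * ((?w (r n) x) ^ 4 + (?v x) ^ 4)" by (rule power4_diff_le)
      also have "\<dots> \<le> 8 * (4 * R\<^sup>2 / norm x + 4 * R\<^sup>2 / norm x)"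
        using b4[OF \<open>0 < (norm x)\<^sup>2\<close>, of "r n"] v4[OF \<open>0 < (norm x)\<^sup>2\<close>] by (intro mult_left_mono add_mono) auto
      finally have "(?w (r n) x - ?v x) ^ 4 \<le> 64 * R\<^sup>2 / norm x" by simp
      then show ?case by (simp add: indicator_def)
    qed
    show "integrable lborel (\<lambda>x. indicator {..A} ((norm x)\<^sup>2) * (?w (r n) x - ?v x) ^ 4)"
    proof (rule Bochner_Integration.integrable_bound[OF ig])
      show "AE x in lborel. norm (indicator {..A} ((norm x)\<^sup>2) * (?w (r n) x - ?v x) ^ 4) \<le> norm (?g x)"
        using bd[of n] by eventually_elim (unfold real_norm_def, erule order_trans[OF _ abs_ge_self])
    qed measurable
    have "(\<lambda>n. \<integral>x. indicator {..A} ((norm x)\<^sup>2) * (?w (r n) x - ?v x) ^ 4 \<partial>lborel)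
       \<longlonglongrightarrow> (\<integral>x. 0 \<partial>(lborel :: (real ^ 2) measure))"
    proof (rule integral_dominated_convergence[where w = ?g])
      show "AE x in lborel. (\<lambda>n. indicator {..A} ((norm x)\<^sup>2) * (?w (r n) x - ?v x) ^ 4) \<longlonglongrightarrow> 0"
        using nz
      proof eventually_elim
        case (elim x)
        then have "0 < (norm x)\<^sup>2" by simp
        from lim[OF this] have "(\<lambda>n. ?w (r n) x - ?v x) \<longlonglongrightarrow> 0" by (rule LIM_zero)
        then have "(\<lambda>n. indicator {..A} ((norm x)\<^sup>2) * (?w (r n) x - ?v x) ^ 4) \<longlonglongrightarrow> indicator {..A} ((norm x)\<^sup>2) * 0 ^ 4"
          by (intro tendsto_mult tendsto_power tendsto_const)
        then show ?case by simp
      qed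
    qed (use ig bd in \<open>simp_all\<close>)
    then show "(\<lambda>n. \<integral>x. indicator {..A} ((norm x)\<^sup>2) * (?w (r n) x - ?v x) ^ 4 \<partial>lborel) \<longlonglongrightarrow> 0" by simp
  qed
  \<comment> \<open>splitting at \<open>|x|\<^sup>2 = A\<close>, with the pointwise limit as an intermediate function inside\<close>
  have main: "(\<integral>x. (u (r m) x - u (r n) x) ^ 4 \<partial>lborel)
     \<le> 8 * (\<integral>x. indicator {..A} ((norm x)\<^sup>2) * (?w (r m) x - ?v x) ^ 4 \<partial>lborel)
     + 8 * (\<integral>x. indicator {..A} ((norm x)\<^sup>2) * (?w (r n) x - ?v x) ^ 4 \<partial>lborel)
     + 16 * R\<^sup>2 / sqrt A" if "1 \<le> A" for A m n
  proof -
    let ?i = "\<lambda>k x. indicator {..A} ((norm x)\<^sup>2) * (?w (r k) x - ?v x) ^ 4"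
    let ?t = "\<lambda>x. 4 * R / sqrt A * (2 * (u (r m) x)\<^sup>2 + 2 * (u (r n) x)\<^sup>2)"
    let ?g = "\<lambda>x. 8 * ?i m x + 8 * ?i n x + ?t x"
    have "0 \<le> A" using that by simp
    have it: "integrable lborel ?t"
      using H1r_D(5)[OF H] by (intro integrable_mult_right Bochner_Integration.integrable_add)
    have ii: "integrable lborel (\<lambda>x. 8 * ?i k x)" for k
      using inside_i[OF \<open>0 \<le> A\<close>] by (intro integrable_mult_right)
    have ig: "integrable lborel ?g" by (intro Bochner_Integration.integrable_add ii it)
    have bd: "AE x in lborel. (u (r m) x - u (r n) x) ^ 4 \<le> ?g x"
      using w(2)[of "r m"] w(2)[of "r n"]
    proof eventually_elim
      case (elim x)
      let ?\<rho> = "(norm x)\<^sup>2" and ?a = "u (r m) x" and ?b = "u (r n) x"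
      show ?case
      proof (cases "?\<rho> \<le> A")
        case True
        have "(?a - ?b) ^ 4 = ((?a - ?v x) - (?b - ?v x)) ^ 4" by simp
        also have "\<dots> \<le> 8 * ((?a - ?v x) ^ 4 + (?b - ?v x) ^ 4)" by (rule power4_diff_le)
        also have "\<dots> = 8 * ?i m x + 8 * ?i n x" using True elim by simp
        also have "\<dots> \<le> ?g x" using \<open>R \<ge> 0\<close> \<open>0 \<le> A\<close> by simp
        finally show ?thesis .
      next
        case False
        then have "1 \<le> ?\<rho>" "0 < sqrt A" using that by auto
        have "sqrt A \<le> sqrt ?\<rho>" using False by (intro real_sqrt_le_mono) auto
        then have "R / sqrt ?\<rho> \<le> R / sqrt A" using \<open>R \<ge> 0\<close> \<open>0 < sqrt A\<close> by (intro frac_le) auto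
        then have ab: "?a\<^sup>2 \<le> R / sqrt A" "?b\<^sup>2 \<le> R / sqrt A"
          using b2[OF \<open>1 \<le> ?\<rho>\<close>, of "r m"] b2[OF \<open>1 \<le> ?\<rho>\<close>, of "r n"] elim by simp_all
        have sq: "(?a - ?b)\<^sup>2 \<le> 2 * ?a\<^sup>2 + 2 * ?b\<^sup>2"
          using zero_le_power2[of "?a + ?b"] by (simp add: power2_eq_square algebra_simps)
        have "(?a - ?b) ^ 4 = (?a - ?b)\<^sup>2 * (?a - ?b)\<^sup>2" by (simp add: power4_eq_xxxx power2_eq_square mult_ac)
        also have "\<dots> \<le> (2 * ?a\<^sup>2 + 2 * ?b\<^sup>2) * (2 * ?a\<^sup>2 + 2 * ?b\<^sup>2)"
          by (intro mult_mono sq) auto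
        also have "\<dots> \<le> (4 * R / sqrt A) * (2 * ?a\<^sup>2 + 2 * ?b\<^sup>2)"
          using ab by (intro mult_right_mono) auto
        finally show ?thesis using False by simp
      qed
    qed
    have "(\<integral>x. (u (r m) x - u (r n) x) ^ 4 \<partial>lborel) \<le> (\<integral>x. ?g x \<partial>lborel)"
    proof (rule integral_mono_AE[OF _ ig bd])
      have "(\<lambda>x. 1 * u (r m) x + (- 1) * u (r n) x) \<in> H1r" by (intro H1r_lincomb H)
      from L4_embedding(1)[OF this] show "integrable lborel (\<lambda>x. (u (r m) x - u (r n) x) ^ 4)" by simp
    qed
    also have "\<dots> = (\<integral>x. 8 * ?i m x \<partial>lborel) + (\<integral>x. 8 * ?i n x \<partial>lborel) + (\<integral>x. ?t x \<partial>lborel)"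
      by (simp only: Bochner_Integration.integral_add[OF Bochner_Integration.integrable_add[OF ii ii] it]
          Bochner_Integration.integral_add[OF ii ii])
    also have "(\<integral>x. ?t x \<partial>lborel) = 4 * R / sqrt A * (2 * Mass (u (r m)) + 2 * Mass (u (r n)))"
      unfolding Mass_def using H1r_D(5)[OF H] by simp
    also have "\<dots> \<le> 4 * R / sqrt A * (2 * R + 2 * R)"
      using R[of "r m"] R[of "r n"] Mass_le_H1sq[of "u (r m)"] Mass_le_H1sq[of "u (r n)"] \<open>R \<ge> 0\<close> \<open>0 \<le> A\<close>
      by (intro mult_left_mono) auto
    also have "\<dots> = 16 * R\<^sup>2 / sqrt A" by (simp add: power2_eq_square)
    finally show ?thesis by simp
  qed
  have "\<exists>N. \<forall>m\<ge>N. \<forall>n\<ge>N. (\<integral>x. (u (r m) x - u (r n) x) ^ 4 \<partial>lborel) < \<eta>" if "0 < \<eta>" for \<eta>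
  proof -
    define s where "s = 32 * R\<^sup>2 / \<eta> + 1"
    have "s \<ge> 1" using that by (simp add: s_def)
    define A where "A = s\<^sup>2"
    have "1 \<le> A" "sqrt A = s" using \<open>s \<ge> 1\<close> by (simp_all add: A_def)
    have "32 * R\<^sup>2 < s * \<eta>" using that by (simp add: s_def field_simps)
    then have tail: "16 * R\<^sup>2 / sqrt A < \<eta> / 2" using \<open>s \<ge> 1\<close> by (simp add: \<open>sqrt A = s\<close> field_simps)
    have "0 \<le> A" using \<open>1 \<le> A\<close> by simp
    from inside[OF this, THEN LIMSEQ_D, of "\<eta> / 32"] that obtain N where
      N: "\<And>n. n \<ge> N \<Longrightarrow> \<bar>\<integral>x. indicator {..A} ((norm x)\<^sup>2) * (?w (r n) x - ?v x) ^ 4 \<partial>lborel\<bar> < \<eta> / 32"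
      by auto
    have "(\<integral>x. (u (r m) x - u (r n) x) ^ 4 \<partial>lborel) < \<eta>" if "m \<ge> N" "n \<ge> N" for m n
      using main[OF \<open>1 \<le> A\<close>, of m n] N[OF that(1)] N[OF that(2)] tail by linarith
    then show ?thesis by blast
  qed
  then show ?thesis using \<open>strict_mono r\<close> by blast
qed

section \<open>The Chern-Simons term as a trilinear form in densities\<close>

definition L2norm :: "(real ^ 2 \<Rightarrow> real) \<Rightarrow> real" where
  "L2norm a = sqrt (\<integral>x. (a x)\<^sup>2 \<partial>lborel)"

definition L1norm :: "(real ^ 2 \<Rightarrow> real) \<Rightarrow> real" where
  "L1norm a = (\<integral>x. \<bar>a x\<bar> \<partial>lborel)"

text \<open>The class of products of two \<open>H1r\<close> functions, in particular of the densities \<open>u\<^sup>2\<close>.\<close>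

definition density_class :: "(real ^ 2 \<Rightarrow> real) \<Rightarrow> bool" where
  "density_class a \<longleftrightarrow> L2 a \<and> integrable lborel a"

definition dnorm :: "(real ^ 2 \<Rightarrow> real) \<Rightarrow> real" where
  "dnorm a = L1norm a + L2norm a"

lemma L2norm_nonneg [simp]: "0 \<le> L2norm a" and L1norm_nonneg [simp]: "0 \<le> L1norm a"
  and dnorm_nonneg [simp]: "0 \<le> dnorm a" and L2norm_le_dnorm: "L2norm a \<le> dnorm a"
  and L1norm_le_dnorm: "L1norm a \<le> dnorm a"
  by (auto simp: L2norm_def L1norm_def dnorm_def)

lemma L2norm_sq: "(L2norm a)\<^sup>2 = (\<integral>x. (a x)\<^sup>2 \<partial>lborel)"
  by (simp add: L2norm_def)

lemma L2_D: "L2 a \<Longrightarrow> a \<in> borel_measurable borel" "L2 a \<Longrightarrow> integrable lborel (\<lambda>x. (a x)\<^sup>2)" for a :: "real ^ 2 \<Rightarrow> real"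
  by (auto simp: L2_def)

lemma L2_pairing_bound:
  assumes "L2 a" "L2 b"
  shows "\<bar>\<integral>x. a x * b x \<partial>lborel\<bar> \<le> L2norm a * L2norm b"
proof (rule power2_le_imp_le)
  have "(\<integral>x. a x * b x \<partial>lborel)\<^sup>2 \<le> (\<integral>x. (a x)\<^sup>2 \<partial>lborel) * (\<integral>x. (b x)\<^sup>2 \<partial>lborel)"
    using L2_D[OF assms(1)] L2_D[OF assms(2)] by (intro Cauchy_Schwarz_integral(2)) simp_all
  then show "\<bar>\<integral>x. a x * b x \<partial>lborel\<bar>\<^sup>2 \<le> (L2norm a * L2norm b)\<^sup>2"
    by (simp add: power_mult_distrib L2norm_sq)
qed simp

text \<open>Normalised so that the density \<open>u\<^sup>2\<close> of a radial \<open>u\<close> gives \<open>h u\<close>; see \<open>h_eq_disc_flux\<close>.\<close>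

definition disc_flux :: "(real ^ 2 \<Rightarrow> real) \<Rightarrow> real \<Rightarrow> real" where
  "disc_flux a r = (\<integral>x. (if norm x \<le> r then 1 else 0) * a x \<partial>lborel) / (2 * pi)"

lemma density_D:
  assumes "density_class a"
  shows "L2 a" "integrable lborel a" "a \<in> borel_measurable borel"
  using assms L2_D by (auto simp: density_class_def)

lemma density_lincomb:
  assumes "density_class a" "density_class b"
  shows "density_class (\<lambda>x. s * a x + t * b x)"
  using L2_lincomb[OF density_D(1)[OF assms(1)] density_D(1)[OF assms(2)], of s t] density_D(2)[OF assms(1)] density_D(2)[OF assms(2)]
  by (auto simp: density_class_def)

lemma disc_integrable:
  assumes "density_class a"
  shows "integrable lborel (\<lambda>x. (if norm x \<le> r then 1 else 0) * a x)"
proof (rule Bochner_Integration.integrable_bound[OF density_D(2)[OF assms]])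
  note [measurable] = density_D(3)[OF assms]
  show "(\<lambda>x. (if norm x \<le> r then 1 else 0) * a x) \<in> borel_measurable lborel" by measurable
qed (auto intro!: AE_I2)

lemma disc_flux_lincomb:
  assumes "density_class a" "density_class b"
  shows "disc_flux (\<lambda>x. s * a x + t * b x) r = s * disc_flux a r + t * disc_flux b r"
proof -
  have "(\<integral>x. (if norm x \<le> r then 1 else 0) * (s * a x + t * b x) \<partial>lborel)
     = (\<integral>x. s * ((if norm x \<le> r then 1 else 0) * a x) + t * ((if norm x \<le> r then 1 else 0) * b x) \<partial>lborel)"
    by (intro Bochner_Integration.integral_cong) (auto simp: algebra_simps)
  also have "\<dots> = s * (\<integral>x. (if norm x \<le> r then 1 else 0) * a x \<partial>lborel) + t * (\<integral>x. (if norm x \<le> r then 1 else 0) * b x \<partial>lborel)"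
    unfolding Bochner_Integration.integral_add[OF integrable_mult_right[OF disc_integrable[OF assms(1)]] integrable_mult_right[OF disc_integrable[OF assms(2)]]]
      integral_mult_right_zero ..
  finally show ?thesis by (simp add: disc_flux_def add_divide_distrib)
qed

lemma disc_flux_L1: 
  assumes "density_class a" shows "\<bar>disc_flux a r\<bar> \<le> L1norm a"
proof -
  have "\<bar>\<integral>x. (if norm x \<le> r then 1 else 0) * a x \<partial>lborel\<bar> \<le> (\<integral>x. \<bar>(if norm x \<le> r then 1 else 0) * a x\<bar> \<partial>lborel)"
    by (rule integral_abs_bound)
  also have "\<dots> \<le> L1norm a"
    unfolding L1norm_def
    by (intro integral_mono integrable_abs disc_integrable assms density_D(2)[OF assms]) auto
  finally have "\<bar>disc_flux a r\<bar> \<le> L1norm a / (2 * pi)" by (simp add: disc_flux_def abs_divide divide_right_mono)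
  also have "\<dots> \<le> L1norm a / 1"
  proof (rule divide_left_mono)
    show "1 \<le> 2 * pi" using pi_gt3 by linarith
  qed (auto)
  finally show ?thesis by simp
qed

lemma disc_flux_L2: 
  assumes "density_class a" "0 \<le> r" shows "\<bar>disc_flux a r\<bar> \<le> r * L2norm a"
proof (rule power2_le_imp_le)
  note [measurable] = density_D(3)[OF assms(1)]
  have ind: "(if norm x \<le> r then 1 else 0) = (indicator (cball 0 r) x :: real)" for x :: "real ^ 2" by (auto simp: indicator_def)
  have sq: "(indicator (cball 0 r) x :: real)\<^sup>2 = indicator (cball 0 r) x" for x :: "real ^ 2" by (simp add: indicator_def)
  have m: "measure lborel (cball (0 :: real ^ 2) r) = pi * r\<^sup>2"
    using assms(2) by (simp add: content_cball unit_ball_vol_2)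
  have ii: "integrable lborel (indicator (cball (0 :: real ^ 2) r) :: _ \<Rightarrow> real)"
    using emeasure_lborel_cball_finite[of "0 :: real ^ 2" r] by (intro integrable_real_indicator) auto
  have "(\<integral>x. indicator (cball 0 r) x * a x \<partial>lborel)\<^sup>2 \<le> (\<integral>x. (indicator (cball 0 r) x)\<^sup>2 \<partial>(lborel :: (real ^ 2) measure)) * (\<integral>x. (a x)\<^sup>2 \<partial>lborel)"
    by (rule Cauchy_Schwarz_integral(2)) (use ii L2_D(2)[OF density_D(1)[OF assms(1)]] in \<open>auto simp: sq\<close>)
  also have "\<dots> = pi * r\<^sup>2 * (L2norm a)\<^sup>2" using m by (simp add: sq L2norm_sq)
  finally have "(disc_flux a r)\<^sup>2 \<le> pi * r\<^sup>2 * (L2norm a)\<^sup>2 / (2 * pi)\<^sup>2"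
    unfolding disc_flux_def ind power_divide by (intro divide_right_mono) auto
  also have "\<dots> = (r\<^sup>2 * (L2norm a)\<^sup>2) / (4 * pi)" by (simp add: power2_eq_square)
  also have "\<dots> \<le> (r\<^sup>2 * (L2norm a)\<^sup>2) / 1"
  proof (rule divide_left_mono)
    show "1 \<le> 4 * pi" using pi_gt3 by linarith
  qed auto
  finally show "\<bar>disc_flux a r\<bar>\<^sup>2 \<le> (r * L2norm a)\<^sup>2" by (simp add: power_mult_distrib)
qed (use assms in auto)

definition CS_kernel :: "(real ^ 2 \<Rightarrow> real) \<Rightarrow> (real ^ 2 \<Rightarrow> real) \<Rightarrow> real ^ 2 \<Rightarrow> real" where
  "CS_kernel b c x = disc_flux b (norm x) * disc_flux c (norm x) / (norm x)\<^sup>2"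

text \<open>The Chern-Simons energy is this form on the diagonal \<open>a = b = c = u\<^sup>2\<close>. Trilinearity reduces its
  expansion and its continuity to estimates of one form.\<close>

definition CS_form :: "(real ^ 2 \<Rightarrow> real) \<Rightarrow> (real ^ 2 \<Rightarrow> real) \<Rightarrow> (real ^ 2 \<Rightarrow> real) \<Rightarrow> real" where
  "CS_form a b c = (\<integral>x. a x * CS_kernel b c x \<partial>lborel)"

lemma disc_flux_measurable:
  assumes "density_class a" shows "(\<lambda>x :: real ^ 2. disc_flux a (norm x)) \<in> borel_measurable borel"
proof -
  note [measurable] = density_D(3)[OF assms]
  show ?thesis unfolding disc_flux_def by measurable
qed

lemma CS_kernel_measurable:
  assumes "density_class b" "density_class c" shows "CS_kernel b c \<in> borel_measurable borel"
proof -
  note [measurable] = disc_flux_measurable[OF assms(1)] disc_flux_measurable[OF assms(2)]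
  show ?thesis unfolding CS_kernel_def[abs_def] by measurable
qed

text \<open>Cauchy-Schwarz on the disc bounds each flux by a multiple of \<open>|x|\<close>, which cancels the singularity
  \<open>1 / |x|\<^sup>2\<close>.\<close>

lemma CS_kernel_bound:
  assumes "density_class b" "density_class c"
  shows "\<bar>CS_kernel b c x\<bar> \<le> L2norm b * L2norm c"
proof (cases "x = 0")
  case False
  have "\<bar>CS_kernel b c x\<bar> = \<bar>disc_flux b (norm x)\<bar> * \<bar>disc_flux c (norm x)\<bar> / (norm x)\<^sup>2"
    by (simp add: CS_kernel_def abs_mult)
  also have "\<dots> \<le> (norm x * L2norm b) * (norm x * L2norm c) / (norm x)\<^sup>2"
    by (intro divide_right_mono mult_mono disc_flux_L2 assms) auto
  also have "\<dots> = L2norm b * L2norm c" using False by (simp add: power2_eq_square)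
  finally show ?thesis .
qed (simp add: CS_kernel_def)

lemma CS_form_integrable:
  assumes "density_class a" "density_class b" "density_class c"
  shows "integrable lborel (\<lambda>x. a x * CS_kernel b c x)"
proof (rule Bochner_Integration.integrable_bound)
  note [measurable] = density_D(3)[OF assms(1)] CS_kernel_measurable[OF assms(2,3)]
  show "integrable lborel (\<lambda>x. \<bar>a x\<bar> * (L2norm b * L2norm c))" by (intro integrable_mult_left integrable_abs density_D(2) assms)
  show "(\<lambda>x. a x * CS_kernel b c x) \<in> borel_measurable lborel" by measurable
  show "AE x in lborel. norm (a x * CS_kernel b c x) \<le> norm (\<bar>a x\<bar> * (L2norm b * L2norm c))"
    using CS_kernel_bound[OF assms(2,3)] by (intro AE_I2) (auto simp: abs_mult intro!: mult_left_mono)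
qed

lemma CS_form_bound1:
  assumes "density_class a" "density_class b" "density_class c"
  shows "\<bar>CS_form a b c\<bar> \<le> L1norm a * (L2norm b * L2norm c)"
proof -
  have "\<bar>CS_form a b c\<bar> \<le> (\<integral>x. \<bar>a x * CS_kernel b c x\<bar> \<partial>lborel)" unfolding CS_form_def by (rule integral_abs_bound)
  also have "\<dots> \<le> (\<integral>x. \<bar>a x\<bar> * (L2norm b * L2norm c) \<partial>lborel)"
    using CS_kernel_bound[OF assms(2,3)]
    by (intro integral_mono integrable_abs CS_form_integrable assms integrable_mult_left density_D(2)) (auto simp: abs_mult intro!: mult_left_mono)
  finally show ?thesis by (simp add: L1norm_def)
qed

lemma CS_form_bound:
  assumes "density_class a" "density_class b" "density_class c"
  shows "\<bar>CS_form a b c\<bar> \<le> dnorm a * dnorm b * dnorm c"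
proof -
  have "\<bar>CS_form a b c\<bar> \<le> L1norm a * (L2norm b * L2norm c)" by (rule CS_form_bound1[OF assms])
  also have "\<dots> \<le> dnorm a * (dnorm b * dnorm c)"
    by (intro mult_mono L1norm_le_dnorm L2norm_le_dnorm) auto
  finally show ?thesis by (simp add: mult.assoc)
qed

text \<open>A positive square integrable weight: it dominates Chern-Simons kernels, and it turns \<open>L\<^sup>2\<close> bounds on
  the plane into \<open>L\<^sup>1\<close> bounds.\<close>

definition decay :: "real ^ 2 \<Rightarrow> real" where
  "decay x = (if norm x \<le> 1 then 1 else 1 / (norm x)\<^sup>2)"

lemma decay_L2: "L2 decay"
  unfolding L2_def
proof
  show "decay \<in> borel_measurable lborel" unfolding decay_def[abs_def] by measurable
  define f :: "real \<Rightarrow> real" where "f = (\<lambda>\<rho>. if \<rho> \<le> 1 then 1 else 1 / \<rho>\<^sup>2)"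
  have [measurable]: "f \<in> borel_measurable borel" unfolding f_def by measurable
  have "(\<lambda>x :: real. x powr (- 2)) integrable_on {1..}"
    using has_integral_powr_to_inf[of "- 2" 1] by (auto simp: integrable_on_def)
  then have "set_integrable lebesgue {1..} (\<lambda>x :: real. x powr (- 2))"
    by (subst absolutely_integrable_on_iff_nonneg) auto
  then have 1: "integrable lborel (\<lambda>x :: real. indicator {1..} x *\<^sub>R x powr (- 2))"
    unfolding set_integrable_def by (subst (asm) integrable_completion) auto
  have 2: "integrable lborel (indicator {0..1} :: real \<Rightarrow> real)"
    by (intro integrable_real_indicator) auto
  have "set_integrable lborel {0<..} f"
    unfolding set_integrable_def
  proof (rule Bochner_Integration.integrable_bound[OF Bochner_Integration.integrable_add[OF 1 2]])
    show "AE x in lborel. norm (indicator {0<..} x *\<^sub>R f x) \<le> norm (indicator {1..} x *\<^sub>R x powr (- 2) + indicator {0..1} x)"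
      by (intro AE_I2) (auto simp: f_def indicator_def powr_minus powr_numeral inverse_eq_divide)
  qed measurable
  then have "integrable lborel (\<lambda>x :: real ^ 2. f ((norm x)\<^sup>2))"
    by (subst integrable_radial_iff) auto
  also have "(\<lambda>x :: real ^ 2. f ((norm x)\<^sup>2)) = (\<lambda>x. (norm (decay x))\<^sup>2)"
    by (auto simp: f_def decay_def fun_eq_iff abs_square_le_1 power_divide)
  finally show "integrable lborel (\<lambda>x. (norm (decay x))\<^sup>2)" .
qed

text \<open>In contrast to \<open>CS_form_bound1\<close>, the first slot enters through its \<open>L\<^sup>2\<close> norm only. That matters because
  the compactness above makes differences of densities small in \<open>L\<^sup>2\<close>, not in \<open>L\<^sup>1\<close>. The price is a
  square integrable kernel, which follows from the \<open>L\<^sup>1\<close> bound of the fluxes at infinity.\<close>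

lemma CS_form_bound2:
  assumes "density_class a" "density_class b" "density_class c"
  shows "\<bar>CS_form a b c\<bar> \<le> L2norm decay * (L2norm a * dnorm b * dnorm c)"
proof -
  note [measurable] = density_D(3)[OF assms(1)] CS_kernel_measurable[OF assms(2,3)]
  have k: "\<bar>CS_kernel b c x\<bar> \<le> dnorm b * dnorm c * decay x" for x
  proof (cases "norm x \<le> 1")
    case True
    have "\<bar>CS_kernel b c x\<bar> \<le> L2norm b * L2norm c" by (rule CS_kernel_bound[OF assms(2,3)])
    also have "\<dots> \<le> dnorm b * dnorm c" by (intro mult_mono L2norm_le_dnorm) auto
    finally show ?thesis using True by (simp add: decay_def)
  next
    case False
    have "\<bar>CS_kernel b c x\<bar> = \<bar>disc_flux b (norm x)\<bar> * \<bar>disc_flux c (norm x)\<bar> / (norm x)\<^sup>2"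
      by (simp add: CS_kernel_def abs_mult)
    also have "\<dots> \<le> dnorm b * dnorm c / (norm x)\<^sup>2"
      using disc_flux_L1[OF assms(2)] disc_flux_L1[OF assms(3)] L1norm_le_dnorm
      by (intro divide_right_mono mult_mono) (auto intro: order_trans)
    finally show ?thesis using False by (simp add: decay_def)
  qed
  have absa: "L2 (\<lambda>x. \<bar>a x\<bar>)" "L2norm (\<lambda>x. \<bar>a x\<bar>) = L2norm a" using density_D(1)[OF assms(1)] by (auto simp: L2_def L2norm_def)
  have i: "integrable lborel (\<lambda>x. \<bar>a x\<bar> * decay x)" by (rule L2_mult_integrable[OF absa(1) decay_L2])
  have "\<bar>CS_form a b c\<bar> \<le> (\<integral>x. \<bar>a x * CS_kernel b c x\<bar> \<partial>lborel)" unfolding CS_form_def by (rule integral_abs_bound)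
  also have "\<dots> \<le> (\<integral>x. (dnorm b * dnorm c) * (\<bar>a x\<bar> * decay x) \<partial>lborel)"
  proof (rule integral_mono)
    show "integrable lborel (\<lambda>x. \<bar>a x * CS_kernel b c x\<bar>)" by (intro integrable_abs CS_form_integrable assms)
    show "integrable lborel (\<lambda>x. (dnorm b * dnorm c) * (\<bar>a x\<bar> * decay x))" by (intro integrable_mult_right i)
    show "\<bar>a x * CS_kernel b c x\<bar> \<le> (dnorm b * dnorm c) * (\<bar>a x\<bar> * decay x)" for x
      using mult_left_mono[OF k[of x] abs_ge_zero[of "a x"]] by (simp add: abs_mult mult_ac)
  qed
  also have "\<dots> = (dnorm b * dnorm c) * (\<integral>x. \<bar>a x\<bar> * decay x \<partial>lborel)" by (rule integral_mult_right_zero)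
  also have "\<dots> \<le> (dnorm b * dnorm c) * (L2norm a * L2norm decay)"
    using L2_pairing_bound[OF absa(1) decay_L2] unfolding absa(2) by (intro mult_left_mono) auto
  finally show ?thesis by (simp add: mult_ac)
qed

lemma CS_form_sym: "CS_form a b c = CS_form a c b"
  by (simp add: CS_form_def CS_kernel_def mult.commute)

lemma CS_form_lincomb1:
  assumes "density_class a" "density_class a'" "density_class b" "density_class c"
  shows "CS_form (\<lambda>x. s * a x + t * a' x) b c = s * CS_form a b c + t * CS_form a' b c"
proof -
  have "CS_form (\<lambda>x. s * a x + t * a' x) b c = (\<integral>x. s * (a x * CS_kernel b c x) + t * (a' x * CS_kernel b c x) \<partial>lborel)"
    unfolding CS_form_def by (intro Bochner_Integration.integral_cong) (auto simp: algebra_simps)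
  also have "\<dots> = s * CS_form a b c + t * CS_form a' b c"
    unfolding CS_form_def Bochner_Integration.integral_add[OF integrable_mult_right[OF CS_form_integrable[OF assms(1,3,4)]]
        integrable_mult_right[OF CS_form_integrable[OF assms(2,3,4)]]] integral_mult_right_zero ..
  finally show ?thesis .
qed

lemma CS_form_lincomb2:
  assumes "density_class a" "density_class b" "density_class b'" "density_class c"
  shows "CS_form a (\<lambda>x. s * b x + t * b' x) c = s * CS_form a b c + t * CS_form a b' c"
proof -
  have k: "CS_kernel (\<lambda>x. s * b x + t * b' x) c x = s * CS_kernel b c x + t * CS_kernel b' c x" for x
    unfolding CS_kernel_def disc_flux_lincomb[OF assms(2,3)] by (simp add: add_divide_distrib distrib_right)
  have "CS_form a (\<lambda>x. s * b x + t * b' x) c = (\<integral>x. s * (a x * CS_kernel b c x) + t * (a x * CS_kernel b' c x) \<partial>lborel)"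
    unfolding CS_form_def k by (intro Bochner_Integration.integral_cong) (auto simp: algebra_simps)
  also have "\<dots> = s * CS_form a b c + t * CS_form a b' c"
    unfolding CS_form_def Bochner_Integration.integral_add[OF integrable_mult_right[OF CS_form_integrable[OF assms(1,2,4)]]
        integrable_mult_right[OF CS_form_integrable[OF assms(1,3,4)]]] integral_mult_right_zero ..
  finally show ?thesis .
qed

lemma CS_form_lincomb3:
  assumes "density_class a" "density_class b" "density_class c" "density_class c'"
  shows "CS_form a b (\<lambda>x. s * c x + t * c' x) = s * CS_form a b c + t * CS_form a b c'"
  using CS_form_lincomb2[OF assms(1,3,4,2)] by (simp add: CS_form_sym)

subsection \<open>The flux function of a radial density\<close>

lemma distr_norm:
  "distr (lborel :: (real ^ 2) measure) borel norm
     = density lborel (\<lambda>r. ennreal (2 * pi * r * indicator {0..} r))" (is "?L = ?R")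
proof (rule measure_eqI_atMost)
  have eL: "emeasure ?L {..b} = ennreal (pi * (max 0 b)\<^sup>2)" for b :: real
  proof (cases "b \<ge> 0")
    case True
    have "(norm :: real ^ 2 \<Rightarrow> real) -` {..b} = cball 0 b" by auto
    then show ?thesis
      using True by (simp add: emeasure_distr emeasure_cball unit_ball_vol_2)
  next
    case False
    have "(norm :: real ^ 2 \<Rightarrow> real) -` {..b} = {}"
      using False by auto (smt (verit) norm_ge_zero)
    then show ?thesis using False by (simp add: emeasure_distr)
  qed
  have eR: "emeasure ?R {..b} = ennreal (pi * (max 0 b)\<^sup>2)" for b :: real
  proof -
    have "emeasure ?R {..b} = (\<integral>\<^sup>+ r. ennreal (2 * pi * r) * indicator {0..b} r \<partial>lborel)"
      by (subst emeasure_density, simp, simp) (intro nn_integral_cong, auto simp: indicator_def)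
    also have "\<dots> = ennreal (pi * (max 0 b)\<^sup>2)"
    proof (cases "b \<ge> 0")
      case True
      have "(\<integral>\<^sup>+ r. ennreal (2 * pi * r) * indicator {0..b} r \<partial>lborel) = ennreal (pi * b\<^sup>2 - pi * 0\<^sup>2)"
        using True by (intro nn_integral_FTC_Icc) (auto intro!: derivative_eq_intros)
      then show ?thesis using True by simp
    qed (simp add: indicator_def)
    finally show ?thesis .
  qed
  show "sets ?L = sets borel" "sets ?R = sets borel" by simp_all
  show "emeasure ?L {..b} = emeasure ?R {..b}" "emeasure ?L {..b} \<noteq> \<infinity>" for b
    by (simp_all add: eL eR)
qed

lemma h_eq_disc_flux:
  assumes "radial u" and [measurable]: "u \<in> borel_measurable borel"
  shows "h u r = disc_flux (\<lambda>x. (u x)\<^sup>2) r"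
proof -
  define f where "f = (\<lambda>s. (if s \<le> r then 1 else 0) * (profile u s)\<^sup>2)"
  have [measurable]: "profile u \<in> borel_measurable borel"
    unfolding profile_def[abs_def]
    by (rule measurable_compose[OF _ assms(2)]) (intro borel_measurable_continuous_onI continuous_intros)
  have [measurable]: "f \<in> borel_measurable borel" unfolding f_def by measurable
  have "(\<integral>x. (if norm x \<le> r then 1 else 0) * (u x)\<^sup>2 \<partial>lborel) = (\<integral>x. f (norm (x :: real ^ 2)) \<partial>lborel)"
    by (simp add: f_def profile_norm[OF assms(1)])
  also have "\<dots> = (\<integral>s. f s \<partial>distr (lborel :: (real ^ 2) measure) borel norm)"
    by (subst integral_distr) auto
  also have "\<dots> = (\<integral>s. (2 * pi * s * indicator {0..} s) *\<^sub>R f s \<partial>lborel)"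
    unfolding distr_norm by (subst integral_density) (auto simp: indicator_def)
  also have "\<dots> = (\<integral>s. (2 * pi) * (indicator {0..r} s *\<^sub>R (s * (profile u s)\<^sup>2)) \<partial>lborel)"
    by (intro Bochner_Integration.integral_cong) (auto simp: f_def indicator_def)
  also have "\<dots> = 2 * pi * h u r" unfolding h_def set_lebesgue_integral_def by simp
  finally show ?thesis by (simp add: disc_flux_def)
qed

section \<open>Completeness\<close>

lemma decay_pos: "0 < decay x"
  by (auto simp: decay_def)

text \<open>Multiplication with \<open>decay\<close> turns the sequence into an \<open>L\<^sup>1\<close> Cauchy sequence, which has an almost
  everywhere convergent subsequence; Fatou's lemma then gives convergence in \<open>L\<^sup>2\<close>. The limit is
  given by an explicit pointwise formula because pointwise properties such as radial symmetry pass
  to it.\<close>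

lemma L2_complete:
  fixes f :: "nat \<Rightarrow> real ^ 2 \<Rightarrow> 'b::euclidean_space"
  assumes L: "\<And>n. L2 (f n)"
    and C: "\<And>e. e > 0 \<Longrightarrow> \<exists>N. \<forall>m\<ge>N. \<forall>n\<ge>N. (\<integral>x. (norm (f m x - f n x))\<^sup>2 \<partial>lborel) < e"
  obtains r :: "nat \<Rightarrow> nat" and F where "F = (\<lambda>x. lim (\<lambda>k. f (r k) x))" "L2 F"
    "(\<lambda>n. \<integral>x. (norm (f n x - F x))\<^sup>2 \<partial>lborel) \<longlonglongrightarrow> 0"
proof -
  have m [measurable]: "f n \<in> borel_measurable borel" for n using L[of n] by (simp add: L2_def)
  have Ldiff: "L2 (\<lambda>x. f m x - f n x)" for m n using L2_lincomb[OF L L, of 1 m "-1" n] by simp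
  have normL2: "L2 (\<lambda>x. norm (g x))" if "L2 g" for g :: "real ^ 2 \<Rightarrow> 'b"
    using that unfolding L2_def by (auto intro: borel_measurable_norm)
  have int: "integrable lborel (\<lambda>x. decay x *\<^sub>R f n x)" for n
  proof -
    have [measurable]: "decay \<in> borel_measurable borel" using decay_L2 by (simp add: L2_def)
    have "integrable lborel (\<lambda>x. norm (decay x *\<^sub>R f n x))"
      using L2_mult_integrable[OF decay_L2 normL2[OF L[of n]]] decay_pos by (simp add: less_imp_le abs_of_pos)
    then show ?thesis by (rule integrable_norm_cancel) measurable
  qed
  have Ld: "L2norm decay \<ge> 0" by simp
  obtain r :: "nat \<Rightarrow> nat" where "strict_mono r" and r: "AE x in lborel. Cauchy (\<lambda>i. decay x *\<^sub>R f (r i) x)"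
  proof (rule cauchy_L1_AE_cauchy_subseq[of lborel "\<lambda>n x. decay x *\<^sub>R f n x"])
    show "\<exists>N. \<forall>i\<ge>N. \<forall>j\<ge>N. (LINT x|lborel. norm (decay x *\<^sub>R f i x - decay x *\<^sub>R f j x)) < e" if "0 < e" for e
    proof -
      define d where "d = (e / (L2norm decay + 1))\<^sup>2"
      have "0 < e / (L2norm decay + 1)" using that Ld by (intro divide_pos_pos add_nonneg_pos) auto
      then have "0 < d" unfolding d_def by (rule zero_less_power)
      from C[OF this] obtain N where N: "\<And>m n. m \<ge> N \<Longrightarrow> n \<ge> N \<Longrightarrow> (\<integral>x. (norm (f m x - f n x))\<^sup>2 \<partial>lborel) < d" by blast
      have "(LINT x|lborel. norm (decay x *\<^sub>R f i x - decay x *\<^sub>R f j x)) < e" if "i \<ge> N" "j \<ge> N" for i j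
      proof -
        have "(LINT x|lborel. norm (decay x *\<^sub>R f i x - decay x *\<^sub>R f j x)) = (\<integral>x. decay x * norm (f i x - f j x) \<partial>lborel)"
          unfolding scaleR_diff_right[symmetric] using decay_pos by (simp add: abs_of_pos)
        also have "\<dots> \<le> L2norm decay * L2norm (\<lambda>x. norm (f i x - f j x))"
          using L2_pairing_bound[OF decay_L2 normL2[OF Ldiff[of i j]]] by linarith
        also have "\<dots> \<le> L2norm decay * (e / (L2norm decay + 1))"
        proof (rule mult_left_mono[OF _ Ld])
          have "(L2norm (\<lambda>x. norm (f i x - f j x)))\<^sup>2 \<le> d" using N[OF that] by (simp add: L2norm_sq)
          then show "L2norm (\<lambda>x. norm (f i x - f j x)) \<le> e / (L2norm decay + 1)"
            unfolding d_def by (rule power2_le_imp_le) (use \<open>0 < e / (L2norm decay + 1)\<close> in simp)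
        qed
        also have "\<dots> < e"
        proof -
          have p: "0 < L2norm decay + 1" using Ld by (rule add_nonneg_pos) simp
          show ?thesis unfolding times_divide_eq_right pos_divide_less_eq[OF p] using \<open>0 < e\<close> by (simp add: algebra_simps)
        qed
        finally show ?thesis .
      qed
      then show ?thesis by blast
    qed
  qed (use int in auto)
  define F where "F = (\<lambda>x. lim (\<lambda>k. f (r k) x))"
  have [measurable]: "F \<in> borel_measurable borel" unfolding F_def by measurable
  have lim: "AE x in lborel. (\<lambda>k. f (r k) x) \<longlonglongrightarrow> F x"
    using r
  proof eventually_elim
    case (elim x)
    have "convergent (\<lambda>i. decay x *\<^sub>R f (r i) x)" using elim by (simp add: Cauchy_convergent_iff)
    then obtain l where "(\<lambda>i. decay x *\<^sub>R f (r i) x) \<longlonglongrightarrow> l" by (auto simp: convergent_def)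
    then have "(\<lambda>i. (1 / decay x) *\<^sub>R (decay x *\<^sub>R f (r i) x)) \<longlonglongrightarrow> (1 / decay x) *\<^sub>R l" by (intro tendsto_intros)
    then have "convergent (\<lambda>i. f (r i) x)" using decay_pos[of x] by (auto simp: convergent_def)
    then show ?case unfolding F_def by (simp add: convergent_LIMSEQ_iff)
  qed
  have r_ge: "n \<le> r n" for n using \<open>strict_mono r\<close> by (rule strict_mono_imp_increasing)
  have est: "\<exists>N. \<forall>n\<ge>N. (\<integral>\<^sup>+x. ennreal ((norm (f n x - F x))\<^sup>2) \<partial>lborel) \<le> ennreal e" if "0 < e" for e
  proof -
    from C[OF that] obtain N where N: "\<And>m n. m \<ge> N \<Longrightarrow> n \<ge> N \<Longrightarrow> (\<integral>x. (norm (f m x - f n x))\<^sup>2 \<partial>lborel) < e" by blast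
    have "(\<integral>\<^sup>+x. ennreal ((norm (f n x - F x))\<^sup>2) \<partial>lborel) \<le> ennreal e" if "n \<ge> N" for n
    proof -
      have "AE x in lborel. ennreal ((norm (f n x - F x))\<^sup>2) = liminf (\<lambda>k. ennreal ((norm (f n x - f (r k) x))\<^sup>2))"
        using lim
      proof eventually_elim
        case (elim x)
        then have "(\<lambda>k. ennreal ((norm (f n x - f (r k) x))\<^sup>2)) \<longlonglongrightarrow> ennreal ((norm (f n x - F x))\<^sup>2)"
          by (intro tendsto_intros)
        then show ?case by (rule lim_imp_Liminf[symmetric, rotated]) simp
      qed
      then have "(\<integral>\<^sup>+x. ennreal ((norm (f n x - F x))\<^sup>2) \<partial>lborel)
        = (\<integral>\<^sup>+x. liminf (\<lambda>k. ennreal ((norm (f n x - f (r k) x))\<^sup>2)) \<partial>lborel)"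
        by (rule nn_integral_cong_AE)
      also have "\<dots> \<le> liminf (\<lambda>k. \<integral>\<^sup>+x. ennreal ((norm (f n x - f (r k) x))\<^sup>2) \<partial>lborel)"
        by (rule nn_integral_liminf) measurable
      also have "\<dots> \<le> liminf (\<lambda>k. ennreal e)"
      proof (rule Liminf_mono)
        show "\<forall>\<^sub>F k in sequentially. (\<integral>\<^sup>+x. ennreal ((norm (f n x - f (r k) x))\<^sup>2) \<partial>lborel) \<le> ennreal e"
          using eventually_ge_at_top[of N]
        proof eventually_elim
          case (elim k)
          then have "r k \<ge> N" using r_ge[of k] by simp
          have "(\<integral>\<^sup>+x. ennreal ((norm (f n x - f (r k) x))\<^sup>2) \<partial>lborel) = ennreal (\<integral>x. (norm (f n x - f (r k) x))\<^sup>2 \<partial>lborel)"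
            using Ldiff[of n "r k"] by (intro nn_integral_eq_integral) (auto simp: L2_def)
          also have "\<dots> \<le> ennreal e" using N[OF that \<open>r k \<ge> N\<close>] by (intro ennreal_leI) simp
          finally show ?case .
        qed
      qed
      also have "\<dots> = ennreal e" by (simp add: Liminf_const)
      finally show ?thesis .
    qed
    then show ?thesis by blast
  qed
  have diffL2: "\<exists>N. \<forall>n\<ge>N. L2 (\<lambda>x. f n x - F x) \<and> (\<integral>x. (norm (f n x - F x))\<^sup>2 \<partial>lborel) \<le> e" if "0 < e" for e
  proof -
    from est[OF that] obtain N where N: "\<And>n. n \<ge> N \<Longrightarrow> (\<integral>\<^sup>+x. ennreal ((norm (f n x - F x))\<^sup>2) \<partial>lborel) \<le> ennreal e" by blast
    have "L2 (\<lambda>x. f n x - F x) \<and> (\<integral>x. (norm (f n x - F x))\<^sup>2 \<partial>lborel) \<le> e" if "n \<ge> N" for n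
    proof -
      have i: "integrable lborel (\<lambda>x. (norm (f n x - F x))\<^sup>2)"
        using N[OF that] by (intro integrableI_bounded) (auto simp: top_unique less_top[symmetric])
      have "ennreal (\<integral>x. (norm (f n x - F x))\<^sup>2 \<partial>lborel) \<le> ennreal e"
        using N[OF that] nn_integral_eq_integral[OF i] by simp
      then have "(\<integral>x. (norm (f n x - F x))\<^sup>2 \<partial>lborel) \<le> e" using \<open>0 < e\<close> by (simp add: ennreal_le_iff)
      then show ?thesis using i by (simp add: L2_def)
    qed
    then show ?thesis by blast
  qed
  have "L2 F"
  proof -
    obtain n where "L2 (\<lambda>x. f n x - F x)" using diffL2[of 1] by auto
    from L2_lincomb[OF L[of n] this, of 1 "-1"] show ?thesis by simp
  qed
  moreover have "(\<lambda>n. \<integral>x. (norm (f n x - F x))\<^sup>2 \<partial>lborel) \<longlonglongrightarrow> 0"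
  proof (rule LIMSEQ_I)
    fix e :: real assume "0 < e"
    then have "0 < e / 2" by simp
    from diffL2[OF this] obtain N where N: "\<And>n. n \<ge> N \<Longrightarrow> (\<integral>x. (norm (f n x - F x))\<^sup>2 \<partial>lborel) \<le> e / 2" by blast
    have "norm ((\<integral>x. (norm (f n x - F x))\<^sup>2 \<partial>lborel) - 0) < e" if "n \<ge> N" for n
    proof -
      have "0 \<le> (\<integral>x. (norm (f n x - F x))\<^sup>2 \<partial>lborel)" by simp
      then show ?thesis using N[OF that] \<open>0 < e\<close> by simp
    qed
    then show "\<exists>N. \<forall>n\<ge>N. norm ((\<integral>x. (norm (f n x - F x))\<^sup>2 \<partial>lborel) - 0) < e" by blast
  qed
  ultimately show thesis using that[OF F_def] by blast
qed

section \<open>The Sobolev seminorm\<close>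

definition dir_form :: "(real ^ 2 \<Rightarrow> real) \<Rightarrow> (real ^ 2 \<Rightarrow> real) \<Rightarrow> real" where
  "dir_form u v = (\<integral>x. grad u x \<bullet> grad v x \<partial>lborel)"

definition mass_form :: "(real ^ 2 \<Rightarrow> real) \<Rightarrow> (real ^ 2 \<Rightarrow> real) \<Rightarrow> real" where
  "mass_form u v = (\<integral>x. u x * v x \<partial>lborel)"

lemma L2_inner_integrable:
  fixes f g :: "real ^ 2 \<Rightarrow> real ^ 2"
  assumes "L2 f" "L2 g" shows "integrable lborel (\<lambda>x. f x \<bullet> g x)"
  unfolding inner_vec_def sum_2
  by (simp add: L2_mult_integrable L2_component assms)

lemma Dir_lincomb:
  assumes "u \<in> H1" "v \<in> H1"
  shows "Dir (\<lambda>x. a * u x + b * v x) = a\<^sup>2 * Dir u + 2 * a * b * dir_form u v + b\<^sup>2 * Dir v"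
proof -
  note L = H1_L2(2)[OF assms(1)] H1_L2(2)[OF assms(2)]
  have [measurable]: "grad u \<in> borel_measurable borel" "grad v \<in> borel_measurable borel" using L by (auto simp: L2_def)
  have [measurable]: "grad (\<lambda>x. a * u x + b * v x) \<in> borel_measurable borel"
    using H1_L2(2)[OF H1_lincomb(1)[OF assms, of a b]] by (simp add: L2_def)
  have i: "integrable lborel (\<lambda>x. a\<^sup>2 * (norm (grad u x))\<^sup>2)" "integrable lborel (\<lambda>x. 2 * a * b * (grad u x \<bullet> grad v x))"
    "integrable lborel (\<lambda>x. b\<^sup>2 * (norm (grad v x))\<^sup>2)"
    using L L2_inner_integrable[OF L] by (auto simp: L2_def)
  have "Dir (\<lambda>x. a * u x + b * v x)
     = (\<integral>x. a\<^sup>2 * (norm (grad u x))\<^sup>2 + 2 * a * b * (grad u x \<bullet> grad v x) + b\<^sup>2 * (norm (grad v x))\<^sup>2 \<partial>lborel)"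
    unfolding Dir_def
  proof (rule integral_cong_AE)
    show "AE x in lborel. (norm (grad (\<lambda>x. a * u x + b * v x) x))\<^sup>2
       = a\<^sup>2 * (norm (grad u x))\<^sup>2 + 2 * a * b * (grad u x \<bullet> grad v x) + b\<^sup>2 * (norm (grad v x))\<^sup>2"
      using H1_lincomb(2)[OF assms, of a b]
    proof eventually_elim
      case (elim x)
      show ?case unfolding elim power2_norm_eq_inner
        by (simp add: inner_add_left inner_add_right inner_commute[of "grad v x" "grad u x"] power2_eq_square algebra_simps)
    qed
  qed measurable
  also have "\<dots> = a\<^sup>2 * Dir u + 2 * a * b * dir_form u v + b\<^sup>2 * Dir v"
    unfolding Bochner_Integration.integral_add[OF Bochner_Integration.integrable_add[OF i(1,2)] i(3)]
      Bochner_Integration.integral_add[OF i(1,2)] integral_mult_right_zero Dir_def dir_form_def ..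
  finally show ?thesis .
qed

lemma Mass_lincomb:
  assumes "L2 u" "L2 v"
  shows "Mass (\<lambda>x. a * u x + b * v x) = a\<^sup>2 * Mass u + 2 * a * b * mass_form u v + b\<^sup>2 * Mass v"
proof -
  have i: "integrable lborel (\<lambda>x. a\<^sup>2 * (u x)\<^sup>2)" "integrable lborel (\<lambda>x. 2 * a * b * (u x * v x))"
    "integrable lborel (\<lambda>x. b\<^sup>2 * (v x)\<^sup>2)"
    using assms L2_mult_integrable[OF assms] by (auto simp: L2_def)
  have "Mass (\<lambda>x. a * u x + b * v x)
     = (\<integral>x. a\<^sup>2 * (u x)\<^sup>2 + 2 * a * b * (u x * v x) + b\<^sup>2 * (v x)\<^sup>2 \<partial>lborel)"
    unfolding Mass_def by (intro Bochner_Integration.integral_cong) (auto simp: power2_eq_square algebra_simps)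
  also have "\<dots> = a\<^sup>2 * Mass u + 2 * a * b * mass_form u v + b\<^sup>2 * Mass v"
    unfolding Bochner_Integration.integral_add[OF Bochner_Integration.integrable_add[OF i(1,2)] i(3)]
      Bochner_Integration.integral_add[OF i(1,2)] integral_mult_right_zero Mass_def mass_form_def ..
  finally show ?thesis .
qed

lemma H1r_add: "u \<in> H1r \<Longrightarrow> v \<in> H1r \<Longrightarrow> (\<lambda>x. u x + v x) \<in> H1r"
  using H1r_lincomb[of u v 1 1] by simp

lemma H1r_diff: "u \<in> H1r \<Longrightarrow> v \<in> H1r \<Longrightarrow> (\<lambda>x. u x - v x) \<in> H1r"
  using H1r_lincomb[of u v 1 "-1"] by simp

lemma H1r_scale: "u \<in> H1r \<Longrightarrow> (\<lambda>x. c * u x) \<in> H1r"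
  using H1r_lincomb[of u u c 0] by simp

lemma Dir_scale: "u \<in> H1r \<Longrightarrow> Dir (\<lambda>x. c * u x) = c\<^sup>2 * Dir u"
  using Dir_lincomb[of u u c 0] H1r_D(1) by simp

lemma Mass_scale: "Mass (\<lambda>x. c * u x) = c\<^sup>2 * Mass u"
  by (simp add: Mass_def power_mult_distrib)

lemma H1sq_scale: "u \<in> H1r \<Longrightarrow> H1sq (\<lambda>x. c * u x) = c\<^sup>2 * H1sq u"
  by (simp add: H1sq_def Dir_scale Mass_scale algebra_simps)

lemma Dir_add: "u \<in> H1r \<Longrightarrow> v \<in> H1r \<Longrightarrow> Dir (\<lambda>x. u x + v x) = Dir u + 2 * dir_form u v + Dir v"
  using Dir_lincomb[of u v 1 1] H1r_D(1) by simp

lemma Mass_add: "u \<in> H1r \<Longrightarrow> v \<in> H1r \<Longrightarrow> Mass (\<lambda>x. u x + v x) = Mass u + 2 * mass_form u v + Mass v"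
  using Mass_lincomb[of u v 1 1] H1r_D(2) by simp

lemma Dir_diff: "u \<in> H1r \<Longrightarrow> v \<in> H1r \<Longrightarrow> Dir (\<lambda>x. u x - v x) = Dir u - 2 * dir_form u v + Dir v"
  using Dir_lincomb[of u v 1 "-1"] H1r_D(1) by simp

lemma Mass_diff: "u \<in> H1r \<Longrightarrow> v \<in> H1r \<Longrightarrow> Mass (\<lambda>x. u x - v x) = Mass u - 2 * mass_form u v + Mass v"
  using Mass_lincomb[of u v 1 "-1"] H1r_D(2) by simp

lemma H1sq_parallelogram:
  assumes "u \<in> H1r" "v \<in> H1r"
  shows "H1sq (\<lambda>x. u x + v x) + H1sq (\<lambda>x. u x - v x) = 2 * H1sq u + 2 * H1sq v"
  unfolding H1sq_def Dir_add[OF assms] Mass_add[OF assms] Dir_diff[OF assms] Mass_diff[OF assms] by simp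

lemma H1sq_add_le:
  assumes "u \<in> H1r" "v \<in> H1r"
  shows "H1sq (\<lambda>x. u x + v x) \<le> 2 * H1sq u + 2 * H1sq v"
  unfolding H1sq_parallelogram[OF assms, symmetric] by (simp add: H1sq_nonneg)

lemma dir_form_scale:
  assumes "u \<in> H1r" "v \<in> H1r"
  shows "dir_form u (\<lambda>x. c * v x) = c * dir_form u v"
proof -
  have "Dir (\<lambda>x. u x + c * v x) = Dir u + 2 * c * dir_form u v + c\<^sup>2 * Dir v"
    using Dir_lincomb[of u v 1 c] H1r_D(1)[OF assms(1)] H1r_D(1)[OF assms(2)] by simp
  moreover have "Dir (\<lambda>x. u x + c * v x) = Dir u + 2 * dir_form u (\<lambda>x. c * v x) + c\<^sup>2 * Dir v"
    using Dir_add[OF assms(1) H1r_scale[OF assms(2)]] Dir_scale[OF assms(2)] by simp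
  ultimately show ?thesis by simp
qed

lemma mass_form_scale: "mass_form u (\<lambda>x. c * v x) = c * mass_form u v"
  by (simp add: mass_form_def mult.left_commute)

text \<open>Functions and gradients converge separately in \<open>L\<^sup>2\<close>, and the defining identity of the weak gradient
  is continuous in both.\<close>

lemma H1r_complete:
  assumes H: "\<And>n. u n \<in> H1r"
    and C: "\<And>e. e > 0 \<Longrightarrow> \<exists>N. \<forall>m\<ge>N. \<forall>n\<ge>N. H1sq (\<lambda>x. u m x - u n x) < e"
  obtains v where "v \<in> H1r" "(\<lambda>n. H1sq (\<lambda>x. u n x - v x)) \<longlonglongrightarrow> 0"
proof -
  have D: "Dir (\<lambda>x. u m x - v x) = (\<integral>x. (norm (grad (u m) x - grad v x))\<^sup>2 \<partial>lborel)" if "v \<in> H1r" for m v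
  proof -
    have e: "AE x in lborel. grad (\<lambda>x. u m x - v x) x = grad (u m) x - grad v x"
      using H1_lincomb(2)[OF H1r_D(1)[OF H[of m]] H1r_D(1)[OF that], of 1 "-1"] by simp
    have [measurable]: "grad (u m) \<in> borel_measurable borel" "grad v \<in> borel_measurable borel"
      "grad (\<lambda>x. u m x - v x) \<in> borel_measurable borel"
      using H1_L2(2)[OF H1r_D(1)[OF H[of m]]] H1_L2(2)[OF H1r_D(1)[OF that]] H1_L2(2)[OF H1r_D(1)[OF H1r_diff[OF H[of m] that]]]
      by (auto simp: L2_def)
    show ?thesis unfolding Dir_def by (rule integral_cong_AE) (use e in auto)
  qed
  have Cu: "\<exists>N. \<forall>m\<ge>N. \<forall>n\<ge>N. (\<integral>x. (norm (u m x - u n x))\<^sup>2 \<partial>lborel) < e" if "0 < e" for e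
  proof -
    have "(\<integral>x. (norm (u m x - u n x))\<^sup>2 \<partial>lborel) \<le> H1sq (\<lambda>x. u m x - u n x)" for m n
      using Mass_le_H1sq[of "\<lambda>x. u m x - u n x"] by (simp add: Mass_def)
    then show ?thesis using C[OF that] by (meson order_le_less_trans)
  qed
  have Cg: "\<exists>N. \<forall>m\<ge>N. \<forall>n\<ge>N. (\<integral>x. (norm (grad (u m) x - grad (u n) x))\<^sup>2 \<partial>lborel) < e" if "0 < e" for e
  proof -
    have "(\<integral>x. (norm (grad (u m) x - grad (u n) x))\<^sup>2 \<partial>lborel) \<le> H1sq (\<lambda>x. u m x - u n x)" for m n
      using Dir_le_H1sq[of "\<lambda>x. u m x - u n x"] D[OF H[of n], of m] by simp
    then show ?thesis using C[OF that] by (meson order_le_less_trans)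
  qed
  obtain r v where v: "v = (\<lambda>x. lim (\<lambda>k. u (r k) x))" "L2 v"
    "(\<lambda>n. \<integral>x. (norm (u n x - v x))\<^sup>2 \<partial>lborel) \<longlonglongrightarrow> 0"
    by (rule L2_complete[of u, OF H1r_D(2)[OF H] Cu])
  obtain r' g where g: "L2 g" "(\<lambda>n. \<integral>x. (norm (grad (u n) x - g x))\<^sup>2 \<partial>lborel) \<longlonglongrightarrow> 0"
    by (rule L2_complete[of "\<lambda>n. grad (u n)", OF H1_L2(2)[OF H1r_D(1)[OF H]] Cg])
  have pair: "(\<lambda>n. \<integral>x. f n x * \<phi> x \<partial>lborel) \<longlonglongrightarrow> (\<integral>x. F x * \<phi> x \<partial>lborel)"
    if "\<And>n. L2 (f n)" "L2 F" "L2 \<phi>" "(\<lambda>n. \<integral>x. (f n x - F x)\<^sup>2 \<partial>lborel) \<longlonglongrightarrow> 0" for f :: "nat \<Rightarrow> real ^ 2 \<Rightarrow> real" and F \<phi> :: "real ^ 2 \<Rightarrow> real"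
  proof -
    have "(\<lambda>n. L2norm (\<lambda>x. f n x - F x) * L2norm \<phi>) \<longlonglongrightarrow> sqrt 0 * L2norm \<phi>"
      unfolding L2norm_def[of "\<lambda>x. f _ x - F x"] by (intro tendsto_mult tendsto_real_sqrt that tendsto_const)
    then have t1: "(\<lambda>n. L2norm (\<lambda>x. f n x - F x) * L2norm \<phi>) \<longlonglongrightarrow> 0" by simp
    have t2: "norm ((\<integral>x. f n x * \<phi> x \<partial>lborel) - (\<integral>x. F x * \<phi> x \<partial>lborel)) \<le> L2norm (\<lambda>x. f n x - F x) * L2norm \<phi>" for n
    proof -
      have L: "L2 (\<lambda>x. f n x - F x)" using L2_lincomb[OF that(1)[of n] that(2), of 1 "-1"] by simp
      have "(\<integral>x. f n x * \<phi> x \<partial>lborel) - (\<integral>x. F x * \<phi> x \<partial>lborel) = (\<integral>x. (f n x - F x) * \<phi> x \<partial>lborel)"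
        using L2_mult_integrable[OF that(1)[of n] that(3)] L2_mult_integrable[OF that(2,3)] by (simp add: left_diff_distrib)
      then show ?thesis using L2_pairing_bound[OF L that(3)] by simp
    qed
    have "(\<lambda>n. (\<integral>x. f n x * \<phi> x \<partial>lborel) - (\<integral>x. F x * \<phi> x \<partial>lborel)) \<longlonglongrightarrow> 0"
      by (rule Lim_null_comparison[OF always_eventually[OF allI[OF t2]] t1])
    then show ?thesis by (rule LIM_zero_cancel)
  qed
  have wg: "L2_weak_gradient v g"
    unfolding L2_weak_gradient_def
  proof (intro conjI allI impI)
    show "L2 g" by (rule g(1))
    fix \<phi> i assume t: "test_function \<phi>"
    have gi: "(\<lambda>n. \<integral>x. (grad (u n) x $ i - g x $ i)\<^sup>2 \<partial>lborel) \<longlonglongrightarrow> 0"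
    proof (rule Lim_null_comparison[OF _ g(2)], rule always_eventually, rule allI)
      fix n
      have L: "L2 (\<lambda>x. grad (u n) x - g x)"
        using L2_lincomb[OF H1_L2(2)[OF H1r_D(1)[OF H[of n]]] g(1), of 1 "-1"] by simp
      have "(\<integral>x. (grad (u n) x $ i - g x $ i)\<^sup>2 \<partial>lborel) \<le> (\<integral>x. (norm (grad (u n) x - g x))\<^sup>2 \<partial>lborel)"
      proof (rule integral_mono)
        show "integrable lborel (\<lambda>x. (grad (u n) x $ i - g x $ i)\<^sup>2)"
          using L2_component[OF L, of i] by (simp add: L2_def)
        show "integrable lborel (\<lambda>x. (norm (grad (u n) x - g x))\<^sup>2)" using L by (simp add: L2_def)
        show "(grad (u n) x $ i - g x $ i)\<^sup>2 \<le> (norm (grad (u n) x - g x))\<^sup>2" for x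
          using power_mono[OF component_le_norm_cart[of "grad (u n) x - g x" i] abs_ge_zero, of 2] by simp
      qed
      then show "norm (\<integral>x. (grad (u n) x $ i - g x $ i)\<^sup>2 \<partial>lborel) \<le> (\<integral>x. (norm (grad (u n) x - g x))\<^sup>2 \<partial>lborel)"
        by simp
    qed
    have "(\<lambda>n. \<integral>x. u n x * partial i \<phi> x \<partial>lborel) \<longlonglongrightarrow> (\<integral>x. v x * partial i \<phi> x \<partial>lborel)"
      using v(3) by (intro pair H1r_D(2)[OF H] v(2) test_function_L2 test_function_partial t) simp
    moreover have "(\<lambda>n. - (\<integral>x. grad (u n) x $ i * \<phi> x \<partial>lborel)) \<longlonglongrightarrow> - (\<integral>x. g x $ i * \<phi> x \<partial>lborel)"
      by (intro tendsto_minus pair gi L2_component H1_L2(2) H1r_D(1)[OF H] g(1) test_function_L2 t)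
    moreover have "(\<integral>x. u n x * partial i \<phi> x \<partial>lborel) = - (\<integral>x. grad (u n) x $ i * \<phi> x \<partial>lborel)" for n
      using grad_weak[OF H1r_D(1)[OF H[of n]]] t by (simp add: L2_weak_gradient_def)
    ultimately show "(\<integral>x. v x * partial i \<phi> x \<partial>lborel) = - (\<integral>x. g x $ i * \<phi> x \<partial>lborel)"
      using LIMSEQ_unique by simp
  qed
  have "radial v"
    unfolding radial_def
  proof (intro allI impI)
    fix x y :: "real ^ 2" assume "norm x = norm y"
    then have "u (r k) x = u (r k) y" for k using H1r_D(3)[OF H[of "r k"]] unfolding radial_def by blast
    then show "v x = v y" by (simp add: v(1))
  qed
  then have vH: "v \<in> H1r" using wg v(2) by (auto simp: H1r_def H1_def)
  have [measurable]: "g \<in> borel_measurable borel" "grad v \<in> borel_measurable borel" "grad (u n) \<in> borel_measurable borel" for n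
    using g(1) H1_L2(2)[OF H1r_D(1)[OF vH]] H1_L2(2)[OF H1r_D(1)[OF H[of n]]] by (auto simp: L2_def)
  have "Dir (\<lambda>x. u n x - v x) = (\<integral>x. (norm (grad (u n) x - g x))\<^sup>2 \<partial>lborel)" for n
    unfolding D[OF vH] by (rule integral_cong_AE) (use grad_AE[OF wg] in auto)
  then have "(\<lambda>n. Dir (\<lambda>x. u n x - v x) + Mass (\<lambda>x. u n x - v x)) \<longlonglongrightarrow> 0 + 0"
    using g(2) v(3) by (intro tendsto_add) (auto simp: Mass_def)
  then show thesis using that[OF vH] by (simp add: H1sq_def)
qed

section \<open>The energy as a polynomial in \<open>u\<close> and \<open>N\<close>\<close>

lemma product_density:
  assumes "u \<in> H1r" "v \<in> H1r"
  shows "density_class (\<lambda>x. u x * v x)"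
    and "(L2norm (\<lambda>x. u x * v x))\<^sup>2 \<le> sqrt (\<integral>x. (u x) ^ 4 \<partial>lborel) * sqrt (\<integral>x. (v x) ^ 4 \<partial>lborel)"
    and "L1norm (\<lambda>x. u x * v x) \<le> sqrt (H1sq u) * sqrt (H1sq v)"
proof -
  note [measurable] = H1r_D(4)[OF assms(1)] H1r_D(4)[OF assms(2)]
  have p4: "((f x)\<^sup>2)\<^sup>2 = (f x) ^ 4" for f :: "real ^ 2 \<Rightarrow> real" and x by simp
  have Lsq: "L2 (\<lambda>x. (w x)\<^sup>2)" if "w \<in> H1r" for w
    using H1r_D(4)[OF that] L4_embedding(1)[OF that] by (auto simp: L2_def)
  have L2n: "L2norm (\<lambda>x. (w x)\<^sup>2) = sqrt (\<integral>x. (w x) ^ 4 \<partial>lborel)" for w by (simp add: L2norm_def)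
  have iuv: "integrable lborel (\<lambda>x. (u x)\<^sup>2 * (v x)\<^sup>2)" by (rule L2_mult_integrable[OF Lsq[OF assms(1)] Lsq[OF assms(2)]])
  have i2: "integrable lborel (\<lambda>x. (u x * v x)\<^sup>2)" using iuv by (simp add: power_mult_distrib)
  have i1: "integrable lborel (\<lambda>x. u x * v x)" by (rule L2_mult_integrable[OF H1r_D(2)[OF assms(1)] H1r_D(2)[OF assms(2)]])
  show "density_class (\<lambda>x. u x * v x)"
    unfolding density_class_def L2_def using i1 i2 by simp
  have "(L2norm (\<lambda>x. u x * v x))\<^sup>2 = (\<integral>x. (u x)\<^sup>2 * (v x)\<^sup>2 \<partial>lborel)" by (simp add: L2norm_sq power_mult_distrib)
  also have "\<dots> \<le> L2norm (\<lambda>x. (u x)\<^sup>2) * L2norm (\<lambda>x. (v x)\<^sup>2)"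
    using L2_pairing_bound[OF Lsq[OF assms(1)] Lsq[OF assms(2)]] by linarith
  finally show "(L2norm (\<lambda>x. u x * v x))\<^sup>2 \<le> sqrt (\<integral>x. (u x) ^ 4 \<partial>lborel) * sqrt (\<integral>x. (v x) ^ 4 \<partial>lborel)"
    unfolding L2n .
  have absL: "L2 (\<lambda>x. \<bar>w x\<bar>)" "L2norm (\<lambda>x. \<bar>w x\<bar>) \<le> sqrt (H1sq w)" if "w \<in> H1r" for w
    using H1r_D(4,5)[OF that] Mass_le_H1sq[of w] by (auto simp: L2_def L2norm_def Mass_def)
  have "L1norm (\<lambda>x. u x * v x) = (\<integral>x. \<bar>u x\<bar> * \<bar>v x\<bar> \<partial>lborel)" by (simp add: L1norm_def abs_mult)
  also have "\<dots> \<le> L2norm (\<lambda>x. \<bar>u x\<bar>) * L2norm (\<lambda>x. \<bar>v x\<bar>)"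
    using L2_pairing_bound[OF absL(1)[OF assms(1)] absL(1)[OF assms(2)]] by linarith
  also have "\<dots> \<le> sqrt (H1sq u) * sqrt (H1sq v)"
    by (intro mult_mono absL(2) assms) (auto simp: H1sq_nonneg)
  finally show "L1norm (\<lambda>x. u x * v x) \<le> sqrt (H1sq u) * sqrt (H1sq v)" .
qed

text \<open>The summands bound the \<open>L\<^sup>1\<close> and the \<open>L\<^sup>2\<close> norm of a product of two \<open>H1r\<close> functions.\<close>

definition KP :: real where "KP = 1 + sqrt K4"

lemma KP_ge: "1 \<le> KP" "0 \<le> KP" "0 < KP" using K4_pos by (auto simp: KP_def add_pos_nonneg)

lemma product_dnorm:
  assumes "u \<in> H1r" "v \<in> H1r"
  shows "dnorm (\<lambda>x. u x * v x) \<le> KP * (sqrt (H1sq u) * sqrt (H1sq v))"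
proof -
  have q: "sqrt (\<integral>x. (w x) ^ 4 \<partial>lborel) \<le> sqrt K4 * H1sq w" if "w \<in> H1r" for w
  proof -
    have "sqrt (\<integral>x. (w x) ^ 4 \<partial>lborel) \<le> sqrt (K4 * (H1sq w)\<^sup>2)" by (intro real_sqrt_le_mono L4_embedding(2) that)
    then show ?thesis by (simp add: real_sqrt_mult H1sq_nonneg)
  qed
  have "(L2norm (\<lambda>x. u x * v x))\<^sup>2 \<le> sqrt (\<integral>x. (u x) ^ 4 \<partial>lborel) * sqrt (\<integral>x. (v x) ^ 4 \<partial>lborel)"
    by (rule product_density(2)[OF assms])
  also have "\<dots> \<le> (sqrt K4 * H1sq u) * (sqrt K4 * H1sq v)"
    using K4_pos H1sq_nonneg by (intro mult_mono q assms mult_nonneg_nonneg) auto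
  also have "\<dots> = (sqrt K4 * (sqrt (H1sq u) * sqrt (H1sq v)))\<^sup>2"
    using K4_pos H1sq_nonneg by (simp add: power_mult_distrib)
  finally have "L2norm (\<lambda>x. u x * v x) \<le> sqrt K4 * (sqrt (H1sq u) * sqrt (H1sq v))"
    by (rule power2_le_imp_le) (use K4_pos H1sq_nonneg in auto)
  then show ?thesis using product_density(3)[OF assms] unfolding dnorm_def KP_def by (simp add: algebra_simps)
qed

lemma square_density: "u \<in> H1r \<Longrightarrow> density_class (\<lambda>x. (u x)\<^sup>2)"
  using product_density(1)[of u u] by (simp add: power2_eq_square)

lemma square_dnorm: "u \<in> H1r \<Longrightarrow> dnorm (\<lambda>x. (u x)\<^sup>2) \<le> KP * H1sq u"
  using product_dnorm[of u u] H1sq_nonneg[of u] by (simp add: power2_eq_square)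

definition Cub :: "(real ^ 2 \<Rightarrow> real) \<Rightarrow> (real ^ 2 \<Rightarrow> real) \<Rightarrow> real" where
  "Cub u N = (\<integral>x. N x * (u x)\<^sup>2 \<partial>lborel)"

definition Quart :: "(real ^ 2 \<Rightarrow> real) \<Rightarrow> real" where
  "Quart u = (\<integral>x. (u x) ^ 4 \<partial>lborel)"

definition CSE :: "(real ^ 2 \<Rightarrow> real) \<Rightarrow> real" where
  "CSE u = CS_form (\<lambda>x. (u x)\<^sup>2) (\<lambda>x. (u x)\<^sup>2) (\<lambda>x. (u x)\<^sup>2)"

lemma CSE_eq:
  assumes "u \<in> H1r"
  shows "(\<integral>x. (u x)\<^sup>2 * (h u (norm x))\<^sup>2 / (norm x)\<^sup>2 \<partial>lborel) = CSE u"
  unfolding CSE_def CS_form_def CS_kernel_def h_eq_disc_flux[OF H1r_D(3,4)[OF assms]]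
  by (simp add: power2_eq_square)

lemma CSE_nonneg: "0 \<le> CSE u"
  unfolding CSE_def CS_form_def CS_kernel_def
  by (intro Bochner_Integration.integral_nonneg) (simp flip: power2_eq_square)

lemma CSE_bound:
  assumes "u \<in> H1r" shows "CSE u \<le> (KP * H1sq u) ^ 3"
proof -
  note d = square_density[OF assms]
  have "CSE u \<le> dnorm (\<lambda>x. (u x)\<^sup>2) * dnorm (\<lambda>x. (u x)\<^sup>2) * dnorm (\<lambda>x. (u x)\<^sup>2)"
    unfolding CSE_def using CS_form_bound[OF d d d] by linarith
  also have "\<dots> \<le> (KP * H1sq u) * (KP * H1sq u) * (KP * H1sq u)"
    using KP_ge H1sq_nonneg by (intro mult_mono square_dnorm assms mult_nonneg_nonneg) auto
  finally show ?thesis by (simp add: power3_eq_cube)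
qed

lemma Cub_bound:
  assumes "u \<in> H1r" "N \<in> H1r"
  shows "\<bar>Cub u N\<bar> \<le> sqrt (Mass N) * sqrt (Quart u)"
proof -
  have "L2norm N = sqrt (Mass N)" "L2norm (\<lambda>x. (u x)\<^sup>2) = sqrt (Quart u)"
    by (auto simp: L2norm_def Mass_def Quart_def)
  then show ?thesis
    using L2_pairing_bound[OF H1r_D(2)[OF assms(2)] density_D(1)[OF square_density[OF assms(1)]]] by (simp add: Cub_def)
qed

lemma Quart_nonneg: "0 \<le> Quart u" by (simp add: Quart_def)

lemma Quart_bound: "u \<in> H1r \<Longrightarrow> Quart u \<le> K4 * (H1sq u)\<^sup>2"
  unfolding Quart_def by (rule L4_embedding(2))

lemma scaling:
  assumes "u \<in> H1r"
  shows "Cub (\<lambda>x. s * u x) (\<lambda>x. t * N x) = s\<^sup>2 * t * Cub u N"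
    and "Quart (\<lambda>x. s * u x) = s ^ 4 * Quart u"
    and "CSE (\<lambda>x. s * u x) = s ^ 6 * CSE u"
proof -
  have "(\<lambda>x. t * N x * (s * u x)\<^sup>2) = (\<lambda>x. (s\<^sup>2 * t) * (N x * (u x)\<^sup>2))" by (auto simp: fun_eq_iff power_mult_distrib)
  then show "Cub (\<lambda>x. s * u x) (\<lambda>x. t * N x) = s\<^sup>2 * t * Cub u N" by (simp add: Cub_def)
  show "Quart (\<lambda>x. s * u x) = s ^ 4 * Quart u" by (simp add: Quart_def power_mult_distrib)
  have e: "(\<lambda>x. (s * u x)\<^sup>2) = (\<lambda>x. s\<^sup>2 * (u x)\<^sup>2 + 0 * (u x)\<^sup>2)" by (auto simp: power_mult_distrib)
  note d = square_density[OF assms]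
  have dl: "density_class (\<lambda>x. s\<^sup>2 * (u x)\<^sup>2 + 0 * (u x)\<^sup>2)" by (rule density_lincomb[OF d d])
  have "CSE (\<lambda>x. s * u x) = s\<^sup>2 * (s\<^sup>2 * (s\<^sup>2 * CSE u))"
    unfolding CSE_def e CS_form_lincomb1[OF d d dl dl] CS_form_lincomb2[OF d d d dl] CS_form_lincomb3[OF d d d d] by simp
  also have "\<dots> = s ^ 6 * CSE u" 
  proof -
    have "s ^ 6 = s\<^sup>2 * (s\<^sup>2 * s\<^sup>2)" by (simp flip: power_add)
    then show ?thesis by (simp add: mult.assoc)
  qed
  finally show "CSE (\<lambda>x. s * u x) = s ^ 6 * CSE u" .
qed

subsection \<open>Lipschitz dependence on \<open>u\<close> in \<open>L\<^sup>4\<close>\<close>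

text \<open>Write \<open>u\<^sup>2 - v\<^sup>2 = (u - v) (u + v)\<close> and apply Cauchy-Schwarz to the squares. All nonlinear terms
  depend on \<open>u\<close> through \<open>u\<^sup>2\<close>, so closeness in \<open>L\<^sup>4\<close> acts on them through this estimate.\<close>

lemma square_diff_L2norm:
  assumes "u \<in> H1r" "v \<in> H1r" "H1sq u \<le> R" "H1sq v \<le> R"
  shows "(L2norm (\<lambda>x. (u x)\<^sup>2 - (v x)\<^sup>2))\<^sup>2 \<le> sqrt (Quart (\<lambda>x. u x - v x)) * (sqrt K4 * (4 * R))"
proof -
  have "(\<lambda>x. (u x)\<^sup>2 - (v x)\<^sup>2) = (\<lambda>x. (u x - v x) * (u x + v x))"
    by (auto simp: fun_eq_iff power2_eq_square algebra_simps)
  then have "(L2norm (\<lambda>x. (u x)\<^sup>2 - (v x)\<^sup>2))\<^sup>2 \<le> sqrt (Quart (\<lambda>x. u x - v x)) * sqrt (Quart (\<lambda>x. u x + v x))"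
    unfolding Quart_def using product_density(2)[OF H1r_diff[OF assms(1,2)] H1r_add[OF assms(1,2)]] by simp
  also have "\<dots> \<le> sqrt (Quart (\<lambda>x. u x - v x)) * (sqrt K4 * (4 * R))"
  proof (rule mult_left_mono)
    have "H1sq (\<lambda>x. u x + v x) \<le> 4 * R" using H1sq_add_le[OF assms(1,2)] assms(3,4) by linarith
    then have "(H1sq (\<lambda>x. u x + v x))\<^sup>2 \<le> (4 * R)\<^sup>2" by (intro power_mono H1sq_nonneg)
    then have "Quart (\<lambda>x. u x + v x) \<le> K4 * (4 * R)\<^sup>2"
      using Quart_bound[OF H1r_add[OF assms(1,2)]] K4_pos mult_left_mono[of _ "(4 * R)\<^sup>2" K4] by (meson order_trans zero_le_one)
    then have "sqrt (Quart (\<lambda>x. u x + v x)) \<le> sqrt (K4 * (4 * R)\<^sup>2)" by (rule real_sqrt_le_mono)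
    also have "\<dots> = sqrt K4 * (4 * R)" using assms(3) H1sq_nonneg[of u] by (simp add: real_sqrt_mult)
    finally show "sqrt (Quart (\<lambda>x. u x + v x)) \<le> sqrt K4 * (4 * R)" .
  qed (simp add: Quart_nonneg)
  finally show ?thesis .
qed

lemma Cub_diff:
  assumes "u \<in> H1r" "v \<in> H1r" "N \<in> H1r"
  shows "\<bar>Cub u N - Cub v N\<bar> \<le> sqrt (H1sq N) * L2norm (\<lambda>x. (u x)\<^sup>2 - (v x)\<^sup>2)"
proof -
  note d = density_D(1)[OF square_density[OF assms(1)]] density_D(1)[OF square_density[OF assms(2)]]
  have L: "L2 (\<lambda>x. (u x)\<^sup>2 - (v x)\<^sup>2)" using L2_lincomb[OF d, of 1 "-1"] by simp
  have "Cub u N - Cub v N = (\<integral>x. N x * ((u x)\<^sup>2 - (v x)\<^sup>2) \<partial>lborel)"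
    unfolding Cub_def using L2_mult_integrable[OF H1r_D(2)[OF assms(3)] d(1)] L2_mult_integrable[OF H1r_D(2)[OF assms(3)] d(2)]
    by (simp add: right_diff_distrib)
  also have "\<bar>\<dots>\<bar> \<le> L2norm N * L2norm (\<lambda>x. (u x)\<^sup>2 - (v x)\<^sup>2)" by (rule L2_pairing_bound[OF H1r_D(2)[OF assms(3)] L])
  also have "\<dots> \<le> sqrt (H1sq N) * L2norm (\<lambda>x. (u x)\<^sup>2 - (v x)\<^sup>2)"
    using Mass_le_H1sq[of N] by (intro mult_right_mono) (auto simp: L2norm_def Mass_def)
  finally show ?thesis .
qed

lemma Quart_diff:
  assumes "u \<in> H1r" "v \<in> H1r" "H1sq u \<le> R" "H1sq v \<le> R"
  shows "\<bar>Quart u - Quart v\<bar> \<le> 2 * KP * R * L2norm (\<lambda>x. (u x)\<^sup>2 - (v x)\<^sup>2)"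
proof -
  let ?\<delta> = "\<lambda>x. (u x)\<^sup>2 - (v x)\<^sup>2"
  note d = density_D(1)[OF square_density[OF assms(1)]] density_D(1)[OF square_density[OF assms(2)]]
  have L: "L2 ?\<delta>" using L2_lincomb[OF d, of 1 "-1"] by simp
  have "Quart u - Quart v = (\<integral>x. (u x) ^ 4 - (v x) ^ 4 \<partial>lborel)"
    unfolding Quart_def using L4_embedding(1)[OF assms(1)] L4_embedding(1)[OF assms(2)] by simp
  also have "\<dots> = (\<integral>x. ?\<delta> x * (u x)\<^sup>2 + ?\<delta> x * (v x)\<^sup>2 \<partial>lborel)"
    by (intro Bochner_Integration.integral_cong) (auto simp: power4_eq_xxxx power2_eq_square algebra_simps)
  also have "\<dots> = (\<integral>x. ?\<delta> x * (u x)\<^sup>2 \<partial>lborel) + (\<integral>x. ?\<delta> x * (v x)\<^sup>2 \<partial>lborel)"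
    by (rule Bochner_Integration.integral_add[OF L2_mult_integrable[OF L d(1)] L2_mult_integrable[OF L d(2)]])
  finally have "\<bar>Quart u - Quart v\<bar> \<le> L2norm ?\<delta> * L2norm (\<lambda>x. (u x)\<^sup>2) + L2norm ?\<delta> * L2norm (\<lambda>x. (v x)\<^sup>2)"
    using L2_pairing_bound[OF L d(1)] L2_pairing_bound[OF L d(2)] by linarith
  also have "\<dots> \<le> L2norm ?\<delta> * (KP * R) + L2norm ?\<delta> * (KP * R)"
  proof (intro add_mono mult_left_mono)
    show "L2norm (\<lambda>x. (u x)\<^sup>2) \<le> KP * R"
      using L2norm_le_dnorm square_dnorm[OF assms(1)] mult_left_mono[OF assms(3) KP_ge(2)] by (meson order_trans)
    show "L2norm (\<lambda>x. (v x)\<^sup>2) \<le> KP * R"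
      using L2norm_le_dnorm square_dnorm[OF assms(2)] mult_left_mono[OF assms(4) KP_ge(2)] by (meson order_trans)
  qed auto
  finally show ?thesis by (simp add: algebra_simps)
qed

text \<open>The difference of the trilinear form telescopes over its three slots; \<open>CS_form_bound2\<close> serves the
  first slot and \<open>CS_form_bound1\<close> the other two.\<close>

lemma CSE_diff:
  assumes "u \<in> H1r" "v \<in> H1r" "H1sq u \<le> R" "H1sq v \<le> R"
  shows "\<bar>CSE u - CSE v\<bar> \<le> (L2norm decay + 2) * (KP * R)\<^sup>2 * L2norm (\<lambda>x. (u x)\<^sup>2 - (v x)\<^sup>2)"
proof -
  let ?a = "\<lambda>x. (u x)\<^sup>2" and ?b = "\<lambda>x. (v x)\<^sup>2" and ?\<delta> = "\<lambda>x. (u x)\<^sup>2 - (v x)\<^sup>2"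
  note d = square_density[OF assms(1)] square_density[OF assms(2)]
  have \<delta>: "density_class ?\<delta>" using density_lincomb[OF d, of 1 "-1"] by simp
  have bR: "dnorm ?a \<le> KP * R" "dnorm ?b \<le> KP * R"
    using square_dnorm[OF assms(1)] square_dnorm[OF assms(2)] mult_left_mono[OF assms(3) KP_ge(2)] mult_left_mono[OF assms(4) KP_ge(2)]
    by linarith+
  have R: "0 \<le> KP * R" using bR(1) dnorm_nonneg order_trans by blast
  have 1: "CS_form ?\<delta> ?a ?a = CS_form ?a ?a ?a - CS_form ?b ?a ?a"
    using CS_form_lincomb1[OF d d(1) d(1), of 1 "-1"] by simp
  have 2: "CS_form ?b ?\<delta> ?a = CS_form ?b ?a ?a - CS_form ?b ?b ?a"
    using CS_form_lincomb2[OF d(2) d d(1), of 1 "-1"] by simp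
  have 3: "CS_form ?b ?b ?\<delta> = CS_form ?b ?b ?a - CS_form ?b ?b ?b"
    using CS_form_lincomb3[OF d(2) d(2) d, of 1 "-1"] by simp
  have B1: "\<bar>CS_form ?\<delta> ?a ?a\<bar> \<le> L2norm decay * (L2norm ?\<delta> * (KP * R) * (KP * R))"
    by (rule order_trans[OF CS_form_bound2[OF \<delta> d(1) d(1)]]) (intro mult_left_mono mult_mono bR mult_nonneg_nonneg R; simp)
  have B2: "\<bar>CS_form ?b ?\<delta> ?a\<bar> \<le> (KP * R) * (L2norm ?\<delta> * (KP * R))"
    by (rule order_trans[OF CS_form_bound1[OF d(2) \<delta> d(1)]])
       (intro mult_mono order_trans[OF L1norm_le_dnorm bR(2)] order_trans[OF L2norm_le_dnorm bR(1)] order_refl mult_nonneg_nonneg R; simp)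
  have B3: "\<bar>CS_form ?b ?b ?\<delta>\<bar> \<le> (KP * R) * ((KP * R) * L2norm ?\<delta>)"
    by (rule order_trans[OF CS_form_bound1[OF d(2) d(2) \<delta>]])
       (intro mult_mono order_trans[OF L1norm_le_dnorm bR(2)] order_trans[OF L2norm_le_dnorm bR(2)] order_refl mult_nonneg_nonneg R; simp)
  have "\<bar>CSE u - CSE v\<bar> \<le> L2norm decay * (L2norm ?\<delta> * (KP * R) * (KP * R)) + (KP * R) * (L2norm ?\<delta> * (KP * R)) + (KP * R) * ((KP * R) * L2norm ?\<delta>)"
    unfolding CSE_def using 1 2 3 B1 B2 B3 by linarith
  then show ?thesis by (simp add: power2_eq_square algebra_simps)
qed

subsection \<open>Differentiability\<close>

text \<open>\<open>L\<close> is the directional derivative of \<open>X\<close> at \<open>(u, N)\<close>, with a quadratic remainder. Only its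
  homogeneity is recorded, because criticality is established along one line at a time.\<close>

definition quad_diff :: "((real ^ 2 \<Rightarrow> real) \<Rightarrow> (real ^ 2 \<Rightarrow> real) \<Rightarrow> real) \<Rightarrow> (real ^ 2 \<Rightarrow> real) \<Rightarrow> (real ^ 2 \<Rightarrow> real)
   \<Rightarrow> ((real ^ 2 \<Rightarrow> real) \<Rightarrow> (real ^ 2 \<Rightarrow> real) \<Rightarrow> real) \<Rightarrow> bool" where
  "quad_diff X u N L \<longleftrightarrow>
    (\<forall>c. \<forall>\<phi>\<in>H1r. \<forall>\<psi>\<in>H1r. L (\<lambda>x. c * \<phi> x) (\<lambda>x. c * \<psi> x) = c * L \<phi> \<psi>) \<and>
    (\<exists>K\<ge>0. \<forall>\<phi>\<in>H1r. \<forall>\<psi>\<in>H1r. H1sq \<phi> + H1sq \<psi> \<le> 1 \<longrightarrow>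
      \<bar>X (\<lambda>x. u x + \<phi> x) (\<lambda>x. N x + \<psi> x) - X u N - L \<phi> \<psi>\<bar> \<le> K * (H1sq \<phi> + H1sq \<psi>))"

lemma quad_diff_lincomb:
  assumes "quad_diff X u N L" "quad_diff Y u N M"
  shows "quad_diff (\<lambda>u N. a * X u N + b * Y u N) u N (\<lambda>\<phi> \<psi>. a * L \<phi> \<psi> + b * M \<phi> \<psi>)"
proof -
  obtain K where K: "K \<ge> 0" "\<And>\<phi> \<psi>. \<phi> \<in> H1r \<Longrightarrow> \<psi> \<in> H1r \<Longrightarrow> H1sq \<phi> + H1sq \<psi> \<le> 1 \<Longrightarrow>
      \<bar>X (\<lambda>x. u x + \<phi> x) (\<lambda>x. N x + \<psi> x) - X u N - L \<phi> \<psi>\<bar> \<le> K * (H1sq \<phi> + H1sq \<psi>)"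
    using assms(1) unfolding quad_diff_def by blast
  obtain K' where K': "K' \<ge> 0" "\<And>\<phi> \<psi>. \<phi> \<in> H1r \<Longrightarrow> \<psi> \<in> H1r \<Longrightarrow> H1sq \<phi> + H1sq \<psi> \<le> 1 \<Longrightarrow>
      \<bar>Y (\<lambda>x. u x + \<phi> x) (\<lambda>x. N x + \<psi> x) - Y u N - M \<phi> \<psi>\<bar> \<le> K' * (H1sq \<phi> + H1sq \<psi>)"
    using assms(2) unfolding quad_diff_def by blast
  have "\<bar>(a * X (\<lambda>x. u x + \<phi> x) (\<lambda>x. N x + \<psi> x) + b * Y (\<lambda>x. u x + \<phi> x) (\<lambda>x. N x + \<psi> x)) - (a * X u N + b * Y u N) - (a * L \<phi> \<psi> + b * M \<phi> \<psi>)\<bar>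
      \<le> (\<bar>a\<bar> * K + \<bar>b\<bar> * K') * (H1sq \<phi> + H1sq \<psi>)"
    if "\<phi> \<in> H1r" "\<psi> \<in> H1r" "H1sq \<phi> + H1sq \<psi> \<le> 1" for \<phi> \<psi>
  proof -
    define p where "p = X (\<lambda>x. u x + \<phi> x) (\<lambda>x. N x + \<psi> x) - X u N - L \<phi> \<psi>"
    define q where "q = Y (\<lambda>x. u x + \<phi> x) (\<lambda>x. N x + \<psi> x) - Y u N - M \<phi> \<psi>"
    have "\<bar>a * p + b * q\<bar> \<le> \<bar>a\<bar> * \<bar>p\<bar> + \<bar>b\<bar> * \<bar>q\<bar>"
      using abs_triangle_ineq[of "a * p" "b * q"] by (simp add: abs_mult)
    also have "\<dots> \<le> \<bar>a\<bar> * (K * (H1sq \<phi> + H1sq \<psi>)) + \<bar>b\<bar> * (K' * (H1sq \<phi> + H1sq \<psi>))"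
      using K(2)[OF that] K'(2)[OF that] unfolding p_def q_def by (intro add_mono mult_left_mono) auto
    finally show ?thesis unfolding p_def q_def by (simp add: algebra_simps)
  qed
  moreover have "0 \<le> \<bar>a\<bar> * K + \<bar>b\<bar> * K'" using K(1) K'(1) by simp
  moreover have "a * L (\<lambda>x. c * \<phi> x) (\<lambda>x. c * \<psi> x) + b * M (\<lambda>x. c * \<phi> x) (\<lambda>x. c * \<psi> x) = c * (a * L \<phi> \<psi> + b * M \<phi> \<psi>)"
    if "\<phi> \<in> H1r" "\<psi> \<in> H1r" for c \<phi> \<psi>
    using assms that unfolding quad_diff_def by (simp add: algebra_simps)
  ultimately show ?thesis unfolding quad_diff_def by blast
qed

lemma quad_diffI:
  assumes "\<And>c \<phi> \<psi>. \<phi> \<in> H1r \<Longrightarrow> \<psi> \<in> H1r \<Longrightarrow> L (\<lambda>x. c * \<phi> x) (\<lambda>x. c * \<psi> x) = c * L \<phi> \<psi>"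
    and "0 \<le> K" and "\<And>\<phi> \<psi>. \<phi> \<in> H1r \<Longrightarrow> \<psi> \<in> H1r \<Longrightarrow> H1sq \<phi> + H1sq \<psi> \<le> 1 \<Longrightarrow>
      \<bar>X (\<lambda>x. u x + \<phi> x) (\<lambda>x. N x + \<psi> x) - X u N - L \<phi> \<psi>\<bar> \<le> K * (H1sq \<phi> + H1sq \<psi>)"
  shows "quad_diff X u N L"
  using assms unfolding quad_diff_def by blast

lemma quad_diff_Dir:
  assumes "u \<in> H1r" "N \<in> H1r"
  shows "quad_diff (\<lambda>u N. Dir u) u N (\<lambda>\<phi> \<psi>. 2 * dir_form u \<phi>)"
    and "quad_diff (\<lambda>u N. Dir N) u N (\<lambda>\<phi> \<psi>. 2 * dir_form N \<psi>)"
proof -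
  have "0 \<le> Dir \<phi>" "Dir \<phi> \<le> H1sq \<phi>" "0 \<le> H1sq \<phi>" for \<phi> using Dir_nonneg Dir_le_H1sq H1sq_nonneg by auto
  note * = this
  show "quad_diff (\<lambda>u N. Dir u) u N (\<lambda>\<phi> \<psi>. 2 * dir_form u \<phi>)"
  proof (rule quad_diffI[where K = 1])
    fix \<phi> \<psi> assume "\<phi> \<in> H1r" "\<psi> \<in> H1r"
    then show "\<bar>Dir (\<lambda>x. u x + \<phi> x) - Dir u - 2 * dir_form u \<phi>\<bar> \<le> 1 * (H1sq \<phi> + H1sq \<psi>)"
      using *[of \<phi>] *[of \<psi>] by (simp add: Dir_add[OF assms(1)])
  qed (auto simp: dir_form_scale[OF assms(1)])
  show "quad_diff (\<lambda>u N. Dir N) u N (\<lambda>\<phi> \<psi>. 2 * dir_form N \<psi>)"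
  proof (rule quad_diffI[where K = 1])
    fix \<phi> \<psi> assume "\<phi> \<in> H1r" "\<psi> \<in> H1r"
    then show "\<bar>Dir (\<lambda>x. N x + \<psi> x) - Dir N - 2 * dir_form N \<psi>\<bar> \<le> 1 * (H1sq \<phi> + H1sq \<psi>)"
      using *[of \<phi>] *[of \<psi>] by (simp add: Dir_add[OF assms(2)])
  qed (auto simp: dir_form_scale[OF assms(2)])
qed

lemma quad_diff_Mass:
  assumes "u \<in> H1r" "N \<in> H1r"
  shows "quad_diff (\<lambda>u N. Mass u) u N (\<lambda>\<phi> \<psi>. 2 * mass_form u \<phi>)"
    and "quad_diff (\<lambda>u N. Mass N) u N (\<lambda>\<phi> \<psi>. 2 * mass_form N \<psi>)"
proof -
  have "0 \<le> Mass \<phi>" "Mass \<phi> \<le> H1sq \<phi>" "0 \<le> H1sq \<phi>" for \<phi> using Mass_nonneg Mass_le_H1sq H1sq_nonneg by auto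
  note * = this
  show "quad_diff (\<lambda>u N. Mass u) u N (\<lambda>\<phi> \<psi>. 2 * mass_form u \<phi>)"
  proof (rule quad_diffI[where K = 1])
    fix \<phi> \<psi> assume "\<phi> \<in> H1r" "\<psi> \<in> H1r"
    then show "\<bar>Mass (\<lambda>x. u x + \<phi> x) - Mass u - 2 * mass_form u \<phi>\<bar> \<le> 1 * (H1sq \<phi> + H1sq \<psi>)"
      using *[of \<phi>] *[of \<psi>] by (simp add: Mass_add[OF assms(1)])
  qed (auto simp: mass_form_scale)
  show "quad_diff (\<lambda>u N. Mass N) u N (\<lambda>\<phi> \<psi>. 2 * mass_form N \<psi>)"
  proof (rule quad_diffI[where K = 1])
    fix \<phi> \<psi> assume "\<phi> \<in> H1r" "\<psi> \<in> H1r"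
    then show "\<bar>Mass (\<lambda>x. N x + \<psi> x) - Mass N - 2 * mass_form N \<psi>\<bar> \<le> 1 * (H1sq \<phi> + H1sq \<psi>)"
      using *[of \<phi>] *[of \<psi>] by (simp add: Mass_add[OF assms(2)])
  qed (auto simp: mass_form_scale)
qed

lemma mass_form_sym: "mass_form a b = mass_form b a"
  by (simp add: mass_form_def mult.commute)

lemma mass_form_lincomb:
  assumes "L2 a" "L2 b" "L2 c"
  shows "mass_form a (\<lambda>x. s * b x + t * c x) = s * mass_form a b + t * mass_form a c"
proof -
  have "mass_form a (\<lambda>x. s * b x + t * c x) = (\<integral>x. s * (a x * b x) + t * (a x * c x) \<partial>lborel)"
    unfolding mass_form_def by (intro Bochner_Integration.integral_cong) (auto simp: algebra_simps)
  also have "\<dots> = s * mass_form a b + t * mass_form a c"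
    unfolding mass_form_def Bochner_Integration.integral_add[OF integrable_mult_right[OF L2_mult_integrable[OF assms(1,2)]]
      integrable_mult_right[OF L2_mult_integrable[OF assms(1,3)]]] integral_mult_right_zero ..
  finally show ?thesis .
qed

lemma mass_form_bound: "L2 a \<Longrightarrow> L2 b \<Longrightarrow> \<bar>mass_form a b\<bar> \<le> L2norm a * L2norm b"
  unfolding mass_form_def by (rule L2_pairing_bound)

lemma mass_form_add:
  assumes "L2 a" "L2 b" "L2 c"
  shows "mass_form a (\<lambda>x. b x + c x) = mass_form a b + mass_form a c"
    and "mass_form (\<lambda>x. b x + c x) a = mass_form b a + mass_form c a"
  using mass_form_lincomb[OF assms, of 1 1] by (auto simp: mass_form_sym[of _ a])

lemma L2_add: "L2 a \<Longrightarrow> L2 b \<Longrightarrow> L2 (\<lambda>x. a x + b x)" for a b :: "real ^ 2 \<Rightarrow> real"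
  using L2_lincomb[of a b 1 1] by simp

lemma density_add: "density_class a \<Longrightarrow> density_class b \<Longrightarrow> density_class (\<lambda>x. a x + b x)"
  using density_lincomb[of a b 1 1] by simp

lemma density_scale: "density_class a \<Longrightarrow> density_class (\<lambda>x. c * a x)"
  using density_lincomb[of a a c 0] by simp

lemma L2norm_le_sqrt_H1sq: "u \<in> H1r \<Longrightarrow> L2norm u \<le> sqrt (H1sq u)"
  using Mass_le_H1sq[of u] by (simp add: L2norm_def Mass_def)

text \<open>This is \<open>(u + \<phi>)\<^sup>2 - u\<^sup>2 = (2 u + \<phi>) \<phi>\<close>, which is of first order in \<open>\<phi>\<close>.\<close>

lemma density_increment:
  assumes "u \<in> H1r" "\<phi> \<in> H1r" "H1sq \<phi> \<le> 1"
  shows "density_class (\<lambda>x. 2 * (u x * \<phi> x) + (\<phi> x)\<^sup>2)"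
    and "dnorm (\<lambda>x. 2 * (u x * \<phi> x) + (\<phi> x)\<^sup>2) \<le> KP * sqrt (8 * H1sq u + 2) * sqrt (H1sq \<phi>)"
proof -
  show "density_class (\<lambda>x. 2 * (u x * \<phi> x) + (\<phi> x)\<^sup>2)"
    by (intro density_add density_scale product_density(1) square_density assms)
  have e: "(\<lambda>x. 2 * (u x * \<phi> x) + (\<phi> x)\<^sup>2) = (\<lambda>x. (2 * u x + \<phi> x) * \<phi> x)"
    by (auto simp: fun_eq_iff power2_eq_square algebra_simps)
  have H: "(\<lambda>x. 2 * u x + \<phi> x) \<in> H1r" by (intro H1r_add H1r_scale assms)
  have "H1sq (\<lambda>x. 2 * u x + \<phi> x) \<le> 8 * H1sq u + 2"
    using H1sq_add_le[OF H1r_scale[OF assms(1), of 2] assms(2)] H1sq_scale[OF assms(1), of 2] assms(3) by simp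
  then have "sqrt (H1sq (\<lambda>x. 2 * u x + \<phi> x)) \<le> sqrt (8 * H1sq u + 2)" by (rule real_sqrt_le_mono)
  then have "KP * (sqrt (H1sq (\<lambda>x. 2 * u x + \<phi> x)) * sqrt (H1sq \<phi>)) \<le> KP * (sqrt (8 * H1sq u + 2) * sqrt (H1sq \<phi>))"
    using KP_ge H1sq_nonneg by (intro mult_left_mono mult_right_mono) auto
  then show "dnorm (\<lambda>x. 2 * (u x * \<phi> x) + (\<phi> x)\<^sup>2) \<le> KP * sqrt (8 * H1sq u + 2) * sqrt (H1sq \<phi>)"
    using product_dnorm[OF H assms(2)] unfolding e by (simp add: mult.assoc)
qed

lemma square_add: "(\<lambda>x. (u x + \<phi> x)\<^sup>2) = (\<lambda>x. (u x)\<^sup>2 + (2 * (u x * \<phi> x) + (\<phi> x)\<^sup>2))" for u \<phi> :: "real ^ 2 \<Rightarrow> real"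
  by (auto simp: fun_eq_iff power2_eq_square algebra_simps)

text \<open>With \<open>\<rho> = u\<^sup>2\<close>, \<open>\<sigma> = u \<phi>\<close> and \<open>\<tau> = \<phi>\<^sup>2\<close> the perturbed density is \<open>\<rho> + 2 \<sigma> + \<tau>\<close>, and the bilinear pairing
  with \<open>N + \<psi>\<close> is expanded; the same splitting is used for the quartic and the Chern-Simons terms.\<close>

lemma quad_diff_Cub:
  assumes "u \<in> H1r" "N \<in> H1r"
  shows "quad_diff Cub u N (\<lambda>\<phi> \<psi>. mass_form \<psi> (\<lambda>x. (u x)\<^sup>2) + 2 * mass_form N (\<lambda>x. u x * \<phi> x))"
proof (rule quad_diffI)
  let ?\<rho> = "\<lambda>x. (u x)\<^sup>2"
  note L\<rho> = density_D(1)[OF square_density[OF assms(1)]]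
  note LN = H1r_D(2)[OF assms(2)]
  show "mass_form (\<lambda>x. c * \<psi> x) ?\<rho> + 2 * mass_form N (\<lambda>x. u x * (c * \<phi> x)) = c * (mass_form \<psi> ?\<rho> + 2 * mass_form N (\<lambda>x. u x * \<phi> x))" for c \<phi> \<psi>
  proof -
    have "(\<lambda>x. u x * (c * \<phi> x)) = (\<lambda>x. c * (u x * \<phi> x))" by (auto simp: mult.left_commute)
    then show ?thesis
      using mass_form_scale[of ?\<rho> c \<psi>] mass_form_scale[of N c "\<lambda>x. u x * \<phi> x"] by (simp add: mass_form_sym[of _ ?\<rho>] algebra_simps)
  qed
  show "0 \<le> KP * L2norm N + 2 * KP * sqrt (H1sq u) + KP" using KP_ge H1sq_nonneg by simp
  fix \<phi> \<psi> assume \<phi>: "\<phi> \<in> H1r" and \<psi>: "\<psi> \<in> H1r" and le: "H1sq \<phi> + H1sq \<psi> \<le> 1"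
  define E where "E = H1sq \<phi> + H1sq \<psi>"
  have E: "H1sq \<phi> \<le> E" "H1sq \<psi> \<le> E" "0 \<le> E" "E \<le> 1" using H1sq_nonneg[of \<phi>] H1sq_nonneg[of \<psi>] le by (auto simp: E_def)
  have sE: "sqrt (H1sq \<phi>) \<le> sqrt E" "sqrt (H1sq \<psi>) \<le> sqrt E" "sqrt E \<le> 1" using E by auto
  let ?\<sigma> = "\<lambda>x. u x * \<phi> x" and ?\<tau> = "\<lambda>x. (\<phi> x)\<^sup>2"
  note L\<sigma> = density_D(1)[OF product_density(1)[OF assms(1) \<phi>]]
  note L\<tau> = density_D(1)[OF square_density[OF \<phi>]]
  note L\<psi> = H1r_D(2)[OF \<psi>]
  have n\<tau>: "L2norm ?\<tau> \<le> KP * E"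
    using L2norm_le_dnorm[of ?\<tau>] square_dnorm[OF \<phi>] mult_left_mono[OF E(1) KP_ge(2)] by linarith
  have n\<sigma>: "L2norm ?\<sigma> \<le> KP * (sqrt (H1sq u) * sqrt E)"
  proof -
    have "KP * (sqrt (H1sq u) * sqrt (H1sq \<phi>)) \<le> KP * (sqrt (H1sq u) * sqrt E)"
      using KP_ge sE H1sq_nonneg by (intro mult_left_mono) auto
    then show ?thesis using L2norm_le_dnorm[of ?\<sigma>] product_dnorm[OF assms(1) \<phi>] by linarith
  qed
  have n\<psi>: "L2norm \<psi> \<le> sqrt E" using L2norm_le_sqrt_H1sq[OF \<psi>] sE by linarith
  have L2\<sigma>: "L2 (\<lambda>x. 2 * ?\<sigma> x)" using density_D(1)[OF density_scale[OF product_density(1)[OF assms(1) \<phi>]]] .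
  have L\<delta>: "L2 (\<lambda>x. 2 * ?\<sigma> x + ?\<tau> x)" by (rule L2_add[OF L2\<sigma> L\<tau>])
  have sc: "mass_form a (\<lambda>x. 2 * ?\<sigma> x) = 2 * mass_form a ?\<sigma>" for a by (rule mass_form_scale)
  have "Cub (\<lambda>x. u x + \<phi> x) (\<lambda>x. N x + \<psi> x) = mass_form (\<lambda>x. N x + \<psi> x) (\<lambda>x. ?\<rho> x + (2 * ?\<sigma> x + ?\<tau> x))"
    unfolding Cub_def mass_form_def square_add[of u \<phi>, THEN fun_cong] ..
  also have "\<dots> = mass_form N ?\<rho> + (2 * mass_form N ?\<sigma> + mass_form N ?\<tau>) + (mass_form \<psi> ?\<rho> + (2 * mass_form \<psi> ?\<sigma> + mass_form \<psi> ?\<tau>))"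
    unfolding mass_form_add(2)[OF L2_add[OF L\<rho> L\<delta>] LN L\<psi>] mass_form_add(1)[OF LN L\<rho> L\<delta>] mass_form_add(1)[OF L\<psi> L\<rho> L\<delta>]
      mass_form_add(1)[OF LN L2\<sigma> L\<tau>] mass_form_add(1)[OF L\<psi> L2\<sigma> L\<tau>] sc by simp
  finally have "Cub (\<lambda>x. u x + \<phi> x) (\<lambda>x. N x + \<psi> x) - Cub u N - (mass_form \<psi> ?\<rho> + 2 * mass_form N ?\<sigma>)
      = mass_form N ?\<tau> + 2 * mass_form \<psi> ?\<sigma> + mass_form \<psi> ?\<tau>"
    by (simp add: Cub_def mass_form_def)
  moreover have "\<bar>mass_form N ?\<tau>\<bar> \<le> L2norm N * (KP * E)"
    by (rule order_trans[OF mass_form_bound[OF LN L\<tau>]]) (intro mult_left_mono n\<tau>; simp)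
  moreover have "\<bar>mass_form \<psi> ?\<sigma>\<bar> \<le> sqrt E * (KP * (sqrt (H1sq u) * sqrt E))"
    by (rule order_trans[OF mass_form_bound[OF L\<psi> L\<sigma>]]) (intro mult_mono n\<sigma> n\<psi>; use E in simp)
  moreover have "sqrt E * (KP * (sqrt (H1sq u) * sqrt E)) = KP * sqrt (H1sq u) * E"
    using E by (simp add: mult_ac)
  moreover have "\<bar>mass_form \<psi> ?\<tau>\<bar> \<le> 1 * (KP * E)"
    by (rule order_trans[OF mass_form_bound[OF L\<psi> L\<tau>]]) (intro mult_mono n\<tau> order_trans[OF n\<psi> sE(3)]; simp)
  ultimately have "\<bar>Cub (\<lambda>x. u x + \<phi> x) (\<lambda>x. N x + \<psi> x) - Cub u N - (mass_form \<psi> ?\<rho> + 2 * mass_form N ?\<sigma>)\<bar>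
      \<le> L2norm N * (KP * E) + 2 * (KP * sqrt (H1sq u) * E) + 1 * (KP * E)"
    by linarith
  also have "\<dots> = (KP * L2norm N + 2 * KP * sqrt (H1sq u) + KP) * E" by (simp add: algebra_simps)
  finally show "\<bar>Cub (\<lambda>x. u x + \<phi> x) (\<lambda>x. N x + \<psi> x) - Cub u N - (mass_form \<psi> ?\<rho> + 2 * mass_form N ?\<sigma>)\<bar>
      \<le> (KP * L2norm N + 2 * KP * sqrt (H1sq u) + KP) * (H1sq \<phi> + H1sq \<psi>)" unfolding E_def .
qed

lemma Quart_eq_mass_form: "Quart u = mass_form (\<lambda>x. (u x)\<^sup>2) (\<lambda>x. (u x)\<^sup>2)"
  unfolding Quart_def mass_form_def by (intro Bochner_Integration.integral_cong) (auto simp flip: power_add)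

lemma quad_diff_Quart:
  assumes "u \<in> H1r" "N \<in> H1r"
  shows "quad_diff (\<lambda>u N. Quart u) u N (\<lambda>\<phi> \<psi>. 4 * mass_form (\<lambda>x. (u x)\<^sup>2) (\<lambda>x. u x * \<phi> x))"
proof (rule quad_diffI)
  let ?\<rho> = "\<lambda>x. (u x)\<^sup>2"
  let ?K = "2 * (KP * H1sq u * KP) + (KP * sqrt (8 * H1sq u + 2))\<^sup>2"
  note L\<rho> = density_D(1)[OF square_density[OF assms(1)]]
  show "4 * mass_form ?\<rho> (\<lambda>x. u x * (c * \<phi> x)) = c * (4 * mass_form ?\<rho> (\<lambda>x. u x * \<phi> x))" for c \<phi>
  proof -
    have "(\<lambda>x. u x * (c * \<phi> x)) = (\<lambda>x. c * (u x * \<phi> x))" by (auto simp: mult.left_commute)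
    then show ?thesis using mass_form_scale[of ?\<rho> c "\<lambda>x. u x * \<phi> x"] by simp
  qed
  show "0 \<le> ?K" using KP_ge H1sq_nonneg by simp
  fix \<phi> \<psi> assume \<phi>: "\<phi> \<in> H1r" and \<psi>: "\<psi> \<in> H1r" and le: "H1sq \<phi> + H1sq \<psi> \<le> 1"
  have E: "H1sq \<phi> \<le> 1" "0 \<le> H1sq \<phi>" using H1sq_nonneg[of \<phi>] H1sq_nonneg[of \<psi>] le by auto
  let ?\<sigma> = "\<lambda>x. u x * \<phi> x" and ?\<tau> = "\<lambda>x. (\<phi> x)\<^sup>2" and ?\<delta> = "\<lambda>x. 2 * (u x * \<phi> x) + (\<phi> x)\<^sup>2"
  note L\<tau> = density_D(1)[OF square_density[OF \<phi>]]
  note L\<delta> = density_D(1)[OF density_increment(1)[OF assms(1) \<phi> E(1)]]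
  have L2\<sigma>: "L2 (\<lambda>x. 2 * ?\<sigma> x)" using density_D(1)[OF density_scale[OF product_density(1)[OF assms(1) \<phi>]]] .
  have n\<delta>: "L2norm ?\<delta> \<le> KP * sqrt (8 * H1sq u + 2) * sqrt (H1sq \<phi>)"
    using L2norm_le_dnorm[of ?\<delta>] density_increment(2)[OF assms(1) \<phi> E(1)] by linarith
  have "Quart (\<lambda>x. u x + \<phi> x) = mass_form (\<lambda>x. ?\<rho> x + ?\<delta> x) (\<lambda>x. ?\<rho> x + ?\<delta> x)"
    unfolding Quart_eq_mass_form square_add ..
  also have "\<dots> = mass_form ?\<rho> ?\<rho> + 2 * mass_form ?\<rho> ?\<delta> + mass_form ?\<delta> ?\<delta>"
    unfolding mass_form_add(1)[OF L2_add[OF L\<rho> L\<delta>] L\<rho> L\<delta>] mass_form_add(2)[OF L\<rho> L\<rho> L\<delta>] mass_form_add(2)[OF L\<delta> L\<rho> L\<delta>]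
    by (simp add: mass_form_sym[of ?\<delta> ?\<rho>])
  also have "mass_form ?\<rho> ?\<delta> = 2 * mass_form ?\<rho> ?\<sigma> + mass_form ?\<rho> ?\<tau>"
    unfolding mass_form_add(1)[OF L\<rho> L2\<sigma> L\<tau>] mass_form_scale ..
  finally have e: "Quart (\<lambda>x. u x + \<phi> x) - Quart u - 4 * mass_form ?\<rho> ?\<sigma> = 2 * mass_form ?\<rho> ?\<tau> + mass_form ?\<delta> ?\<delta>"
    by (simp add: Quart_eq_mass_form)
  have 1: "\<bar>mass_form ?\<rho> ?\<tau>\<bar> \<le> (KP * H1sq u) * (KP * H1sq \<phi>)"
    by (rule order_trans[OF mass_form_bound[OF L\<rho> L\<tau>]])
       (intro mult_mono order_trans[OF L2norm_le_dnorm square_dnorm] assms \<phi>; use KP_ge H1sq_nonneg in simp)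
  have 2: "\<bar>mass_form ?\<delta> ?\<delta>\<bar> \<le> (KP * sqrt (8 * H1sq u + 2) * sqrt (H1sq \<phi>)) * (KP * sqrt (8 * H1sq u + 2) * sqrt (H1sq \<phi>))"
    by (rule order_trans[OF mass_form_bound[OF L\<delta> L\<delta>]]) (intro mult_mono n\<delta>; use KP_ge H1sq_nonneg in simp)
  have 3: "(KP * sqrt (8 * H1sq u + 2) * sqrt (H1sq \<phi>)) * (KP * sqrt (8 * H1sq u + 2) * sqrt (H1sq \<phi>)) = (KP * sqrt (8 * H1sq u + 2))\<^sup>2 * H1sq \<phi>"
  proof -
    have "(b * sqrt y) * (b * sqrt y) = b\<^sup>2 * (sqrt y * sqrt y)" for b y :: real
      by (simp add: power2_eq_square mult_ac)
    then show ?thesis using E(2) by simp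
  qed
  have "\<bar>Quart (\<lambda>x. u x + \<phi> x) - Quart u - 4 * mass_form ?\<rho> ?\<sigma>\<bar> \<le> 2 * ((KP * H1sq u) * (KP * H1sq \<phi>)) + (KP * sqrt (8 * H1sq u + 2))\<^sup>2 * H1sq \<phi>"
    unfolding e using 1 2 3 by linarith
  also have "\<dots> = ?K * H1sq \<phi>" by (simp only: distrib_right mult.assoc)
  also have "\<dots> \<le> ?K * (H1sq \<phi> + H1sq \<psi>)"
    using H1sq_nonneg[of \<psi>] \<open>0 \<le> ?K\<close> by (intro mult_left_mono) auto
  finally show "\<bar>Quart (\<lambda>x. u x + \<phi> x) - Quart u - 4 * mass_form ?\<rho> ?\<sigma>\<bar> \<le> ?K * (H1sq \<phi> + H1sq \<psi>)" .
qed

lemma quad_diff_CSE: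
  assumes "u \<in> H1r" "N \<in> H1r"
  shows "quad_diff (\<lambda>u N. CSE u) u N
    (\<lambda>\<phi> \<psi>. 2 * CS_form (\<lambda>x. u x * \<phi> x) (\<lambda>x. (u x)\<^sup>2) (\<lambda>x. (u x)\<^sup>2) + 4 * CS_form (\<lambda>x. (u x)\<^sup>2) (\<lambda>x. u x * \<phi> x) (\<lambda>x. (u x)\<^sup>2))"
proof (rule quad_diffI)
  let ?\<rho> = "\<lambda>x. (u x)\<^sup>2"
  define r where "r = KP * H1sq u"
  define k where "k = KP * sqrt (8 * H1sq u + 2)"
  let ?K = "3 * (KP * r * r) + 3 * (k * k * r) + k * k * k"
  have r0: "0 \<le> r" and k0: "0 \<le> k" using KP_ge H1sq_nonneg by (auto simp: r_def k_def)
  note d\<rho> = square_density[OF assms(1)]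
  have n\<rho>: "dnorm ?\<rho> \<le> r" unfolding r_def by (rule square_dnorm[OF assms(1)])
  show "2 * CS_form (\<lambda>x. u x * (c * \<phi> x)) ?\<rho> ?\<rho> + 4 * CS_form ?\<rho> (\<lambda>x. u x * (c * \<phi> x)) ?\<rho>
      = c * (2 * CS_form (\<lambda>x. u x * \<phi> x) ?\<rho> ?\<rho> + 4 * CS_form ?\<rho> (\<lambda>x. u x * \<phi> x) ?\<rho>)"
    if "\<phi> \<in> H1r" for c \<phi>
  proof -
    note d = product_density(1)[OF assms(1) that]
    have "(\<lambda>x. u x * (c * \<phi> x)) = (\<lambda>x. c * (u x * \<phi> x) + 0 * (u x * \<phi> x))" by (auto simp: mult.left_commute)
    then show ?thesis
      using CS_form_lincomb1[OF d d d\<rho> d\<rho>, of c 0] CS_form_lincomb2[OF d\<rho> d d d\<rho>, of c 0] by (simp add: algebra_simps)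
  qed
  show "0 \<le> ?K" using KP_ge r0 k0 by simp
  fix \<phi> \<psi> assume \<phi>: "\<phi> \<in> H1r" and \<psi>: "\<psi> \<in> H1r" and le: "H1sq \<phi> + H1sq \<psi> \<le> 1"
  have E: "H1sq \<phi> \<le> 1" "0 \<le> H1sq \<phi>" using H1sq_nonneg[of \<phi>] H1sq_nonneg[of \<psi>] le by auto
  define E where "E = H1sq \<phi>"
  define s where "s = sqrt E"
  have s: "0 \<le> s" "s \<le> 1" "s * s = E" "0 \<le> E" using E by (auto simp: s_def E_def)
  let ?\<sigma> = "\<lambda>x. u x * \<phi> x" and ?\<tau> = "\<lambda>x. (\<phi> x)\<^sup>2" and ?\<delta> = "\<lambda>x. 2 * (u x * \<phi> x) + (\<phi> x)\<^sup>2"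
  note d\<sigma> = product_density(1)[OF assms(1) \<phi>]
  note d\<tau> = square_density[OF \<phi>]
  note d\<delta> = density_increment(1)[OF assms(1) \<phi> E(1)]
  have n\<tau>: "dnorm ?\<tau> \<le> KP * E" unfolding E_def by (rule square_dnorm[OF \<phi>])
  have n\<delta>: "dnorm ?\<delta> \<le> k * s" unfolding k_def s_def E_def by (rule density_increment(2)[OF assms(1) \<phi> E(1)])
  have T: "\<bar>CS_form a b c\<bar> \<le> A * B * C"
    if "density_class a" "density_class b" "density_class c" "dnorm a \<le> A" "dnorm b \<le> B" "dnorm c \<le> C" for a b c A B C
  proof -
    have "0 \<le> A" "0 \<le> B" "0 \<le> C" using that dnorm_nonneg order_trans by blast+
    then show ?thesis using that
      by (intro order_trans[OF CS_form_bound[OF that(1-3)]] mult_mono) auto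
  qed
  have ad: "CS_form (\<lambda>x. a x + a' x) b c = CS_form a b c + CS_form a' b c"
    "CS_form b (\<lambda>x. a x + a' x) c = CS_form b a c + CS_form b a' c"
    "CS_form b c (\<lambda>x. a x + a' x) = CS_form b c a + CS_form b c a'"
    if "density_class a" "density_class a'" "density_class b" "density_class c" for a a' b c
    using CS_form_lincomb1[OF that, of 1 1] CS_form_lincomb2[OF that(3,1,2,4), of 1 1] CS_form_lincomb3[OF that(3,4,1,2), of 1 1] by auto
  note dsum = density_add[OF d\<rho> d\<delta>]
  have "CSE (\<lambda>x. u x + \<phi> x) = CS_form (\<lambda>x. ?\<rho> x + ?\<delta> x) (\<lambda>x. ?\<rho> x + ?\<delta> x) (\<lambda>x. ?\<rho> x + ?\<delta> x)"
    unfolding CSE_def square_add ..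
  also have "\<dots> = CS_form ?\<rho> ?\<rho> ?\<rho> + CS_form ?\<delta> ?\<rho> ?\<rho> + 2 * CS_form ?\<rho> ?\<delta> ?\<rho>
      + (2 * CS_form ?\<delta> ?\<delta> ?\<rho> + CS_form ?\<rho> ?\<delta> ?\<delta> + CS_form ?\<delta> ?\<delta> ?\<delta>)"
    unfolding ad(1)[OF d\<rho> d\<delta> dsum dsum] ad(2)[OF d\<rho> d\<delta> d\<rho> dsum] ad(2)[OF d\<rho> d\<delta> d\<delta> dsum]
      ad(3)[OF d\<rho> d\<delta> d\<rho> d\<rho>] ad(3)[OF d\<rho> d\<delta> d\<rho> d\<delta>] ad(3)[OF d\<rho> d\<delta> d\<delta> d\<rho>] ad(3)[OF d\<rho> d\<delta> d\<delta> d\<delta>]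
    by (simp add: CS_form_sym[of ?\<rho> ?\<rho> ?\<delta>] CS_form_sym[of ?\<delta> ?\<rho> ?\<delta>])
  also have "CS_form ?\<delta> ?\<rho> ?\<rho> = 2 * CS_form ?\<sigma> ?\<rho> ?\<rho> + CS_form ?\<tau> ?\<rho> ?\<rho>"
    using CS_form_lincomb1[OF d\<sigma> d\<tau> d\<rho> d\<rho>, of 2 1] by simp
  also have "CS_form ?\<rho> ?\<delta> ?\<rho> = 2 * CS_form ?\<rho> ?\<sigma> ?\<rho> + CS_form ?\<rho> ?\<tau> ?\<rho>"
    using CS_form_lincomb2[OF d\<rho> d\<sigma> d\<tau> d\<rho>, of 2 1] by simp
  finally have e: "CSE (\<lambda>x. u x + \<phi> x) - CSE u - (2 * CS_form ?\<sigma> ?\<rho> ?\<rho> + 4 * CS_form ?\<rho> ?\<sigma> ?\<rho>)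
      = CS_form ?\<tau> ?\<rho> ?\<rho> + 2 * CS_form ?\<rho> ?\<tau> ?\<rho> + 2 * CS_form ?\<delta> ?\<delta> ?\<rho> + CS_form ?\<rho> ?\<delta> ?\<delta> + CS_form ?\<delta> ?\<delta> ?\<delta>"
    by (simp add: CSE_def)
  have "\<bar>CS_form ?\<tau> ?\<rho> ?\<rho>\<bar> \<le> KP * E * r * r" by (rule T[OF d\<tau> d\<rho> d\<rho> n\<tau> n\<rho> n\<rho>])
  moreover have "\<bar>CS_form ?\<rho> ?\<tau> ?\<rho>\<bar> \<le> r * (KP * E) * r" by (rule T[OF d\<rho> d\<tau> d\<rho> n\<rho> n\<tau> n\<rho>])
  moreover have "\<bar>CS_form ?\<delta> ?\<delta> ?\<rho>\<bar> \<le> (k * s) * (k * s) * r" by (rule T[OF d\<delta> d\<delta> d\<rho> n\<delta> n\<delta> n\<rho>])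
  moreover have "\<bar>CS_form ?\<rho> ?\<delta> ?\<delta>\<bar> \<le> r * (k * s) * (k * s)" by (rule T[OF d\<rho> d\<delta> d\<delta> n\<rho> n\<delta> n\<delta>])
  moreover have "\<bar>CS_form ?\<delta> ?\<delta> ?\<delta>\<bar> \<le> (k * s) * (k * s) * k"
  proof -
    have "k * s \<le> k" using k0 s by (simp add: mult_left_le)
    then show ?thesis by (intro T[OF d\<delta> d\<delta> d\<delta> n\<delta> n\<delta>] order_trans[OF n\<delta>])
  qed
  moreover have "KP * E * r * r = KP * r * r * E" "r * (KP * E) * r = KP * r * r * E"
    "(k * s) * (k * s) * r = k * k * r * E" "r * (k * s) * (k * s) = k * k * r * E" "(k * s) * (k * s) * k = k * k * k * E"
    unfolding s(3)[symmetric] by simp_all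
  ultimately have "\<bar>CSE (\<lambda>x. u x + \<phi> x) - CSE u - (2 * CS_form ?\<sigma> ?\<rho> ?\<rho> + 4 * CS_form ?\<rho> ?\<sigma> ?\<rho>)\<bar>
     \<le> 3 * (KP * r * r * E) + 3 * (k * k * r * E) + k * k * k * E"
    unfolding e by linarith
  also have "\<dots> = ?K * E" by (simp add: algebra_simps)
  also have "\<dots> \<le> ?K * (H1sq \<phi> + H1sq \<psi>)"
    unfolding E_def using H1sq_nonneg[of \<psi>] \<open>0 \<le> ?K\<close> by (intro mult_left_mono) auto
  finally show "\<bar>CSE (\<lambda>x. u x + \<phi> x) - CSE u - (2 * CS_form ?\<sigma> ?\<rho> ?\<rho> + 4 * CS_form ?\<rho> ?\<sigma> ?\<rho>)\<bar> \<le> ?K * (H1sq \<phi> + H1sq \<psi>)" .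
qed

subsection \<open>Continuity along strongly convergent sequences\<close>

lemma dir_form_bound:
  assumes "u \<in> H1r" "v \<in> H1r"
  shows "\<bar>dir_form u v\<bar> \<le> sqrt (Dir u) * sqrt (Dir v)"
proof -
  note L = H1_L2(2)[OF H1r_D(1)[OF assms(1)]] H1_L2(2)[OF H1r_D(1)[OF assms(2)]]
  have n: "L2 (\<lambda>x. norm (g x))" if "L2 g" for g :: "real ^ 2 \<Rightarrow> real ^ 2"
    using that unfolding L2_def by (auto intro: borel_measurable_norm)
  have "\<bar>dir_form u v\<bar> \<le> (\<integral>x. \<bar>grad u x \<bullet> grad v x\<bar> \<partial>lborel)"
    unfolding dir_form_def by (rule integral_abs_bound)
  also have "\<dots> \<le> (\<integral>x. norm (grad u x) * norm (grad v x) \<partial>lborel)"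
    by (intro integral_mono integrable_abs L2_inner_integrable L L2_mult_integrable n Cauchy_Schwarz_ineq2)
  also have "\<dots> \<le> L2norm (\<lambda>x. norm (grad u x)) * L2norm (\<lambda>x. norm (grad v x))"
    using L2_pairing_bound[OF n[OF L(1)] n[OF L(2)]] by linarith
  finally show ?thesis by (simp add: L2norm_def Dir_def)
qed

lemma Dir_continuous:
  assumes "\<And>n. u n \<in> H1r" "v \<in> H1r" "(\<lambda>n. H1sq (\<lambda>x. u n x - v x)) \<longlonglongrightarrow> 0"
  shows "(\<lambda>n. Dir (u n)) \<longlonglongrightarrow> Dir v"
proof -
  define d where "d n = H1sq (\<lambda>x. u n x - v x)" for n
  have D: "Dir (u n) = Dir v + 2 * dir_form v (\<lambda>x. u n x - v x) + Dir (\<lambda>x. u n x - v x)" for n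
    using Dir_add[OF assms(2) H1r_diff[OF assms(1)[of n] assms(2)]] by simp
  have t1: "(\<lambda>n. 2 * (sqrt (Dir v) * sqrt (d n)) + d n) \<longlonglongrightarrow> 2 * (sqrt (Dir v) * sqrt 0) + 0"
    using assms(3) unfolding d_def[symmetric] by (intro tendsto_intros)
  have t2: "norm (Dir (u n) - Dir v) \<le> 2 * (sqrt (Dir v) * sqrt (d n)) + d n" for n
  proof -
    have "\<bar>dir_form v (\<lambda>x. u n x - v x)\<bar> \<le> sqrt (Dir v) * sqrt (Dir (\<lambda>x. u n x - v x))"
      by (intro dir_form_bound H1r_diff assms)
    also have "\<dots> \<le> sqrt (Dir v) * sqrt (d n)"
      unfolding d_def by (intro mult_left_mono real_sqrt_le_mono Dir_le_H1sq) (simp add: Dir_nonneg)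
    finally show ?thesis
      using D[of n] Dir_le_H1sq[of "\<lambda>x. u n x - v x"] Dir_nonneg[of "\<lambda>x. u n x - v x"] unfolding d_def real_norm_def by linarith
  qed
  have "(\<lambda>n. Dir (u n) - Dir v) \<longlonglongrightarrow> 0"
    using t1 by (intro Lim_null_comparison[OF always_eventually[OF allI[OF t2]]]) simp
  then show ?thesis by (rule LIM_zero_cancel)
qed

lemma Mass_continuous:
  assumes "\<And>n. u n \<in> H1r" "v \<in> H1r" "(\<lambda>n. H1sq (\<lambda>x. u n x - v x)) \<longlonglongrightarrow> 0"
  shows "(\<lambda>n. Mass (u n)) \<longlonglongrightarrow> Mass v"
proof -
  define d where "d n = H1sq (\<lambda>x. u n x - v x)" for n
  have D: "Mass (u n) = Mass v + 2 * mass_form v (\<lambda>x. u n x - v x) + Mass (\<lambda>x. u n x - v x)" for n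
    using Mass_add[OF assms(2) H1r_diff[OF assms(1)[of n] assms(2)]] by simp
  have t1: "(\<lambda>n. 2 * (L2norm v * sqrt (d n)) + d n) \<longlonglongrightarrow> 2 * (L2norm v * sqrt 0) + 0"
    using assms(3) unfolding d_def[symmetric] by (intro tendsto_intros)
  have t2: "norm (Mass (u n) - Mass v) \<le> 2 * (L2norm v * sqrt (d n)) + d n" for n
  proof -
    have H: "(\<lambda>x. u n x - v x) \<in> H1r" by (intro H1r_diff assms)
    have "\<bar>mass_form v (\<lambda>x. u n x - v x)\<bar> \<le> L2norm v * L2norm (\<lambda>x. u n x - v x)"
      by (intro mass_form_bound H1r_D(2) H assms)
    also have "\<dots> \<le> L2norm v * sqrt (d n)"
      unfolding d_def by (intro mult_left_mono L2norm_le_sqrt_H1sq H) simp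
    finally show ?thesis
      using D[of n] Mass_le_H1sq[of "\<lambda>x. u n x - v x"] Mass_nonneg[of "\<lambda>x. u n x - v x"] unfolding d_def real_norm_def by linarith
  qed
  have "(\<lambda>n. Mass (u n) - Mass v) \<longlonglongrightarrow> 0"
    using t1 by (intro Lim_null_comparison[OF always_eventually[OF allI[OF t2]]]) simp
  then show ?thesis by (rule LIM_zero_cancel)
qed

lemma square_L2norm_continuous:
  assumes "\<And>n. u n \<in> H1r" "v \<in> H1r" "(\<lambda>n. H1sq (\<lambda>x. u n x - v x)) \<longlonglongrightarrow> 0"
    and R: "\<And>n. H1sq (u n) \<le> R" "H1sq v \<le> R"
  shows "(\<lambda>n. L2norm (\<lambda>x. (u n x)\<^sup>2 - (v x)\<^sup>2)) \<longlonglongrightarrow> 0"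
proof -
  define d where "d n = H1sq (\<lambda>x. u n x - v x)" for n
  have R0: "0 \<le> R" using R(2) H1sq_nonneg[of v] by linarith
  have d0: "0 \<le> d n" for n by (simp add: d_def H1sq_nonneg)
  define B where "B n = sqrt (sqrt (K4 * (d n)\<^sup>2) * (sqrt K4 * (4 * R)))" for n
  have t1: "B \<longlonglongrightarrow> sqrt (sqrt (K4 * 0\<^sup>2) * (sqrt K4 * (4 * R)))"
    unfolding B_def[abs_def] using assms(3) unfolding d_def[symmetric] by (intro tendsto_intros)
  have t2: "norm (L2norm (\<lambda>x. (u n x)\<^sup>2 - (v x)\<^sup>2)) \<le> B n" for n
  proof -
    have "(L2norm (\<lambda>x. (u n x)\<^sup>2 - (v x)\<^sup>2))\<^sup>2 \<le> sqrt (Quart (\<lambda>x. u n x - v x)) * (sqrt K4 * (4 * R))"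
      by (rule square_diff_L2norm[OF assms(1,2) R])
    also have "\<dots> \<le> sqrt (K4 * (d n)\<^sup>2) * (sqrt K4 * (4 * R))"
      unfolding d_def using R0 K4_pos by (intro mult_right_mono real_sqrt_le_mono Quart_bound H1r_diff assms) auto
    finally have "sqrt ((L2norm (\<lambda>x. (u n x)\<^sup>2 - (v x)\<^sup>2))\<^sup>2) \<le> B n" unfolding B_def by (rule real_sqrt_le_mono)
    then show ?thesis by simp
  qed
  show ?thesis using t1 by (intro Lim_null_comparison[OF always_eventually[OF allI[OF t2]]]) simp
qed

lemma nonlinear_continuous:
  assumes "\<And>n. u n \<in> H1r" "v \<in> H1r" "(\<lambda>n. H1sq (\<lambda>x. u n x - v x)) \<longlonglongrightarrow> 0"
    and R0: "\<And>n. H1sq (u n) \<le> R"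
  shows "(\<lambda>n. Quart (u n)) \<longlonglongrightarrow> Quart v" and "(\<lambda>n. CSE (u n)) \<longlonglongrightarrow> CSE v"
    and "\<And>N M. (\<And>n. N n \<in> H1r) \<Longrightarrow> M \<in> H1r \<Longrightarrow> (\<lambda>n. H1sq (\<lambda>x. N n x - M x)) \<longlonglongrightarrow> 0 \<Longrightarrow>
      (\<And>n. H1sq (N n) \<le> R') \<Longrightarrow> (\<lambda>n. Cub (u n) (N n)) \<longlonglongrightarrow> Cub v M"
proof -
  define S where "S = R + H1sq v"
  have S: "H1sq (u n) \<le> S" "H1sq v \<le> S" for n
    using R0[of n] R0[of 0] H1sq_nonneg[of v] H1sq_nonneg[of "u 0"] by (auto simp: S_def)
  define l where "l n = L2norm (\<lambda>x. (u n x)\<^sup>2 - (v x)\<^sup>2)" for n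
  have l: "l \<longlonglongrightarrow> 0" unfolding l_def[abs_def] by (rule square_L2norm_continuous[OF assms(1-3) S])
  have z: "(\<lambda>n. c * l n) \<longlonglongrightarrow> 0" for c using tendsto_mult_left[OF l, of c] by simp
  have "(\<lambda>n. Quart (u n) - Quart v) \<longlonglongrightarrow> 0"
    by (rule Lim_null_comparison[OF always_eventually z[of "2 * KP * S"]])
       (use Quart_diff[OF assms(1,2) S] in \<open>simp add: l_def\<close>)
  then show "(\<lambda>n. Quart (u n)) \<longlonglongrightarrow> Quart v" by (rule LIM_zero_cancel)
  have "(\<lambda>n. CSE (u n) - CSE v) \<longlonglongrightarrow> 0"
    by (rule Lim_null_comparison[OF always_eventually z[of "(L2norm decay + 2) * (KP * S)\<^sup>2"]])
       (use CSE_diff[OF assms(1,2) S] in \<open>simp add: l_def\<close>)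
  then show "(\<lambda>n. CSE (u n)) \<longlonglongrightarrow> CSE v" by (rule LIM_zero_cancel)
  show "(\<lambda>n. Cub (u n) (N n)) \<longlonglongrightarrow> Cub v M"
    if N: "\<And>n. N n \<in> H1r" "M \<in> H1r" and lim: "(\<lambda>n. H1sq (\<lambda>x. N n x - M x)) \<longlonglongrightarrow> 0" and R': "\<And>n. H1sq (N n) \<le> R'" for N M
  proof -
    let ?\<rho> = "\<lambda>x. (v x)\<^sup>2"
    have L\<rho>: "L2 ?\<rho>" by (rule density_D(1)[OF square_density[OF assms(2)]])
    let ?g = "\<lambda>n. sqrt R' * l n + sqrt (H1sq (\<lambda>x. N n x - M x)) * L2norm ?\<rho>"
    have t1: "?g \<longlonglongrightarrow> sqrt R' * 0 + sqrt 0 * L2norm ?\<rho>" by (intro tendsto_intros l lim)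
    have t2: "norm (Cub (u n) (N n) - Cub v M) \<le> ?g n" for n
    proof -
      have H: "(\<lambda>x. N n x - M x) \<in> H1r" by (intro H1r_diff N)
      have "\<bar>Cub (u n) (N n) - Cub v (N n)\<bar> \<le> sqrt (H1sq (N n)) * l n"
        unfolding l_def by (rule Cub_diff[OF assms(1,2) N(1)])
      also have "\<dots> \<le> sqrt R' * l n" using R'[of n] by (intro mult_right_mono real_sqrt_le_mono) (auto simp: l_def)
      finally have 1: "\<bar>Cub (u n) (N n) - Cub v (N n)\<bar> \<le> sqrt R' * l n" .
      have "Cub v (N n) - Cub v M = mass_form ?\<rho> (\<lambda>x. N n x - M x)"
        using mass_form_lincomb[OF L\<rho> H1r_D(2)[OF N(1)[of n]] H1r_D(2)[OF N(2)], of 1 "-1"]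
        by (simp add: Cub_def mass_form_def mult.commute)
      then have "\<bar>Cub v (N n) - Cub v M\<bar> \<le> L2norm ?\<rho> * L2norm (\<lambda>x. N n x - M x)"
        using mass_form_bound[OF L\<rho> H1r_D(2)[OF H]] by simp
      also have "\<dots> \<le> L2norm ?\<rho> * sqrt (H1sq (\<lambda>x. N n x - M x))" by (intro mult_left_mono L2norm_le_sqrt_H1sq H) simp
      finally show ?thesis using 1 unfolding real_norm_def by (simp add: mult.commute)
    qed
    have "(\<lambda>n. Cub (u n) (N n) - Cub v M) \<longlonglongrightarrow> 0"
      using t1 by (intro Lim_null_comparison[OF always_eventually[OF allI[OF t2]]]) simp
    then show ?thesis by (rule LIM_zero_cancel)
  qed
qed

section \<open>The min-max level on rays\<close>

lemma midpoint_identity: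
  fixes c d :: real
  shows "c * ((1 / 2)\<^sup>2 * A + 2 * (1 / 2) * (1 / 2) * F + (1 / 2)\<^sup>2 * B) + d * ((1 / 2)\<^sup>2 * A' + 2 * (1 / 2) * (1 / 2) * F' + (1 / 2)\<^sup>2 * B')
    = ((c * A + d * A') + (c * B + d * B')) / 2 - (c * (A - 2 * F + B) + d * (A' - 2 * F' + B')) / 4"
  by (simp add: power2_eq_square field_simps)

text \<open>Parameters common to the whole variational argument. The coupling constant \<open>e\<close> is kept outside, because
  the constants \<open>c0\<close>, \<open>KB\<close> and \<open>KN\<close> have to be fixed before it is chosen.\<close>

locale coupling_constants =
  fixes m \<omega> \<kappa> q :: real
  assumes m: "0 < m" and \<omega>: "0 < \<omega>" and \<kappa>: "0 < \<kappa>" and q: "0 < q"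
begin

definition "a = 1 + \<kappa> * q / (2 * m)"

definition Qf :: "(real ^ 2 \<Rightarrow> real) \<Rightarrow> real" where
  "Qf u = 1 / (4 * m) * Dir u + \<omega> / 2 * Mass u"

definition Pf :: "(real ^ 2 \<Rightarrow> real) \<Rightarrow> real" where
  "Pf N = 1 / (4 * q) * Dir N + \<kappa>\<^sup>2 * q / 4 * Mass N"

definition Cf :: "(real ^ 2 \<Rightarrow> real) \<Rightarrow> (real ^ 2 \<Rightarrow> real) \<Rightarrow> real" where
  "Cf u N = - (a / 2 * Cub u N + q / (16 * m\<^sup>2) * Quart u + Pf N)"

text \<open>The functional along \<open>(\<surd>t u, t N)\<close>. With these exponents the interaction \<open>N u\<^sup>2\<close>, the quartic term
  and \<open>Pf N\<close> all scale like \<open>t\<^sup>2\<close>, which is why they are collected in one functional \<open>Cf\<close>.\<close>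

definition ray :: "real \<Rightarrow> (real ^ 2 \<Rightarrow> real) \<Rightarrow> (real ^ 2 \<Rightarrow> real) \<Rightarrow> real \<Rightarrow> real" where
  "ray \<epsilon> u N t = t * Qf u - t\<^sup>2 * Cf u N + \<epsilon> * t ^ 3 * CSE u"

lemma a_pos: "0 < a" unfolding a_def using m \<kappa> q by (simp add: add_pos_nonneg)

definition "cQ = min (1 / (4 * m)) (\<omega> / 2)"
definition "cP = min (1 / (4 * q)) (\<kappa>\<^sup>2 * q / 4)"

lemma cQ_pos: "0 < cQ" using m \<omega> by (simp add: cQ_def)
lemma cP_pos: "0 < cP" using q \<kappa> by (simp add: cP_def)

lemma Qf_ge: "cQ * H1sq u \<le> Qf u"
  unfolding H1sq_def Qf_def distrib_left cQ_def by (intro add_mono mult_right_mono Dir_nonneg Mass_nonneg) auto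

lemma Pf_ge: "cP * H1sq u \<le> Pf u"
  unfolding H1sq_def Pf_def distrib_left cP_def by (intro add_mono mult_right_mono Dir_nonneg Mass_nonneg) auto

lemma Qf_nonneg: "0 \<le> Qf u" and Pf_nonneg: "0 \<le> Pf u"
  using Qf_ge[of u] Pf_ge[of u] cQ_pos cP_pos H1sq_nonneg[of u] by (meson mult_nonneg_nonneg less_imp_le order_trans)+

lemma H1sq_le_Qf: "H1sq u \<le> Qf u / cQ" and H1sq_le_Pf: "H1sq u \<le> Pf u / cP"
  using Qf_ge[of u] Pf_ge[of u] cQ_pos cP_pos by (simp_all add: pos_le_divide_eq mult.commute)

lemma Qf_midpoint:
  assumes "u \<in> H1r" "v \<in> H1r"
  shows "Qf (\<lambda>x. 1 / 2 * u x + 1 / 2 * v x) = (Qf u + Qf v) / 2 - Qf (\<lambda>x. u x - v x) / 4"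
  unfolding Qf_def Dir_lincomb[OF H1r_D(1)[OF assms(1)] H1r_D(1)[OF assms(2)]] Mass_lincomb[OF H1r_D(2)[OF assms(1)] H1r_D(2)[OF assms(2)]]
    Dir_diff[OF assms] Mass_diff[OF assms] by (rule midpoint_identity)

lemma Pf_midpoint:
  assumes "u \<in> H1r" "v \<in> H1r"
  shows "Pf (\<lambda>x. 1 / 2 * u x + 1 / 2 * v x) = (Pf u + Pf v) / 2 - Pf (\<lambda>x. u x - v x) / 4"
  unfolding Pf_def Dir_lincomb[OF H1r_D(1)[OF assms(1)] H1r_D(1)[OF assms(2)]] Mass_lincomb[OF H1r_D(2)[OF assms(1)] H1r_D(2)[OF assms(2)]]
    Dir_diff[OF assms] Mass_diff[OF assms] by (rule midpoint_identity)

lemma form_scaling: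
  assumes "u \<in> H1r" "N \<in> H1r" "0 \<le> t"
  shows "Qf (\<lambda>x. sqrt t * u x) = t * Qf u" and "Cf (\<lambda>x. sqrt t * u x) (\<lambda>x. t * N x) = t\<^sup>2 * Cf u N"
    and "CSE (\<lambda>x. sqrt t * u x) = t ^ 3 * CSE u"
proof -
  have s: "(sqrt t)\<^sup>2 = t" "(sqrt t) ^ 4 = t\<^sup>2" "(sqrt t) ^ 6 = t ^ 3"
  proof -
    show 1: "(sqrt t)\<^sup>2 = t" using assms(3) by simp
    have "(sqrt t) ^ 4 = ((sqrt t)\<^sup>2)\<^sup>2" "(sqrt t) ^ 6 = ((sqrt t)\<^sup>2) ^ 3" by (simp_all flip: power_mult)
    then show "(sqrt t) ^ 4 = t\<^sup>2" "(sqrt t) ^ 6 = t ^ 3" unfolding 1 by auto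
  qed
  show "Qf (\<lambda>x. sqrt t * u x) = t * Qf u"
    unfolding Qf_def Dir_scale[OF assms(1)] Mass_scale s by (simp add: algebra_simps)
  have P: "Pf (\<lambda>x. t * N x) = t\<^sup>2 * Pf N"
    unfolding Pf_def Dir_scale[OF assms(2)] Mass_scale by (simp add: algebra_simps)
  show "Cf (\<lambda>x. sqrt t * u x) (\<lambda>x. t * N x) = t\<^sup>2 * Cf u N"
    unfolding Cf_def scaling[OF assms(1)] s P by (simp add: power2_eq_square algebra_simps)
  show "CSE (\<lambda>x. sqrt t * u x) = t ^ 3 * CSE u" unfolding scaling[OF assms(1)] s ..
qed

text \<open>Completing the square in \<open>N\<close>: the negative mass term of \<open>N\<close> limits what the interaction can
  contribute.\<close>

lemma Cf_le_Quart:
  assumes "u \<in> H1r" "N \<in> H1r"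
  shows "Cf u N \<le> a\<^sup>2 / (4 * \<kappa>\<^sup>2 * q) * Quart u"
proof -
  define x y where "x = sqrt (Mass N)" and "y = sqrt (Quart u)"
  have xy: "0 \<le> x" "0 \<le> y" "x\<^sup>2 = Mass N" "y\<^sup>2 = Quart u"
    using Mass_nonneg Quart_nonneg by (auto simp: x_def y_def)
  have "- Cub u N \<le> x * y" using Cub_bound[OF assms] by (simp add: x_def y_def)
  then have 1: "a / 2 * (- Cub u N) \<le> a / 2 * (x * y)" using a_pos by (intro mult_left_mono) auto
  have 2: "a / 2 * (x * y) \<le> \<kappa>\<^sup>2 * q / 4 * x\<^sup>2 + a\<^sup>2 / (4 * \<kappa>\<^sup>2 * q) * y\<^sup>2"
  proof -
    have k: "0 < \<kappa>\<^sup>2 * q" using \<kappa> q by simp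
    have "0 \<le> (\<kappa>\<^sup>2 * q * x - a * y)\<^sup>2 / (4 * (\<kappa>\<^sup>2 * q))" using k by simp
    also have "\<dots> = \<kappa>\<^sup>2 * q / 4 * x\<^sup>2 + a\<^sup>2 / (4 * (\<kappa>\<^sup>2 * q)) * y\<^sup>2 - a / 2 * (x * y)"
    proof -
      define k where "k = \<kappa>\<^sup>2 * q"
      have "0 < k" using \<open>0 < \<kappa>\<^sup>2 * q\<close> by (simp add: k_def)
      then show ?thesis unfolding k_def[symmetric] by (simp add: field_simps power2_eq_square)
    qed
    finally show ?thesis by (simp add: mult.assoc)
  qed
  have 3: "\<kappa>\<^sup>2 * q / 4 * x\<^sup>2 \<le> Pf N" unfolding Pf_def xy using q Dir_nonneg by simp
  have 4: "0 \<le> q / (16 * m\<^sup>2) * Quart u" using q Quart_nonneg by simp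
  have "Cf u N = a / 2 * (- Cub u N) - q / (16 * m\<^sup>2) * Quart u - Pf N" by (simp add: Cf_def)
  then show ?thesis using 1 2 3 4 unfolding xy by linarith
qed

definition "c0 = a\<^sup>2 / (4 * \<kappa>\<^sup>2 * q) * K4 / cQ\<^sup>2"

lemma c0_pos: "0 < c0"
  unfolding c0_def using a_pos \<kappa> q K4_pos cQ_pos by (intro divide_pos_pos mult_pos_pos) auto

lemma Cf_bound:
  assumes "u \<in> H1r" "N \<in> H1r"
  shows "Cf u N \<le> c0 * (Qf u)\<^sup>2"
proof -
  have k: "0 \<le> a\<^sup>2 / (4 * \<kappa>\<^sup>2 * q)" using \<kappa> q by simp
  have "(H1sq u)\<^sup>2 \<le> (Qf u / cQ)\<^sup>2" by (intro power_mono H1sq_le_Qf H1sq_nonneg)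
  then have "K4 * (H1sq u)\<^sup>2 \<le> K4 * (Qf u / cQ)\<^sup>2" using K4_pos by (intro mult_left_mono) auto
  then have "Quart u \<le> K4 * (Qf u / cQ)\<^sup>2" using Quart_bound[OF assms(1)] by linarith
  from mult_left_mono[OF this k] show ?thesis
    using Cf_le_Quart[OF assms] by (simp add: c0_def power_divide)
qed

definition "KB = (KP / cQ) ^ 3"

lemma KB_pos: "0 < KB" unfolding KB_def using KP_ge cQ_pos by simp

lemma CSE_le_Qf:
  assumes "u \<in> H1r" shows "CSE u \<le> KB * (Qf u) ^ 3"
proof -
  have "CSE u \<le> (KP * H1sq u) ^ 3" by (rule CSE_bound[OF assms])
  also have "\<dots> \<le> (KP * (Qf u / cQ)) ^ 3"
    using KP_ge H1sq_nonneg by (intro power_mono mult_left_mono H1sq_le_Qf mult_nonneg_nonneg) auto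
  finally show ?thesis by (simp add: KB_def power_divide power_mult_distrib)
qed

definition "KN = a / 2 * sqrt K4 / (cQ * cP)"

text \<open>If \<open>Cf u N \<ge> 0\<close> then \<open>Pf N\<close>, quadratic in \<open>N\<close>, is at most the interaction, linear in \<open>N\<close>.
  Hence the constraint \<open>Cf = 1\<close> bounds \<open>N\<close> by \<open>u\<close>.\<close>

lemma neutral_field_bound:
  assumes "u \<in> H1r" "N \<in> H1r" "0 \<le> Cf u N"
  shows "H1sq N \<le> (KN * Qf u)\<^sup>2"
proof -
  define x where "x = sqrt (H1sq N)"
  have x: "0 \<le> x" "x * x = H1sq N" using H1sq_nonneg by (auto simp: x_def)
  have K: "0 \<le> KN" unfolding KN_def using a_pos K4_pos cQ_pos cP_pos by (intro divide_nonneg_nonneg mult_nonneg_nonneg) auto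
  have y: "sqrt (Quart u) \<le> sqrt K4 * (Qf u / cQ)"
  proof -
    have "sqrt (Quart u) \<le> sqrt (K4 * (H1sq u)\<^sup>2)" by (intro real_sqrt_le_mono Quart_bound assms)
    also have "\<dots> = sqrt K4 * H1sq u" using H1sq_nonneg by (simp add: real_sqrt_mult)
    also have "\<dots> \<le> sqrt K4 * (Qf u / cQ)" using K4_pos by (intro mult_left_mono H1sq_le_Qf) auto
    finally show ?thesis .
  qed
  have "0 \<le> q / (16 * m\<^sup>2) * Quart u" using q Quart_nonneg[of u] by simp
  then have "Pf N \<le> a / 2 * (- Cub u N)"
    using assms(3) unfolding Cf_def mult_minus_right by linarith
  also have "\<dots> \<le> a / 2 * (sqrt (Mass N) * sqrt (Quart u))"
    using Cub_bound[OF assms(1,2)] a_pos by (intro mult_left_mono) auto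
  also have "\<dots> \<le> a / 2 * (x * (sqrt K4 * (Qf u / cQ)))"
    unfolding x_def using a_pos Mass_le_H1sq[of N] Mass_nonneg[of N] Quart_nonneg[of u] H1sq_nonneg by (intro mult_left_mono mult_mono y) auto
  also have "\<dots> = cP * (x * (KN * Qf u))" using cP_pos cQ_pos by (simp add: KN_def)
  finally have "cP * (x * x) \<le> cP * (x * (KN * Qf u))" using Pf_ge[of N] unfolding x by linarith
  then have "x * x \<le> x * (KN * Qf u)" using cP_pos by simp
  then have "x \<le> KN * Qf u"
    using x(1) K Qf_nonneg[of u] by (cases "x = 0") (auto simp: mult_le_cancel_left)
  then have "x\<^sup>2 \<le> (KN * Qf u)\<^sup>2" using x(1) by (rule power_mono)
  then show ?thesis by (simp add: power2_eq_square x)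
qed

lemma ray_continuous: "continuous_on S (ray \<epsilon> u N)"
  unfolding ray_def[abs_def] by (intro continuous_intros)

text \<open>Moving along a ray changes \<open>Cf\<close> by the factor \<open>t\<^sup>2\<close> and reparametrises the ray linearly.\<close>

lemma normalise:
  assumes "u \<in> H1r" "N \<in> H1r" "0 < Cf u N"
  obtains u' N' s where "u' \<in> H1r" "N' \<in> H1r" "Cf u' N' = 1" "s = 1 / sqrt (Cf u N)" "\<And>t. ray \<epsilon> u' N' t = ray \<epsilon> u N (s * t)"
proof -
  define s where "s = 1 / sqrt (Cf u N)"
  have s: "0 \<le> s" "s\<^sup>2 * Cf u N = 1" using assms(3) by (auto simp: s_def power_divide)
  note f = form_scaling[OF assms(1,2) s(1)]
  show thesis
  proof (rule that[of "\<lambda>x. sqrt s * u x" "\<lambda>x. s * N x" s])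
    show "ray \<epsilon> (\<lambda>x. sqrt s * u x) (\<lambda>x. s * N x) t = ray \<epsilon> u N (s * t)" for t
      unfolding ray_def f by (simp add: power_mult_distrib algebra_simps)
    show "(\<lambda>x. sqrt s * u x) \<in> H1r" "(\<lambda>x. s * N x) \<in> H1r" by (intro H1r_scale assms)+
    show "Cf (\<lambda>x. sqrt s * u x) (\<lambda>x. s * N x) = 1" unfolding f by (rule s(2))
    show "s = 1 / sqrt (Cf u N)" by (rule s_def)
  qed
qed

end

text \<open>The difference has the factor \<open>Q - (t + T) + \<epsilon> B (t\<^sup>2 + t T + T\<^sup>2)\<close>. The first two terms are at most \<open>- T\<close>,
  and \<open>12 \<epsilon> K T\<^sup>4 \<le> 1\<close> bounds the last one by \<open>7 T / 12\<close>.\<close>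

lemma cubic_decreasing_tail:
  fixes Q B T t \<epsilon> K :: real
  assumes "0 < T" "Q \<le> T" "0 \<le> B" "B \<le> K * T ^ 3" "0 \<le> \<epsilon>" "12 * \<epsilon> * K * T ^ 4 \<le> 1" "T \<le> t" "t \<le> 2 * T"
  shows "t * Q - t\<^sup>2 + \<epsilon> * t ^ 3 * B \<le> T * Q - T\<^sup>2 + \<epsilon> * T ^ 3 * B"
proof -
  have e1: "\<epsilon> * B \<le> \<epsilon> * (K * T ^ 3)" using assms by (intro mult_left_mono) auto
  have e2: "0 \<le> \<epsilon> * B" using assms by simp
  have e3: "t\<^sup>2 + t * T + T\<^sup>2 \<le> 7 * T\<^sup>2"
  proof -
    have "t\<^sup>2 \<le> (2 * T)\<^sup>2" by (rule power_mono) (use assms in auto)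
    moreover have "t * T \<le> 2 * T * T" by (rule mult_right_mono) (use assms in auto)
    ultimately show ?thesis by (simp add: power2_eq_square)
  qed
  have e4: "0 \<le> t\<^sup>2 + t * T + T\<^sup>2" using assms by simp
  have "\<epsilon> * B * (t\<^sup>2 + t * T + T\<^sup>2) \<le> \<epsilon> * (K * T ^ 3) * (7 * T\<^sup>2)"
    by (rule mult_mono[OF e1 e3 order_trans[OF e2 e1] e4])
  also have "\<dots> = 7 / 12 * T * (12 * \<epsilon> * K * T ^ 4)" by (simp add: power2_eq_square eval_nat_numeral)
  also have "\<dots> \<le> 7 / 12 * T * 1" using assms by (intro mult_left_mono) auto
  finally have "Q - (t + T) + \<epsilon> * B * (t\<^sup>2 + t * T + T\<^sup>2) \<le> 0" using assms by linarith
  then have "(t - T) * (Q - (t + T) + \<epsilon> * B * (t\<^sup>2 + t * T + T\<^sup>2)) \<le> 0" using assms by (intro mult_nonneg_nonpos) auto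
  moreover have "(t * Q - t\<^sup>2 + \<epsilon> * t ^ 3 * B) - (T * Q - T\<^sup>2 + \<epsilon> * T ^ 3 * B) = (t - T) * (Q - (t + T) + \<epsilon> * B * (t\<^sup>2 + t * T + T\<^sup>2))"
    by (simp add: power2_eq_square power3_eq_cube algebra_simps)
  ultimately show ?thesis by linarith
qed

text \<open>On \<open>[0, 2T]\<close> the second derivative \<open>- 2 + 6 \<epsilon> t B\<close> is at most \<open>- 2 + 12 \<epsilon> K T\<^sup>4 \<le> - 1\<close>.\<close>

lemma cubic_strictly_concave:
  fixes Q B T s t \<epsilon> K :: real
  defines "p \<equiv> \<lambda>t. t * Q - t\<^sup>2 + \<epsilon> * t ^ 3 * B"
  assumes "0 < T" "0 \<le> B" "B \<le> K * T ^ 3" "0 \<le> \<epsilon>" "12 * \<epsilon> * K * T ^ 4 \<le> 1" "0 \<le> t" "t \<le> 2 * T" "0 \<le> s" "s \<le> 2 * T"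
  shows "(p s + p t) / 2 + (s - t)\<^sup>2 / 8 \<le> p ((s + t) / 2)"
proof -
  have "\<epsilon> * B \<le> \<epsilon> * (K * T ^ 3)" using assms by (intro mult_left_mono) auto
  moreover have "0 \<le> \<epsilon> * B" using assms by simp
  ultimately have "\<epsilon> * B * (s + t) \<le> \<epsilon> * (K * T ^ 3) * (4 * T)" using assms by (intro mult_mono) auto
  also have "\<dots> = 1 / 3 * (12 * \<epsilon> * K * T ^ 4)" by (simp add: eval_nat_numeral)
  also have "\<dots> \<le> 1 / 3 * 1" by (rule mult_left_mono[OF assms(6)]) simp
  finally have "3 / 8 * (\<epsilon> * B * (s + t)) \<le> 1 / 8" by linarith
  then have "3 / 8 * (\<epsilon> * B * (s + t)) * (s - t)\<^sup>2 \<le> 1 / 8 * (s - t)\<^sup>2" by (intro mult_right_mono) auto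
  moreover have "p ((s + t) / 2) - (p s + p t) / 2 = 1 / 4 * (s - t)\<^sup>2 - 3 / 8 * (\<epsilon> * B * (s + t)) * (s - t)\<^sup>2"
    unfolding p_def by (simp add: field_simps power2_eq_square power3_eq_cube)
  ultimately show ?thesis by linarith
qed

lemma average_le: "x \<le> y + d \<Longrightarrow> x' \<le> y' + d \<Longrightarrow> (x + x') / 2 \<le> (y + y') / 2 + d" for d :: real
  by (simp add: field_simps)

lemma cancel_Suc_factor: "0 \<le> k \<Longrightarrow> (k + 1) * (c / (k + 1)) = c" for c k :: real
  by (simp add: add_nonneg_eq_0_iff)

lemma le_of_abs_diff_le: "\<bar>x - y\<bar> \<le> c \<Longrightarrow> c \<le> d \<Longrightarrow> x \<le> y + d" for d :: real
  by linarith

context coupling_constants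
begin

definition level_set :: "real \<Rightarrow> real \<Rightarrow> real set" where
  "level_set \<epsilon> T = {y. \<exists>u\<in>H1r. \<exists>N\<in>H1r. Cf u N = 1 \<and> (\<forall>t\<in>{0..T}. ray \<epsilon> u N t \<le> y)}"

definition level :: "real \<Rightarrow> real \<Rightarrow> real" where
  "level \<epsilon> T = Inf (level_set \<epsilon> T)"

lemma ray_zero: "ray \<epsilon> u N 0 = 0"
  by (simp add: ray_def)

lemma level_le:
  assumes "u \<in> H1r" "N \<in> H1r" "Cf u N = 1" "0 \<le> T" "\<And>t. t \<in> {0..T} \<Longrightarrow> ray \<epsilon> u N t \<le> y"
  shows "level \<epsilon> T \<le> y"
  unfolding level_def
proof (rule cInf_lower)
  show "y \<in> level_set \<epsilon> T" unfolding level_set_def using assms by blast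
  show "bdd_below (level_set \<epsilon> T)"
  proof (rule bdd_belowI[of _ 0])
    fix z assume "z \<in> level_set \<epsilon> T"
    then obtain v M where "\<forall>t\<in>{0..T}. ray \<epsilon> v M t \<le> z" unfolding level_set_def by blast
    then have "ray \<epsilon> v M 0 \<le> z" using assms(4) by simp
    then show "0 \<le> z" by (simp add: ray_zero)
  qed
qed

text \<open>Normalising \<open>Cf v M \<ge> 1 / 4\<close> to one stretches the ray by at most the factor 2. This is why rays
  are studied up to \<open>2 T\<close> although the level only involves \<open>[0, T]\<close>.\<close>

lemma level_reached:
  assumes "v \<in> H1r" "M \<in> H1r" "1 / 4 \<le> Cf v M" "0 < T"
  shows "\<exists>t\<in>{0..2 * T}. level \<epsilon> T \<le> ray \<epsilon> v M t"
proof -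
  have "0 < Cf v M" using assms(3) by linarith
  then obtain u N s where u: "u \<in> H1r" "N \<in> H1r" "Cf u N = 1" and s: "s = 1 / sqrt (Cf v M)"
    and r: "\<And>t. ray \<epsilon> u N t = ray \<epsilon> v M (s * t)"
    by (rule normalise[OF assms(1,2)]) blast
  have "sqrt (1 / 4) \<le> sqrt (Cf v M)" using assms(3) by (rule real_sqrt_le_mono)
  then have "1 / 2 \<le> sqrt (Cf v M)" by (simp add: real_sqrt_divide)
  then have "0 \<le> s" "s \<le> 2" using \<open>0 < Cf v M\<close> unfolding s by (simp_all add: divide_le_eq)
  obtain t where t: "t \<in> {0..T}" "\<And>t'. t' \<in> {0..T} \<Longrightarrow> ray \<epsilon> u N t' \<le> ray \<epsilon> u N t"
    using continuous_attains_sup[OF compact_Icc[of 0 T] _ ray_continuous[of "{0..T}" \<epsilon> u N]] assms(4) by auto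
  have "level \<epsilon> T \<le> ray \<epsilon> v M (s * t)"
    unfolding r[symmetric] using assms(4) by (intro level_le[OF u] t(2)) auto
  moreover have "s * t \<in> {0..2 * T}"
    using \<open>0 \<le> s\<close> \<open>s \<le> 2\<close> t(1) by (auto intro!: mult_mono)
  ultimately show ?thesis by blast
qed

lemma level_approx:
  assumes "level_set \<epsilon> T \<noteq> {}" "0 < e"
  shows "\<exists>u N. u \<in> H1r \<and> N \<in> H1r \<and> Cf u N = 1 \<and> (\<forall>t\<in>{0..T}. ray \<epsilon> u N t \<le> level \<epsilon> T + e)"
proof -
  have "Inf (level_set \<epsilon> T) < level \<epsilon> T + e" using assms(2) by (simp add: level_def)
  then obtain y where "y \<in> level_set \<epsilon> T" "y < level \<epsilon> T + e" using cInf_lessD[OF assms(1)] by blast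
  then show ?thesis unfolding level_set_def by (auto intro: order_trans less_imp_le) (meson less_imp_le order_trans)
qed

text \<open>By \<open>Cf_bound\<close> the constraint \<open>Cf u N = 1\<close> forces \<open>Qf u \<ge> 1 / sqrt c0\<close>, so at a small fixed time \<open>\<tau>\<close> the
  linear term of every admissible ray dominates.\<close>

lemma level_pos:
  assumes "level_set \<epsilon> T \<noteq> {}" "0 < T" "0 \<le> \<epsilon>"
  shows "0 < level \<epsilon> T"
proof -
  define Q0 where "Q0 = 1 / sqrt c0"
  have "0 < Q0" using c0_pos by (simp add: Q0_def)
  define \<tau> where "\<tau> = min (Q0 / 2) T"
  have \<tau>: "0 < \<tau>" "\<tau> \<le> Q0 / 2" "\<tau> \<le> T" using \<open>0 < Q0\<close> assms(2) by (auto simp: \<tau>_def)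
  have "\<tau> * (Q0 / 2) \<le> level \<epsilon> T"
    unfolding level_def
  proof (rule cInf_greatest[OF assms(1)])
    fix y assume "y \<in> level_set \<epsilon> T"
    then obtain u N where u: "u \<in> H1r" "N \<in> H1r" "Cf u N = 1" "\<forall>t\<in>{0..T}. ray \<epsilon> u N t \<le> y" unfolding level_set_def by blast
    have "1 \<le> c0 * (Qf u)\<^sup>2" using Cf_bound[OF u(1,2)] u(3) by simp
    then have "Q0\<^sup>2 \<le> (Qf u)\<^sup>2" using c0_pos by (simp add: Q0_def power_divide divide_le_eq mult.commute)
    then have "Q0 \<le> Qf u" by (rule power2_le_imp_le) (rule Qf_nonneg)
    have "\<tau> * (Q0 / 2) \<le> \<tau> * (Qf u - \<tau>)" using \<tau> \<open>Q0 \<le> Qf u\<close> by (intro mult_left_mono) auto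
    also have "\<dots> = \<tau> * Qf u - \<tau>\<^sup>2" by (simp add: power2_eq_square algebra_simps)
    also have "\<dots> \<le> ray \<epsilon> u N \<tau>" unfolding ray_def u(3) using assms(3) \<tau> CSE_nonneg[of u] by simp
    also have "\<dots> \<le> y" using u(4) \<tau> by auto
    finally show "\<tau> * (Q0 / 2) \<le> y" .
  qed
  moreover have "0 < \<tau> * (Q0 / 2)" using \<tau> \<open>0 < Q0\<close> by simp
  ultimately show ?thesis by linarith
qed

text \<open>The terms that are continuous in \<open>L\<^sup>4\<close> change by at most a multiple of \<open>\<delta>\<close> between \<open>u\<close>, \<open>v\<close> and their
  midpoint, and the interaction is linear in \<open>N\<close>. The form \<open>Pf\<close> enters \<open>Cf\<close> with a negative sign,
  so its strict convexity raises \<open>Cf\<close>.\<close>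

lemma midpoint_estimates:
  assumes u: "u \<in> H1r" "v \<in> H1r" and N: "N \<in> H1r" "M \<in> H1r"
    and R: "H1sq u \<le> R" "H1sq v \<le> R" and S: "H1sq N \<le> S" "H1sq M \<le> S"
  defines "w \<equiv> \<lambda>x. 1 / 2 * u x + 1 / 2 * v x" and "L \<equiv> \<lambda>x. 1 / 2 * N x + 1 / 2 * M x"
    and "\<delta> \<equiv> sqrt (sqrt (Quart (\<lambda>x. u x - v x)) * (sqrt K4 * (4 * R)))"
  shows "(Cf u N + Cf v M) / 2 + Pf (\<lambda>x. N x - M x) / 4 - (a / 2 * sqrt S + q / (16 * m\<^sup>2) * (2 * KP * R)) * \<delta> \<le> Cf w L"
    and "CSE w \<le> (CSE u + CSE v) / 2 + (L2norm decay + 2) * (KP * R)\<^sup>2 * \<delta>"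
proof -
  have R0: "0 \<le> R" using R(1) H1sq_nonneg[of u] by linarith
  have wH: "w \<in> H1r" unfolding w_def by (rule H1r_lincomb[OF u])
  have LH: "L \<in> H1r" unfolding L_def by (rule H1r_lincomb[OF N])
  have wR: "H1sq w \<le> R"
  proof -
    have "H1sq w \<le> 2 * H1sq (\<lambda>x. 1 / 2 * u x) + 2 * H1sq (\<lambda>x. 1 / 2 * v x)"
      unfolding w_def by (intro H1sq_add_le H1r_scale u)
    also have "\<dots> = H1sq u / 2 + H1sq v / 2"
      unfolding H1sq_scale[OF u(1)] H1sq_scale[OF u(2)] by (simp add: power2_eq_square)
    finally show ?thesis using R by linarith
  qed
  have quarter: "Quart (\<lambda>x. w x - u x) \<le> Quart (\<lambda>x. u x - v x)" "Quart (\<lambda>x. w x - v x) \<le> Quart (\<lambda>x. u x - v x)"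
  proof -
    have "(\<lambda>x. w x - u x) = (\<lambda>x. (- 1 / 2) * (u x - v x))" "(\<lambda>x. w x - v x) = (\<lambda>x. (1 / 2) * (u x - v x))"
      by (auto simp: w_def fun_eq_iff field_simps)
    then have "Quart (\<lambda>x. w x - u x) = (- 1 / 2) ^ 4 * Quart (\<lambda>x. u x - v x)"
      "Quart (\<lambda>x. w x - v x) = (1 / 2) ^ 4 * Quart (\<lambda>x. u x - v x)"
      using scaling(2)[OF H1r_diff[OF u]] by metis+
    then show "Quart (\<lambda>x. w x - u x) \<le> Quart (\<lambda>x. u x - v x)" "Quart (\<lambda>x. w x - v x) \<le> Quart (\<lambda>x. u x - v x)"
      using Quart_nonneg[of "\<lambda>x. u x - v x"] by (simp_all add: power4_eq_xxxx)
  qed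
  have near: "L2norm (\<lambda>x. (w x)\<^sup>2 - (y x)\<^sup>2) \<le> \<delta>"
    if "y \<in> H1r" "H1sq y \<le> R" "Quart (\<lambda>x. w x - y x) \<le> Quart (\<lambda>x. u x - v x)" for y
  proof -
    have "(L2norm (\<lambda>x. (w x)\<^sup>2 - (y x)\<^sup>2))\<^sup>2 \<le> sqrt (Quart (\<lambda>x. w x - y x)) * (sqrt K4 * (4 * R))"
      by (rule square_diff_L2norm[OF wH that(1) wR that(2)])
    also have "\<dots> \<le> sqrt (Quart (\<lambda>x. u x - v x)) * (sqrt K4 * (4 * R))"
      using that(3) R0 K4_pos by (intro mult_right_mono) auto
    finally have "sqrt ((L2norm (\<lambda>x. (w x)\<^sup>2 - (y x)\<^sup>2))\<^sup>2) \<le> \<delta>" unfolding \<delta>_def by (rule real_sqrt_le_mono)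
    then show ?thesis by simp
  qed
  note nu = near[OF u(1) R(1) quarter(1)] and nv = near[OF u(2) R(2) quarter(2)]
  have cub: "Cub w N \<le> Cub u N + sqrt S * \<delta>" "Cub w M \<le> Cub v M + sqrt S * \<delta>"
  proof -
    have "\<bar>Cub w N - Cub u N\<bar> \<le> sqrt S * \<delta>"
      by (rule order_trans[OF Cub_diff[OF wH u(1) N(1)]]) (intro mult_mono real_sqrt_le_mono S nu; use S H1sq_nonneg[of N] in simp)
    then show "Cub w N \<le> Cub u N + sqrt S * \<delta>" by linarith
    have "\<bar>Cub w M - Cub v M\<bar> \<le> sqrt S * \<delta>"
      by (rule order_trans[OF Cub_diff[OF wH u(2) N(2)]]) (intro mult_mono real_sqrt_le_mono S nv; use S H1sq_nonneg[of M] in simp)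
    then show "Cub w M \<le> Cub v M + sqrt S * \<delta>" by linarith
  qed
  have cubL: "Cub w L = (Cub w N + Cub w M) / 2"
  proof -
    have "Cub w L = mass_form (\<lambda>x. (w x)\<^sup>2) (\<lambda>x. 1 / 2 * N x + 1 / 2 * M x)"
      unfolding Cub_def L_def mass_form_def by (simp add: mult.commute)
    also have "\<dots> = (Cub w N + Cub w M) / 2"
      unfolding mass_form_lincomb[OF density_D(1)[OF square_density[OF wH]] H1r_D(2)[OF N(1)] H1r_D(2)[OF N(2)]]
      by (simp add: Cub_def mass_form_def mult.commute)
    finally show ?thesis .
  qed
  have KR: "0 \<le> 2 * KP * R" using KP_ge R0 by simp
  have quart: "Quart w \<le> Quart u + 2 * KP * R * \<delta>" "Quart w \<le> Quart v + 2 * KP * R * \<delta>"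
    using Quart_diff[OF wH u(1) wR R(1)] mult_left_mono[OF nu KR] Quart_diff[OF wH u(2) wR R(2)] mult_left_mono[OF nv KR] by linarith+
  have c1: "a / 2 * Cub w L \<le> a / 2 * ((Cub u N + Cub v M) / 2 + sqrt S * \<delta>)"
  proof (rule mult_left_mono)
    show "Cub w L \<le> (Cub u N + Cub v M) / 2 + sqrt S * \<delta>" unfolding cubL by (rule average_le[OF cub])
  qed (use a_pos in simp)
  have c2: "q / (16 * m\<^sup>2) * Quart w \<le> q / (16 * m\<^sup>2) * ((Quart u + Quart v) / 2 + 2 * KP * R * \<delta>)"
  proof (rule mult_left_mono)
    show "Quart w \<le> (Quart u + Quart v) / 2 + 2 * KP * R * \<delta>" using average_le[OF quart] by simp
  qed (use q in simp)
  have c3: "Pf L = (Pf N + Pf M) / 2 - Pf (\<lambda>x. N x - M x) / 4" unfolding L_def by (rule Pf_midpoint[OF N])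
  have "(Cf u N + Cf v M) / 2 + Pf (\<lambda>x. N x - M x) / 4 - (a / 2 * sqrt S + q / (16 * m\<^sup>2) * (2 * KP * R)) * \<delta>
     = - (a / 2 * ((Cub u N + Cub v M) / 2 + sqrt S * \<delta>) + q / (16 * m\<^sup>2) * ((Quart u + Quart v) / 2 + 2 * KP * R * \<delta>) + Pf L)"
  proof -
    define b c where "b = a / 2" and "c = q / (16 * m\<^sup>2)"
    show ?thesis unfolding Cf_def c3 b_def[symmetric] c_def[symmetric]
      by (simp add: algebra_simps add_divide_distrib diff_divide_distrib)
  qed
  also have "\<dots> \<le> Cf w L" unfolding Cf_def using c1 c2 by linarith
  finally show "(Cf u N + Cf v M) / 2 + Pf (\<lambda>x. N x - M x) / 4 - (a / 2 * sqrt S + q / (16 * m\<^sup>2) * (2 * KP * R)) * \<delta> \<le> Cf w L" .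
  have K: "0 \<le> (L2norm decay + 2) * (KP * R)\<^sup>2" by simp
  show "CSE w \<le> (CSE u + CSE v) / 2 + (L2norm decay + 2) * (KP * R)\<^sup>2 * \<delta>"
  proof -
    have e1: "CSE w \<le> CSE u + (L2norm decay + 2) * (KP * R)\<^sup>2 * \<delta>"
      by (rule le_of_abs_diff_le[OF CSE_diff[OF wH u(1) wR R(1)]]) (rule mult_left_mono[OF nu K])
    have e2: "CSE w \<le> CSE v + (L2norm decay + 2) * (KP * R)\<^sup>2 * \<delta>"
      by (rule le_of_abs_diff_le[OF CSE_diff[OF wH u(2) wR R(2)]]) (rule mult_left_mono[OF nv K])
    show ?thesis using average_le[OF e1 e2] by simp
  qed
qed

lemma forms_continuous:
  assumes u: "\<And>n. u n \<in> H1r" "v \<in> H1r" "(\<lambda>n. H1sq (\<lambda>x. u n x - v x)) \<longlonglongrightarrow> 0" "\<And>n. H1sq (u n) \<le> R"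
    and N: "\<And>n. N n \<in> H1r" "M \<in> H1r" "(\<lambda>n. H1sq (\<lambda>x. N n x - M x)) \<longlonglongrightarrow> 0" "\<And>n. H1sq (N n) \<le> S"
  shows "(\<lambda>n. Qf (u n)) \<longlonglongrightarrow> Qf v" and "(\<lambda>n. Cf (u n) (N n)) \<longlonglongrightarrow> Cf v M"
    and "(\<lambda>n. ray \<epsilon> (u n) (N n) t) \<longlonglongrightarrow> ray \<epsilon> v M t"
proof -
  show Q: "(\<lambda>n. Qf (u n)) \<longlonglongrightarrow> Qf v"
    unfolding Qf_def by (intro tendsto_intros Dir_continuous Mass_continuous u)
  have P: "(\<lambda>n. Pf (N n)) \<longlonglongrightarrow> Pf M"
    unfolding Pf_def by (intro tendsto_intros Dir_continuous Mass_continuous N)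
  show C: "(\<lambda>n. Cf (u n) (N n)) \<longlonglongrightarrow> Cf v M"
    unfolding Cf_def by (intro tendsto_intros P nonlinear_continuous(3)[OF u N] nonlinear_continuous(1)[OF u])
  show "(\<lambda>n. ray \<epsilon> (u n) (N n) t) \<longlonglongrightarrow> ray \<epsilon> v M t"
    unfolding ray_def by (intro tendsto_intros Q C nonlinear_continuous(2)[OF u])
qed

text \<open>If two members \<open>(u, N)\<close> and \<open>(v, M)\<close> of a minimizing sequence are \<open>L\<^sup>4\<close> close in the first component,
  the ray of their midpoint lies below the average of the two rays by
  \<open>t Qf (u - v) / 4 + t\<^sup>2 Pf (N - M) / 4\<close>, up to a small error. Since that ray reaches the level at some
  \<open>t\<close> bounded away from zero, both forms are small and the sequence is Cauchy in \<open>H\<^sup>1\<close>.\<close>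

lemma level_minimizer:
  assumes z: "us \<in> H1r" "Ns \<in> H1r" "Cf us Ns = 1" and T: "T = Qf us + 3"
    and \<epsilon>: "0 < \<epsilon>" "\<epsilon> * T ^ 3 * CSE us \<le> 1 / 4" "12 * \<epsilon> * KB * T ^ 4 \<le> 1"
  obtains u N where "u \<in> H1r" "N \<in> H1r" "Cf u N = 1" "Qf u \<le> T" "\<And>t. t \<in> {0..2 * T} \<Longrightarrow> ray \<epsilon> u N t \<le> level \<epsilon> T"
    and "level_set \<epsilon> T \<noteq> {}"
proof -
  define f where "f = level \<epsilon> T"
  have T0: "0 < T" using T Qf_nonneg[of us] by simp
  let ?y = "(Qf us)\<^sup>2 / 4 + 1 / 4"
  have ys: "ray \<epsilon> us Ns t \<le> ?y" if "t \<in> {0..T}" for t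
  proof -
    have "\<epsilon> * t ^ 3 * CSE us \<le> \<epsilon> * T ^ 3 * CSE us"
      using that \<epsilon>(1) CSE_nonneg[of us] by (intro mult_right_mono mult_left_mono power_mono) auto
    moreover have "t * Qf us - t\<^sup>2 \<le> (Qf us)\<^sup>2 / 4"
      using zero_le_power2[of "t - Qf us / 2"] by (simp add: power2_eq_square algebra_simps)
    ultimately show ?thesis unfolding ray_def z(3) using \<epsilon>(2) by linarith
  qed
  have ne: "level_set \<epsilon> T \<noteq> {}" unfolding level_set_def using z ys by blast
  have fy: "f \<le> ?y" unfolding f_def using T0 by (intro level_le[OF z] ys) auto
  have f0: "0 < f" unfolding f_def using level_pos[OF ne T0] \<epsilon>(1) by simp
  have "\<exists>p. fst p \<in> H1r \<and> snd p \<in> H1r \<and> Cf (fst p) (snd p) = 1 \<and> (\<forall>t\<in>{0..T}. ray \<epsilon> (fst p) (snd p) t \<le> f + 1 / real (Suc n))" for n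
    using level_approx[OF ne, of "1 / real (Suc n)"] unfolding f_def by fastforce
  then obtain p where p: "\<And>n. fst (p n) \<in> H1r \<and> snd (p n) \<in> H1r \<and> Cf (fst (p n)) (snd (p n)) = 1 \<and> (\<forall>t\<in>{0..T}. ray \<epsilon> (fst (p n)) (snd (p n)) t \<le> f + 1 / real (Suc n))"
    by metis
  define u0 N0 where "u0 n = fst (p n)" and "N0 n = snd (p n)" for n
  have u0: "u0 n \<in> H1r" and N0: "N0 n \<in> H1r" and C0: "Cf (u0 n) (N0 n) = 1"
    and r0: "\<And>t. t \<in> {0..T} \<Longrightarrow> ray \<epsilon> (u0 n) (N0 n) t \<le> f + 1 / real (Suc n)" for n
    using p[of n] by (auto simp: u0_def N0_def)
  \<comment> \<open>evaluate the ray at \<open>T / 2\<close>: the right-hand side is at most \<open>(Qf us)\<^sup>2 / 4 + 5 / 4\<close>, and the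
    summand 3 in \<open>T\<close> makes this at most \<open>(T / 2)\<^sup>2\<close>\<close>
  have Q0: "Qf (u0 n) \<le> T" for n
  proof -
    have "ray \<epsilon> (u0 n) (N0 n) (T / 2) \<le> f + 1 / real (Suc n)" using T0 by (intro r0) auto
    also have "\<dots> \<le> f + 1" by simp
    finally have "T / 2 * Qf (u0 n) - (T / 2)\<^sup>2 + \<epsilon> * (T / 2) ^ 3 * CSE (u0 n) \<le> (Qf us)\<^sup>2 / 4 + 5 / 4"
      using fy unfolding ray_def C0 by simp
    moreover have "0 \<le> \<epsilon> * (T / 2) ^ 3 * CSE (u0 n)" using \<epsilon>(1) T0 CSE_nonneg by simp
    moreover have "(Qf us)\<^sup>2 / 4 + 5 / 4 \<le> (T / 2)\<^sup>2"
      unfolding T using Qf_nonneg[of us] by (simp add: power2_eq_square field_simps)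
    ultimately have "T / 2 * Qf (u0 n) \<le> 2 * (T / 2)\<^sup>2" by linarith
    also have "\<dots> = T / 2 * T" by (simp add: power2_eq_square)
    finally show ?thesis using T0 by simp
  qed
  define R S where "R = T / cQ" and "S = (KN * T)\<^sup>2"
  have R: "H1sq (u0 n) \<le> R" for n
    unfolding R_def using H1sq_le_Qf[of "u0 n"] divide_right_mono[OF Q0[of n], of cQ] cQ_pos by linarith
  have KN0: "0 \<le> KN" unfolding KN_def using a_pos K4_pos cQ_pos cP_pos by (intro divide_nonneg_nonneg mult_nonneg_nonneg) auto
  have S: "H1sq (N0 n) \<le> S" for n
  proof -
    have "H1sq (N0 n) \<le> (KN * Qf (u0 n))\<^sup>2" using C0 by (intro neutral_field_bound u0 N0) simp
    also have "\<dots> \<le> S" unfolding S_def using KN0 Q0[of n] Qf_nonneg by (intro power_mono mult_left_mono mult_nonneg_nonneg) auto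
    finally show ?thesis .
  qed
  have B0: "CSE (u0 n) \<le> KB * T ^ 3" for n
  proof -
    have "(Qf (u0 n)) ^ 3 \<le> T ^ 3" by (intro power_mono Q0 Qf_nonneg)
    then show ?thesis using CSE_le_Qf[OF u0[of n]] mult_left_mono[of _ "T ^ 3" KB] KB_pos by (meson less_imp_le order_trans)
  qed
  \<comment> \<open>beyond \<open>T\<close> the rays decrease, so the bound extends to \<open>[0, 2T]\<close>\<close>
  have r2: "ray \<epsilon> (u0 n) (N0 n) t \<le> f + 1 / real (Suc n)" if "t \<in> {0..2 * T}" for n t
  proof (cases "t \<le> T")
    case True
    then show ?thesis using that by (intro r0) auto
  next
    case False
    have "ray \<epsilon> (u0 n) (N0 n) t \<le> ray \<epsilon> (u0 n) (N0 n) T"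
      using cubic_decreasing_tail[OF T0 Q0[of n] CSE_nonneg B0[of n] less_imp_le[OF \<epsilon>(1)] \<epsilon>(3)] False that
      unfolding ray_def C0 by simp
    also have "\<dots> \<le> f + 1 / real (Suc n)" using T0 by (intro r0) auto
    finally show ?thesis .
  qed
  obtain r :: "nat \<Rightarrow> nat" where "strict_mono r"
    and r: "\<And>\<eta>. \<eta> > 0 \<Longrightarrow> \<exists>N. \<forall>m\<ge>N. \<forall>n\<ge>N. (\<integral>x. (u0 (r m) x - u0 (r n) x) ^ 4 \<partial>lborel) < \<eta>"
  proof -
    from L4_compactness[of u0 R, OF u0 R] show thesis
    proof (elim exE conjE)
      fix r :: "nat \<Rightarrow> nat" assume A: "strict_mono r" "\<forall>\<eta>>0. \<exists>N. \<forall>m\<ge>N. \<forall>n\<ge>N. (\<integral>x. (u0 (r m) x - u0 (r n) x) ^ 4 \<partial>lborel) < \<eta>"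
      show thesis by (rule that[OF A(1)]) (rule A(2)[rule_format])
    qed
  qed
  define k1 where "k1 = a / 2 * sqrt S + q / (16 * m\<^sup>2) * (2 * KP * R)"
  define k2 where "k2 = (L2norm decay + 2) * (KP * R)\<^sup>2"
  have R0: "0 \<le> R" using R[of 0] H1sq_nonneg[of "u0 0"] by linarith
  have k1: "0 \<le> k1" unfolding k1_def S_def using a_pos q R0 KP_ge by simp
  have k2: "0 \<le> k2" unfolding k2_def by simp
  \<comment> \<open>on \<open>[0, 2T]\<close> the ray of a midpoint lies below \<open>k3 * t\<close>, so it cannot reach the level before time \<open>\<tau>\<close>\<close>
  define k3 where "k3 = T + \<epsilon> * (2 * T)\<^sup>2 * (KB * T ^ 3)"
  have k3: "0 < k3" unfolding k3_def using T0 \<epsilon>(1) KB_pos by (intro add_pos_nonneg) auto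
  define \<tau> where "\<tau> = f / k3"
  have \<tau>: "0 < \<tau>" using f0 k3 by (simp add: \<tau>_def)
  \<comment> \<open>the total error of the midpoint estimates along a ray is at most \<open>k4 * \<Delta>\<close>\<close>
  define k4 where "k4 = (2 * T)\<^sup>2 * k1 + \<epsilon> * (2 * T) ^ 3 * k2"
  have k4: "0 \<le> k4" unfolding k4_def using k1 k2 T0 \<epsilon>(1) by simp
  define \<Delta> where "\<Delta> m n = sqrt (sqrt (Quart (\<lambda>x. u0 (r m) x - u0 (r n) x)) * (sqrt K4 * (4 * R)))" for m n
  have \<Delta>0: "0 \<le> \<Delta> m n" for m n unfolding \<Delta>_def using R0 K4_pos Quart_nonneg by simp
  have \<Delta>: "\<exists>N. \<forall>m\<ge>N. \<forall>n\<ge>N. \<Delta> m n \<le> e" if "0 < e" for e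
  proof -
    define c where "c = sqrt K4 * (4 * R) + 1"
    have c: "0 < c" using R0 K4_pos by (simp add: c_def add_nonneg_pos)
    have "0 < (e\<^sup>2 / c)\<^sup>2" using that c by simp
    from r[OF this] obtain N where N: "\<And>m n. m \<ge> N \<Longrightarrow> n \<ge> N \<Longrightarrow> Quart (\<lambda>x. u0 (r m) x - u0 (r n) x) < (e\<^sup>2 / c)\<^sup>2"
      unfolding Quart_def by blast
    have "\<Delta> m n \<le> e" if "m \<ge> N" "n \<ge> N" for m n
    proof -
      have "sqrt (Quart (\<lambda>x. u0 (r m) x - u0 (r n) x)) \<le> sqrt ((e\<^sup>2 / c)\<^sup>2)"
        using N[OF that] by (intro real_sqrt_le_mono) simp
      also have "\<dots> = e\<^sup>2 / c" using c by simp
      finally have "sqrt (Quart (\<lambda>x. u0 (r m) x - u0 (r n) x)) * (sqrt K4 * (4 * R)) \<le> e\<^sup>2 / c * c"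
        using R0 K4_pos c by (intro mult_mono) (auto simp: c_def)
      also have "\<dots> = e\<^sup>2" using c by simp
      finally have "\<Delta> m n \<le> sqrt (e\<^sup>2)" unfolding \<Delta>_def by (rule real_sqrt_le_mono)
      then show ?thesis using \<open>0 < e\<close> by simp
    qed
    then show ?thesis by blast
  qed
  \<comment> \<open>the midpoint ray reaches the level, so the convexity gain is at most the error\<close>
  have gap: "\<tau> * (Qf (\<lambda>x. u0 (r i) x - u0 (r j) x) / 4) + \<tau>\<^sup>2 * (Pf (\<lambda>x. N0 (r i) x - N0 (r j) x) / 4)
      \<le> e + k4 * \<Delta> i j"
    if small: "k1 * \<Delta> i j \<le> 3 / 4" and e: "1 / real (Suc (r i)) \<le> e" "1 / real (Suc (r j)) \<le> e" for i j e
  proof -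
    let ?u = "u0 (r i)" and ?v = "u0 (r j)" and ?N = "N0 (r i)" and ?M = "N0 (r j)"
    define w where "w = (\<lambda>x. 1 / 2 * ?u x + 1 / 2 * ?v x)"
    define L where "L = (\<lambda>x. 1 / 2 * ?N x + 1 / 2 * ?M x)"
    define dQ where "dQ = Qf (\<lambda>x. ?u x - ?v x) / 4"
    define dP where "dP = Pf (\<lambda>x. ?N x - ?M x) / 4"
    have d0: "0 \<le> dQ" "0 \<le> dP" unfolding dQ_def dP_def using Qf_nonneg Pf_nonneg by auto
    have wH: "w \<in> H1r" "L \<in> H1r" unfolding w_def L_def by (intro H1r_lincomb u0 N0)+
    note mid = midpoint_estimates[OF u0[of "r i"] u0[of "r j"] N0[of "r i"] N0[of "r j"] R R S S,
        folded w_def L_def \<Delta>_def k1_def k2_def dP_def]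
    have Cw: "1 + dP - k1 * \<Delta> i j \<le> Cf w L" using mid(1) unfolding C0 by simp
    have Bw: "CSE w \<le> (CSE ?u + CSE ?v) / 2 + k2 * \<Delta> i j" by (rule mid(2))
    have Qw: "Qf w = (Qf ?u + Qf ?v) / 2 - dQ" unfolding w_def dQ_def by (rule Qf_midpoint[OF u0 u0])
    have "1 / 4 \<le> Cf w L" using Cw small d0 by linarith
    then obtain t where t: "t \<in> {0..2 * T}" "f \<le> ray \<epsilon> w L t" unfolding f_def using level_reached[OF wH _ T0] by blast
    have t0: "0 \<le> t" "t \<le> 2 * T" using t by auto
    have \<tau>t: "\<tau> \<le> t"
    proof -
      have "(Qf ?u + Qf ?v) / 2 \<le> (T + T) / 2 + 0" by (rule average_le) (simp_all add: Q0)
      moreover define s where "s = (Qf ?u + Qf ?v) / 2"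
      ultimately have "s \<le> T" by simp
      then have "Qf w \<le> T" using Qw[folded s_def] d0 by linarith
      have "(Qf w) ^ 3 \<le> T ^ 3" by (intro power_mono \<open>Qf w \<le> T\<close> Qf_nonneg)
      then have Bw': "CSE w \<le> KB * T ^ 3" using CSE_le_Qf[OF wH(1)] mult_left_mono[of _ "T ^ 3" KB] KB_pos by (meson less_imp_le order_trans)
      have "0 \<le> t\<^sup>2 * Cf w L" using \<open>1 / 4 \<le> Cf w L\<close> by simp
      then have "f \<le> t * Qf w + \<epsilon> * t ^ 3 * CSE w" using t(2) unfolding ray_def by linarith
      also have "\<dots> = t * (Qf w + \<epsilon> * t\<^sup>2 * CSE w)" by (simp add: power2_eq_square power3_eq_cube algebra_simps)
      also have "\<dots> \<le> t * k3"
      proof (rule mult_left_mono[OF _ t0(1)])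
        have "\<epsilon> * t\<^sup>2 * CSE w \<le> \<epsilon> * (2 * T)\<^sup>2 * (KB * T ^ 3)"
          using t0 \<epsilon>(1) Bw' CSE_nonneg by (intro mult_mono power_mono) auto
        then show "Qf w + \<epsilon> * t\<^sup>2 * CSE w \<le> k3" unfolding k3_def using \<open>Qf w \<le> T\<close> by linarith
      qed
      finally show ?thesis unfolding \<tau>_def using k3 by (simp add: pos_divide_le_eq)
    qed
    have "t\<^sup>2 * (1 + dP - k1 * \<Delta> i j) \<le> t\<^sup>2 * Cf w L" by (intro mult_left_mono Cw) simp
    moreover have "\<epsilon> * t ^ 3 * CSE w \<le> \<epsilon> * t ^ 3 * ((CSE ?u + CSE ?v) / 2 + k2 * \<Delta> i j)"
      using \<epsilon>(1) t0 by (intro mult_left_mono Bw) auto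
    ultimately have "f \<le> t * ((Qf ?u + Qf ?v) / 2 - dQ) - t\<^sup>2 * (1 + dP - k1 * \<Delta> i j) + \<epsilon> * t ^ 3 * ((CSE ?u + CSE ?v) / 2 + k2 * \<Delta> i j)"
      using t(2) unfolding ray_def Qw by linarith
    also have "\<dots> = (ray \<epsilon> ?u ?N t + ray \<epsilon> ?v ?M t) / 2 - t * dQ - t\<^sup>2 * dP + (t\<^sup>2 * k1 + \<epsilon> * t ^ 3 * k2) * \<Delta> i j"
      unfolding ray_def C0 by (simp add: field_simps)
    also have "\<dots> \<le> f + e - t * dQ - t\<^sup>2 * dP + k4 * \<Delta> i j"
    proof -
      have "ray \<epsilon> ?u ?N t \<le> f + e" "ray \<epsilon> ?v ?M t \<le> f + e" using r2[OF t(1), of "r i"] r2[OF t(1), of "r j"] e by linarith+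
      from average_le[OF this] have A: "(ray \<epsilon> ?u ?N t + ray \<epsilon> ?v ?M t) / 2 \<le> f + e" by simp
      have B: "(t\<^sup>2 * k1 + \<epsilon> * t ^ 3 * k2) * \<Delta> i j \<le> k4 * \<Delta> i j"
        unfolding k4_def using t0 k1 k2 \<epsilon>(1) \<Delta>0 by (intro mult_right_mono add_mono mult_left_mono power_mono) auto
      show ?thesis by (rule add_mono[OF diff_right_mono[OF diff_right_mono[OF A]] B])
    qed
    finally have "t * dQ + t\<^sup>2 * dP \<le> e + k4 * \<Delta> i j" by linarith
    moreover have "\<tau> * dQ \<le> t * dQ" by (intro mult_right_mono \<tau>t d0)
    moreover have "\<tau>\<^sup>2 * dP \<le> t\<^sup>2 * dP" using \<tau> by (intro mult_right_mono power_mono \<tau>t d0) auto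
    ultimately show ?thesis unfolding dQ_def dP_def by linarith
  qed
  have r_ge: "n \<le> r n" for n using \<open>strict_mono r\<close> by (rule strict_mono_imp_increasing)
  have gap0: "\<exists>N. \<forall>i\<ge>N. \<forall>j\<ge>N. \<tau> * (Qf (\<lambda>x. u0 (r i) x - u0 (r j) x) / 4) + \<tau>\<^sup>2 * (Pf (\<lambda>x. N0 (r i) x - N0 (r j) x) / 4) \<le> e"
    if "0 < e" for e
  proof -
    define d where "d = min (3 / 4 / (k1 + 1)) (e / 2 / (k4 + 1))"
    have d: "0 < d" using k1 k4 that by (simp add: d_def add_nonneg_pos)
    obtain N1 where N1: "\<And>m n. m \<ge> N1 \<Longrightarrow> n \<ge> N1 \<Longrightarrow> \<Delta> m n \<le> d" using \<Delta>[OF d] by blast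
    obtain N2 where N2: "1 / real (Suc N2) < e / 2"
      using reals_Archimedean[of "e / 2"] \<open>0 < e\<close> unfolding inverse_eq_divide by auto
    have "\<tau> * (Qf (\<lambda>x. u0 (r i) x - u0 (r j) x) / 4) + \<tau>\<^sup>2 * (Pf (\<lambda>x. N0 (r i) x - N0 (r j) x) / 4) \<le> e"
      if "i \<ge> max N1 N2" "j \<ge> max N1 N2" for i j
    proof -
      have D: "\<Delta> i j \<le> d" using that by (intro N1) auto
      have "k1 * \<Delta> i j \<le> (k1 + 1) * (3 / 4 / (k1 + 1))"
        using D k1 \<Delta>0 by (intro mult_mono) (auto simp: d_def)
      then have s1: "k1 * \<Delta> i j \<le> 3 / 4" unfolding cancel_Suc_factor[OF k1] .
      have "k4 * \<Delta> i j \<le> (k4 + 1) * (e / 2 / (k4 + 1))"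
        using D k4 \<Delta>0 by (intro mult_mono) (auto simp: d_def)
      then have s2: "k4 * \<Delta> i j \<le> e / 2" unfolding cancel_Suc_factor[OF k4] .
      have s3: "1 / real (Suc (r n)) \<le> e / 2" if "n \<ge> max N1 N2" for n
      proof -
        have "N2 \<le> r n" using that r_ge[of n] by simp
        then have "1 / real (Suc (r n)) \<le> 1 / real (Suc N2)" by (intro divide_left_mono) auto
        then show ?thesis using N2 by linarith
      qed
      show ?thesis using gap[OF s1 s3[OF that(1)] s3[OF that(2)]] s2 by linarith
    qed
    then show ?thesis by blast
  qed
  have Cu: "\<exists>N. \<forall>i\<ge>N. \<forall>j\<ge>N. H1sq (\<lambda>x. u0 (r i) x - u0 (r j) x) < e" if "0 < e" for e
  proof -
    have "0 < \<tau> * (cQ * e / 8)" using \<tau> cQ_pos that by simp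
    from gap0[OF this] obtain N where N: "\<And>i j. i \<ge> N \<Longrightarrow> j \<ge> N \<Longrightarrow> \<tau> * (Qf (\<lambda>x. u0 (r i) x - u0 (r j) x) / 4) + \<tau>\<^sup>2 * (Pf (\<lambda>x. N0 (r i) x - N0 (r j) x) / 4) \<le> \<tau> * (cQ * e / 8)"
      by blast
    have "H1sq (\<lambda>x. u0 (r i) x - u0 (r j) x) < e" if "i \<ge> N" "j \<ge> N" for i j
    proof -
      have "0 \<le> \<tau>\<^sup>2 * (Pf (\<lambda>x. N0 (r i) x - N0 (r j) x) / 4)" using Pf_nonneg by simp
      then have "\<tau> * (Qf (\<lambda>x. u0 (r i) x - u0 (r j) x) / 4) \<le> \<tau> * (cQ * e / 8)" using N[OF that] by linarith
      then have "Qf (\<lambda>x. u0 (r i) x - u0 (r j) x) \<le> cQ * (e / 2)" using \<tau> by simp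
      then have "cQ * H1sq (\<lambda>x. u0 (r i) x - u0 (r j) x) \<le> cQ * (e / 2)" using Qf_ge order_trans by blast
      then show ?thesis using cQ_pos \<open>0 < e\<close> by simp
    qed
    then show ?thesis by blast
  qed
  have CN: "\<exists>N. \<forall>i\<ge>N. \<forall>j\<ge>N. H1sq (\<lambda>x. N0 (r i) x - N0 (r j) x) < e" if "0 < e" for e
  proof -
    have "0 < \<tau>\<^sup>2 * (cP * e / 8)" using \<tau> cP_pos that by simp
    from gap0[OF this] obtain N where N: "\<And>i j. i \<ge> N \<Longrightarrow> j \<ge> N \<Longrightarrow> \<tau> * (Qf (\<lambda>x. u0 (r i) x - u0 (r j) x) / 4) + \<tau>\<^sup>2 * (Pf (\<lambda>x. N0 (r i) x - N0 (r j) x) / 4) \<le> \<tau>\<^sup>2 * (cP * e / 8)"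
      by blast
    have "H1sq (\<lambda>x. N0 (r i) x - N0 (r j) x) < e" if "i \<ge> N" "j \<ge> N" for i j
    proof -
      have "0 \<le> \<tau> * (Qf (\<lambda>x. u0 (r i) x - u0 (r j) x) / 4)" using Qf_nonneg \<tau> by simp
      then have "\<tau>\<^sup>2 * (Pf (\<lambda>x. N0 (r i) x - N0 (r j) x) / 4) \<le> \<tau>\<^sup>2 * (cP * e / 8)" using N[OF that] by linarith
      then have "Pf (\<lambda>x. N0 (r i) x - N0 (r j) x) \<le> cP * (e / 2)" using \<tau> by simp
      then have "cP * H1sq (\<lambda>x. N0 (r i) x - N0 (r j) x) \<le> cP * (e / 2)" using Pf_ge order_trans by blast
      then show ?thesis using cP_pos \<open>0 < e\<close> by simp
    qed
    then show ?thesis by blast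
  qed
  obtain u where u: "u \<in> H1r" "(\<lambda>n. H1sq (\<lambda>x. u0 (r n) x - u x)) \<longlonglongrightarrow> 0"
    by (rule H1r_complete[of "\<lambda>n. u0 (r n)", OF u0 Cu])
  obtain N where N: "N \<in> H1r" "(\<lambda>n. H1sq (\<lambda>x. N0 (r n) x - N x)) \<longlonglongrightarrow> 0"
    by (rule H1r_complete[of "\<lambda>n. N0 (r n)", OF N0 CN])
  note lim = forms_continuous[of "\<lambda>n. u0 (r n)" u R "\<lambda>n. N0 (r n)" N S, OF u0 u R N0 N S]
  have "Cf u N = 1" using lim(2) unfolding C0 by (simp add: LIMSEQ_const_iff)
  moreover have "Qf u \<le> T" by (rule LIMSEQ_le_const2[OF lim(1)]) (use Q0 in auto)
  moreover have "ray \<epsilon> u N t \<le> f" if "t \<in> {0..2 * T}" for t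
  proof (rule LIMSEQ_le[OF lim(3)])
    have "(\<lambda>n. 1 / real (Suc (r n))) \<longlonglongrightarrow> 0"
      using LIMSEQ_subseq_LIMSEQ[OF LIMSEQ_inverse_real_of_nat \<open>strict_mono r\<close>] by (simp add: o_def inverse_eq_divide)
    from tendsto_add[OF tendsto_const this, of f] show "(\<lambda>n. f + 1 / real (Suc (r n))) \<longlonglongrightarrow> f" by simp
    show "\<exists>K. \<forall>n\<ge>K. ray \<epsilon> (u0 (r n)) (N0 (r n)) t \<le> f + 1 / real (Suc (r n))" using r2[OF that] by blast
  qed
  ultimately show thesis using that[OF u(1) N(1) _ _ _ ne] unfolding f_def by blast
qed

end

section \<open>From the min-max level to a critical point\<close>

lemma zero_slope:
  fixes l K d :: real
  assumes "0 < d" "0 \<le> K" and h: "\<And>s. \<bar>s\<bar> \<le> d \<Longrightarrow> 0 \<le> s * l + K * s\<^sup>2"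
  shows "l = 0"
proof (rule ccontr)
  assume "l \<noteq> 0"
  define \<sigma> where "\<sigma> = min d (\<bar>l\<bar> / 2 / (K + 1))"
  have \<sigma>: "0 < \<sigma>" "\<sigma> \<le> d" "\<sigma> \<le> \<bar>l\<bar> / 2 / (K + 1)" using assms \<open>l \<noteq> 0\<close> by (auto simp: \<sigma>_def)
  have "0 \<le> (- sgn l * \<sigma>) * l + K * (- sgn l * \<sigma>)\<^sup>2" using \<sigma> \<open>l \<noteq> 0\<close> by (intro h) (simp add: abs_mult abs_sgn_eq)
  moreover have "sgn l * l = \<bar>l\<bar>" by (simp add: abs_sgn mult.commute)
  moreover have "(- sgn l * \<sigma>)\<^sup>2 = \<sigma>\<^sup>2" using \<open>l \<noteq> 0\<close> by (simp add: power_mult_distrib sgn_if)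
  ultimately have "0 \<le> - (\<sigma> * \<bar>l\<bar>) + K * \<sigma>\<^sup>2" by (simp add: mult_ac)
  then have "\<sigma> * \<bar>l\<bar> \<le> \<sigma> * (K * \<sigma>)" by (simp add: power2_eq_square mult_ac)
  then have "\<bar>l\<bar> \<le> K * \<sigma>" using \<sigma> by simp
  also have "\<dots> \<le> (K + 1) * (\<bar>l\<bar> / 2 / (K + 1))" using assms \<sigma> by (intro mult_mono) auto
  also have "\<dots> = \<bar>l\<bar> / 2" by (rule cancel_Suc_factor[OF assms(2)])
  finally show False using \<open>l \<noteq> 0\<close> by simp
qed

lemma quad_diff_homogeneous:
  "quad_diff X u N L \<Longrightarrow> \<phi> \<in> H1r \<Longrightarrow> \<psi> \<in> H1r \<Longrightarrow> L (\<lambda>x. c * \<phi> x) (\<lambda>x. c * \<psi> x) = c * L \<phi> \<psi>"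
  unfolding quad_diff_def by simp

lemma quad_diff_remainder:
  assumes "quad_diff X u N L"
  obtains K where "0 \<le> K" "\<And>\<phi> \<psi>. \<phi> \<in> H1r \<Longrightarrow> \<psi> \<in> H1r \<Longrightarrow> H1sq \<phi> + H1sq \<psi> \<le> 1 \<Longrightarrow>
      \<bar>X (\<lambda>x. u x + \<phi> x) (\<lambda>x. N x + \<psi> x) - X u N - L \<phi> \<psi>\<bar> \<le> K * (H1sq \<phi> + H1sq \<psi>)"
  using assms unfolding quad_diff_def by blast

context coupling_constants
begin

lemma quad_diff_Qf:
  assumes "u \<in> H1r" "N \<in> H1r"
  shows "\<exists>L. quad_diff (\<lambda>u N. Qf u) u N L"
  unfolding Qf_def using quad_diff_lincomb[OF quad_diff_Dir(1)[OF assms] quad_diff_Mass(1)[OF assms]] by blast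

lemma quad_diff_Cf:
  assumes "u \<in> H1r" "N \<in> H1r"
  shows "\<exists>L. quad_diff Cf u N L"
proof -
  obtain L1 where L1: "quad_diff (\<lambda>u N. a / 2 * Cub u N + q / (16 * m\<^sup>2) * Quart u) u N L1"
    using quad_diff_lincomb[OF quad_diff_Cub[OF assms] quad_diff_Quart[OF assms]] by blast
  obtain L2 where L2: "quad_diff (\<lambda>u N. Pf N) u N L2"
    unfolding Pf_def using quad_diff_lincomb[OF quad_diff_Dir(2)[OF assms] quad_diff_Mass(2)[OF assms]] by blast
  have "Cf = (\<lambda>u N. (- 1) * (a / 2 * Cub u N + q / (16 * m\<^sup>2) * Quart u) + (- 1) * Pf N)"
    by (auto simp: Cf_def fun_eq_iff)
  then show ?thesis using quad_diff_lincomb[OF L1 L2, of "- 1" "- 1"] by auto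
qed

lemma quad_diff_ray:
  assumes "quad_diff (\<lambda>u N. Qf u) u N LQ" "quad_diff Cf u N LC" "quad_diff (\<lambda>u N. CSE u) u N LB"
  shows "quad_diff (\<lambda>u N. ray \<epsilon> u N t) u N (\<lambda>\<phi> \<psi>. t * LQ \<phi> \<psi> - t\<^sup>2 * LC \<phi> \<psi> + \<epsilon> * t ^ 3 * LB \<phi> \<psi>)"
  using quad_diff_lincomb[OF quad_diff_lincomb[OF assms(1,2), of t "- t\<^sup>2"] assms(3), of 1 "\<epsilon> * t ^ 3"]
  by (simp add: ray_def)

text \<open>An envelope argument. Let \<open>l t\<close> be the derivative of the ray value at time \<open>t\<close> in a fixed direction. The
  ray of the pair moved by \<open>s\<close> in this direction reaches \<open>f\<close> at some \<open>t\<close>, whereas the original ray is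
  at most \<open>f - (t - t0)\<^sup>2 / 4\<close>. Hence \<open>0 \<le> s l(t) - (t - t0)\<^sup>2 / 4 + O(s\<^sup>2)\<close>. As \<open>l\<close> is Lipschitz, replacing
  \<open>l t\<close> by \<open>l t0\<close> costs at most \<open>M |s| |t - t0|\<close>, which the quadratic gain absorbs. Since \<open>s\<close> may have
  either sign, \<open>l t0 = 0\<close>.\<close>

lemma ray_stationary:
  assumes u: "u \<in> H1r" "N \<in> H1r" "Cf u N = 1" "Qf u \<le> T" and T: "0 < T"
    and \<epsilon>: "0 < \<epsilon>" "12 * \<epsilon> * KB * T ^ 4 \<le> 1"
    and max: "\<And>t. t \<in> {0..2 * T} \<Longrightarrow> ray \<epsilon> u N t \<le> f" and "0 < f"
    and reach: "\<And>v M. v \<in> H1r \<Longrightarrow> M \<in> H1r \<Longrightarrow> 1 / 4 \<le> Cf v M \<Longrightarrow> \<exists>t\<in>{0..2 * T}. f \<le> ray \<epsilon> v M t"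
    and LQ: "quad_diff (\<lambda>u N. Qf u) u N LQ" and LC: "quad_diff Cf u N LC" and LB: "quad_diff (\<lambda>u N. CSE u) u N LB"
  obtains t0 where "0 < t0" "\<And>\<phi> \<psi>. \<phi> \<in> H1r \<Longrightarrow> \<psi> \<in> H1r \<Longrightarrow> t0 * LQ \<phi> \<psi> - t0\<^sup>2 * LC \<phi> \<psi> + \<epsilon> * t0 ^ 3 * LB \<phi> \<psi> = 0"
proof -
  obtain t0 where t0: "t0 \<in> {0..2 * T}" "f \<le> ray \<epsilon> u N t0" using reach[OF u(1,2)] u(3) by auto
  have "ray \<epsilon> u N t0 = f" using max[OF t0(1)] t0(2) by simp
  then have "t0 \<noteq> 0" using \<open>0 < f\<close> by (auto simp: ray_def)
  then have t0': "0 < t0" "t0 \<le> 2 * T" using t0(1) by auto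
  have B0: "CSE u \<le> KB * T ^ 3"
  proof -
    have "(Qf u) ^ 3 \<le> T ^ 3" by (intro power_mono u(4) Qf_nonneg)
    then show ?thesis using CSE_le_Qf[OF u(1)] mult_left_mono[of _ "T ^ 3" KB] KB_pos by (meson less_imp_le order_trans)
  qed
  have conc: "ray \<epsilon> u N t \<le> f - (t - t0)\<^sup>2 / 4" if "t \<in> {0..2 * T}" for t
  proof -
    have "(ray \<epsilon> u N t + ray \<epsilon> u N t0) / 2 + (t - t0)\<^sup>2 / 8 \<le> ray \<epsilon> u N ((t + t0) / 2)"
      unfolding ray_def u(3) mult_1_right
      by (rule cubic_strictly_concave[OF T CSE_nonneg B0 less_imp_le[OF \<epsilon>(1)] \<epsilon>(2)]) (use that t0' in auto)
    also have "\<dots> \<le> f" using that t0' by (intro max) auto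
    finally have "(ray \<epsilon> u N t + f) / 2 + (t - t0)\<^sup>2 / 8 \<le> f" unfolding \<open>ray \<epsilon> u N t0 = f\<close> .
    then have "(ray \<epsilon> u N t + f) + (t - t0)\<^sup>2 / 4 \<le> 2 * f" by (simp add: field_simps)
    then show ?thesis by (simp add: algebra_simps)
  qed
  obtain KQ where KQ: "0 \<le> KQ" "\<And>\<phi> \<psi>. \<phi> \<in> H1r \<Longrightarrow> \<psi> \<in> H1r \<Longrightarrow> H1sq \<phi> + H1sq \<psi> \<le> 1 \<Longrightarrow>
      \<bar>Qf (\<lambda>x. u x + \<phi> x) - Qf u - LQ \<phi> \<psi>\<bar> \<le> KQ * (H1sq \<phi> + H1sq \<psi>)"
    by (rule quad_diff_remainder[OF LQ]) (rule that)
  obtain KC where KC: "0 \<le> KC" "\<And>\<phi> \<psi>. \<phi> \<in> H1r \<Longrightarrow> \<psi> \<in> H1r \<Longrightarrow> H1sq \<phi> + H1sq \<psi> \<le> 1 \<Longrightarrow>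
      \<bar>Cf (\<lambda>x. u x + \<phi> x) (\<lambda>x. N x + \<psi> x) - Cf u N - LC \<phi> \<psi>\<bar> \<le> KC * (H1sq \<phi> + H1sq \<psi>)"
    by (rule quad_diff_remainder[OF LC]) (rule that)
  obtain KS where KS: "0 \<le> KS" "\<And>\<phi> \<psi>. \<phi> \<in> H1r \<Longrightarrow> \<psi> \<in> H1r \<Longrightarrow> H1sq \<phi> + H1sq \<psi> \<le> 1 \<Longrightarrow>
      \<bar>CSE (\<lambda>x. u x + \<phi> x) - CSE u - LB \<phi> \<psi>\<bar> \<le> KS * (H1sq \<phi> + H1sq \<psi>)"
    by (rule quad_diff_remainder[OF LB]) (rule that)
  have hom: "LQ (\<lambda>x. c * \<phi> x) (\<lambda>x. c * \<psi> x) = c * LQ \<phi> \<psi>" "LC (\<lambda>x. c * \<phi> x) (\<lambda>x. c * \<psi> x) = c * LC \<phi> \<psi>"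
    "LB (\<lambda>x. c * \<phi> x) (\<lambda>x. c * \<psi> x) = c * LB \<phi> \<psi>" if "\<phi> \<in> H1r" "\<psi> \<in> H1r" for c \<phi> \<psi>
    using quad_diff_homogeneous[OF LQ that] quad_diff_homogeneous[OF LC that] quad_diff_homogeneous[OF LB that] by auto
  show thesis
  proof (rule that[OF t0'(1)])
    fix \<phi> \<psi> assume \<phi>: "\<phi> \<in> H1r" and \<psi>: "\<psi> \<in> H1r"
    define E where "E = H1sq \<phi> + H1sq \<psi>"
    have E0: "0 \<le> E" using H1sq_nonneg[of \<phi>] H1sq_nonneg[of \<psi>] by (simp add: E_def)
    define lq lc lb where "lq = LQ \<phi> \<psi>" and "lc = LC \<phi> \<psi>" and "lb = LB \<phi> \<psi>"
    define l where "l t = t * lq - t\<^sup>2 * lc + \<epsilon> * t ^ 3 * lb" for t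
    define M where "M = \<bar>lq\<bar> + 4 * T * \<bar>lc\<bar> + \<epsilon> * (12 * T\<^sup>2) * \<bar>lb\<bar>"
    define K where "K = (2 * T * KQ + (2 * T)\<^sup>2 * KC + \<epsilon> * (2 * T) ^ 3 * KS) * E"
    have M0: "0 \<le> M" unfolding M_def using T \<epsilon>(1) by simp
    have K0: "0 \<le> K" unfolding K_def using T \<epsilon>(1) KQ(1) KC(1) KS(1) E0 by simp
    \<comment> \<open>for \<open>|s| \<le> d\<close> the perturbation has norm at most one and \<open>Cf\<close> stays above \<open>1 / 4\<close>\<close>
    define d where "d = 1 / (1 + E + 4 * \<bar>lc\<bar> + 4 * KC * E)"
    have den: "1 \<le> 1 + E + 4 * \<bar>lc\<bar> + 4 * KC * E" using E0 KC(1) by simp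
    have d: "0 < d" "d \<le> 1" using den unfolding d_def by (simp_all add: divide_le_eq_1)
    have dE: "d * E \<le> 1" "d * (4 * \<bar>lc\<bar>) + d * (4 * KC * E) \<le> 1"
    proof -
      have "d * (1 + E + 4 * \<bar>lc\<bar> + 4 * KC * E) = 1" using den unfolding d_def by simp
      then have e: "d + d * E + d * (4 * \<bar>lc\<bar>) + d * (4 * KC * E) = 1" by (simp add: algebra_simps)
      have "0 \<le> d * E" "0 \<le> d * (4 * \<bar>lc\<bar>)" "0 \<le> d * (4 * KC * E)" using d E0 KC(1) by simp_all
      then show "d * E \<le> 1" "d * (4 * \<bar>lc\<bar>) + d * (4 * KC * E) \<le> 1" using e d(1) by linarith+
    qed
    have "l t0 = 0"
    proof (rule zero_slope[OF d(1), of "M\<^sup>2 + K"])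
      show "0 \<le> M\<^sup>2 + K" using K0 by simp
      fix s :: real assume s: "\<bar>s\<bar> \<le> d"
      have s2: "s\<^sup>2 \<le> d"
      proof -
        have "s\<^sup>2 = \<bar>s\<bar> * \<bar>s\<bar>" by (simp add: power2_eq_square)
        also have "\<dots> \<le> d * 1" using s d by (intro mult_mono) auto
        finally show ?thesis by simp
      qed
      let ?\<phi> = "\<lambda>x. s * \<phi> x" and ?\<psi> = "\<lambda>x. s * \<psi> x"
      have H: "?\<phi> \<in> H1r" "?\<psi> \<in> H1r" using \<phi> \<psi> by (auto intro: H1r_scale)
      have Es: "H1sq ?\<phi> + H1sq ?\<psi> = s\<^sup>2 * E" unfolding H1sq_scale[OF \<phi>] H1sq_scale[OF \<psi>] E_def by (simp add: algebra_simps)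
      have Es1: "H1sq ?\<phi> + H1sq ?\<psi> \<le> 1" unfolding Es using mult_right_mono[OF s2 E0] dE(1) by linarith
      define v V where "v = (\<lambda>x. u x + ?\<phi> x)" and "V = (\<lambda>x. N x + ?\<psi> x)"
      have vH: "v \<in> H1r" "V \<in> H1r" unfolding v_def V_def by (intro H1r_add u H)+
      have dQ: "\<bar>Qf v - Qf u - s * lq\<bar> \<le> KQ * (s\<^sup>2 * E)"
        using KQ(2)[OF H Es1] unfolding hom[OF \<phi> \<psi>] Es v_def lq_def .
      have dC: "\<bar>Cf v V - 1 - s * lc\<bar> \<le> KC * (s\<^sup>2 * E)"
        using KC(2)[OF H Es1] unfolding hom[OF \<phi> \<psi>] Es v_def V_def lc_def u(3) .
      have dB: "\<bar>CSE v - CSE u - s * lb\<bar> \<le> KS * (s\<^sup>2 * E)"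
        using KS(2)[OF H Es1] unfolding hom[OF \<phi> \<psi>] Es v_def lb_def .
      have "1 / 4 \<le> Cf v V"
      proof -
        have "\<bar>s * lc\<bar> \<le> d * \<bar>lc\<bar>" unfolding abs_mult using s by (intro mult_right_mono) auto
        moreover have "KC * (s\<^sup>2 * E) \<le> d * (KC * E)"
        proof -
          have "s\<^sup>2 * (KC * E) \<le> d * (KC * E)" using s2 KC(1) E0 by (intro mult_right_mono) auto
          then show ?thesis by (simp add: mult_ac)
        qed
        moreover have "4 * (d * \<bar>lc\<bar>) + 4 * (d * (KC * E)) \<le> 1" using dE(2) by (simp add: mult_ac)
        ultimately show ?thesis using dC by linarith
      qed
      then obtain t where t: "t \<in> {0..2 * T}" "f \<le> ray \<epsilon> v V t" using reach[OF vH] by blast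
      have tb: "0 \<le> t" "t \<le> 2 * T" using t(1) by auto
      have up: "ray \<epsilon> v V t \<le> ray \<epsilon> u N t + s * l t + K * s\<^sup>2"
      proof -
        have t2: "t\<^sup>2 \<le> (2 * T)\<^sup>2" "t ^ 3 \<le> (2 * T) ^ 3" by (rule power_mono[OF tb(2) tb(1)])+
        define rQ rC rB where "rQ = Qf v - Qf u - s * lq" and "rC = Cf v V - 1 - s * lc" and "rB = CSE v - CSE u - s * lb"
        have e: "Qf v = Qf u + s * lq + rQ" "Cf v V = 1 + s * lc + rC" "CSE v = CSE u + s * lb + rB"
          by (simp_all add: rQ_def rC_def rB_def)
        have "ray \<epsilon> v V t = ray \<epsilon> u N t + s * l t + (t * rQ - t\<^sup>2 * rC + \<epsilon> * t ^ 3 * rB)"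
          unfolding ray_def l_def e u(3) by (simp add: algebra_simps)
        moreover have "t * rQ \<le> 2 * T * (KQ * (s\<^sup>2 * E))"
        proof -
          have "t * rQ \<le> t * (KQ * (s\<^sup>2 * E))" using dQ tb unfolding rQ_def by (intro mult_left_mono) auto
          also have "\<dots> \<le> 2 * T * (KQ * (s\<^sup>2 * E))" using tb KQ(1) E0 by (intro mult_right_mono) auto
          finally show ?thesis .
        qed
        moreover have "- (t\<^sup>2 * rC) \<le> (2 * T)\<^sup>2 * (KC * (s\<^sup>2 * E))"
        proof -
          have "t\<^sup>2 * (- rC) \<le> t\<^sup>2 * (KC * (s\<^sup>2 * E))" using dC unfolding rC_def by (intro mult_left_mono) auto
          also have "\<dots> \<le> (2 * T)\<^sup>2 * (KC * (s\<^sup>2 * E))" using t2 KC(1) E0 by (intro mult_right_mono) auto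
          finally show ?thesis by simp
        qed
        moreover have "\<epsilon> * t ^ 3 * rB \<le> \<epsilon> * (2 * T) ^ 3 * (KS * (s\<^sup>2 * E))"
        proof -
          have "\<epsilon> * t ^ 3 * rB \<le> \<epsilon> * t ^ 3 * (KS * (s\<^sup>2 * E))" using dB tb \<epsilon>(1) unfolding rB_def by (intro mult_left_mono) auto
          also have "\<dots> \<le> \<epsilon> * (2 * T) ^ 3 * (KS * (s\<^sup>2 * E))" using t2 \<epsilon>(1) KS(1) E0 by (intro mult_right_mono mult_left_mono) auto
          finally show ?thesis .
        qed
        moreover have "2 * T * (KQ * (s\<^sup>2 * E)) + (2 * T)\<^sup>2 * (KC * (s\<^sup>2 * E)) + \<epsilon> * (2 * T) ^ 3 * (KS * (s\<^sup>2 * E)) = K * s\<^sup>2"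
          unfolding K_def by (simp add: algebra_simps)
        ultimately show ?thesis by linarith
      qed
      define D where "D = \<bar>t - t0\<bar>"
      have osc: "\<bar>l t - l t0\<bar> \<le> M * D"
      proof -
        have e: "l t - l t0 = (t - t0) * (lq - (t + t0) * lc + \<epsilon> * (t\<^sup>2 + t * t0 + t0\<^sup>2) * lb)"
          unfolding l_def by (simp add: power2_eq_square power3_eq_cube algebra_simps)
        have b1: "\<bar>(t + t0) * lc\<bar> \<le> 4 * T * \<bar>lc\<bar>" unfolding abs_mult using tb t0' by (intro mult_right_mono) auto
        have b2: "\<bar>\<epsilon> * (t\<^sup>2 + t * t0 + t0\<^sup>2) * lb\<bar> \<le> \<epsilon> * (12 * T\<^sup>2) * \<bar>lb\<bar>"
        proof -
          have "t\<^sup>2 \<le> (2 * T)\<^sup>2" by (rule power_mono[OF tb(2) tb(1)])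
          moreover have "t0\<^sup>2 \<le> (2 * T)\<^sup>2" by (rule power_mono) (use t0' in auto)
          moreover have "t * t0 \<le> (2 * T) * (2 * T)" by (rule mult_mono) (use tb t0' in auto)
          ultimately have "t\<^sup>2 + t * t0 + t0\<^sup>2 \<le> 12 * T\<^sup>2" by (simp add: power2_eq_square)
          moreover have "0 \<le> t\<^sup>2 + t * t0 + t0\<^sup>2" using tb t0' by simp
          ultimately have "\<epsilon> * (t\<^sup>2 + t * t0 + t0\<^sup>2) * \<bar>lb\<bar> \<le> \<epsilon> * (12 * T\<^sup>2) * \<bar>lb\<bar>"
            using \<epsilon>(1) by (intro mult_right_mono mult_left_mono) auto
          then show ?thesis using \<open>0 \<le> t\<^sup>2 + t * t0 + t0\<^sup>2\<close> \<epsilon>(1) by (simp add: abs_mult)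
        qed
        have "\<bar>lq - (t + t0) * lc + \<epsilon> * (t\<^sup>2 + t * t0 + t0\<^sup>2) * lb\<bar> \<le> M" unfolding M_def using b1 b2 by linarith
        then have "\<bar>t - t0\<bar> * \<bar>lq - (t + t0) * lc + \<epsilon> * (t\<^sup>2 + t * t0 + t0\<^sup>2) * lb\<bar> \<le> D * M"
          unfolding D_def by (intro mult_left_mono) auto
        then show ?thesis unfolding e abs_mult by (simp add: mult.commute)
      qed
      have "s * l t \<le> s * l t0 + \<bar>s\<bar> * (M * D)"
      proof -
        have "s * (l t - l t0) \<le> \<bar>s\<bar> * \<bar>l t - l t0\<bar>" by (metis abs_ge_self abs_mult)
        also have "\<dots> \<le> \<bar>s\<bar> * (M * D)" by (intro mult_left_mono osc) simp
        finally show ?thesis by (simp add: algebra_simps)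
      qed
      \<comment> \<open>Young's inequality, matched to the constant \<open>1 / 4\<close> of the concavity estimate\<close>
      moreover have "\<bar>s\<bar> * (M * D) \<le> D\<^sup>2 / 4 + M\<^sup>2 * s\<^sup>2"
      proof -
        have "0 \<le> (D / 2 - M * \<bar>s\<bar>)\<^sup>2" by simp
        also have "\<dots> = D\<^sup>2 / 4 - \<bar>s\<bar> * (M * D) + M\<^sup>2 * \<bar>s\<bar>\<^sup>2" by (simp add: power2_eq_square algebra_simps)
        finally show ?thesis by simp
      qed
      moreover have "ray \<epsilon> u N t \<le> f - D\<^sup>2 / 4" using conc[OF t(1)] by (simp add: D_def)
      ultimately have "0 \<le> s * l t0 + M\<^sup>2 * s\<^sup>2 + K * s\<^sup>2" using up t(2) by linarith
      then show "0 \<le> s * l t0 + (M\<^sup>2 + K) * s\<^sup>2" by (simp add: algebra_simps)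
    qed
    then show "t0 * LQ \<phi> \<psi> - t0\<^sup>2 * LC \<phi> \<psi> + \<epsilon> * t0 ^ 3 * LB \<phi> \<psi> = 0"
      unfolding l_def lq_def lc_def lb_def .
  qed
qed

lemma I_functional_ray:
  assumes "u \<in> H1r" "N \<in> H1r" "0 \<le> t"
  shows "I_functional m \<omega> \<kappa> q e (\<lambda>x. sqrt t * u x) (\<lambda>x. t * N x) = ray (e ^ 4 / (4 * m * \<kappa>\<^sup>2)) u N t"
proof -
  let ?u = "\<lambda>x. sqrt t * u x" and ?N = "\<lambda>x. t * N x"
  have "I_functional m \<omega> \<kappa> q e ?u ?N = Qf ?u - Cf ?u ?N + e ^ 4 / (4 * m * \<kappa>\<^sup>2) * CSE ?u"
    unfolding I_functional_def CSE_eq[OF H1r_scale[OF assms(1)]] Qf_def Cf_def Pf_def a_def Dir_def Mass_def Cub_def Quart_def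
    by simp
  then show ?thesis unfolding form_scaling[OF assms] ray_def by simp
qed

text \<open>A perturbation \<open>(\<phi>, \<psi>)\<close> of \<open>(\<surd>t0 u, t0 N)\<close> is the time \<open>t0\<close> point of the ray through the pair perturbed by
  \<open>(\<phi> / \<surd>t0, \<psi> / t0)\<close>, so the functional changes only by the quadratic remainder of the ray.\<close>

lemma critical_point_of_stationary_ray:
  assumes u: "u \<in> H1r" "N \<in> H1r" and t0: "0 < t0" and \<epsilon>: "\<epsilon> = e ^ 4 / (4 * m * \<kappa>\<^sup>2)"
    and LQ: "quad_diff (\<lambda>u N. Qf u) u N LQ" and LC: "quad_diff Cf u N LC" and LB: "quad_diff (\<lambda>u N. CSE u) u N LB"
    and zero: "\<And>\<phi> \<psi>. \<phi> \<in> H1r \<Longrightarrow> \<psi> \<in> H1r \<Longrightarrow> t0 * LQ \<phi> \<psi> - t0\<^sup>2 * LC \<phi> \<psi> + \<epsilon> * t0 ^ 3 * LB \<phi> \<psi> = 0"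
  shows "weak_solution m \<omega> \<kappa> q e (\<lambda>x. sqrt t0 * u x) (\<lambda>x. t0 * N x)"
  unfolding weak_solution_def critical_point_def
proof (intro conjI allI impI)
  show "(\<lambda>x. sqrt t0 * u x) \<in> H1r" "(\<lambda>x. t0 * N x) \<in> H1r" by (intro H1r_scale u)+
  obtain K where K: "0 \<le> K" "\<And>\<phi> \<psi>. \<phi> \<in> H1r \<Longrightarrow> \<psi> \<in> H1r \<Longrightarrow> H1sq \<phi> + H1sq \<psi> \<le> 1 \<Longrightarrow>
      \<bar>ray \<epsilon> (\<lambda>x. u x + \<phi> x) (\<lambda>x. N x + \<psi> x) t0 - ray \<epsilon> u N t0\<bar> \<le> K * (H1sq \<phi> + H1sq \<psi>)"
  proof (rule quad_diff_remainder[OF quad_diff_ray[OF LQ LC LB, of \<epsilon> t0]])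
    fix K assume "0 \<le> K" and K: "\<And>\<phi> \<psi>. \<phi> \<in> H1r \<Longrightarrow> \<psi> \<in> H1r \<Longrightarrow> H1sq \<phi> + H1sq \<psi> \<le> 1 \<Longrightarrow>
      \<bar>ray \<epsilon> (\<lambda>x. u x + \<phi> x) (\<lambda>x. N x + \<psi> x) t0 - ray \<epsilon> u N t0 - (t0 * LQ \<phi> \<psi> - t0\<^sup>2 * LC \<phi> \<psi> + \<epsilon> * t0 ^ 3 * LB \<phi> \<psi>)\<bar>
      \<le> K * (H1sq \<phi> + H1sq \<psi>)"
    show thesis
    proof (rule that[OF \<open>0 \<le> K\<close>])
      fix \<phi> \<psi> assume "\<phi> \<in> H1r" "\<psi> \<in> H1r" "H1sq \<phi> + H1sq \<psi> \<le> 1"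
      from K[OF this] show "\<bar>ray \<epsilon> (\<lambda>x. u x + \<phi> x) (\<lambda>x. N x + \<psi> x) t0 - ray \<epsilon> u N t0\<bar> \<le> K * (H1sq \<phi> + H1sq \<psi>)"
        unfolding zero[OF \<open>\<phi> \<in> H1r\<close> \<open>\<psi> \<in> H1r\<close>] by simp
    qed
  qed
  \<comment> \<open>the factor by which the rescaling of the perturbation can enlarge \<open>H1sq\<close>\<close>
  define c where "c = 1 / t0 + 1 / t0\<^sup>2"
  have c: "0 < c" using t0 by (simp add: c_def add_pos_pos)
  fix \<eta> :: real assume "0 < \<eta>"
  define \<delta> where "\<delta> = min (1 / (c + 1)) (\<eta> / (K * c + 1))"
  have Kc: "0 \<le> K * c" using K(1) c by simp
  have \<delta>: "0 < \<delta>" using c Kc \<open>0 < \<eta>\<close> by (simp add: \<delta>_def add_nonneg_pos)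
  show "\<exists>\<delta>>0. \<forall>\<phi>\<in>H1r. \<forall>\<psi>\<in>H1r. H1_pair_norm \<phi> \<psi> < \<delta> \<longrightarrow>
      \<bar>I_functional m \<omega> \<kappa> q e (\<lambda>x. sqrt t0 * u x + \<phi> x) (\<lambda>x. t0 * N x + \<psi> x) - I_functional m \<omega> \<kappa> q e (\<lambda>x. sqrt t0 * u x) (\<lambda>x. t0 * N x)\<bar>
      \<le> \<eta> * H1_pair_norm \<phi> \<psi>"
  proof (intro exI[of _ \<delta>] conjI \<delta> ballI impI)
    fix \<phi> \<psi> assume \<phi>: "\<phi> \<in> H1r" and \<psi>: "\<psi> \<in> H1r" and small: "H1_pair_norm \<phi> \<psi> < \<delta>"
    define n where "n = H1_pair_norm \<phi> \<psi>"
    have n: "n = sqrt (H1sq \<phi> + H1sq \<psi>)" unfolding n_def H1_pair_norm_def H1sq_def Dir_def Mass_def by (simp add: add.assoc)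
    have n2: "n * n = H1sq \<phi> + H1sq \<psi>" "0 \<le> n" unfolding n using H1sq_nonneg[of \<phi>] H1sq_nonneg[of \<psi>] by auto
    let ?\<phi> = "\<lambda>x. (1 / sqrt t0) * \<phi> x" and ?\<psi> = "\<lambda>x. (1 / t0) * \<psi> x"
    have H: "?\<phi> \<in> H1r" "?\<psi> \<in> H1r" by (intro H1r_scale \<phi> \<psi>)+
    have le: "H1sq ?\<phi> + H1sq ?\<psi> \<le> c * (n * n)"
    proof -
      have "H1sq ?\<phi> + H1sq ?\<psi> = 1 / t0 * H1sq \<phi> + 1 / t0\<^sup>2 * H1sq \<psi>"
        unfolding H1sq_scale[OF \<phi>] H1sq_scale[OF \<psi>] using t0 by (simp add: power_divide)
      also have "\<dots> \<le> c * H1sq \<phi> + c * H1sq \<psi>"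
        using t0 H1sq_nonneg by (intro add_mono mult_right_mono) (auto simp: c_def)
      finally show ?thesis by (simp add: n2 algebra_simps)
    qed
    have nd: "n \<le> 1 / (c + 1)" "n \<le> \<eta> / (K * c + 1)" using small unfolding n_def[symmetric] \<delta>_def by auto
    have "c * n \<le> 1"
    proof -
      have "(c + 1) * n \<le> 1" using nd(1) c by (simp add: pos_le_divide_eq mult.commute)
      then show ?thesis using n2(2) by (simp add: algebra_simps)
    qed
    have n1: "n \<le> 1"
    proof -
      have "(c + 1) * n \<le> 1" using nd(1) c by (simp add: pos_le_divide_eq mult.commute)
      moreover have "0 \<le> c * n" using c n2(2) by simp
      ultimately show ?thesis by (simp add: algebra_simps)
    qed
    have "c * (n * n) \<le> 1 * 1" unfolding mult.assoc[symmetric] using \<open>c * n \<le> 1\<close> n1 n2(2) c by (intro mult_mono) auto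
    then have le1: "H1sq ?\<phi> + H1sq ?\<psi> \<le> 1" using le by simp
    have e1: "(\<lambda>x. sqrt t0 * u x + \<phi> x) = (\<lambda>x. sqrt t0 * (u x + ?\<phi> x))" "(\<lambda>x. t0 * N x + \<psi> x) = (\<lambda>x. t0 * (N x + ?\<psi> x))"
      using t0 by (auto simp: fun_eq_iff algebra_simps)
    have "\<bar>I_functional m \<omega> \<kappa> q e (\<lambda>x. sqrt t0 * u x + \<phi> x) (\<lambda>x. t0 * N x + \<psi> x) - I_functional m \<omega> \<kappa> q e (\<lambda>x. sqrt t0 * u x) (\<lambda>x. t0 * N x)\<bar>
       = \<bar>ray \<epsilon> (\<lambda>x. u x + ?\<phi> x) (\<lambda>x. N x + ?\<psi> x) t0 - ray \<epsilon> u N t0\<bar>"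
      unfolding e1 I_functional_ray[OF H1r_add[OF u(1) H(1)] H1r_add[OF u(2) H(2)] less_imp_le[OF t0]] I_functional_ray[OF u less_imp_le[OF t0]] \<epsilon> ..
    also have "\<dots> \<le> K * (H1sq ?\<phi> + H1sq ?\<psi>)" by (rule K(2)[OF H le1])
    also have "\<dots> \<le> K * (c * (n * n))" by (intro mult_left_mono le K(1))
    also have "\<dots> = (K * c * n) * n" by simp
    also have "\<dots> \<le> \<eta> * n"
    proof (rule mult_right_mono[OF _ n2(2)])
      have "0 < K * c + 1" using Kc by simp
      then have "(K * c + 1) * n \<le> \<eta>" using nd(2) by (simp add: pos_le_divide_eq mult.commute)
      then show "K * c * n \<le> \<eta>" using n2(2) by (simp add: algebra_simps)
    qed
    finally show "\<bar>I_functional m \<omega> \<kappa> q e (\<lambda>x. sqrt t0 * u x + \<phi> x) (\<lambda>x. t0 * N x + \<psi> x) - I_functional m \<omega> \<kappa> q e (\<lambda>x. sqrt t0 * u x) (\<lambda>x. t0 * N x)\<bar>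
      \<le> \<eta> * H1_pair_norm \<phi> \<psi>" unfolding n_def .
  qed
qed

lemma exists_solution:
  assumes z: "us \<in> H1r" "Ns \<in> H1r" "Cf us Ns = 1" and T: "T = Qf us + 3" and \<epsilon>: "\<epsilon> = e ^ 4 / (4 * m * \<kappa>\<^sup>2)"
    and small: "0 < \<epsilon>" "\<epsilon> * T ^ 3 * CSE us \<le> 1 / 4" "12 * \<epsilon> * KB * T ^ 4 \<le> 1"
  shows "\<exists>u N. weak_solution m \<omega> \<kappa> q e u N \<and> nontrivial u N"
proof -
  obtain u N where u: "u \<in> H1r" "N \<in> H1r" "Cf u N = 1" "Qf u \<le> T"
    and max: "\<And>t. t \<in> {0..2 * T} \<Longrightarrow> ray \<epsilon> u N t \<le> level \<epsilon> T" and ne: "level_set \<epsilon> T \<noteq> {}"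
    by (rule level_minimizer[OF z T small]) (rule that)
  have T0: "0 < T" using T Qf_nonneg[of us] by simp
  obtain LQ where LQ: "quad_diff (\<lambda>u N. Qf u) u N LQ" using quad_diff_Qf[OF u(1,2)] by blast
  obtain LC where LC: "quad_diff Cf u N LC" using quad_diff_Cf[OF u(1,2)] by blast
  note LB = quad_diff_CSE[OF u(1,2)]
  have pos: "0 < level \<epsilon> T" using level_pos[OF ne T0] small(1) by simp
  obtain t0 where t0: "0 < t0" and zero: "\<And>\<phi> \<psi>. \<phi> \<in> H1r \<Longrightarrow> \<psi> \<in> H1r \<Longrightarrow> t0 * LQ \<phi> \<psi> - t0\<^sup>2 * LC \<phi> \<psi> + \<epsilon> * t0 ^ 3 *
      (2 * CS_form (\<lambda>x. u x * \<phi> x) (\<lambda>x. (u x)\<^sup>2) (\<lambda>x. (u x)\<^sup>2) + 4 * CS_form (\<lambda>x. (u x)\<^sup>2) (\<lambda>x. u x * \<phi> x) (\<lambda>x. (u x)\<^sup>2)) = 0"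
  proof (rule ray_stationary[OF u T0 small(1,3)])
    show "ray \<epsilon> u N t \<le> level \<epsilon> T" if "t \<in> {0..2 * T}" for t by (rule max[OF that])
    show "0 < level \<epsilon> T" by (rule pos)
    show "\<exists>t\<in>{0..2 * T}. level \<epsilon> T \<le> ray \<epsilon> v M t" if "v \<in> H1r" "M \<in> H1r" "1 / 4 \<le> Cf v M" for v M
      by (rule level_reached[OF that T0])
  qed (rule LQ LC LB that; assumption)+
  have "weak_solution m \<omega> \<kappa> q e (\<lambda>x. sqrt t0 * u x) (\<lambda>x. t0 * N x)"
    by (rule critical_point_of_stationary_ray[OF u(1,2) t0 \<epsilon> LQ LC LB zero])
  moreover have "nontrivial (\<lambda>x. sqrt t0 * u x) (\<lambda>x. t0 * N x)"
    unfolding nontrivial_def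
  proof
    assume "AE x in lborel. sqrt t0 * u x = 0 \<and> t0 * N x = 0"
    then have ae: "AE x in lborel. u x = 0" by eventually_elim (use t0 in auto)
    note [measurable] = H1r_D(4)[OF u(1)]
    \<comment> \<open>\<open>u = 0\<close> is excluded because \<open>Cf u N = 1\<close> is at most a multiple of \<open>Quart u\<close>\<close>
    have "Quart u = 0" unfolding Quart_def
      by (rule integral_eq_zero_AE) (use ae in eventually_elim, simp)
    then show False using Cf_le_Quart[OF u(1,2)] u(3) by simp
  qed
  ultimately show ?thesis by blast
qed

end

section \<open>A Gaussian test pair\<close>

lemma test_function_integrable:
  assumes "test_function F" shows "integrable lborel F"
proof -
  obtain B R where B: "\<And>x. \<bar>F x\<bar> \<le> B * indicator (cball 0 R) x" using test_function_bound[OF assms] by metis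
  show ?thesis
  proof (rule Bochner_Integration.integrable_bound)
    show "integrable lborel (\<lambda>x :: real ^ 2. B * indicator (cball 0 R) x)"
      using emeasure_lborel_cball_finite[of "0::real^2" R] by (intro integrable_mult_right integrable_real_indicator) auto
    show "F \<in> borel_measurable lborel" using test_function_L2[OF assms] by (simp add: L2_def)
    show "AE x in lborel. norm (F x) \<le> norm (B * indicator (cball 0 R) x)"
      unfolding real_norm_def by (intro AE_I2 order_trans[OF B abs_ge_self])
  qed
qed

lemma integral_translate:
  fixes F :: "real ^ 2 \<Rightarrow> real"
  assumes [measurable]: "F \<in> borel_measurable borel"
  shows "(\<integral>x. F (c + x) \<partial>lborel) = (\<integral>x. F x \<partial>lborel)"
proof -
  have "(\<integral>x. F x \<partial>lborel) = (\<integral>x. F x \<partial>distr lborel borel ((+) c))" by (simp add: lborel_distr_plus)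
  also have "\<dots> = (\<integral>x. F (c + x) \<partial>lborel)" by (rule integral_distr) measurable
  finally show ?thesis by simp
qed

text \<open>Difference quotients have integral zero by translation invariance, and the mean value theorem
  dominates them by the bound of the partial derivative.\<close>

lemma integral_partial_test_function:
  assumes F: "test_function F"
  shows "(\<integral>x. partial i F x \<partial>lborel) = 0"
proof -
  define e where "e = (axis i 1 :: real ^ 2)"
  have ne: "norm e = 1" by (simp add: e_def norm_axis_1)
  define t where "t n = 1 / real (Suc n)" for n
  have t: "0 < t n" "t n \<le> 1" for n by (auto simp: t_def)
  have Ck: "C_k (Suc 0) F" using F by (simp only: test_function_def)
  have deriv: "((\<lambda>\<tau>. F (x + \<tau> *\<^sub>R e)) has_real_derivative partial i F (x + \<tau> *\<^sub>R e)) (at \<tau>)" for x \<tau>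
  proof -
    obtain D where D: "(F has_derivative D) (at (x + \<tau> *\<^sub>R e))" "\<And>i. D (axis i 1) = partial i F (x + \<tau> *\<^sub>R e)"
      using C_k_has_derivative[OF Ck] by blast
    have "((\<lambda>\<tau>. x + \<tau> *\<^sub>R e) has_derivative (\<lambda>h. h *\<^sub>R e)) (at \<tau>)" by (auto intro!: derivative_eq_intros)
    from has_derivative_compose[OF this D(1)] have "((\<lambda>\<tau>. F (x + \<tau> *\<^sub>R e)) has_derivative (\<lambda>h. D (h *\<^sub>R e))) (at \<tau>)" .
    moreover have "D (h *\<^sub>R e) = partial i F (x + \<tau> *\<^sub>R e) * h" for h
      using linear_scale[OF has_derivative_linear[OF D(1)], of h e] D(2)[of i] by (simp add: e_def)
    ultimately show ?thesis unfolding has_field_derivative_def by simp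
  qed
  obtain B R where B: "B \<ge> 0" "\<And>x. \<bar>partial i F x\<bar> \<le> B * indicator (cball 0 R) x"
    using test_function_bound[OF test_function_partial[OF F, of i]] by metis
  have m [measurable]: "F \<in> borel_measurable borel" "partial i F \<in> borel_measurable borel"
    using test_function_L2[OF F] test_function_L2[OF test_function_partial[OF F, of i]] by (auto simp: L2_def)
  have iF: "integrable lborel F" by (rule test_function_integrable[OF F])
  have iFt: "integrable lborel (\<lambda>x. F (c + x))" for c
  proof -
    have "integrable (distr lborel borel ((+) c)) F" using iF by (simp add: lborel_distr_plus)
    then show ?thesis by (subst (asm) integrable_distr_eq) auto
  qed
  let ?G = "\<lambda>n x. (F (t n *\<^sub>R e + x) - F x) / t n"
  have z0: "(\<integral>x. ?G n x \<partial>lborel) = 0" for n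
    using iF iFt[of "t n *\<^sub>R e"] integral_translate[OF m(1), of "t n *\<^sub>R e"] by simp
  have lim0: "(\<lambda>n. \<integral>x. ?G n x \<partial>lborel) \<longlonglongrightarrow> (\<integral>x. partial i F x \<partial>lborel)"
  proof (rule integral_dominated_convergence[where w = "\<lambda>x. B * indicator (cball 0 (R + 1)) x"])
    show "integrable lborel (\<lambda>x :: real ^ 2. B * indicator (cball 0 (R + 1)) x)"
      using emeasure_lborel_cball_finite[of "0::real^2" "R + 1"] by (intro integrable_mult_right integrable_real_indicator) auto
    show "AE x in lborel. (\<lambda>n. ?G n x) \<longlonglongrightarrow> partial i F x"
    proof (rule AE_I2)
      fix x
      have "((\<lambda>h. (F (x + h *\<^sub>R e) - F x) / h) \<longlongrightarrow> partial i F x) (at 0)"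
        using deriv[of x 0] unfolding DERIV_def by simp
      moreover have "t \<longlonglongrightarrow> 0" unfolding t_def[abs_def] using LIMSEQ_inverse_real_of_nat by (simp add: inverse_eq_divide)
      then have "filterlim t (at 0) sequentially"
        using t(1) by (auto simp: filterlim_at intro!: always_eventually less_imp_neq[symmetric])
      ultimately have "(\<lambda>n. (F (x + t n *\<^sub>R e) - F x) / t n) \<longlonglongrightarrow> partial i F x" by (rule filterlim_compose)
      then show "(\<lambda>n. ?G n x) \<longlonglongrightarrow> partial i F x" by (simp add: add.commute)
    qed
    show "AE x in lborel. norm (?G n x) \<le> B * indicator (cball 0 (R + 1)) x" for n
    proof (rule AE_I2)
      fix x :: "real ^ 2"
      obtain z where z: "0 < z" "z < t n" "F (x + t n *\<^sub>R e) - F (x + 0 *\<^sub>R e) = (t n - 0) * partial i F (x + z *\<^sub>R e)"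
        using MVT2[OF t(1)[of n], of "\<lambda>\<tau>. F (x + \<tau> *\<^sub>R e)" "\<lambda>\<tau>. partial i F (x + \<tau> *\<^sub>R e)"] deriv by blast
      have "?G n x = partial i F (x + z *\<^sub>R e)" using z(3) t(1)[of n] by (simp add: add.commute)
      then have "norm (?G n x) \<le> B * indicator (cball 0 R) (x + z *\<^sub>R e)" using B(2) by simp
      also have "\<dots> \<le> B * indicator (cball 0 (R + 1)) x"
      proof (rule mult_left_mono[OF _ B(1)])
        have "norm x \<le> norm (x + z *\<^sub>R e) + norm (z *\<^sub>R e)" using norm_triangle_ineq4[of "x + z *\<^sub>R e" "z *\<^sub>R e"] by simp
        also have "norm (z *\<^sub>R e) \<le> 1" using z(1,2) t(2)[of n] by (simp add: ne)
        finally show "indicator (cball 0 R) (x + z *\<^sub>R e) \<le> (indicator (cball 0 (R + 1)) x :: real)"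
          by (auto simp: indicator_def)
      qed
      finally show "norm (?G n x) \<le> B * indicator (cball 0 (R + 1)) x" .
    qed
  qed measurable
  from lim0 show ?thesis unfolding z0 by (simp add: LIMSEQ_const_iff)
qed

definition gaussian :: "real \<Rightarrow> real ^ 2 \<Rightarrow> real" where
  "gaussian s x = exp (- (s * (norm x)\<^sup>2))"

lemma radial_exponential_integral:
  fixes f F :: "real \<Rightarrow> real"
  assumes [measurable]: "f \<in> borel_measurable borel"
    and d: "\<And>x. 0 \<le> x \<Longrightarrow> (F has_real_derivative f x) (at x)" and nn: "\<And>x. 0 \<le> x \<Longrightarrow> 0 \<le> f x"
    and lim: "(F \<longlongrightarrow> 0) at_top" and "F 0 \<le> 0"
  shows "integrable lborel (\<lambda>x :: real ^ 2. f ((norm x)\<^sup>2))" and "(\<integral>x. f ((norm (x :: real ^ 2))\<^sup>2) \<partial>lborel) = pi * (- F 0)"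
proof -
  have "(\<integral>\<^sup>+x. ennreal (f x) * indicator {0..} x \<partial>lborel) = ennreal (0 - F 0)"
    by (rule nn_integral_FTC_atLeast[OF assms(1) d nn lim])
  also have "(\<integral>\<^sup>+x. ennreal (f x) * indicator {0..} x \<partial>lborel) = (\<integral>\<^sup>+x. ennreal (f x * indicator {0..} x) \<partial>lborel)"
    by (intro nn_integral_cong) (auto simp: indicator_def)
  finally have h: "has_bochner_integral lborel (\<lambda>x. f x * indicator {0..} x) (- F 0)"
    using nn \<open>F 0 \<le> 0\<close> by (intro has_bochner_integral_nn_integral) (auto simp: indicator_def)
  have ae: "AE x :: real in lborel. f x * indicator {0..} x = indicator {0<..} x *\<^sub>R f x"
    using AE_lborel_singleton[of 0] by eventually_elim (auto simp: indicator_def)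
  have h2: "has_bochner_integral lborel (\<lambda>x. indicator {0<..} x *\<^sub>R f x) (- F 0)"
    by (rule has_bochner_integral_cong_AE[THEN iffD1, OF _ _ ae h]) measurable
  show "integrable lborel (\<lambda>x :: real ^ 2. f ((norm x)\<^sup>2))"
    unfolding integrable_radial_iff[OF assms(1)] set_integrable_def using h2 by (simp add: has_bochner_integral_iff)
  show "(\<integral>x. f ((norm (x :: real ^ 2))\<^sup>2) \<partial>lborel) = pi * (- F 0)"
    unfolding integral_radial[OF assms(1)] set_lebesgue_integral_def using h2 by (simp add: has_bochner_integral_iff)
qed

lemma gaussian_integral:
  assumes "0 < s"
  shows "integrable lborel (gaussian s)" and "(\<integral>x. gaussian s x \<partial>lborel) = pi / s"
proof -
  have l: "((\<lambda>\<rho>. - exp (- (s * \<rho>)) / s) \<longlongrightarrow> 0) at_top" using assms by real_asymp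
  have d: "((\<lambda>\<rho>. - exp (- (s * \<rho>)) / s) has_real_derivative exp (- (s * x))) (at x)" for x
    using assms by (auto intro!: derivative_eq_intros)
  note r = radial_exponential_integral[where f = "\<lambda>\<rho>. exp (- (s * \<rho>))", OF _ d _ l]
  show "integrable lborel (gaussian s)" unfolding gaussian_def[abs_def] by (rule r(1)) (use assms in auto)
  have "(\<integral>x. gaussian s x \<partial>lborel) = pi * - (- exp (- (s * 0)) / s)"
    unfolding gaussian_def[abs_def] by (rule r(2)) (use assms in auto)
  then show "(\<integral>x. gaussian s x \<partial>lborel) = pi / s" by simp
qed

lemma gaussian_moment:
  assumes "0 < s"
  shows "integrable lborel (\<lambda>x. (norm x)\<^sup>2 * gaussian s x)" and "(\<integral>x. (norm x)\<^sup>2 * gaussian s x \<partial>lborel) = pi / s\<^sup>2"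
proof -
  let ?F = "\<lambda>\<rho>. - (\<rho> / s + 1 / s\<^sup>2) * exp (- (s * \<rho>))"
  have l: "(?F \<longlongrightarrow> 0) at_top" using assms by real_asymp
  have d: "(?F has_real_derivative x * exp (- (s * x))) (at x)" for x
    using assms by (auto intro!: derivative_eq_intros simp: field_simps power2_eq_square)
  note r = radial_exponential_integral[where f = "\<lambda>\<rho>. \<rho> * exp (- (s * \<rho>))", OF _ d _ l]
  show "integrable lborel (\<lambda>x. (norm x)\<^sup>2 * gaussian s x)" unfolding gaussian_def[abs_def] by (rule r(1)) (use assms in auto)
  have "(\<integral>x. (norm x)\<^sup>2 * gaussian s x \<partial>lborel) = pi * - (?F 0)"
    unfolding gaussian_def[abs_def] by (rule r(2)) (use assms in auto)
  then show "(\<integral>x. (norm x)\<^sup>2 * gaussian s x \<partial>lborel) = pi / s\<^sup>2" by simp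
qed

lemma gaussian_power: "gaussian s x * gaussian t x = gaussian (s + t) x"
  by (simp add: gaussian_def exp_add[symmetric] algebra_simps)

lemma Dk_exp: "Dk k exp"
  by (induction k) (auto intro!: exI[of _ exp] continuous_intros)

lemma C_k_gaussian: "C_k k (gaussian s)"
proof -
  have "gaussian s = (\<lambda>x. exp ((- s) * (x $ 1 * x $ 1 + x $ 2 * x $ 2)))"
    by (auto simp: gaussian_def norm_square_2 fun_eq_iff)
  moreover have "C_k k \<dots>" by (intro C_k_comp[OF Dk_exp] C_k_mult C_k_add C_k_const C_k_coord)
  ultimately show ?thesis by simp
qed

definition gaussian_grad :: "real \<Rightarrow> real ^ 2 \<Rightarrow> real ^ 2" where
  "gaussian_grad s x = (- 2 * s * gaussian s x) *\<^sub>R x"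

lemma gaussian_partial: "partial i (gaussian s) x = gaussian_grad s x $ i"
proof -
  have "((\<lambda>\<rho>. exp (- (s * \<rho>))) has_real_derivative exp (- (s * (norm x)\<^sup>2)) * (- s)) (at ((norm x)\<^sup>2))"
    by (auto intro!: derivative_eq_intros)
  from has_derivative_compose[OF norm_square_has_derivative this[unfolded has_field_derivative_def]]
  have "(gaussian s has_derivative (\<lambda>h. exp (- (s * (norm x)\<^sup>2)) * (- s) * (2 * (x \<bullet> h)))) (at x)"
    unfolding gaussian_def[abs_def] .
  from partial_eq[OF this, of i] show ?thesis by (simp add: gaussian_grad_def gaussian_def inner_axis)
qed

lemma gaussian_L2:
  assumes "0 < s"
  shows "L2 (gaussian s)" and "L2 (gaussian_grad s)" and "(norm (gaussian_grad s x))\<^sup>2 = 4 * s\<^sup>2 * ((norm x)\<^sup>2 * gaussian (2 * s) x)"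
proof -
  have [measurable]: "gaussian s \<in> borel_measurable borel" unfolding gaussian_def[abs_def] by measurable
  have sq: "(gaussian s x)\<^sup>2 = gaussian (2 * s) x" for x using gaussian_power[of s x s] by (simp add: power2_eq_square)
  show "L2 (gaussian s)" unfolding L2_def using gaussian_integral(1)[of "2 * s"] assms by (simp add: sq)
  have g: "(norm (gaussian_grad s x))\<^sup>2 = 4 * s\<^sup>2 * ((norm x)\<^sup>2 * gaussian (2 * s) x)" for x
    by (simp add: gaussian_grad_def power_mult_distrib sq)
  show "(norm (gaussian_grad s x))\<^sup>2 = 4 * s\<^sup>2 * ((norm x)\<^sup>2 * gaussian (2 * s) x)" by (rule g)
  show "L2 (gaussian_grad s)" unfolding L2_def
  proof
    show "gaussian_grad s \<in> borel_measurable lborel" unfolding gaussian_grad_def[abs_def] by measurable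
    show "integrable lborel (\<lambda>x. (norm (gaussian_grad s x))\<^sup>2)"
      unfolding g using gaussian_moment(1)[of "2 * s"] assms by (intro integrable_mult_right) auto
  qed
qed

text \<open>A Gaussian times a test function is a test function, so its partial derivatives have integral zero;
  the product rule turns this into integration by parts.\<close>

lemma gaussian_weak_gradient:
  assumes "0 < s" shows "L2_weak_gradient (gaussian s) (gaussian_grad s)"
  unfolding L2_weak_gradient_def
proof (intro conjI allI impI)
  show "L2 (gaussian_grad s)" by (rule gaussian_L2(2)[OF assms])
  fix \<phi> i assume t: "test_function \<phi>"
  obtain R where R: "\<And>x. R < norm x \<Longrightarrow> \<phi> x = 0" using test_function_support[OF t] by metis
  have tF: "test_function (\<lambda>x. gaussian s x * \<phi> x)"
  proof (rule test_functionI[of _ R])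
    show "C_k k (\<lambda>x. gaussian s x * \<phi> x)" for k using t by (intro C_k_mult C_k_gaussian) (simp add: test_function_def)
  qed (use R in simp)
  have p: "partial i (\<lambda>x. gaussian s x * \<phi> x) x = gaussian s x * partial i \<phi> x + gaussian_grad s x $ i * \<phi> x" for x
  proof -
    obtain D where D: "(gaussian s has_derivative D) (at x)" "\<And>i. D (axis i 1) = partial i (gaussian s) x"
      using C_k_has_derivative[OF C_k_gaussian[of "Suc 0" s]] by blast
    have "C_k (Suc 0) \<phi>" using t by (simp only: test_function_def)
    then obtain E where E: "(\<phi> has_derivative E) (at x)" "\<And>i. E (axis i 1) = partial i \<phi> x"
      using C_k_has_derivative by blast
    show ?thesis using partial_eq[OF has_derivative_mult[OF D(1) E(1)], of i] D(2) E(2) by (simp add: gaussian_partial)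
  qed
  have "0 = (\<integral>x. gaussian s x * partial i \<phi> x + gaussian_grad s x $ i * \<phi> x \<partial>lborel)"
    using integral_partial_test_function[OF tF, of i] unfolding p by simp
  also have "\<dots> = (\<integral>x. gaussian s x * partial i \<phi> x \<partial>lborel) + (\<integral>x. gaussian_grad s x $ i * \<phi> x \<partial>lborel)"
    by (intro Bochner_Integration.integral_add L2_mult_integrable L2_component gaussian_L2 assms test_function_L2 test_function_partial t)
  finally show "(\<integral>x. gaussian s x * partial i \<phi> x \<partial>lborel) = - (\<integral>x. gaussian_grad s x $ i * \<phi> x \<partial>lborel)" by linarith
qed

lemma gaussian_H1r:
  assumes "0 < s"
  shows "gaussian s \<in> H1r" and "Mass (gaussian s) = pi / (2 * s)" and "Dir (gaussian s) = pi"
proof -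
  note L = gaussian_L2[OF assms] and w = gaussian_weak_gradient[OF assms]
  show H: "gaussian s \<in> H1r"
    unfolding H1r_def H1_def radial_def using L(1) w by (auto simp: gaussian_def)
  have sq: "(gaussian s x)\<^sup>2 = gaussian (2 * s) x" for x using gaussian_power[of s x s] by (simp add: power2_eq_square)
  show "Mass (gaussian s) = pi / (2 * s)" unfolding Mass_def sq using gaussian_integral(2)[of "2 * s"] assms by simp
  have [measurable]: "grad (gaussian s) \<in> borel_measurable borel" "gaussian_grad s \<in> borel_measurable borel"
    using H1_L2(2)[OF H1r_D(1)[OF H]] L(2) by (auto simp: L2_def)
  have "Dir (gaussian s) = (\<integral>x. (norm (gaussian_grad s x))\<^sup>2 \<partial>lborel)"
    unfolding Dir_def by (rule integral_cong_AE) (use grad_AE[OF w] in auto)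
  also have "\<dots> = 4 * s\<^sup>2 * (pi / (2 * s)\<^sup>2)"
    unfolding L(3) using gaussian_moment(2)[of "2 * s"] assms by simp
  also have "\<dots> = pi" using assms by (simp add: power_mult_distrib)
  finally show "Dir (gaussian s) = pi" .
qed

context coupling_constants
begin

text \<open>The pair is \<open>u\<^sup>2 = gaussian s\<close>, \<open>N = - b u\<^sup>2\<close>. The value \<open>b = a / (\<kappa>\<^sup>2q)\<close> maximises \<open>a b / 2 - \<kappa>\<^sup>2q b\<^sup>2 / 4\<close>.
  The integrals of \<open>u\<^sup>4\<close>, \<open>N u\<^sup>2\<close> and \<open>N\<^sup>2\<close> grow like \<open>1 / s\<close> while the Dirichlet integral of \<open>N\<close> does
  not depend on \<open>s\<close>; the chosen \<open>s\<close> makes its cost half of the gain.\<close>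

lemma exists_positive_Cf: "\<exists>u\<in>H1r. \<exists>N\<in>H1r. 0 < Cf u N"
proof -
  define b where "b = a / (\<kappa>\<^sup>2 * q)"
  define D where "D = a\<^sup>2 / (4 * \<kappa>\<^sup>2 * q) - q / (16 * m\<^sup>2)"
  define s where "s = q * D / b\<^sup>2"
  have b: "0 < b" unfolding b_def using a_pos \<kappa> q by simp
  have "a\<^sup>2 / (4 * \<kappa>\<^sup>2 * q) = 1 / (4 * \<kappa>\<^sup>2 * q) + 1 / (4 * \<kappa> * m) + q / (16 * m\<^sup>2)"
    unfolding a_def using m \<kappa> q by (simp add: field_simps power2_eq_square)
  then have "D = 1 / (4 * \<kappa>\<^sup>2 * q) + 1 / (4 * \<kappa> * m)" by (simp add: D_def)
  then have D: "0 < D" using m \<kappa> q by (simp add: add_pos_pos)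
  have s: "0 < s" unfolding s_def using D b q by simp
  let ?u = "gaussian (s / 2)" and ?N = "\<lambda>x. (- b) * gaussian s x"
  have s2: "0 < s / 2" using s by simp
  have uH: "?u \<in> H1r" by (rule gaussian_H1r(1)[OF s2])
  have NH: "?N \<in> H1r" by (intro H1r_scale gaussian_H1r(1) s)
  have usq: "(?u x)\<^sup>2 = gaussian s x" for x using gaussian_power[of "s / 2" x "s / 2"] by (simp add: power2_eq_square)
  have u4: "(?u x) ^ 4 = gaussian (2 * s) x" for x
  proof -
    have "(?u x) ^ 4 = (?u x)\<^sup>2 * (?u x)\<^sup>2" by (simp add: power4_eq_xxxx power2_eq_square)
    then show ?thesis unfolding usq gaussian_power by simp
  qed
  have Q: "Quart ?u = pi / (2 * s)" unfolding Quart_def u4 using gaussian_integral(2)[of "2 * s"] s by simp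
  have "(\<lambda>x. ?N x * (?u x)\<^sup>2) = (\<lambda>x. (- b) * gaussian (2 * s) x)"
    unfolding usq mult.assoc gaussian_power by simp
  then have C: "Cub ?u ?N = - b * (pi / (2 * s))"
    unfolding Cub_def using gaussian_integral(2)[of "2 * s"] s by simp
  have P: "Pf ?N = 1 / (4 * q) * (b\<^sup>2 * pi) + \<kappa>\<^sup>2 * q / 4 * (b\<^sup>2 * (pi / (2 * s)))"
    unfolding Pf_def Dir_scale[OF gaussian_H1r(1)[OF s]] Mass_scale gaussian_H1r(2,3)[OF s] by simp
  define y where "y = pi / (2 * s)"
  have y: "0 < y" using s by (simp add: y_def)
  have "Cf ?u ?N = y * (a * b / 2 - q / (16 * m\<^sup>2) - \<kappa>\<^sup>2 * q / 4 * b\<^sup>2) - b\<^sup>2 * pi / (4 * q)"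
    unfolding Cf_def Q C P y_def[symmetric] by (simp add: algebra_simps)
  also have "a * b / 2 - q / (16 * m\<^sup>2) - \<kappa>\<^sup>2 * q / 4 * b\<^sup>2 = D"
    unfolding D_def b_def using \<kappa> q by (simp add: power2_eq_square)
  also have "y * D = b\<^sup>2 * pi / (2 * q)"
    unfolding y_def s_def using D q b by (simp add: field_simps)
  also have "b\<^sup>2 * pi / (2 * q) - b\<^sup>2 * pi / (4 * q) = b\<^sup>2 * pi / (4 * q)" by (simp add: field_simps)
  finally have "0 < Cf ?u ?N" using b q by simp
  then show ?thesis using uH NH by blast
qed

end

theorem theorem1p1:
  fixes m \<omega> \<kappa> q :: real
  assumes "m > 0" and "\<omega> > 0" and "\<kappa> > 0" and "q > 0"
  shows "\<exists>e0>0. \<forall>e. 0 < e \<and> e < e0 \<longrightarrow>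
    (\<exists>u N. weak_solution m \<omega> \<kappa> q e u N \<and> nontrivial u N)"
proof -
  interpret coupling_constants m \<omega> \<kappa> q by unfold_locales (use assms in auto)
  obtain u N where "u \<in> H1r" "N \<in> H1r" "0 < Cf u N" using exists_positive_Cf by blast
  then obtain us Ns where z: "us \<in> H1r" "Ns \<in> H1r" "Cf us Ns = 1" by (rule normalise) (rule that)
  \<comment> \<open>\<open>T\<close> is fixed by the test pair before \<open>e\<close> is chosen, so \<open>A\<close> and \<open>B\<close> are constants\<close>
  define T where "T = Qf us + 3"
  define A where "A = T ^ 3 * CSE us"
  define B where "B = 12 * KB * T ^ 4"
  have T: "0 < T" unfolding T_def using Qf_nonneg[of us] by simp
  have A: "0 \<le> A" unfolding A_def using T CSE_nonneg by simp
  have B: "0 \<le> B" unfolding B_def using KB_pos by simp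
  define \<epsilon>0 where "\<epsilon>0 = 1 / (4 * A + B + 1)"
  have \<epsilon>0: "0 < \<epsilon>0" unfolding \<epsilon>0_def using A B by simp
  have bounds: "\<epsilon> * A \<le> 1 / 4" "\<epsilon> * B \<le> 1" if "0 < \<epsilon>" "\<epsilon> \<le> \<epsilon>0" for \<epsilon>
  proof -
    have "0 < 4 * A + B + 1" using A B by simp
    then have "\<epsilon> * (4 * A + B + 1) \<le> 1" using that(2) unfolding \<epsilon>0_def by (simp add: pos_le_divide_eq)
    then have "4 * (\<epsilon> * A) + \<epsilon> * B + \<epsilon> \<le> 1" by (simp add: algebra_simps)
    moreover have "0 \<le> \<epsilon> * A" "0 \<le> \<epsilon> * B" using that(1) A B by simp_all
    ultimately show "\<epsilon> * A \<le> 1 / 4" "\<epsilon> * B \<le> 1" using that(1) by linarith+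
  qed
  define c where "c = 4 * m * \<kappa>\<^sup>2"
  have c: "0 < c" unfolding c_def using m \<kappa> by simp
  show ?thesis
  proof (intro exI[of _ "min 1 (\<epsilon>0 * c)"] conjI allI impI)
    show "0 < min 1 (\<epsilon>0 * c)" using \<epsilon>0 c by simp
    fix e assume e: "0 < e \<and> e < min 1 (\<epsilon>0 * c)"
    have "e ^ 4 \<le> e ^ 1" using e by (intro power_decreasing) auto
    then have "e ^ 4 \<le> \<epsilon>0 * c" using e by simp
    then have le: "e ^ 4 / c \<le> \<epsilon>0" using c by (simp add: pos_divide_le_eq)
    have pos: "0 < e ^ 4 / c" using e c by simp
    note b = bounds[OF pos le]
    show "\<exists>u N. weak_solution m \<omega> \<kappa> q e u N \<and> nontrivial u N"
    proof (rule exists_solution[OF z T_def, of "e ^ 4 / c"])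
      show "e ^ 4 / c = e ^ 4 / (4 * m * \<kappa>\<^sup>2)" by (simp add: c_def)
      show "0 < e ^ 4 / c" by (rule pos)
      show "e ^ 4 / c * T ^ 3 * CSE us \<le> 1 / 4" using b(1) by (simp add: A_def mult.assoc)
      show "12 * (e ^ 4 / c) * KB * T ^ 4 \<le> 1" using b(2) by (simp add: B_def mult_ac)
    qed
  qed
qed

end
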